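(* (Computability of definable synthesis.) Given an $\mathit{MSO}[<]$ formula $\Psi(X,Y)$, it is decidable whether there exists an $\mathit{MSO}[<]$-definable C-operator $F$ such that $\mathit{FVsig}\models \forall X.\ \Psi(X,F(X))$; and if such an operator exists, there is an algorithm that constructs an $\mathit{MSO}[<]$ formula that defines such an $F$.
   Context: A (finitely variable) signal over a finite set $\Sigma$ is a function $f:\mathbb{R}^{\geq 0}\to\Sigma$ for which there is an unbounded strictly increasing sequence $0=\tau_0<\tau_1<\cdots$ of reals such that $f$ is constant on every open interval $(\tau_i,\tau_{i+1})$; boolean signals ($\Sigma=\{0,1\}$) are identified with subsets of $\mathbb{R}^{\geq 0}$, and signals over a finite $\Sigma$ are coded in the standard way by tuples of boolean signals. $\mathit{MSO}[<]$ is monadic second-order logic with atomic formulas $t<v$ and $X(t)$, boolean connectives, and first- and second-order quantifiers. $\mathit{FVsig}$ is the structure in which first-order variables range over $\mathbb{R}^{\geq 0}$ with its usual order and monadic second-order variables range over the finitely variable boolean signals. An operator is a function $F$ from signals to signals. $F$ is a C-operator (causal) if for every $t\geq 0$ and all signals $X_1,X_2$ that agree on $[0,t]$, $F(X_1)(t)=F(X_2)(t)$. An operator $F$ is $\mathit{MSO}[<]$-definable if there is an $\mathit{MSO}[<]$ formula $U(X,Y)$ such that for all signals $X,Y$: $\mathit{FVsig}\models U(X,Y)$ iff $Y=F(X)$. *)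

theory Defs
  imports "HOL-Analysis.Analysis" "HOL-Library.Nat_Bijection" "HOL-Library.Log_Nat"
    "HOL-Library.FuncSet"
begin

subsection \<open>Finitely variable signals\<close>

definition finitely_variable :: "(real \<Rightarrow> 'a) \<Rightarrow> bool" where
  "finitely_variable f \<longleftrightarrow>
     (\<exists>\<tau> :: nat \<Rightarrow> real. \<tau> 0 = 0 \<and> strict_mono \<tau> \<and> \<not> bdd_above (range \<tau>) \<and>
        (\<forall>i. f constant_on {\<tau> i<..<\<tau> (Suc i)}))"

text \<open>
  Finite alphabets are represented by initial segments \<open>{..<p}\<close> of the natural numbers. A signal is
  a function on the nonnegative reals, made extensional (\<open>undefined\<close> at negative arguments) so that
  equality of signals is equality in HOL.
\<close>

definition signals :: "nat \<Rightarrow> (real \<Rightarrow> nat) set" where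
  "signals p = {f \<in> {0..} \<rightarrow>\<^sub>E {..<p}. finitely_variable f}"

definition bool_signals :: "real set set" where
  "bool_signals = {A. A \<subseteq> {0..} \<and> finitely_variable (\<lambda>t. t \<in> A)}"

text \<open>
  A signal over \<open>{..<p}\<close> is coded by the \<open>ceillog2 p\<close> boolean signals given by the binary digits of
  its letters; for \<open>p = 2\<close> this is the single set of times at which the signal has the value 1.
\<close>

definition component :: "(real \<Rightarrow> nat) \<Rightarrow> nat \<Rightarrow> real set" where
  "component f i = {t. 0 \<le> t \<and> bit (f t) i}"


subsection \<open>Monadic second-order logic of order over \<open>FVsig\<close>\<close>

datatype mso =
    Less nat nat
  | In nat nat  \<comment> \<open>\<open>In X t\<close> stands for \<open>X(t)\<close>\<close>
  | Neg mso
  | Conj mso mso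
  | Disj mso mso
  | Impl mso mso
  | Ex1 nat mso
  | All1 nat mso
  | Ex2 nat mso
  | All2 nat mso

fun fv1 :: "mso \<Rightarrow> nat set" where
  "fv1 (Less t v) = {t, v}"
| "fv1 (In X t) = {t}"
| "fv1 (Neg \<phi>) = fv1 \<phi>"
| "fv1 (Conj \<phi> \<psi>) = fv1 \<phi> \<union> fv1 \<psi>"
| "fv1 (Disj \<phi> \<psi>) = fv1 \<phi> \<union> fv1 \<psi>"
| "fv1 (Impl \<phi> \<psi>) = fv1 \<phi> \<union> fv1 \<psi>"
| "fv1 (Ex1 t \<phi>) = fv1 \<phi> - {t}"
| "fv1 (All1 t \<phi>) = fv1 \<phi> - {t}"
| "fv1 (Ex2 X \<phi>) = fv1 \<phi>"
| "fv1 (All2 X \<phi>) = fv1 \<phi>"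

fun fv2 :: "mso \<Rightarrow> nat set" where
  "fv2 (Less t v) = {}"
| "fv2 (In X t) = {X}"
| "fv2 (Neg \<phi>) = fv2 \<phi>"
| "fv2 (Conj \<phi> \<psi>) = fv2 \<phi> \<union> fv2 \<psi>"
| "fv2 (Disj \<phi> \<psi>) = fv2 \<phi> \<union> fv2 \<psi>"
| "fv2 (Impl \<phi> \<psi>) = fv2 \<phi> \<union> fv2 \<psi>"
| "fv2 (Ex1 t \<phi>) = fv2 \<phi>"
| "fv2 (All1 t \<phi>) = fv2 \<phi>"
| "fv2 (Ex2 X \<phi>) = fv2 \<phi> - {X}"
| "fv2 (All2 X \<phi>) = fv2 \<phi> - {X}"

fun sat :: "(nat \<Rightarrow> real) \<Rightarrow> (nat \<Rightarrow> real set) \<Rightarrow> mso \<Rightarrow> bool" where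
  "sat u w (Less t v) \<longleftrightarrow> u t < u v"
| "sat u w (In X t) \<longleftrightarrow> u t \<in> w X"
| "sat u w (Neg \<phi>) \<longleftrightarrow> \<not> sat u w \<phi>"
| "sat u w (Conj \<phi> \<psi>) \<longleftrightarrow> sat u w \<phi> \<and> sat u w \<psi>"
| "sat u w (Disj \<phi> \<psi>) \<longleftrightarrow> sat u w \<phi> \<or> sat u w \<psi>"
| "sat u w (Impl \<phi> \<psi>) \<longleftrightarrow> (sat u w \<phi> \<longrightarrow> sat u w \<psi>)"
| "sat u w (Ex1 t \<phi>) \<longleftrightarrow> (\<exists>r\<in>{0..}. sat (u(t := r)) w \<phi>)"
| "sat u w (All1 t \<phi>) \<longleftrightarrow> (\<forall>r\<in>{0..}. sat (u(t := r)) w \<phi>)"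
| "sat u w (Ex2 X \<phi>) \<longleftrightarrow> (\<exists>A\<in>bool_signals. sat u (w(X := A)) \<phi>)"
| "sat u w (All2 X \<phi>) \<longleftrightarrow> (\<forall>A\<in>bool_signals. sat u (w(X := A)) \<phi>)"

text \<open>
  In a formula \<open>\<Psi>(X,Y)\<close>, with \<open>X\<close> over \<open>{..<p}\<close> and \<open>Y\<close> over \<open>{..<q}\<close>, the second-order variables
  \<open>0, \<dots>, ceillog2 p - 1\<close> hold the code of \<open>X\<close> and the next \<open>ceillog2 q\<close> ones the code of \<open>Y\<close>.
\<close>

definition formulas :: "nat \<Rightarrow> nat \<Rightarrow> mso set" where
  "formulas p q = {\<Psi>. fv1 \<Psi> = {} \<and> fv2 \<Psi> \<subseteq> {..<ceillog2 p + ceillog2 q}}"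

definition FVsig_sat :: "nat \<Rightarrow> mso \<Rightarrow> (real \<Rightarrow> nat) \<Rightarrow> (real \<Rightarrow> nat) \<Rightarrow> bool" where
  "FVsig_sat p \<Psi> X Y \<longleftrightarrow>
     sat (\<lambda>_. 0) (\<lambda>i. if i < ceillog2 p then component X i else component Y (i - ceillog2 p)) \<Psi>"


subsection \<open>Operators\<close>

definition C_operator :: "nat \<Rightarrow> nat \<Rightarrow> ((real \<Rightarrow> nat) \<Rightarrow> (real \<Rightarrow> nat)) \<Rightarrow> bool" where
  "C_operator p q F \<longleftrightarrow> F \<in> signals p \<rightarrow> signals q \<and>
     (\<forall>t\<ge>0. \<forall>X1\<in>signals p. \<forall>X2\<in>signals p.
        (\<forall>s\<in>{0..t}. X1 s = X2 s) \<longrightarrow> F X1 t = F X2 t)"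

definition defines_operator ::
    "nat \<Rightarrow> nat \<Rightarrow> mso \<Rightarrow> ((real \<Rightarrow> nat) \<Rightarrow> (real \<Rightarrow> nat)) \<Rightarrow> bool" where
  "defines_operator p q U F \<longleftrightarrow> U \<in> formulas p q \<and>
     (\<forall>X\<in>signals p. \<forall>Y\<in>signals q. FVsig_sat p U X Y \<longleftrightarrow> Y = F X)"

definition definable_operator ::
    "nat \<Rightarrow> nat \<Rightarrow> ((real \<Rightarrow> nat) \<Rightarrow> (real \<Rightarrow> nat)) \<Rightarrow> bool" where
  "definable_operator p q F \<longleftrightarrow> (\<exists>U. defines_operator p q U F)"

definition implements ::
    "nat \<Rightarrow> ((real \<Rightarrow> nat) \<Rightarrow> (real \<Rightarrow> nat)) \<Rightarrow> mso \<Rightarrow> bool" where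
  "implements p F \<Psi> \<longleftrightarrow> (\<forall>X\<in>signals p. FVsig_sat p \<Psi> X (F X))"


subsection \<open>Algorithms: partial recursive functions and Goedel numbers of formulas\<close>

datatype recf =
    Zero
  | Succ
  | Proj nat
  | Comp recf "recf list"
  | PrimRec recf recf
  | Mu recf

text \<open>
  \<open>computes f xs y\<close>: the partial recursive function described by \<open>f\<close> is defined at the argument tuple
  \<open>xs\<close> and has the value \<open>y\<close> there. The recursion and minimisation argument comes first.
\<close>

inductive computes :: "recf \<Rightarrow> nat list \<Rightarrow> nat \<Rightarrow> bool" where
  Zero: "computes Zero xs 0"
| Succ: "computes Succ (x # xs) (Suc x)"
| Proj: "i < length xs \<Longrightarrow> computes (Proj i) xs (xs ! i)"
| Comp: "list_all2 (\<lambda>g y. computes g xs y) gs ys \<Longrightarrow> computes f ys z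
    \<Longrightarrow> computes (Comp f gs) xs z"
| PrimRec_0: "computes f xs y \<Longrightarrow> computes (PrimRec f g) (0 # xs) y"
| PrimRec_Suc: "computes (PrimRec f g) (n # xs) r \<Longrightarrow> computes g (n # r # xs) y
    \<Longrightarrow> computes (PrimRec f g) (Suc n # xs) y"
| Mu: "computes f (n # xs) 0 \<Longrightarrow> \<forall>i<n. \<exists>m. computes f (i # xs) (Suc m)
    \<Longrightarrow> computes (Mu f) xs n"

inductive_cases computes_elims:
  "computes Zero xs y" "computes Succ xs y" "computes (Proj i) xs y" "computes (Comp f gs) xs y"
  "computes (PrimRec f g) (0 # xs) y" "computes (PrimRec f g) (Suc n # xs) y"
  "computes (Mu f) xs y"

lemma computes_functional: "computes f xs y \<Longrightarrow> computes f xs z \<Longrightarrow> y = z"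
proof (induction arbitrary: z rule: computes.induct)
  case (Comp xs gs ys f w)
  from Comp.prems obtain ys' where ys': "list_all2 (\<lambda>g y. computes g xs y) gs ys'"
    and f: "computes f ys' z"
    by (auto elim: computes_elims)
  have "ys = ys'"
    using Comp.IH(1) ys' by (auto simp: list_all2_conv_all_nth intro!: nth_equalityI)
  then show ?case using Comp.IH(2) f by blast
next
  case (PrimRec_Suc f g n xs r y)
  from PrimRec_Suc.prems obtain r' where "computes (PrimRec f g) (n # xs) r'"
    and "computes g (n # r' # xs) z"
    by (auto elim: computes_elims)
  then show ?case using PrimRec_Suc.IH by blast
next
  case (Mu f n xs)
  from Mu.prems have z: "computes f (z # xs) 0" "\<forall>i<z. \<exists>m. computes f (i # xs) (Suc m)"
    by (auto elim: computes_elims)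
  show ?case
  proof (rule linorder_cases[of n z])
    assume "n < z" then show ?thesis using z Mu.IH(1) by fastforce
  next
    assume "z < n" then show ?thesis using z Mu.IH(2) by fastforce
  qed
qed (blast elim: computes_elims)+

fun code :: "mso \<Rightarrow> nat" where
  "code (Less t v) = prod_encode (0, prod_encode (t, v))"
| "code (In X t) = prod_encode (1, prod_encode (X, t))"
| "code (Neg \<phi>) = prod_encode (2, code \<phi>)"
| "code (Conj \<phi> \<psi>) = prod_encode (3, prod_encode (code \<phi>, code \<psi>))"
| "code (Disj \<phi> \<psi>) = prod_encode (4, prod_encode (code \<phi>, code \<psi>))"
| "code (Impl \<phi> \<psi>) = prod_encode (5, prod_encode (code \<phi>, code \<psi>))"
| "code (Ex1 t \<phi>) = prod_encode (6, prod_encode (t, code \<phi>))"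
| "code (All1 t \<phi>) = prod_encode (7, prod_encode (t, code \<phi>))"
| "code (Ex2 X \<phi>) = prod_encode (8, prod_encode (X, code \<phi>))"
| "code (All2 X \<phi>) = prod_encode (9, prod_encode (X, code \<phi>))"

lemma inj_code: "inj code"
proof (rule injI)
  show "code \<phi> = code \<psi> \<Longrightarrow> \<phi> = \<psi>" for \<phi> \<psi>
    by (induction \<phi> arbitrary: \<psi>; case_tac \<psi>; simp)
qed

end

theory Submission
  imports Defs "HOL-Library.Ramsey"
begin

text \<open>
  A finitely variable signal is an \<open>\<omega>\<close>-word whose letters alternate between values at breakpoints and values on
  the open intervals between them. Every formula is recognised by a finite algebra with a product and an
  \<open>\<omega>\<close>-power that types such words independently of the choice of the breakpoints; second-order quantification
  is the power algebra construction, which is correct by Ramsey's theorem. The algebra can be computed from the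
  formula, so the sentence ``\<open>U\<close> defines a causal operator that implements \<open>\<Psi>\<close>'' can be decided.

  A definable operator commutes with all automorphisms of the time line, so its value can change only where its
  input changes. Definable causal operators are therefore strategies of Output in a discrete game in which Input
  and Output alternately choose letters and Output must repeat its letter when Input does. The winning condition
  of this game, membership in the language of the algebra of \<open>\<Psi>\<close>, is turned into a parity condition of a
  deterministic automaton that tracks the right ideals generated by the factors of the word. By positional
  determinacy either Output wins with a finite-state strategy, which is a definable operator, or Input wins with
  a finite-state strategy, which is summarised by a finite certificate. A simultaneous search for a formula and for
  a certificate hence terminates.
\<close>

section \<open>Computable functions\<close>

text \<open>Only two things have to be computed: the algebra of a given formula, and a bounded check
  of a proposed certificate. The parity automaton, determinacy and the machines enter as pure
  existence proofs; they show that the search stops, and the algorithm itself never constructs a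
  strategy. The obstacle that shapes everything else is that a signal does not determine its
  breakpoints. Recognition by an algebra is therefore demanded for all breakpoint sequences at once.
  In the game, a breakpoint at which nothing changes must give no advantage to Output, which is the
  reason for the repetition rule. A causal machine that sees the old letter again at a time t cannot
  tell whether the input changes immediately after t, so its reading of the word has to lag behind
  the play, and the two are compared on one particular sequence of breakpoints. Letters, elements of
  algebras and finite relations are all numbers, read as sets through their binary digits; this
  keeps every quantifier in the decidable part bounded.\<close>

definition rcomp :: "nat \<Rightarrow> (nat list \<Rightarrow> nat) \<Rightarrow> bool" where
  "rcomp n f \<longleftrightarrow> (\<exists>r. \<forall>xs. length xs = n \<longrightarrow> computes r xs (f xs))"

lemma rcomp_cong: "(\<And>xs. length xs = n \<Longrightarrow> f xs = g xs) \<Longrightarrow> rcomp n f \<Longrightarrow> rcomp n g"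
  unfolding rcomp_def by metis

lemma rcomp_zero: "rcomp n (\<lambda>_. 0)"
  unfolding rcomp_def using computes.Zero by blast

lemma rcomp_Suc: "rcomp 1 (\<lambda>xs. Suc (xs ! 0))"
  unfolding rcomp_def
  by (rule exI[of _ Succ]) (auto simp: length_Suc_conv intro: computes.Succ)

lemma rcomp_proj: "i < n \<Longrightarrow> rcomp n (\<lambda>xs. xs ! i)"
  unfolding rcomp_def by (rule exI[of _ "Proj i"]) (auto intro: computes.Proj)

lemma rcomp_comp1:
  assumes "rcomp 1 f" "rcomp n g"
  shows "rcomp n (\<lambda>xs. f [g xs])"
proof -
  obtain r s where r: "\<And>xs. length xs = 1 \<Longrightarrow> computes r xs (f xs)"
    and s: "\<And>xs. length xs = n \<Longrightarrow> computes s xs (g xs)"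
    using assms unfolding rcomp_def by auto
  show ?thesis unfolding rcomp_def
    by (rule exI[of _ "Comp r [s]"]) (auto intro!: computes.Comp r s)
qed

lemma rcomp_comp2:
  assumes "rcomp 2 f" "rcomp n g" "rcomp n h"
  shows "rcomp n (\<lambda>xs. f [g xs, h xs])"
proof -
  obtain r s t where r: "\<And>xs. length xs = 2 \<Longrightarrow> computes r xs (f xs)"
    and s: "\<And>xs. length xs = n \<Longrightarrow> computes s xs (g xs)"
    and t: "\<And>xs. length xs = n \<Longrightarrow> computes t xs (h xs)"
    using assms unfolding rcomp_def by auto
  show ?thesis unfolding rcomp_def
    by (rule exI[of _ "Comp r [s, t]"]) (auto intro!: computes.Comp r s t)
qed

lemma rcomp_rec:
  assumes "rcomp n f" "rcomp (Suc (Suc n)) g"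
  shows "rcomp (Suc n) (\<lambda>xs. rec_nat (f (tl xs)) (\<lambda>k r. g (k # r # tl xs)) (hd xs))"
proof -
  obtain r s where r: "\<And>xs. length xs = n \<Longrightarrow> computes r xs (f xs)"
    and s: "\<And>xs. length xs = Suc (Suc n) \<Longrightarrow> computes s xs (g xs)"
    using assms unfolding rcomp_def by auto
  have "computes (PrimRec r s) (m # xs) (rec_nat (f xs) (\<lambda>k r. g (k # r # xs)) m)"
    if "length xs = n" for m xs
  proof (induction m)
    case 0
    show ?case using r[OF that] by (auto intro: computes.PrimRec_0)
  next
    case (Suc m)
    then show ?case using s that by (auto intro!: computes.PrimRec_Suc)
  qed
  then show ?thesis unfolding rcomp_def
    by (intro exI[of _ "PrimRec r s"]) (auto simp: length_Suc_conv)
qed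

lemma rcomp_least:
  assumes "rcomp (Suc n) f" "\<And>xs. length xs = n \<Longrightarrow> \<exists>k. f (k # xs) = 0"
  shows "rcomp n (\<lambda>xs. LEAST k. f (k # xs) = 0)"
proof -
  obtain r where r: "\<And>xs. length xs = Suc n \<Longrightarrow> computes r xs (f xs)"
    using assms unfolding rcomp_def by auto
  have "computes (Mu r) xs (LEAST k. f (k # xs) = 0)" if xs: "length xs = n" for xs
  proof (rule computes.Mu)
    have "f ((LEAST k. f (k # xs) = 0) # xs) = 0"
      using assms(2)[OF xs] by (rule LeastI_ex)
    then show "computes r ((LEAST k. f (k # xs) = 0) # xs) 0"
      using r[of "(LEAST k. f (k # xs) = 0) # xs"] xs by simp
    show "\<forall>i<LEAST k. f (k # xs) = 0. \<exists>m. computes r (i # xs) (Suc m)"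
    proof (intro allI impI)
      fix i assume "i < (LEAST k. f (k # xs) = 0)"
      then have "f (i # xs) \<noteq> 0" using not_less_Least by blast
      then obtain m where "f (i # xs) = Suc m" using not0_implies_Suc by blast
      then show "\<exists>m. computes r (i # xs) (Suc m)" using r[of "i # xs"] xs by auto
    qed
  qed
  then show ?thesis unfolding rcomp_def by blast
qed

lemma rcomp_Suc': "rcomp n f \<Longrightarrow> rcomp n (\<lambda>xs. Suc (f xs))"
  using rcomp_comp1[OF rcomp_Suc] by simp

lemma rcomp_recI:
  assumes "rcomp n f" "rcomp (Suc (Suc n)) g"
    "\<And>xs. length xs = n \<Longrightarrow> h (0 # xs) = f xs"
    "\<And>xs k. length xs = n \<Longrightarrow> h (Suc k # xs) = g (k # h (k # xs) # xs)"
  shows "rcomp (Suc n) h"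
proof (rule rcomp_cong[OF _ rcomp_rec[OF assms(1,2)]])
  fix xs :: "nat list" assume "length xs = Suc n"
  then obtain k ys where xs: "xs = k # ys" "length ys = n" by (auto simp: length_Suc_conv)
  have "rec_nat (f ys) (\<lambda>k r. g (k # r # ys)) k = h (k # ys)"
    using xs(2) by (induction k) (auto simp: assms(3,4))
  then show "rec_nat (f (tl xs)) (\<lambda>k r. g (k # r # tl xs)) (hd xs) = h xs" by (simp add: xs)
qed

lemma rcomp_add: "rcomp n f \<Longrightarrow> rcomp n g \<Longrightarrow> rcomp n (\<lambda>xs. f xs + g xs)"
proof -
  assume f: "rcomp n f" "rcomp n g"
  have "rcomp (Suc 1) (\<lambda>xs. xs ! 0 + xs ! 1)"
    by (rule rcomp_recI[OF rcomp_proj[of 0] rcomp_Suc'[OF rcomp_proj[of 1]]]) auto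
  from rcomp_comp2[OF this[folded Suc_1[symmetric], simplified, folded numeral_2_eq_2] f]
  show ?thesis by simp
qed

lemma rcomp_pred: "rcomp n f \<Longrightarrow> rcomp n (\<lambda>xs. f xs - 1)"
proof -
  assume f: "rcomp n f"
  have "rcomp (Suc 0) (\<lambda>xs. xs ! 0 - 1)"
    by (rule rcomp_recI[OF rcomp_zero rcomp_proj[of 0]]) auto
  from rcomp_comp1[OF this[folded One_nat_def] f] show ?thesis by simp
qed

lemma rcomp_diff: "rcomp n f \<Longrightarrow> rcomp n g \<Longrightarrow> rcomp n (\<lambda>xs. f xs - g xs)"
proof -
  assume f: "rcomp n f" "rcomp n g"
  have "rcomp (Suc 1) (\<lambda>xs. xs ! 1 - xs ! 0)"
    by (rule rcomp_recI[OF rcomp_proj[of 0] rcomp_pred[OF rcomp_proj[of 1]]]) auto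
  from rcomp_comp2[OF this[folded Suc_1[symmetric], simplified, folded numeral_2_eq_2] f(2,1)]
  show ?thesis by simp
qed

lemma rcomp_triangle: "rcomp n f \<Longrightarrow> rcomp n (\<lambda>xs. triangle (f xs))"
proof -
  assume f: "rcomp n f"
  have "rcomp (Suc 0) (\<lambda>xs. triangle (xs ! 0))"
    by (rule rcomp_recI[OF rcomp_zero rcomp_add[OF rcomp_proj[of 1] rcomp_Suc'[OF rcomp_proj[of 0]]]]) auto
  from rcomp_comp1[OF this[folded One_nat_def] f] show ?thesis by simp
qed

lemma rcomp_pair: "rcomp n f \<Longrightarrow> rcomp n g \<Longrightarrow> rcomp n (\<lambda>xs. prod_encode (f xs, g xs))"
  unfolding prod_encode_def by (simp add: rcomp_add rcomp_triangle)

lemma triangle_mono: "m \<le> n \<Longrightarrow> triangle m \<le> triangle n"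
  by (induction n rule: nat_induct) (auto simp: le_Suc_eq)

text \<open>Cantor's pairing maps \<open>(a, b)\<close> to \<open>triangle (a + b) + a\<close>, so
  the diagonal \<open>a + b\<close> is the least \<open>y\<close> with
  \<open>n < triangle (Suc y)\<close>. The condition is a truncated difference equal to 0, the form
  that minimisation accepts.\<close>

lemma prod_decode_eq_triangle:
  fixes n :: nat
  defines "y \<equiv> LEAST y. Suc n - triangle (Suc y) = 0"
  shows "prod_decode n = (n - triangle y, y - (n - triangle y))"
proof -
  obtain a b where ab: "prod_decode n = (a, b)" by fastforce
  then have n: "n = triangle (a + b) + a"
    using prod_decode_inverse[of n] by (simp add: prod_encode_def)
  have "y = a + b"
    unfolding y_def
  proof (rule Least_equality)
    show "Suc n - triangle (Suc (a + b)) = 0" using n by simp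
    fix y assume "Suc n - triangle (Suc y) = 0"
    then have "n < triangle (Suc y)" by simp
    then show "a + b \<le> y"
      using triangle_mono[of "Suc y" "a + b"] n by (cases "a + b \<le> y") auto
  qed
  then show ?thesis using ab n by simp
qed

lemma rcomp_unpair:
  shows "rcomp n f \<Longrightarrow> rcomp n (\<lambda>xs. fst (prod_decode (f xs)))"
    and "rcomp n f \<Longrightarrow> rcomp n (\<lambda>xs. snd (prod_decode (f xs)))"
proof -
  have "rcomp (Suc 1) (\<lambda>xs. Suc (xs ! 1) - triangle (Suc (xs ! 0)))"
    by (intro rcomp_diff rcomp_triangle rcomp_Suc' rcomp_proj) auto
  then have "rcomp 1 (\<lambda>xs. LEAST k. Suc ((k # xs) ! 1) - triangle (Suc ((k # xs) ! 0)) = 0)"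
  proof (rule rcomp_least)
    fix xs :: "nat list" assume "length xs = 1"
    have "Suc ((k # xs) ! 1) - triangle (Suc ((k # xs) ! 0)) = 0" if "k = xs ! 0" for k
      using that by simp
    then show "\<exists>k. Suc ((k # xs) ! 1) - triangle (Suc ((k # xs) ! 0)) = 0" by blast
  qed
  then have y: "rcomp 1 (\<lambda>xs. LEAST k. Suc (xs ! 0) - triangle (Suc k) = 0)" by simp
  have "rcomp 1 (\<lambda>xs. fst (prod_decode (xs ! 0)))" "rcomp 1 (\<lambda>xs. snd (prod_decode (xs ! 0)))"
    unfolding prod_decode_eq_triangle fst_conv snd_conv
    by (intro rcomp_diff rcomp_triangle rcomp_proj y; simp)+
  from this[THEN rcomp_comp1]
  show "rcomp n f \<Longrightarrow> rcomp n (\<lambda>xs. fst (prod_decode (f xs)))"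
    and "rcomp n f \<Longrightarrow> rcomp n (\<lambda>xs. snd (prod_decode (f xs)))" by simp_all
qed

section \<open>Computability for functions between coded types of data\<close>

class cenc = fixes ce :: "'a \<Rightarrow> nat"

instantiation nat :: cenc begin
definition "ce (n :: nat) = n"
instance ..
end

instantiation bool :: cenc begin
definition "ce (b :: bool) = (if b then 1 else 0)"
instance ..
end

instantiation prod :: (cenc, cenc) cenc begin
definition "ce (x :: 'a \<times> 'b) = prod_encode (ce (fst x), ce (snd x))"
instance ..
end

text \<open>Arguments are passed as one number: programs are unary and an environment of several
  variables is a nested pair. The closure rules can then follow the structure of a lambda
  term.\<close>

definition cmpf :: "('a::cenc \<Rightarrow> 'b::cenc) \<Rightarrow> bool" where
  "cmpf f \<longleftrightarrow> (\<exists>r. \<forall>z. computes r [ce z] (ce (f z)))"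

lemma cmpf_id: "cmpf (\<lambda>z. z)"
  unfolding cmpf_def using computes.Proj[of 0 "[x]" for x] by auto

lemma cmpf_comp:
  assumes "cmpf f" "cmpf g" shows "cmpf (\<lambda>z. f (g z))"
proof -
  obtain r s where "\<And>z. computes r [ce z] (ce (f z))" "\<And>z. computes s [ce z] (ce (g z))"
    using assms unfolding cmpf_def by auto
  then have "computes (Comp r [s]) [ce z] (ce (f (g z)))" for z
    by (intro computes.Comp[of _ _ "[ce (g z)]"]) auto
  then show ?thesis unfolding cmpf_def by blast
qed

lemma cmpf_rcomp1:
  assumes "rcomp 1 h" "cmpf f" "\<And>z. h [ce (f z)] = ce (k z)" shows "cmpf k"
proof -
  obtain r s where "\<And>xs. length xs = 1 \<Longrightarrow> computes r xs (h xs)" "\<And>z. computes s [ce z] (ce (f z))"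
    using assms(1,2) unfolding cmpf_def rcomp_def by auto
  then have "computes (Comp r [s]) [ce z] (h [ce (f z)])" for z
    by (intro computes.Comp[of _ _ "[ce (f z)]"]) auto
  then show ?thesis unfolding cmpf_def assms(3) by blast
qed

lemma cmpf_rcomp2:
  assumes "rcomp 2 h" "cmpf f" "cmpf g" "\<And>z. h [ce (f z), ce (g z)] = ce (k z)" shows "cmpf k"
proof -
  obtain r s t where "\<And>xs. length xs = 2 \<Longrightarrow> computes r xs (h xs)" "\<And>z. computes s [ce z] (ce (f z))"
    "\<And>z. computes t [ce z] (ce (g z))"
    using assms(1,2,3) unfolding cmpf_def rcomp_def by metis
  then have "computes (Comp r [s, t]) [ce z] (h [ce (f z), ce (g z)])" for z
    by (intro computes.Comp[of _ _ "[ce (f z), ce (g z)]"]) auto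
  then show ?thesis unfolding cmpf_def assms(4) by blast
qed

lemma rcomp_const: "rcomp n (\<lambda>_. k)"
  by (induction k) (auto intro: rcomp_zero rcomp_Suc')

lemma cmpf_const: "cmpf (\<lambda>z. c)"
  by (rule cmpf_rcomp1[OF rcomp_const cmpf_id]) simp

lemma cmpf_pair: "cmpf f \<Longrightarrow> cmpf g \<Longrightarrow> cmpf (\<lambda>z. (f z, g z))"
  by (rule cmpf_rcomp2[OF rcomp_pair[OF rcomp_proj[of 0] rcomp_proj[of 1]]])
    (auto simp: ce_prod_def)

lemma cmpf_fst: "cmpf f \<Longrightarrow> cmpf (\<lambda>z. fst (f z))"
  by (rule cmpf_rcomp1[OF rcomp_unpair(1)[OF rcomp_proj[of 0]]]) (auto simp: ce_prod_def)

lemma cmpf_snd: "cmpf f \<Longrightarrow> cmpf (\<lambda>z. snd (f z))"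
  by (rule cmpf_rcomp1[OF rcomp_unpair(2)[OF rcomp_proj[of 0]]]) (auto simp: ce_prod_def)

lemma cmpf_prod_encode: "cmpf f \<Longrightarrow> cmpf (\<lambda>z. prod_encode (f z))"
  unfolding cmpf_def ce_prod_def ce_nat_def by simp

lemma cmpf_prod_decode: "cmpf f \<Longrightarrow> cmpf (\<lambda>z. prod_decode (f z))"
  unfolding cmpf_def ce_prod_def ce_nat_def by simp

lemma cmpf_Suc: "cmpf f \<Longrightarrow> cmpf (\<lambda>z. Suc (f z))"
  by (rule cmpf_rcomp1[OF rcomp_Suc]) (auto simp: ce_nat_def)

lemma cmpf_add: "cmpf f \<Longrightarrow> cmpf g \<Longrightarrow> cmpf (\<lambda>z. f z + g z :: nat)"
  by (rule cmpf_rcomp2[OF rcomp_add[OF rcomp_proj[of 0] rcomp_proj[of 1]], of f g])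
    (auto simp: ce_nat_def)

lemma cmpf_diff: "cmpf f \<Longrightarrow> cmpf g \<Longrightarrow> cmpf (\<lambda>z. f z - g z :: nat)"
  by (rule cmpf_rcomp2[OF rcomp_diff[OF rcomp_proj[of 0] rcomp_proj[of 1]], of f g])
    (auto simp: ce_nat_def)

text \<open>Recursion with the parameter \<open>z\<close> available in every step and with values of
  any coded type. The step function is uncurried in the hypothesis because \<open>cmpf\<close>
  speaks of unary functions.\<close>

lemma cmpf_rec:
  fixes b :: "'a::cenc \<Rightarrow> 'b::cenc"
  assumes "cmpf n" "cmpf b" "cmpf (\<lambda>x. s (fst x) (fst (snd x)) (snd (snd x)))"
  shows "cmpf (\<lambda>z. rec_nat (b z) (\<lambda>k r. s k r z) (n z))"
proof -
  obtain n' b' s' where n': "\<And>z. computes n' [ce z] (n z)"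
    and b': "\<And>z. computes b' [ce z] (ce (b z))"
    and s': "\<And>x. computes s' [ce x] (ce (s (fst x) (fst (snd x)) (snd (snd x))))"
    using assms unfolding cmpf_def ce_nat_def by blast
  \<comment> \<open>\<open>PrimRec\<close> hands the counter, the previous value and the parameter
    to the step as three arguments; \<open>p\<close> packs them into the single number that
    \<open>s'\<close> expects.\<close>
  have "rcomp 3 (\<lambda>xs. prod_encode (xs ! 0, prod_encode (xs ! 1, xs ! 2)))"
    by (intro rcomp_pair rcomp_proj) auto
  then obtain p where p: "\<And>xs. length xs = 3 \<Longrightarrow>
      computes p xs (prod_encode (xs ! 0, prod_encode (xs ! 1, xs ! 2)))"
    unfolding rcomp_def by auto
  have S: "computes (Comp s' [p]) [k, ce r, ce z] (ce (s k r z))" for k r z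
    using s'[of "(k, r, z)"] p[of "[k, ce r, ce z]"]
    by (intro computes.Comp[of _ _ "[ce (k, r, z)]"]) (auto simp: ce_prod_def ce_nat_def)
  have R: "computes (PrimRec b' (Comp s' [p])) [m, ce z] (ce (rec_nat (b z) (\<lambda>k r. s k r z) m))" for m z
  proof (induction m)
    case 0 then show ?case by (auto intro: computes.PrimRec_0 b')
  next
    case (Suc m) then show ?case by (auto intro!: computes.PrimRec_Suc S)
  qed
  have "computes (Comp (PrimRec b' (Comp s' [p])) [n', Proj 0]) [ce z] (ce (rec_nat (b z) (\<lambda>k r. s k r z) (n z)))" for z
    using computes.Proj[of 0 "[ce z]"]
    by (intro computes.Comp[of _ _ "[n z, ce z]"] R) (auto simp: n')
  then show ?thesis unfolding cmpf_def by blast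
qed

text \<open>A recursion whose length is the truth value: zero rounds return \<open>g z\<close>, one
  round replaces it by \<open>f z\<close>.\<close>

lemma cmpf_if:
  fixes f :: "'a::cenc \<Rightarrow> 'b::cenc"
  assumes "cmpf P" "cmpf f" "cmpf g" shows "cmpf (\<lambda>z. if P z then f z else g z)"
proof -
  have 1: "cmpf (\<lambda>z. ce (P z))" using assms(1) unfolding cmpf_def ce_nat_def by simp
  have 2: "(\<lambda>z. if P z then f z else g z) = (\<lambda>z. rec_nat (g z) (\<lambda>k r. f z) (ce (P z)))"
    by (auto simp: ce_bool_def)
  show ?thesis unfolding 2
    by (intro cmpf_rec 1 assms cmpf_comp[OF assms(2), of "\<lambda>x. snd (snd x)"] cmpf_snd cmpf_id)
qed

lemma cmpf_mult: "cmpf f \<Longrightarrow> cmpf g \<Longrightarrow> cmpf (\<lambda>z. f z * g z :: nat)"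
proof -
  assume fg: "cmpf f" "cmpf g"
  have 2: "(\<lambda>z. f z * g z) = (\<lambda>z. rec_nat 0 (\<lambda>k r. r + g z) (f z))"
  proof
    fix z
    have "rec_nat 0 (\<lambda>k r. r + g z) n = n * g z" for n by (induction n) auto
    then show "f z * g z = rec_nat 0 (\<lambda>k r. r + g z) (f z)" by simp
  qed
  show ?thesis unfolding 2
    by (intro cmpf_rec cmpf_const cmpf_add fg cmpf_comp[OF fg(2), of "\<lambda>x. snd (snd x)"] cmpf_fst cmpf_snd cmpf_id)
qed

lemma cmpf_power: "cmpf f \<Longrightarrow> cmpf g \<Longrightarrow> cmpf (\<lambda>z. f z ^ g z :: nat)"
proof -
  assume fg: "cmpf f" "cmpf g"
  have 2: "(\<lambda>z. f z ^ g z) = (\<lambda>z. rec_nat 1 (\<lambda>k r. r * f z) (g z))"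
  proof
    fix z
    have "rec_nat 1 (\<lambda>k r. r * f z) n = f z ^ n" for n by (induction n) auto
    then show "f z ^ g z = rec_nat 1 (\<lambda>k r. r * f z) (g z)" by simp
  qed
  show ?thesis unfolding 2
    by (intro cmpf_rec cmpf_const cmpf_mult fg cmpf_comp[OF fg(1), of "\<lambda>x. snd (snd x)"] cmpf_fst cmpf_snd cmpf_id)
qed

lemma cmpf_eq0: "cmpf f \<Longrightarrow> cmpf (\<lambda>z. f z = (0::nat))"
proof -
  assume f: "cmpf f"
  have 2: "(\<lambda>z. f z = 0) = (\<lambda>z. rec_nat True (\<lambda>k r. False) (f z))"
  proof
    fix z show "(f z = 0) = rec_nat True (\<lambda>k r. False) (f z)" by (cases "f z") auto
  qed
  show ?thesis unfolding 2 by (intro cmpf_rec cmpf_const f)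
qed

lemma cmpf_le: "cmpf f \<Longrightarrow> cmpf g \<Longrightarrow> cmpf (\<lambda>z. f z \<le> (g z :: nat))"
  unfolding diff_is_0_eq[symmetric] by (intro cmpf_eq0 cmpf_diff)

lemma cmpf_less: "cmpf f \<Longrightarrow> cmpf g \<Longrightarrow> cmpf (\<lambda>z. f z < (g z :: nat))"
  unfolding Suc_le_eq[symmetric] by (intro cmpf_le cmpf_Suc)

lemma cmpf_not: "cmpf P \<Longrightarrow> cmpf (\<lambda>z. \<not> P z)"
  using cmpf_if[of P "\<lambda>_. False" "\<lambda>_. True"] by (simp add: cmpf_const if_bool_eq_conj)

lemma cmpf_conj: "cmpf P \<Longrightarrow> cmpf Q \<Longrightarrow> cmpf (\<lambda>z. P z \<and> Q z)"
  using cmpf_if[of P Q "\<lambda>_. False"] by (simp add: cmpf_const if_bool_eq_disj)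

lemma cmpf_disj: "cmpf P \<Longrightarrow> cmpf Q \<Longrightarrow> cmpf (\<lambda>z. P z \<or> Q z)"
  using cmpf_not[OF cmpf_conj[OF cmpf_not cmpf_not]] by (simp add: de_Morgan_conj)

lemma cmpf_imp: "cmpf P \<Longrightarrow> cmpf Q \<Longrightarrow> cmpf (\<lambda>z. P z \<longrightarrow> Q z)"
  unfolding imp_conv_disj by (intro cmpf_disj cmpf_not)

lemma cmpf_eq: "cmpf f \<Longrightarrow> cmpf g \<Longrightarrow> cmpf (\<lambda>z. f z = (g z :: nat))"
  unfolding order.eq_iff by (intro cmpf_conj cmpf_le)

lemma cmpf_iff: "cmpf P \<Longrightarrow> cmpf Q \<Longrightarrow> cmpf (\<lambda>z. P z = (Q z :: bool))"
  unfolding iff_conv_conj_imp by (intro cmpf_conj cmpf_imp)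

lemma cmpf_bex:
  fixes P :: "nat \<Rightarrow> 'a::cenc \<Rightarrow> bool"
  assumes "cmpf n" "cmpf (\<lambda>x. P (fst x) (snd x))" shows "cmpf (\<lambda>z. \<exists>k<n z. P k z)"
proof -
  have 2: "(\<lambda>z. \<exists>k<n z. P k z) = (\<lambda>z. rec_nat False (\<lambda>k r. r \<or> P k z) (n z))"
  proof
    fix z
    have "rec_nat False (\<lambda>k r. r \<or> P k z) m = (\<exists>k<m. P k z)" for m
      by (induction m) (auto simp: less_Suc_eq)
    then show "(\<exists>k<n z. P k z) = rec_nat False (\<lambda>k r. r \<or> P k z) (n z)" by simp
  qed
  have 3: "cmpf (\<lambda>x. P (fst x) (snd (snd x)))"
    using cmpf_comp[OF assms(2), of "\<lambda>x. (fst x, snd (snd x))"]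
    by (simp add: cmpf_pair cmpf_fst cmpf_snd cmpf_id)
  show ?thesis unfolding 2
    by (intro cmpf_rec cmpf_const cmpf_disj 3 assms cmpf_fst cmpf_snd cmpf_id)
qed

lemma cmpf_ball:
  fixes P :: "nat \<Rightarrow> 'a::cenc \<Rightarrow> bool"
  assumes "cmpf n" "cmpf (\<lambda>x. P (fst x) (snd x))" shows "cmpf (\<lambda>z. \<forall>k<n z. P k z)"
  using cmpf_not[OF cmpf_bex[where P = "\<lambda>k z. \<not> P k z", OF assms(1) cmpf_not[OF assms(2)]]] by simp

lemma cmpf_least:
  fixes P :: "nat \<Rightarrow> 'a::cenc \<Rightarrow> bool"
  assumes "cmpf (\<lambda>x. P (fst x) (snd x))" "\<And>z. \<exists>k. P k z" shows "cmpf (\<lambda>z. LEAST k. P k z)"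
proof -
  \<comment> \<open>Minimisation looks for the value 0, which is the code of \<open>False\<close>;
    hence the program of the negated predicate is taken.\<close>
  obtain p where p: "\<And>x. computes p [ce x] (ce (\<not> P (fst x) (snd x)))"
    using cmpf_not[OF assms(1)] unfolding cmpf_def by blast
  obtain e where e: "\<And>xs. length xs = 2 \<Longrightarrow> computes e xs (prod_encode (xs ! 0, xs ! 1))"
    using rcomp_pair[OF rcomp_proj[of 0 2] rcomp_proj[of 1 2]] unfolding rcomp_def by auto
  have c: "computes (Comp p [e]) [k, ce z] (ce (\<not> P k z))" for k z
    using p[of "(k, z)"] e[of "[k, ce z]"]
    by (intro computes.Comp[of _ _ "[ce (k, z)]"]) (auto simp: ce_prod_def ce_nat_def)
  have "computes (Mu (Comp p [e])) [ce z] (LEAST k. P k z)" for z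
  proof (rule computes.Mu)
    have "P (LEAST k. P k z) z" using assms(2) by (rule LeastI_ex)
    then show "computes (Comp p [e]) [LEAST k. P k z, ce z] 0"
      using c[of "LEAST k. P k z" z] by (simp add: ce_bool_def)
    show "\<forall>i<LEAST k. P k z. \<exists>m. computes (Comp p [e]) [i, ce z] (Suc m)"
    proof (intro allI impI)
      fix i assume "i < (LEAST k. P k z)"
      then have "\<not> P i z" using not_less_Least by blast
      then show "\<exists>m. computes (Comp p [e]) [i, ce z] (Suc m)"
        using c[of i z] by (auto simp: ce_bool_def)
    qed
  qed
  then show ?thesis unfolding cmpf_def ce_nat_def by blast
qed

lemmas cmpf_basic = cmpf_id cmpf_const cmpf_pair cmpf_fst cmpf_snd cmpf_prod_encode cmpf_prod_decode
  cmpf_Suc cmpf_add cmpf_diff cmpf_mult cmpf_power cmpf_if cmpf_le cmpf_less cmpf_eq cmpf_iff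
  cmpf_not cmpf_conj cmpf_disj cmpf_imp cmpf_bex cmpf_ball

section \<open>Binary digits, finite sets and arrays as numbers\<close>

lemma cmpf_div2: "cmpf f \<Longrightarrow> cmpf g \<Longrightarrow> cmpf (\<lambda>z. f z div 2 ^ g z :: nat)"
proof -
  assume fg: "cmpf f" "cmpf g"
  have eq: "m div d = (LEAST q. m < d * Suc q)" if "d > 0" for m d :: nat
  proof (intro Least_equality[symmetric])
    show "m < d * Suc (m div d)" using dividend_less_times_div[OF that] by simp
    show "m div d \<le> q" if "m < d * Suc q" for q
      using less_mult_imp_div_less[of m "Suc q" d] that by (simp add: mult.commute)
  qed
  have "cmpf (\<lambda>x. LEAST q. fst x < 2 ^ snd x * Suc q :: nat)"
  proof (rule cmpf_least)
    show "cmpf (\<lambda>x. fst (snd x) < 2 ^ snd (snd x) * Suc (fst x))"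
      by (intro cmpf_basic)
    fix z :: "nat \<times> nat"
    have "fst z < 1 * Suc (fst z)" by simp
    also have "\<dots> \<le> 2 ^ snd z * Suc (fst z)" by (rule mult_right_mono) auto
    finally show "\<exists>k. fst z < 2 ^ snd z * Suc k" by blast
  qed
  from cmpf_comp[OF this cmpf_pair[OF fg]] show ?thesis by (simp add: eq)
qed

lemma cmpf_bit: "cmpf f \<Longrightarrow> cmpf g \<Longrightarrow> cmpf (\<lambda>z. bit (f z :: nat) (g z))"
proof -
  assume fg: "cmpf f" "cmpf g"
  have "bit n k \<longleftrightarrow> n div 2 ^ k - 2 * (n div 2 ^ Suc k) = 1" for n k :: nat
  proof -
    have "n div 2 ^ Suc k = n div 2 ^ k div 2" by (metis div_mult2_eq mult.commute power_Suc)
    then show ?thesis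
      by (simp add: bit_iff_odd odd_iff_mod_2_eq_one minus_mult_div_eq_mod)
  qed
  then show ?thesis by (simp only:) (intro cmpf_basic cmpf_div2 fg)
qed

text \<open>The set of all \<open>k < n\<close> with \<open>P k\<close>, stored as the number with
  these binary digits. The recursion, in place of a sum over a set, is what \<open>cmpf_rec\<close>
  can process.\<close>

definition bset :: "nat \<Rightarrow> (nat \<Rightarrow> bool) \<Rightarrow> nat" where
  "bset n P = rec_nat 0 (\<lambda>k r. if P k then r + 2 ^ k else r) n"

lemma bset_less: "bset n P < 2 ^ n"
  by (induction n) (auto simp: bset_def)

lemma bit_bset: "bit (bset n P) k \<longleftrightarrow> k < n \<and> P k"
proof (induction n)
  case 0 then show ?case by (simp add: bset_def)
next
  case (Suc n)
  have S: "bset (Suc n) P = (if P n then bset n P + 2 ^ n else bset n P)" by (simp add: bset_def)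
  have "bset n P + 2 ^ n = set_bit n (bset n P)"
    using Suc bset_less[of n P] by (simp add: set_bit_eq bit_iff_odd)
  then show ?case using Suc by (auto simp: S bit_set_bit_iff less_Suc_eq split: if_splits)
qed

lemma nat_eq_bset: "m < 2 ^ n \<Longrightarrow> m = bset n (bit m)"
  by (rule bit_eqI) (metis bit_bset bit_take_bit_iff take_bit_nat_eq_self)

lemma cmpf_bset:
  assumes "cmpf n" "cmpf (\<lambda>x. P (fst x) (snd x))" shows "cmpf (\<lambda>z. bset (n z) (\<lambda>k. P k z))"
proof -
  have 3: "cmpf (\<lambda>x. P (fst x) (snd (snd x)))"
    using cmpf_comp[OF assms(2), of "\<lambda>x. (fst x, snd (snd x))"]
    by (simp add: cmpf_pair cmpf_fst cmpf_snd cmpf_id)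
  show ?thesis unfolding bset_def by (intro cmpf_rec 3 assms cmpf_basic)
qed

text \<open>An array \<open>f 0, \<dots>, f (n - 1)\<close> is stored as the set of the codes of the pairs \<open>(k, f k)\<close>.\<close>

definition tab :: "nat \<Rightarrow> (nat \<Rightarrow> nat) \<Rightarrow> nat" where
  "tab n f = rec_nat 0 (\<lambda>k r. set_bit (prod_encode (k, f k)) r) n"

text \<open>The disjunct \<open>T \<le> v\<close> stops the search for keys that are not stored, so
  minimisation is total. It cannot preempt a stored value \<open>v\<close>: this is at most the code
  of its pair, which is a bit position of \<open>T\<close> and therefore below
  \<open>T\<close>.\<close>

definition lk :: "nat \<Rightarrow> nat \<Rightarrow> nat" where
  "lk T k = (LEAST v. bit T (prod_encode (k, v)) \<or> T \<le> v)"

lemma bit_tab: "bit (tab n f) i \<longleftrightarrow> (\<exists>k<n. i = prod_encode (k, f k))"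
  by (induction n) (auto simp: tab_def bit_set_bit_iff less_Suc_eq)

lemma bit_imp_less: "bit (n::nat) k \<Longrightarrow> k < n"
proof -
  assume "bit n k"
  then have "n div 2 ^ k \<noteq> 0" by (metis bit_iff_odd even_zero)
  then have "2 ^ k \<le> n" by (simp add: div_eq_0_iff)
  then show ?thesis using less_exp[of k] by linarith
qed

lemma lk_tab: "k < n \<Longrightarrow> lk (tab n f) k = f k"
proof -
  assume k: "k < n"
  have b: "bit (tab n f) (prod_encode (k, v)) \<longleftrightarrow> v = f k" for v
    using k by (auto simp: bit_tab)
  have "f k < tab n f"
    using bit_imp_less[of "tab n f" "prod_encode (k, f k)"] b le_prod_encode_2[of "f k" k] by fastforce
  then show ?thesis unfolding lk_def b by (intro Least_equality) auto
qed

lemma set_bit_nat_alt: "set_bit k n = (if bit n k then n else n + 2 ^ k)" for n :: nat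
  by (simp add: set_bit_eq bit_iff_odd)

lemma cmpf_lk: "cmpf f \<Longrightarrow> cmpf g \<Longrightarrow> cmpf (\<lambda>z. lk (f z) (g z))"
proof -
  assume fg: "cmpf f" "cmpf g"
  have "cmpf (\<lambda>x. lk (fst x) (snd x))"
    unfolding lk_def by (rule cmpf_least) (auto intro!: cmpf_basic cmpf_bit)
  from cmpf_comp[OF this cmpf_pair[OF fg]] show ?thesis by simp
qed

lemma cmpf_tab:
  assumes "cmpf n" "cmpf (\<lambda>x. f (fst x) (snd x))" shows "cmpf (\<lambda>z. tab (n z) (\<lambda>k. f k z))"
proof -
  have 3: "cmpf (\<lambda>x. f (fst x) (snd (snd x)))"
    using cmpf_comp[OF assms(2), of "\<lambda>x. (fst x, snd (snd x))"]
    by (simp add: cmpf_pair cmpf_fst cmpf_snd cmpf_id)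
  show ?thesis unfolding tab_def set_bit_nat_alt by (intro cmpf_rec 3 assms cmpf_basic cmpf_bit)
qed

lemmas cmpf_intros = cmpf_basic cmpf_bit cmpf_bset cmpf_lk cmpf_tab

text \<open>Course-of-values recursion: the step function sees the array of all earlier values.\<close>

definition cov :: "(nat \<Rightarrow> nat \<Rightarrow> nat) \<Rightarrow> nat \<Rightarrow> nat" where
  "cov s n = s n (rec_nat 0 (\<lambda>k T. set_bit (prod_encode (k, s k T)) T) n)"

lemma cov_unfold: "cov s n = s n (tab n (cov s))"
proof -
  have "rec_nat 0 (\<lambda>k T. set_bit (prod_encode (k, s k T)) T) n = tab n (cov s)"
    unfolding tab_def by (induction n) (auto simp: cov_def)
  then show ?thesis by (simp add: cov_def)
qed

lemma cmpf_cov: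
  assumes "cmpf n" "cmpf (\<lambda>x. s (fst x) (fst (snd x)) (snd (snd x)))"
  shows "cmpf (\<lambda>z. cov (\<lambda>k T. s k T z) (n z))"
proof -
  have 1: "cmpf (\<lambda>z. rec_nat 0 (\<lambda>k T. set_bit (prod_encode (k, s k T z)) T) (n z))"
    unfolding set_bit_nat_alt by (intro cmpf_rec assms cmpf_intros)
  show ?thesis unfolding cov_def
    using cmpf_comp[OF assms(2) cmpf_pair[OF assms(1) cmpf_pair[OF 1 cmpf_id]]] by simp
qed

lemma cmpf_ceillog2: "cmpf f \<Longrightarrow> cmpf (\<lambda>z. ceillog2 (f z))"
proof -
  assume f: "cmpf f"
  have eq: "ceillog2 n = (LEAST k. n \<le> 2 ^ k)" for n
  proof (rule Least_equality[symmetric])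
    show "n \<le> 2 ^ ceillog2 n" by (rule le_two_power_ceillog2)
    show "ceillog2 n \<le> k" if "n \<le> 2 ^ k" for k
      using that ceillog2_le_iff[of n k] by (cases "n = 0") auto
  qed
  have "cmpf (\<lambda>x. LEAST k. x \<le> (2::nat) ^ k)"
    by (rule cmpf_least) (auto intro!: cmpf_basic exI le_two_power_ceillog2)
  from cmpf_comp[OF this f] show ?thesis by (simp add: eq)
qed

section \<open>Finite semigroups and products of infinite sequences\<close>

fun segn :: "(nat \<Rightarrow> nat \<Rightarrow> nat) \<Rightarrow> (nat \<Rightarrow> nat) \<Rightarrow> nat \<Rightarrow> nat \<Rightarrow> nat" where
  "segn mul x i 0 = x i"
| "segn mul x i (Suc n) = mul (segn mul x i n) (x (i + Suc n))"

text \<open>The product of the letters with indices from \<open>i\<close> to \<open>j - 1\<close>.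
  It is meant for \<open>i < j\<close> only, as a semigroup has no empty product.\<close>

definition seg :: "(nat \<Rightarrow> nat \<Rightarrow> nat) \<Rightarrow> (nat \<Rightarrow> nat) \<Rightarrow> nat \<Rightarrow> nat \<Rightarrow> nat" where
  "seg mul x i j = segn mul x i (j - Suc i)"

lemma seg_one [simp]: "seg mul x i (Suc i) = x i"
  by (simp add: seg_def)

lemma seg_Suc: "i < j \<Longrightarrow> seg mul x i (Suc j) = mul (seg mul x i j) (x j)"
proof -
  assume "i < j"
  then obtain n where "j = Suc (i + n)" using less_imp_Suc_add by blast
  then show ?thesis by (simp add: seg_def)
qed

lemma seg_induct [consumes 1, case_names one Suc]:
  assumes "i < (j::nat)" "P (Suc i)" "\<And>j. i < j \<Longrightarrow> P j \<Longrightarrow> P (Suc j)"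
  shows "P j"
  using assms(1)
proof (induction j)
  case (Suc j) then show ?case using assms(2,3) by (cases "i = j") auto
qed simp

lemma seg_cong: "i < j \<Longrightarrow> (\<And>k. i \<le> k \<Longrightarrow> k < j \<Longrightarrow> x k = y k) \<Longrightarrow> seg mul x i j = seg mul y i j"
  by (induction rule: seg_induct) (auto simp: seg_Suc)

lemma seg_shift: "i < j \<Longrightarrow> seg mul x (i + d) (j + d) = seg mul (\<lambda>k. x (k + d)) i j"
  by (induction rule: seg_induct) (auto simp: seg_Suc)

lemma segn_seg: "segn mul x i n = seg mul x i (Suc (i + n))"
  by (simp add: seg_def)

text \<open>A factorisation of the infinite sequence as \<open>s e e e ...\<close>. Neither
  idempotence of \<open>e\<close> nor \<open>s e = s\<close> is demanded, so any periodic grouping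
  that comes up counts as one; Ramsey's theorem supplies the better behaved ones.\<close>

definition fac :: "(nat \<Rightarrow> nat \<Rightarrow> nat) \<Rightarrow> (nat \<Rightarrow> nat) \<Rightarrow> nat \<Rightarrow> nat \<Rightarrow> bool" where
  "fac mul x s e \<longleftrightarrow> (\<exists>\<kappa>. strict_mono \<kappa> \<and> 0 < \<kappa> 0 \<and> seg mul x 0 (\<kappa> 0) = s \<and>
     (\<forall>i. seg mul x (\<kappa> i) (\<kappa> (Suc i)) = e))"

text \<open>\<open>om e\<close> plays the part of the infinite power of \<open>e\<close>, so
  \<open>mul s (om e)\<close> is the value of \<open>s e e e ...\<close>. That the verdict is the
  same for all factorisations is the axiom \<open>consist\<close> of \<open>walg\<close>.\<close>

definition wval :: "(nat \<Rightarrow> nat \<Rightarrow> nat) \<Rightarrow> (nat \<Rightarrow> nat) \<Rightarrow> (nat \<Rightarrow> bool) \<Rightarrow> (nat \<Rightarrow> nat) \<Rightarrow> bool" where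
  "wval mul om ac x \<longleftrightarrow> (\<exists>s e. fac mul x s e \<and> ac (mul s (om e)))"

locale fsg =
  fixes N :: nat and mul :: "nat \<Rightarrow> nat \<Rightarrow> nat"
  assumes mul_closed: "s < N \<Longrightarrow> t < N \<Longrightarrow> mul s t < N"
    and mul_assoc: "s < N \<Longrightarrow> t < N \<Longrightarrow> u < N \<Longrightarrow> mul (mul s t) u = mul s (mul t u)"
begin

abbreviation "sg \<equiv> seg mul"

lemma seg_closed: "i < j \<Longrightarrow> (\<And>k. x k < N) \<Longrightarrow> sg x i j < N"
  by (induction rule: seg_induct) (auto simp: seg_Suc mul_closed)

lemma seg_split:
  assumes "i < j" "j < k" "\<And>k. x k < N"
  shows "sg x i k = mul (sg x i j) (sg x j k)"
  using assms(2)
proof (induction rule: seg_induct)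
  case one then show ?case using assms by (simp add: seg_Suc)
next
  case (Suc k) then show ?case using assms by (simp add: seg_Suc mul_assoc seg_closed)
qed

lemma seg_blocks:
  assumes "strict_mono \<kappa>" "\<And>k. x k < N" "i < j"
  shows "sg (\<lambda>i. sg x (\<kappa> i) (\<kappa> (Suc i))) i j = sg x (\<kappa> i) (\<kappa> j)"
  using assms(3)
proof (induction rule: seg_induct)
  case (Suc j)
  then show ?case using assms(1)
    by (simp add: seg_Suc seg_split[of "\<kappa> i" "\<kappa> j", OF _ _ assms(2)] strict_mono_less)
qed simp

lemma fac_blocks:
  assumes \<kappa>: "strict_mono \<kappa>" "\<kappa> 0 = 0" and x: "\<And>k. x k < N"
    and f: "fac mul (\<lambda>i. sg x (\<kappa> i) (\<kappa> (Suc i))) s e"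
  shows "fac mul x s e"
proof -
  obtain \<mu> where \<mu>: "strict_mono \<mu>" "0 < \<mu> 0"
    "sg (\<lambda>i. sg x (\<kappa> i) (\<kappa> (Suc i))) 0 (\<mu> 0) = s"
    "\<And>i. sg (\<lambda>i. sg x (\<kappa> i) (\<kappa> (Suc i))) (\<mu> i) (\<mu> (Suc i)) = e"
    using f unfolding fac_def by blast
  have "strict_mono (\<kappa> \<circ> \<mu>)" using \<kappa>(1) \<mu>(1) by (rule strict_mono_o)
  moreover have "0 < \<kappa> (\<mu> 0)" using \<kappa> \<mu>(2) by (metis strict_mono_less)
  ultimately show ?thesis unfolding fac_def
    using \<mu>(3,4) seg_blocks[OF \<kappa>(1) x \<mu>(2)] seg_blocks[OF \<kappa>(1) x strict_mono_less[THEN iffD2, OF \<mu>(1)]] \<kappa>(2)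
    by (intro exI[of _ "\<kappa> \<circ> \<mu>"]) auto
qed

text \<open>Pairs of positions in \<open>K\<close> are coloured by the product of the segment
  between them. On a homogeneous set all segments have the same product, and concatenating two of
  them shows that it is idempotent.\<close>

lemma ramsey_fac:
  assumes K: "infinite K" and x: "\<And>k. x k < N"
  obtains \<kappa> :: "nat \<Rightarrow> nat" and s e where "strict_mono \<kappa>" "0 < \<kappa> 0" "\<And>i. \<kappa> i \<in> K" "\<And>i. sg x 0 (\<kappa> i) = s"
    "\<And>i j. i < j \<Longrightarrow> sg x (\<kappa> i) (\<kappa> j) = e" "mul e e = e" "mul s e = s" "s < N" "e < N"
proof -
  have "infinite (K - {0})" using K by simp
  moreover have "\<forall>a\<in>K - {0}. \<forall>b\<in>K - {0}. a \<noteq> b \<longrightarrow> (\<lambda>A. sg x (Min A) (Max A)) {a, b} < N"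
    by (auto intro!: seg_closed x simp: min_def max_def)
  ultimately have "\<exists>Y t. Y \<subseteq> K - {0} \<and> infinite Y \<and> t < N \<and>
      (\<forall>a\<in>Y. \<forall>b\<in>Y. a \<noteq> b \<longrightarrow> sg x (Min {a, b}) (Max {a, b}) = t)"
    by (rule Ramsey2)
  then obtain Y e where Y: "Y \<subseteq> K - {0}" "infinite Y" "e < N"
    "\<And>a b. a \<in> Y \<Longrightarrow> b \<in> Y \<Longrightarrow> a \<noteq> b \<Longrightarrow> sg x (Min {a, b}) (Max {a, b}) = e"
    by auto
  \<comment> \<open>The least position of the homogeneous set is left out and becomes
    \<open>a\<close> below. The prefix up to any later position then ends with a factor
    \<open>e\<close>, which gives \<open>mul s e = s\<close> and one and the same prefix product for
    all cuts.\<close>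
  define \<kappa> where "\<kappa> i = enumerate Y (Suc i)" for i
  have mono: "strict_mono \<kappa>"
    unfolding \<kappa>_def using strict_mono_enumerate[OF Y(2)] by (simp add: strict_mono_def)
  have inY: "\<kappa> i \<in> Y" for i unfolding \<kappa>_def by (rule enumerate_in_set[OF Y(2)])
  have e: "sg x a b = e" if "a \<in> Y" "b \<in> Y" "a < b" for a b
    using Y(4)[OF that(1,2)] that(3) by simp
  have ij: "sg x (\<kappa> i) (\<kappa> j) = e" if "i < j" for i j
    using e[OF inY inY] strict_mono_less[OF mono] that by blast
  define a where "a = enumerate Y 0"
  have a: "a \<in> Y" "a < \<kappa> i" "0 < a" for i
    using enumerate_in_set[OF Y(2), of 0] Y(1) enumerate_mono[OF _ Y(2), of 0 "Suc i"]
    by (auto simp: a_def \<kappa>_def)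
  have ee: "mul e e = e"
    using seg_split[of "\<kappa> 0" "\<kappa> 1" "\<kappa> 2" x] mono x
    by (simp add: ij strict_mono_less)
  have s: "sg x 0 (\<kappa> i) = mul (sg x 0 a) e" for i
    using seg_split[of 0 a "\<kappa> i" x] a x e[OF a(1) inY a(2)] by simp
  have "sg x 0 a < N" using a(3) x by (intro seg_closed) auto
  then have "mul (mul (sg x 0 a) e) e = mul (sg x 0 a) e" "mul (sg x 0 a) e < N"
    using Y(3) by (auto simp: mul_assoc ee mul_closed)
  moreover have "0 < \<kappa> 0" using a by (meson less_trans)
  moreover have "\<kappa> i \<in> K" for i using inY Y(1) by blast
  ultimately show ?thesis 
    using Y(3) mono s ij ee by (intro that[of \<kappa> "mul (sg x 0 a) e" e]) auto
qed

end

text \<open>In place of the equational laws of a Wilke algebra, a single semantic condition relates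
  \<open>om\<close> to \<open>mul\<close>: two factorisations of the same sequence are both accepted
  or both rejected. \<open>om\<close> has to be right only up to acceptance, and in this form the
  condition carries over to the power algebra directly.\<close>

locale walg = fsg +
  fixes om :: "nat \<Rightarrow> nat" and ac :: "nat \<Rightarrow> bool"
  assumes om_closed: "s < N \<Longrightarrow> om s < N"
    and consist: "(\<And>k. x k < N) \<Longrightarrow> fac mul x s e \<Longrightarrow> fac mul x s' e' \<Longrightarrow>
      ac (mul s (om e)) = ac (mul s' (om e'))"
begin

abbreviation "val \<equiv> wval mul om ac"

lemma val_fac: "(\<And>k. x k < N) \<Longrightarrow> fac mul x s e \<Longrightarrow> val x \<longleftrightarrow> ac (mul s (om e))"
  unfolding wval_def using consist by blast

lemma fac_ex: assumes "\<And>k. x k < N" obtains s e where "fac mul x s e" "s < N" "e < N"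
proof -
  have K: "infinite (UNIV :: nat set)" by simp
  obtain \<kappa> :: "nat \<Rightarrow> nat" and s e where "strict_mono \<kappa>" "0 < \<kappa> 0" "\<And>i. sg x 0 (\<kappa> i) = s"
    "\<And>i j. i < j \<Longrightarrow> sg x (\<kappa> i) (\<kappa> j) = e" "s < N" "e < N"
    by (rule ramsey_fac[OF K, of x]) (use assms in auto)
  moreover from this have "fac mul x s e" unfolding fac_def by (intro exI[of _ \<kappa>]) auto
  ultimately show ?thesis by (intro that[of s e])
qed

text \<open>A factorisation of the sequence of block products is also one of the original sequence,
  with coarser cuts.\<close>

lemma val_blocks:
  assumes "strict_mono \<kappa>" "\<kappa> 0 = 0" "\<And>k. x k < N"
  shows "val (\<lambda>i. sg x (\<kappa> i) (\<kappa> (Suc i))) \<longleftrightarrow> val x"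
proof -
  have y: "sg x (\<kappa> i) (\<kappa> (Suc i)) < N" for i
    using assms by (intro seg_closed) (auto simp: strict_mono_less)
  obtain s e where se: "fac mul (\<lambda>i. sg x (\<kappa> i) (\<kappa> (Suc i))) s e" using fac_ex[of "\<lambda>i. sg x (\<kappa> i) (\<kappa> (Suc i))"] y by metis
  show ?thesis using val_fac[of "\<lambda>i. sg x (\<kappa> i) (\<kappa> (Suc i))", OF y se] val_fac[OF assms(3) fac_blocks[OF assms se]] by simp
qed

end

subsection \<open>The power algebra\<close>

definition pmul :: "nat \<Rightarrow> (nat \<Rightarrow> nat \<Rightarrow> nat) \<Rightarrow> nat \<Rightarrow> nat \<Rightarrow> nat" where
  "pmul N mul S T = bset N (\<lambda>x. \<exists>s<N. \<exists>t<N. bit S s \<and> bit T t \<and> x = mul s t)"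

text \<open>The subsemigroup generated by \<open>S\<close>, as the intersection of all closed
  supersets. Such a superset is a number below \<open>2 ^ N\<close>, so only bounded quantifiers
  occur and the definition is computable as it stands.\<close>

definition pgen :: "nat \<Rightarrow> (nat \<Rightarrow> nat \<Rightarrow> nat) \<Rightarrow> nat \<Rightarrow> nat" where
  "pgen N mul S = bset N (\<lambda>x. \<forall>C<(2::nat) ^ N. (\<forall>s<N. bit S s \<longrightarrow> bit C s) \<and>
     (\<forall>s<N. \<forall>t<N. bit C s \<and> bit C t \<longrightarrow> bit C (mul s t)) \<longrightarrow> bit C x)"

text \<open>By Ramsey's theorem every infinite product of elements of \<open>S\<close> groups into
  \<open>s e e ...\<close> with \<open>s\<close> and \<open>e\<close> finite products of elements of
  \<open>S\<close>; these values therefore represent the infinite power of the set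
  \<open>S\<close>.\<close>

definition pom :: "nat \<Rightarrow> (nat \<Rightarrow> nat \<Rightarrow> nat) \<Rightarrow> (nat \<Rightarrow> nat) \<Rightarrow> nat \<Rightarrow> nat" where
  "pom N mul om S = bset N (\<lambda>x. \<exists>s<N. \<exists>e<N. bit (pgen N mul S) s \<and> bit (pgen N mul S) e \<and> x = mul s (om e))"

definition pac :: "nat \<Rightarrow> (nat \<Rightarrow> bool) \<Rightarrow> nat \<Rightarrow> bool" where
  "pac N ac S \<longleftrightarrow> (\<exists>x<N. bit S x \<and> ac x)"

lemma bit_less_exp: "S < 2 ^ N \<Longrightarrow> bit (S::nat) s \<Longrightarrow> s < N"
  by (metis bit_bset nat_eq_bset)

context fsg begin

lemma bit_pmul: "bit (pmul N mul S T) x \<longleftrightarrow> (\<exists>s t. s < N \<and> t < N \<and> bit S s \<and> bit T t \<and> x = mul s t)"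
  unfolding pmul_def bit_bset using mul_closed by auto

lemma pmul_fsg: "fsg (2 ^ N) (pmul N mul)"
proof
  show "pmul N mul S T < 2 ^ N" for S T unfolding pmul_def by (rule bset_less)
  fix S T U
  show "pmul N mul (pmul N mul S T) U = pmul N mul S (pmul N mul T U)"
  proof (rule bit_eqI)
    fix x
    have "bit (pmul N mul (pmul N mul S T) U) x \<longleftrightarrow>
        (\<exists>s t u. s < N \<and> t < N \<and> u < N \<and> bit S s \<and> bit T t \<and> bit U u \<and> x = mul (mul s t) u)"
      unfolding bit_pmul using mul_closed by blast
    also have "\<dots> \<longleftrightarrow> (\<exists>s t u. s < N \<and> t < N \<and> u < N \<and> bit S s \<and> bit T t \<and> bit U u \<and> x = mul s (mul t u))"
      using mul_assoc by metis
    also have "\<dots> \<longleftrightarrow> bit (pmul N mul S (pmul N mul T U)) x"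
      unfolding bit_pmul using mul_closed by blast
    finally show "bit (pmul N mul (pmul N mul S T) U) x = bit (pmul N mul S (pmul N mul T U)) x" .
  qed
qed

lemma bit_pgen:
  "bit (pgen N mul S) s \<longleftrightarrow> (\<exists>f n. (\<forall>i. f i < N \<and> bit S (f i)) \<and> s = segn mul f 0 n)" (is "_ = ?R s")
proof
  assume L: "bit (pgen N mul S) s"
  \<comment> \<open>The finite products form one of the closed sets in the intersection. A finite
    word is presented as a prefix of an infinite sequence \<open>f\<close> with an arbitrary
    tail.\<close>
  define C where "C = bset N ?R"
  have C: "bit C s \<longleftrightarrow> ?R s" for s
    unfolding C_def bit_bset using seg_closed by (auto simp: segn_seg)
  have "bit C (mul s t)" if st: "?R s" "?R t" for s t
  proof -
    obtain f n where f: "\<And>i. f i < N \<and> bit S (f i)" "s = sg f 0 (Suc n)" using st(1) by (auto simp: segn_seg)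
    obtain g m where g: "\<And>i. g i < N \<and> bit S (g i)" "t = sg g 0 (Suc m)" using st(2) by (auto simp: segn_seg)
    define h where "h i = (if i \<le> n then f i else g (i - Suc n))" for i
    have h: "h i < N \<and> bit S (h i)" for i using f g by (auto simp: h_def)
    have "sg h 0 (Suc (Suc (n + m))) = mul (sg h 0 (Suc n)) (sg h (0 + Suc n) (Suc m + Suc n))"
      using seg_split[of 0 "Suc n" "Suc (Suc (n + m))" h] h by (simp add: add.commute)
    also have "sg h 0 (Suc n) = s" unfolding f(2) by (rule seg_cong) (auto simp: h_def)
    also have "sg h (0 + Suc n) (Suc m + Suc n) = t"
      unfolding g(2) by (subst seg_shift) (auto intro!: seg_cong simp: h_def)
    finally show ?thesis unfolding C using h by (auto simp: segn_seg intro!: exI[of _ h] exI[of _ "Suc (n + m)"])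
  qed
  then have 1: "\<forall>s<N. \<forall>t<N. bit C s \<and> bit C t \<longrightarrow> bit C (mul s t)" unfolding C by blast
  have 2: "\<forall>s<N. bit S s \<longrightarrow> bit C s"
    unfolding C by (auto intro!: exI[of _ "\<lambda>_. s" for s] exI[of _ 0])
  have 3: "C < 2 ^ N" unfolding C_def by (rule bset_less)
  have "bit C s" using L 1 2 3 unfolding pgen_def bit_bset by blast
  then show "?R s" unfolding C .
next
  assume "?R s"
  then obtain f n where f: "\<And>i. f i < N \<and> bit S (f i)" "s = segn mul f 0 n" by auto
  have "segn mul f 0 n < N \<and> bit C (segn mul f 0 n)" if "\<forall>s<N. bit S s \<longrightarrow> bit C s"
    "\<forall>s<N. \<forall>t<N. bit C s \<and> bit C t \<longrightarrow> bit C (mul s t)" for C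
    by (induction n) (use that f(1) mul_closed in auto)
  moreover have "s < N" unfolding f(2) segn_seg using f(1) by (intro seg_closed) auto
  ultimately show "bit (pgen N mul S) s" unfolding pgen_def bit_bset f(2) by blast
qed

lemma bit_seg_pmul:
  assumes "i < j" "\<And>k. y k < N" "\<And>k. bit (X k) (y k)"
  shows "bit (seg (pmul N mul) X i j) (sg y i j)"
  using assms(1)
proof (induction rule: seg_induct)
  case (Suc j) then show ?case using assms by (auto simp: seg_Suc bit_pmul intro!: seg_closed)
qed (use assms in auto)

lemma bit_seg_pmul_ex:
  assumes "i < j" "bit (seg (pmul N mul) X i j) s" "\<And>k. X k < 2 ^ N"
  shows "\<exists>y. (\<forall>k. i \<le> k \<and> k < j \<longrightarrow> bit (X k) (y k)) \<and> sg y i j = s"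
  using assms(1,2)
proof (induction arbitrary: s rule: seg_induct)
  case one then show ?case by (intro exI[of _ "\<lambda>_. s"]) (auto simp: less_Suc_eq_le)
next
  case (Suc j)
  from Suc.prems obtain a b where ab: "bit (seg (pmul N mul) X i j) a" "bit (X j) b" "s = mul a b"
    using Suc.hyps by (auto simp: seg_Suc bit_pmul)
  from Suc.IH[OF ab(1)] obtain y where y: "\<forall>k. i \<le> k \<and> k < j \<longrightarrow> bit (X k) (y k)" "sg y i j = a" by blast
  have "sg (y(j := b)) i j = a" unfolding y(2)[symmetric] by (rule seg_cong[OF Suc.hyps]) auto
  then have "sg (y(j := b)) i (Suc j) = s" using ab(3) Suc.hyps by (simp add: seg_Suc)
  moreover have "\<forall>k. i \<le> k \<and> k < Suc j \<longrightarrow> bit (X k) ((y(j := b)) k)" using y(1) ab(2) by (auto simp: less_Suc_eq)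
  ultimately show ?case by blast
qed

lemma choose_blocks:
  assumes \<kappa>: "strict_mono \<kappa>" "\<kappa> 0 = 0" and X: "\<And>k. X k < 2 ^ N"
    and g: "\<And>i. bit (seg (pmul N mul) X (\<kappa> i) (\<kappa> (Suc i))) (g i)"
  obtains y where "\<And>k. bit (X k) (y k)" "\<And>i. sg y (\<kappa> i) (\<kappa> (Suc i)) = g i"
proof -
  have less: "\<kappa> i < \<kappa> (Suc i)" for i using \<kappa>(1) by (simp add: strict_mono_less)
  have "\<forall>i. \<exists>y. (\<forall>k. \<kappa> i \<le> k \<and> k < \<kappa> (Suc i) \<longrightarrow> bit (X k) (y k)) \<and> sg y (\<kappa> i) (\<kappa> (Suc i)) = g i"
    using bit_seg_pmul_ex[OF less g X] by blast
  then obtain Y where Y: "\<And>i k. \<kappa> i \<le> k \<Longrightarrow> k < \<kappa> (Suc i) \<Longrightarrow> bit (X k) (Y i k)"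
    "\<And>i. sg (Y i) (\<kappa> i) (\<kappa> (Suc i)) = g i" by metis
  \<comment> \<open>\<open>b k\<close> is the index of the block that contains position
    \<open>k\<close>; the letters chosen separately for each block are joined along it.\<close>
  define b where "b k = (LEAST i. k < \<kappa> (Suc i))" for k
  have ex: "k < \<kappa> (Suc k)" for k using strict_mono_imp_increasing[OF \<kappa>(1), of "Suc k"] by linarith
  have b1: "k < \<kappa> (Suc (b k))" for k unfolding b_def using ex by (rule LeastI)
  have b2: "\<kappa> (b k) \<le> k" for k
  proof (cases "b k")
    case 0 then show ?thesis using \<kappa>(2) by simp
  next
    case (Suc m)
    then have "\<not> k < \<kappa> (Suc m)" using not_less_Least[of m "\<lambda>i. k < \<kappa> (Suc i)"] by (simp add: b_def)
    then show ?thesis using Suc by simp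
  qed
  have bu: "b k = i" if "\<kappa> i \<le> k" "k < \<kappa> (Suc i)" for i k
  proof (rule antisym)
    show "b k \<le> i" unfolding b_def using that(2) by (rule Least_le)
    have "\<kappa> i < \<kappa> (Suc (b k))" using that(1) b1[of k] by linarith
    then show "i \<le> b k" using \<kappa>(1) by (simp add: strict_mono_less)
  qed
  show ?thesis
  proof (rule that[of "\<lambda>k. Y (b k) k"])
    show "bit (X k) (Y (b k) k)" for k using Y(1) b1 b2 by blast
    show "sg (\<lambda>k. Y (b k) k) (\<kappa> i) (\<kappa> (Suc i)) = g i" for i
      unfolding Y(2)[symmetric] by (rule seg_cong[OF less]) (simp add: bu)
  qed
qed

end

context walg begin

text \<open>The right side does not mention \<open>S\<close> and \<open>E\<close>, so the axiom
  \<open>consist\<close> of the power algebra follows at once. Given a word \<open>y\<close>,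
  Ramsey's theorem regroups its block products into elements of the generated subsemigroup;
  conversely such elements are spelled out as block products, which choices inside the blocks then
  realise.\<close>

lemma power_fac:
  assumes X: "\<And>k. X k < 2 ^ N" and f: "fac (pmul N mul) X S E"
  shows "pac N ac (pmul N mul S (pom N mul om E)) \<longleftrightarrow> (\<exists>y. (\<forall>k. bit (X k) (y k)) \<and> val y)"
proof -
  obtain \<kappa> where \<kappa>: "strict_mono \<kappa>" "0 < \<kappa> 0" "seg (pmul N mul) X 0 (\<kappa> 0) = S"
    "\<And>i. seg (pmul N mul) X (\<kappa> i) (\<kappa> (Suc i)) = E"
    using f unfolding fac_def by blast
  show ?thesis
  proof
    assume "\<exists>y. (\<forall>k. bit (X k) (y k)) \<and> val y"
    then obtain y where y: "\<And>k. bit (X k) (y k)" "val y" by blast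
    have yN: "y k < N" for k using bit_less_exp X y(1) by blast
    define g where "g i = sg y (\<kappa> i) (\<kappa> (Suc i))" for i
    have k1: "\<kappa> i < \<kappa> (Suc i)" for i using \<kappa>(1) by (simp add: strict_mono_less)
    have gE: "bit E (g i)" and gN: "g i < N" for i
      using bit_seg_pmul[OF k1, of y X i] seg_closed[OF k1, of y i] yN y(1) \<kappa>(4) by (auto simp: g_def)
    have s0: "bit S (sg y 0 (\<kappa> 0))" "sg y 0 (\<kappa> 0) < N"
      using bit_seg_pmul[OF \<kappa>(2), of y X] seg_closed[OF \<kappa>(2), of y] yN y(1) \<kappa>(3) by auto
    have inf: "infinite (UNIV :: nat set)" by simp
    obtain \<mu> :: "nat \<Rightarrow> nat" and s e where \<mu>: "strict_mono \<mu>" "0 < \<mu> 0" "\<And>i. sg g 0 (\<mu> i) = s"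
      "\<And>i j. i < j \<Longrightarrow> sg g (\<mu> i) (\<mu> j) = e" "s < N" "e < N"
      by (rule ramsey_fac[OF inf, of g]) (use gN in auto)
    have G: "bit (pgen N mul E) (sg g i j)" if ij: "i < j" for i j
    proof -
      have "sg g (0 + i) ((j - i) + i) = segn mul (\<lambda>k. g (k + i)) 0 (j - i - 1)"
        using ij by (subst seg_shift) (auto simp: segn_seg Suc_diff_Suc)
      then show ?thesis unfolding bit_pgen using gE gN ij
        by (intro exI[of _ "\<lambda>k. g (k + i)"] exI[of _ "j - i - 1"]) auto
    qed
    have seg_g: "sg g i j = sg y (\<kappa> i) (\<kappa> j)" if "i < j" for i j
      unfolding g_def using seg_blocks[OF \<kappa>(1) yN that] .
    have kk: "\<kappa> 0 < \<kappa> (\<mu> 0)" "\<mu> i < \<mu> (Suc i)" for i :: nat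
      using \<kappa>(1) \<mu>(1,2) by (auto simp: strict_mono_less)
    have "fac mul y (mul (sg y 0 (\<kappa> 0)) s) e"
      unfolding fac_def
    proof (intro exI[of _ "\<kappa> \<circ> \<mu>"] conjI allI)
      show "strict_mono (\<kappa> \<circ> \<mu>)" using \<kappa>(1) \<mu>(1) by (rule strict_mono_o)
      show "0 < (\<kappa> \<circ> \<mu>) 0" using kk \<kappa>(2) by simp
      show "sg y 0 ((\<kappa> \<circ> \<mu>) 0) = mul (sg y 0 (\<kappa> 0)) s"
        using seg_split[OF \<kappa>(2) kk(1) yN] seg_g[OF \<mu>(2)] \<mu>(3)[of 0] by simp
      show "sg y ((\<kappa> \<circ> \<mu>) i) ((\<kappa> \<circ> \<mu>) (Suc i)) = e" for i
        using seg_g[OF kk(2)] \<mu>(4)[of i "Suc i"] by simp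
    qed
    with val_fac[of y] yN y(2) have ac: "ac (mul (mul (sg y 0 (\<kappa> 0)) s) (om e))" by blast
    have se: "bit (pgen N mul E) s" "bit (pgen N mul E) e"
      using G[OF \<mu>(2)] G[OF kk(2)[of 0]] \<mu>(3)[of 0] \<mu>(4)[of 0 1] by auto
    have c: "om e < N" "mul s (om e) < N" using om_closed mul_closed \<mu>(5,6) by auto
    have "bit (pom N mul om E) (mul s (om e))"
      unfolding pom_def bit_bset using se c \<mu>(5,6) by blast
    then have "bit (pmul N mul S (pom N mul om E)) (mul (sg y 0 (\<kappa> 0)) (mul s (om e)))"
      unfolding bit_pmul using s0 c by blast
    then show "pac N ac (pmul N mul S (pom N mul om E))"
      unfolding pac_def using ac s0 c \<mu>(5)
      by (intro exI[of _ "mul (sg y 0 (\<kappa> 0)) (mul s (om e))"]) (auto simp: mul_assoc mul_closed)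
  next
    assume "pac N ac (pmul N mul S (pom N mul om E))"
    then obtain s0 s e where s: "s0 < N" "bit S s0" "s < N" "e < N" "bit (pgen N mul E) s" "bit (pgen N mul E) e"
      "ac (mul s0 (mul s (om e)))"
      unfolding pac_def bit_pmul pom_def bit_bset by blast
    obtain f n where f: "\<And>i. f i < N \<and> bit E (f i)" "s = sg f 0 (Suc n)"
      using s(5) unfolding bit_pgen segn_seg by auto
    obtain h m where h: "\<And>i. h i < N \<and> bit E (h i)" "e = sg h 0 (Suc m)"
      using s(6) unfolding bit_pgen segn_seg by auto
    \<comment> \<open>The block products to be realised: \<open>s0\<close> at index 0, the
      \<open>Suc n\<close> factors of \<open>s\<close> at the indices 1 to \<open>Suc n\<close>, and
      from index \<open>n + 2\<close> on the \<open>Suc m\<close> factors of \<open>e\<close>,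
      repeated periodically.\<close>
    define g where "g i = (if i = 0 then s0 else if i \<le> Suc n then f (i - 1) else h ((i - (n + 2)) mod Suc m))" for i
    \<comment> \<open>The cut 0 is put in front of \<open>\<kappa>\<close>, so that block 0 is the
      prefix of type \<open>S\<close> and every other block has type \<open>E\<close>.\<close>
    define \<nu> where "\<nu> i = (case i of 0 \<Rightarrow> 0 | Suc i \<Rightarrow> \<kappa> i)" for i
    have \<nu>: "strict_mono \<nu>" "\<nu> 0 = 0"
      using \<kappa>(1,2) by (auto simp: \<nu>_def strict_mono_Suc_iff split: nat.splits)
    have "bit (seg (pmul N mul) X (\<nu> i) (\<nu> (Suc i))) (g i)" for i
      using \<kappa>(3,4) s(2) f(1) h(1) by (auto simp: \<nu>_def g_def split: nat.splits)
    from choose_blocks[OF \<nu> X this] obtain y where y: "\<And>k. bit (X k) (y k)" "\<And>i. sg y (\<nu> i) (\<nu> (Suc i)) = g i" by blast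
    have yN: "y k < N" for k using bit_less_exp X y(1) by blast
    have gN: "g k < N" for k using s(1) f h by (simp add: g_def)
    have "fac mul g (mul s0 s) e"
      unfolding fac_def
    proof (intro exI[of _ "\<lambda>i. n + 2 + i * Suc m"] conjI allI)
      show "strict_mono (\<lambda>i. n + 2 + i * Suc m)" by (simp add: strict_mono_Suc_iff)
      have "sg g (0 + 1) (Suc n + 1) = s"
        unfolding f(2) by (subst seg_shift) (auto intro!: seg_cong simp: g_def)
      then show "sg g 0 (n + 2 + 0 * Suc m) = mul s0 s"
        using seg_split[of 0 1 "n + 2" g] gN by (simp add: g_def)
      show "sg g (n + 2 + i * Suc m) (n + 2 + Suc i * Suc m) = e" for i
      proof -
        have "sg g (0 + (n + 2 + i * Suc m)) (Suc m + (n + 2 + i * Suc m)) = e"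
          unfolding h(2) by (subst seg_shift) (auto intro!: seg_cong simp: g_def simp del: mult_Suc_right)
        then show ?thesis by (simp add: algebra_simps)
      qed
    qed simp
    then have "fac mul y (mul s0 s) e"
      using fac_blocks[OF \<nu>, of y] yN unfolding y(2) by blast
    then have "val y" using val_fac[of y] yN s by (simp add: mul_assoc om_closed)
    then show "\<exists>y. (\<forall>k. bit (X k) (y k)) \<and> val y" using y(1) by blast
  qed
qed

lemma power_walg: "walg (2 ^ N) (pmul N mul) (pom N mul om) (pac N ac)"
proof -
  interpret P: fsg "2 ^ N" "pmul N mul" by (rule pmul_fsg)
  show ?thesis
  proof
    show "pom N mul om s < 2 ^ N" for s unfolding pom_def by (rule bset_less)
  qed (use power_fac in blast)
qed

lemma power_val:
  assumes "\<And>k. X k < 2 ^ N"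
  shows "wval (pmul N mul) (pom N mul om) (pac N ac) X \<longleftrightarrow> (\<exists>y. (\<forall>k. bit (X k) (y k)) \<and> val y)"
proof -
  interpret P: walg "2 ^ N" "pmul N mul" "pom N mul om" "pac N ac" by (rule power_walg)
  obtain S E where "fac (pmul N mul) X S E" using P.fac_ex[of X] assms by blast
  then show ?thesis using P.val_fac[of X] power_fac[of X] assms by blast
qed

end

section \<open>Finitely variable functions\<close>

text \<open>Constancy on finitely many pieces of the open interval, with no restriction on the value
  at a gluing point. Induction over such derivations replaces the handling of lists of
  breakpoints.\<close>

inductive pcw :: "(real \<Rightarrow> 'a) \<Rightarrow> real \<Rightarrow> real \<Rightarrow> bool" for f where
  base: "a < b \<Longrightarrow> (\<And>t. a < t \<Longrightarrow> t < b \<Longrightarrow> f t = c) \<Longrightarrow> pcw f a b"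
| step: "pcw f a b \<Longrightarrow> pcw f b c \<Longrightarrow> pcw f a c"

lemma pcw_less: "pcw f a b \<Longrightarrow> a < b"
  by (induction rule: pcw.induct) auto

lemma pcw_cong: "pcw f a b \<Longrightarrow> (\<And>t. a < t \<Longrightarrow> t < b \<Longrightarrow> g t = f t) \<Longrightarrow> pcw g a b"
proof (induction rule: pcw.induct)
  case (base a b c) then show ?case by (intro pcw.base[of a b g c]) auto
next
  case (step a b c)
  then show ?case using pcw_less[OF step(1)] pcw_less[OF step(2)]
    by (intro pcw.step[of g a b c]) auto
qed

lemma pcw_sub: "pcw f a b \<Longrightarrow> a \<le> c \<Longrightarrow> c < d \<Longrightarrow> d \<le> b \<Longrightarrow> pcw f c d"
proof (induction arbitrary: c d rule: pcw.induct)
  case (base a b e) then show ?case by (intro pcw.base[of c d f e]) auto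
next
  case (step a b e)
  consider "d \<le> b" | "b \<le> c" | "c < b" "b < d" by linarith
  then show ?case
  proof cases
    case 3 then show ?thesis using step by (intro pcw.step[of f c b d]) auto
  qed (use step in auto)
qed

lemma pcw_map: "pcw f a b \<Longrightarrow> pcw (\<lambda>t. h (f t)) a b"
proof (induction rule: pcw.induct)
  case (base a b c) then show ?case by (intro pcw.base[of a b _ "h c"]) auto
qed (rule pcw.step)

lemma pcw_pair: "pcw f a b \<Longrightarrow> pcw g a b \<Longrightarrow> pcw (\<lambda>t. (f t, g t)) a b"
proof (induction rule: pcw.induct)
  case (base a b c)
  from base(3) have "pcw (\<lambda>t. (c, g t)) a b" by (rule pcw_map)
  then show ?case by (rule pcw_cong) (use base in auto)
next
  case (step a b c)
  have "pcw g a b" "pcw g b c"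
    using pcw_sub[OF step.prems] pcw_less[OF step.hyps(1)] pcw_less[OF step.hyps(2)] by auto
  then show ?case using step.IH by (intro pcw.step[of _ a b c])
qed

lemma pcw_cuts: "pcw f a b \<Longrightarrow> \<exists>D. finite D \<and> D \<subseteq> {a<..<b} \<and>
    (\<forall>c d. a \<le> c \<longrightarrow> d \<le> b \<longrightarrow> D \<inter> {c<..<d} = {} \<longrightarrow> f constant_on {c<..<d})"
proof (induction rule: pcw.induct)
  case (base a b c)
  then show ?case by (intro exI[of _ "{}"]) (auto simp: constant_on_def intro!: exI[of _ c])
next
  case (step a b c)
  obtain D where D: "finite D" "D \<subseteq> {a<..<b}"
    "\<And>c d. a \<le> c \<Longrightarrow> d \<le> b \<Longrightarrow> D \<inter> {c<..<d} = {} \<Longrightarrow> f constant_on {c<..<d}"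
    using step.IH(1) by blast
  obtain E where E: "finite E" "E \<subseteq> {b<..<c}"
    "\<And>d e. b \<le> d \<Longrightarrow> e \<le> c \<Longrightarrow> E \<inter> {d<..<e} = {} \<Longrightarrow> f constant_on {d<..<e}"
    using step.IH(2) by blast
  have "a < b" "b < c" using step.hyps pcw_less by auto
  show ?case
  proof (intro exI[of _ "insert b (D \<union> E)"] conjI allI impI)
    fix d e assume *: "a \<le> d" "e \<le> c" "insert b (D \<union> E) \<inter> {d<..<e} = {}"
    then consider "e \<le> b" | "b \<le> d" by auto
    then show "f constant_on {d<..<e}" using * D(3)[of d e] E(3)[of d e] by cases auto
  qed (use D E \<open>a < b\<close> \<open>b < c\<close> in auto)
qed

locale breaks =
  fixes \<tau> :: "nat \<Rightarrow> real"
  assumes tau0: "\<tau> 0 = 0" and tau_mono: "strict_mono \<tau>" and tau_unb: "\<not> bdd_above (range \<tau>)"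
begin

lemma tau_less [simp]: "\<tau> i < \<tau> j \<longleftrightarrow> i < j" by (rule strict_mono_less[OF tau_mono])

lemma tau_le [simp]: "\<tau> i \<le> \<tau> j \<longleftrightarrow> i \<le> j" by (rule strict_mono_less_eq[OF tau_mono])

lemma tau_nonneg [simp]: "0 \<le> \<tau> i"
  using tau_le[of 0 i] tau0 by simp

lemma tau_beyond: "\<exists>i. t < \<tau> i"
  using tau_unb by (meson bdd_aboveI2 not_le_imp_less)

lemma tau_locate: assumes "0 \<le> t" obtains i where "\<tau> i \<le> t" "t < \<tau> (Suc i)"
proof -
  define k where "k = (LEAST i. t < \<tau> i)"
  have k: "t < \<tau> k" unfolding k_def using tau_beyond by (rule LeastI_ex)
  then obtain i where i: "k = Suc i" using assms tau0 by (cases k) auto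
  then have "\<not> t < \<tau> i" using not_less_Least[of i "\<lambda>i. t < \<tau> i"] by (auto simp: k_def)
  then show ?thesis using that[of i] k i by auto
qed

lemma pcw_all:
  assumes "\<And>i. pcw f (\<tau> i) (\<tau> (Suc i))" "0 \<le> a" "a < b" shows "pcw f a b"
proof -
  have "pcw f 0 (\<tau> (Suc n))" for n
  proof (induction n)
    case 0 then show ?case using assms(1)[of 0] tau0 by simp
  next
    case (Suc n) then show ?case using assms(1)[of "Suc n"] by (rule pcw.step)
  qed
  moreover obtain i where "b < \<tau> i" using tau_beyond by blast
  moreover have "\<tau> i < \<tau> (Suc i)" by simp
  ultimately show ?thesis using assms(2,3) by (intro pcw_sub[of f 0 "\<tau> (Suc i)" a b]) (linarith | simp)+
qed

end

text \<open>Each breakpoint is followed by the next point of \<open>D\<close>, or by the point one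
  unit later once \<open>D\<close> is exhausted. By the last conclusion, apart from the initial 0,
  artificial breakpoints occur only after the last point of \<open>D\<close>.\<close>

lemma locally_finite_enum:
  fixes D :: "real set"
  assumes fin: "\<And>T. finite (D \<inter> {0..T})"
  obtains \<tau> where "breaks \<tau>" "\<And>i. D \<inter> {\<tau> i<..<\<tau> (Suc i)} = {}"
    "\<And>i. D \<inter> {\<tau> i<..} \<noteq> {} \<Longrightarrow> \<tau> (Suc i) \<in> D"
proof -
  have ex: "\<exists>u>t. D \<inter> {t<..<u} = {} \<and> (if D \<inter> {t<..} = {} then u = t + 1 else u \<in> D)" if "0 \<le> t" for t
  proof (cases "D \<inter> {t<..} = {}")
    case True then show ?thesis by (intro exI[of _ "t + 1"]) auto
  next
    case False
    then obtain d where d: "d \<in> D" "t < d" by auto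
    define S where "S = D \<inter> {t<..d}"
    have "finite S" by (rule finite_subset[OF _ fin[of d]]) (use that in \<open>auto simp: S_def\<close>)
    moreover have "d \<in> S" using d by (auto simp: S_def)
    ultimately have "Min S \<in> S" "\<And>s. s \<in> S \<Longrightarrow> Min S \<le> s" by (metis Min_in empty_iff, simp)
    then show ?thesis using False by (intro exI[of _ "Min S"]) (force simp: S_def)
  qed
  define nx where "nx t = (SOME u. u > t \<and> D \<inter> {t<..<u} = {} \<and> (if D \<inter> {t<..} = {} then u = t + 1 else u \<in> D))" for t
  have nx: "t < nx t" "D \<inter> {t<..<nx t} = {}" "if D \<inter> {t<..} = {} then nx t = t + 1 else nx t \<in> D" if "0 \<le> t" for t
    using someI_ex[OF ex[OF that]] unfolding nx_def by blast+
  define \<tau> where "\<tau> n = (nx ^^ n) 0" for n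
  have t0: "\<tau> 0 = 0" and tS: "\<tau> (Suc n) = nx (\<tau> n)" for n by (auto simp: \<tau>_def)
  have nn: "0 \<le> \<tau> n" for n
  proof (induction n)
    case (Suc n) then show ?case using nx(1)[OF Suc] by (simp add: tS)
  qed (simp add: t0)
  have mono: "strict_mono \<tau>" unfolding strict_mono_Suc_iff tS using nx(1)[OF nn] by blast
  \<comment> \<open>A bounded sequence would either make unit steps from some index on, against the
    Archimedean property, or map the indices injectively into a bounded and hence finite part of
    \<open>D\<close>.\<close>
  have unb: "\<not> bdd_above (range \<tau>)"
  proof
    assume "bdd_above (range \<tau>)"
    then obtain T where T: "\<And>i. \<tau> i \<le> T" by (auto simp: bdd_above_def)
    show False
    proof (cases "\<exists>i. D \<inter> {\<tau> i<..} = {}")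
      case True
      then obtain i where i: "D \<inter> {\<tau> i<..} = {}" by blast
      have "\<tau> (i + k) = \<tau> i + real k" for k
      proof (induction k)
        case (Suc k)
        have "D \<inter> {\<tau> (i + k)<..} = {}" using i Suc by (auto simp: disjoint_iff)
        then show ?case using nx(3)[OF nn, of "i + k"] Suc by (simp add: tS)
      qed simp
      then have "\<tau> i + real k \<le> T" for k using T[of "i + k"] by simp
      moreover obtain k where "T - \<tau> i < real k" using reals_Archimedean2 by blast
      ultimately show False by (metis add.commute diff_less_eq linorder_not_less)
    next
      case False
      then have "\<tau> (Suc i) \<in> D" for i using nx(3)[OF nn] by (simp add: tS)
      then have "range (\<lambda>i. \<tau> (Suc i)) \<subseteq> D \<inter> {0..T}" using nn T by auto
      moreover have "inj (\<lambda>i. \<tau> (Suc i))" using strict_mono_eq[OF mono] by (auto simp: inj_def)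
      ultimately show False using fin finite_subset range_inj_infinite by blast
    qed
  qed
  show ?thesis
    by (rule that[of \<tau>]) (use t0 mono unb nx(2,3)[OF nn] in \<open>auto simp: breaks_def tS split: if_splits\<close>)
qed

lemma finitely_variable_iff: "finitely_variable f \<longleftrightarrow> (\<forall>a b. 0 \<le> a \<longrightarrow> a < b \<longrightarrow> pcw f a b)"
proof
  assume "finitely_variable f"
  then obtain \<tau> where \<tau>: "breaks \<tau>" "\<And>i. f constant_on {\<tau> i<..<\<tau> (Suc i)}"
    by (auto simp: finitely_variable_def breaks_def)
  interpret breaks \<tau> by fact
  have "pcw f (\<tau> i) (\<tau> (Suc i))" for i
    using \<tau>(2)[of i] by (auto simp: constant_on_def intro: pcw.base)
  then show "\<forall>a b. 0 \<le> a \<longrightarrow> a < b \<longrightarrow> pcw f a b" using pcw_all by blast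
next
  assume p: "\<forall>a b. 0 \<le> a \<longrightarrow> a < b \<longrightarrow> pcw f a b"
  have "\<forall>n::nat. \<exists>D. finite D \<and> D \<subseteq> {real n<..<real n + 1} \<and>
    (\<forall>c d. real n \<le> c \<longrightarrow> d \<le> real n + 1 \<longrightarrow> D \<inter> {c<..<d} = {} \<longrightarrow> f constant_on {c<..<d})"
    using p by (intro allI pcw_cuts) auto
  then obtain D where D: "\<And>n. finite (D n)" "\<And>n. D n \<subseteq> {real n<..<real n + 1}"
    "\<And>n c d. real n \<le> c \<Longrightarrow> d \<le> real n + 1 \<Longrightarrow> D n \<inter> {c<..<d} = {} \<Longrightarrow> f constant_on {c<..<d}" by metis
  \<comment> \<open>All natural numbers are made breakpoints too, so that every gap lies inside one
    unit interval and the cuts \<open>D n\<close> of that interval apply to it.\<close>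
  define E where "E = (\<Union>n. insert (real n) (D n))"
  have "finite (E \<inter> {0..T})" for T
  proof (rule finite_subset)
    show "E \<inter> {0..T} \<subseteq> (\<Union>n\<in>{..nat \<lfloor>T\<rfloor>}. insert (real n) (D n))"
    proof
      fix t assume "t \<in> E \<inter> {0..T}"
      then obtain n where n: "t \<in> insert (real n) (D n)" "t \<le> T" by (auto simp: E_def)
      then have "real n \<le> T" using D(2)[of n] by auto
      then have "n \<le> nat \<lfloor>T\<rfloor>" by linarith
      then show "t \<in> (\<Union>n\<in>{..nat \<lfloor>T\<rfloor>}. insert (real n) (D n))" using n by blast
    qed
  qed (use D(1) in auto)
  then obtain \<tau> where \<tau>: "breaks \<tau>" "\<And>i. E \<inter> {\<tau> i<..<\<tau> (Suc i)} = {}"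
    using locally_finite_enum by metis
  interpret breaks \<tau> by fact
  have "f constant_on {\<tau> i<..<\<tau> (Suc i)}" for i
  proof (rule D(3)[of "nat \<lfloor>\<tau> i\<rfloor>"])
    show 1: "real (nat \<lfloor>\<tau> i\<rfloor>) \<le> \<tau> i" by simp
    have "real (Suc (nat \<lfloor>\<tau> i\<rfloor>)) \<in> E" unfolding E_def by blast
    moreover have "\<tau> i < real (Suc (nat \<lfloor>\<tau> i\<rfloor>))" by linarith
    ultimately show "\<tau> (Suc i) \<le> real (nat \<lfloor>\<tau> i\<rfloor>) + 1" using \<tau>(2)[of i] by (force simp: disjoint_iff)
    show "D (nat \<lfloor>\<tau> i\<rfloor>) \<inter> {\<tau> i<..<\<tau> (Suc i)} = {}" using \<tau>(2)[of i] by (auto simp: E_def)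
  qed
  then show "finitely_variable f" using tau0 tau_mono tau_unb unfolding finitely_variable_def
    by (intro exI[of _ \<tau>]) auto
qed

lemma fv_pair: "finitely_variable f \<Longrightarrow> finitely_variable g \<Longrightarrow> finitely_variable (\<lambda>t. (f t, g t))"
  unfolding finitely_variable_iff using pcw_pair by blast

lemma fv_map: "finitely_variable f \<Longrightarrow> finitely_variable (\<lambda>t. h (f t))"
  unfolding finitely_variable_iff using pcw_map by blast

lemma fv_breaks:
  assumes "finitely_variable f"
  obtains \<tau> c where "breaks \<tau>" "\<And>i t. \<tau> i < t \<Longrightarrow> t < \<tau> (Suc i) \<Longrightarrow> f t = c i"
proof -
  obtain \<tau> where \<tau>: "breaks \<tau>" "\<And>i. f constant_on {\<tau> i<..<\<tau> (Suc i)}"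
    using assms by (auto simp: finitely_variable_def breaks_def)
  then have "\<forall>i. \<exists>c. \<forall>t. \<tau> i < t \<longrightarrow> t < \<tau> (Suc i) \<longrightarrow> f t = c"
    unfolding constant_on_def by (metis greaterThanLessThan_iff)
  then show ?thesis using that \<tau>(1) by metis
qed

lemma singleton_bool_signal: "0 \<le> r \<Longrightarrow> {r} \<in> bool_signals"
proof -
  assume r: "0 \<le> r"
  have "pcw (\<lambda>t. t \<in> {r}) a b" if "0 \<le> a" "a < b" for a b
  proof (cases "a < r \<and> r < b")
    case True
    then show ?thesis
      by (intro pcw.step[of _ a r b] pcw.base[of _ _ _ False]) auto
  next
    case False then show ?thesis using that by (intro pcw.base[of _ _ _ False]) auto
  qed
  then show ?thesis using r by (auto simp: bool_signals_def finitely_variable_iff)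
qed

lemma component_bool_signal: "f \<in> signals p \<Longrightarrow> component f i \<in> bool_signals"
proof -
  assume "f \<in> signals p"
  then have "finitely_variable (\<lambda>t. bit (f t) i)" by (auto simp: signals_def intro: fv_map)
  then have "finitely_variable (\<lambda>t. t \<in> component f i)"
    unfolding finitely_variable_iff component_def
    by (intro allI impI) (rule pcw_cong[of "\<lambda>t. bit (f t) i"], auto)
  then show ?thesis by (auto simp: bool_signals_def component_def)
qed

section \<open>Algebras recognising properties of signals\<close>

definition ltr :: "nat \<Rightarrow> (nat \<Rightarrow> real set) \<Rightarrow> real \<Rightarrow> nat" where
  "ltr L w t = bset L (\<lambda>j. t \<in> w j)"

lemma ltr_less: "ltr L w t < 2 ^ L"
  unfolding ltr_def by (rule bset_less)

lemma bit_ltr: "bit (ltr L w t) j \<longleftrightarrow> j < L \<and> t \<in> w j"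
  unfolding ltr_def by (rule bit_bset)

text \<open>\<open>OT\<close> assigns types to the restrictions of the environment \<open>w\<close> to bounded open intervals.\<close>

inductive OT :: "nat \<Rightarrow> (nat \<Rightarrow> nat) \<Rightarrow> (nat \<Rightarrow> nat) \<Rightarrow> (nat \<Rightarrow> nat \<Rightarrow> nat) \<Rightarrow> (nat \<Rightarrow> real set) \<Rightarrow>
    real \<Rightarrow> real \<Rightarrow> nat \<Rightarrow> bool"
  for L pt iv mu w where
  base: "a < b \<Longrightarrow> (\<And>t. a < t \<Longrightarrow> t < b \<Longrightarrow> ltr L w t = c) \<Longrightarrow> c < 2 ^ L \<Longrightarrow> OT L pt iv mu w a b (iv c)"
| step: "OT L pt iv mu w a b s \<Longrightarrow> OT L pt iv mu w b c t \<Longrightarrow>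
    OT L pt iv mu w a c (mu s (mu (pt (ltr L w b)) t))"

lemma OT_less: "OT L pt iv mu w a b s \<Longrightarrow> a < b"
  by (induction rule: OT.induct) auto

lemma OT_cong:
  "OT L pt iv mu w a b s \<Longrightarrow> (\<And>t. a < t \<Longrightarrow> t < b \<Longrightarrow> ltr L v t = ltr L w t) \<Longrightarrow> OT L pt iv mu v a b s"
proof (induction rule: OT.induct)
  case (base a b c) then show ?case by (intro OT.base) auto
next
  case (step a b s c t)
  have "a < b" "b < c" using step.hyps OT_less by auto
  then have "OT L pt iv mu v a c (mu s (mu (pt (ltr L v b)) t))"
    using step by (intro OT.step[of _ _ _ _ _ a b s c t]) auto
  then show ?case using step.prems[of b] \<open>a < b\<close> \<open>b < c\<close> by simp
qed

lemma OT_closed: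
  assumes "fsg N mu" "\<And>a. a < 2 ^ L \<Longrightarrow> pt a < N" "\<And>a. a < 2 ^ L \<Longrightarrow> iv a < N" "OT L pt iv mu w a b s"
  shows "s < N"
  using assms(4)
proof (induction rule: OT.induct)
  case (step a b s c t)
  then show ?case using fsg.mul_closed[OF assms(1)] assms(2)[OF ltr_less] by auto
qed (use assms in auto)

text \<open>Recognition is demanded for every breakpoint sequence and for all derivable types of the
  gaps. A gap may have several types, since a constant gap can be split at any point. No law makes
  the type unique; only the acceptance of the resulting sequence is fixed.\<close>

definition recogF :: "nat \<Rightarrow> nat \<Rightarrow> (nat \<Rightarrow> nat) \<Rightarrow> (nat \<Rightarrow> nat) \<Rightarrow> (nat \<Rightarrow> nat \<Rightarrow> nat) \<Rightarrow> (nat \<Rightarrow> nat) \<Rightarrow>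
    (nat \<Rightarrow> bool) \<Rightarrow> ((nat \<Rightarrow> real set) \<Rightarrow> bool) \<Rightarrow> bool" where
  "recogF L N pt iv mu om ac P \<longleftrightarrow> walg N mu om ac \<and> (\<forall>a<2 ^ L. pt a < N \<and> iv a < N) \<and>
     (\<forall>w \<tau> s. breaks \<tau> \<longrightarrow> (\<forall>i. OT L pt iv mu w (\<tau> i) (\<tau> (Suc i)) (s i)) \<longrightarrow>
        (P w \<longleftrightarrow> wval mu om ac (\<lambda>i. mu (pt (ltr L w (\<tau> i))) (s i))))"

lemma recogF_D:
  assumes "recogF L N pt iv mu om ac P"
  shows "walg N mu om ac" "a < 2 ^ L \<Longrightarrow> pt a < N" "a < 2 ^ L \<Longrightarrow> iv a < N"
    and "OT L pt iv mu w a' b s \<Longrightarrow> s < N"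
    and "breaks \<tau> \<Longrightarrow> (\<And>i. OT L pt iv mu w (\<tau> i) (\<tau> (Suc i)) (x i)) \<Longrightarrow>
      P w \<longleftrightarrow> wval mu om ac (\<lambda>i. mu (pt (ltr L w (\<tau> i))) (x i))"
proof -
  have c: "a < 2 ^ L \<Longrightarrow> pt a < N" "a < 2 ^ L \<Longrightarrow> iv a < N" for a
    using assms by (auto simp: recogF_def)
  then show "a < 2 ^ L \<Longrightarrow> pt a < N" "a < 2 ^ L \<Longrightarrow> iv a < N" by auto
  show W: "walg N mu om ac" using assms by (simp add: recogF_def)
  show "s < N" if "OT L pt iv mu w a' b s"
    by (rule OT_closed[where L = L and pt = pt and iv = iv, OF _ _ _ that]) (use c W in \<open>auto simp: walg_def\<close>)
  show "P w \<longleftrightarrow> wval mu om ac (\<lambda>i. mu (pt (ltr L w (\<tau> i))) (x i))"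
    if "breaks \<tau>" "\<And>i. OT L pt iv mu w (\<tau> i) (\<tau> (Suc i)) (x i)"
    using assms that unfolding recogF_def by simp
qed

text \<open>Only the values of the operations on the carrier and on actual letters matter, so the
  operations can be replaced by finite tables; this is how an algebra becomes a number.\<close>

lemma recogF_cong:
  assumes R: "recogF L N pt iv mu om ac P"
    and e: "\<And>a. a < 2 ^ L \<Longrightarrow> pt' a = pt a" "\<And>a. a < 2 ^ L \<Longrightarrow> iv' a = iv a"
      "\<And>s t. s < N \<Longrightarrow> t < N \<Longrightarrow> mu' s t = mu s t" "\<And>s. s < N \<Longrightarrow> om' s = om s"
      "\<And>s. s < N \<Longrightarrow> ac' s = ac s"
  shows "recogF L N pt' iv' mu' om' ac' P"
proof -
  interpret W: walg N mu om ac using R by (simp add: recogF_def)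
  have pt: "a < 2 ^ L \<Longrightarrow> pt a < N" and iv: "a < 2 ^ L \<Longrightarrow> iv a < N" for a
    using R by (auto simp: recogF_def)
  have sg: "seg mu' x i j = seg mu x i j" if "i < j" "\<And>k. x k < N" for x i j
    using that(1)
  proof (induction rule: seg_induct)
    case (Suc j) then show ?case using e(3) W.seg_closed[of i j x] that(2) by (simp add: seg_Suc)
  qed simp
  have fc: "fac mu' x s t \<longleftrightarrow> fac mu x s t" if "\<And>k. x k < N" for x s t
    unfolding fac_def using sg[of _ _ x] that by (metis lessI strict_mono_less)
  have fcl: "s < N" "t < N" if f: "fac mu x s t" "\<And>k. x k < N" for x s t
    using f W.seg_closed[of _ _ x] unfolding fac_def by (metis lessI strict_mono_less)+
  have "walg N mu' om' ac'"
  proof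
    fix x s t s' t' assume x: "\<And>k. x k < N" and f: "fac mu' x s t" "fac mu' x s' t'"
    then have f': "fac mu x s t" "fac mu x s' t'" using fc by auto
    note c = fcl[OF f'(1) x] fcl[OF f'(2) x]
    show "ac' (mu' s (om' t)) = ac' (mu' s' (om' t'))"
      using W.consist[OF x f'] c by (simp add: e W.om_closed W.mul_closed)
  qed (auto simp: e W.mul_closed W.mul_assoc W.om_closed)
  moreover have ot: "s < N \<and> OT L pt iv mu w a b s" if "OT L pt' iv' mu' w a b s" for w a b s
    using that
  proof (induction rule: OT.induct)
    case (base a b c) then show ?case using iv by (auto simp: e intro: OT.base)
  next
    case (step a b s c t)
    then show ?case using OT.step[of L pt iv mu w a b s c t] pt[OF ltr_less, of w b]
      by (simp add: e ltr_less W.mul_closed)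
  qed
  moreover have wv: "wval mu' om' ac' x \<longleftrightarrow> wval mu om ac x" if x: "\<And>k. x k < N" for x
    unfolding wval_def using fc[of x] x fcl[of x] by (metis e(3-5) W.mul_closed W.om_closed)
  ultimately show ?thesis
    unfolding recogF_def
  proof (intro conjI allI impI)
    fix w \<tau> s assume \<tau>: "breaks \<tau>" and s: "\<forall>i. OT L pt' iv' mu' w (\<tau> i) (\<tau> (Suc i)) (s i)"
    have s': "\<And>i. s i < N" "\<And>i. OT L pt iv mu w (\<tau> i) (\<tau> (Suc i)) (s i)" using s ot by blast+
    have "P w \<longleftrightarrow> wval mu om ac (\<lambda>i. mu (pt (ltr L w (\<tau> i))) (s i))"
      using recogF_D(5)[OF R \<tau>, of w s] s'(2) by blast
    then show "P w \<longleftrightarrow> wval mu' om' ac' (\<lambda>i. mu' (pt' (ltr L w (\<tau> i))) (s i))"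
      using s'(1) pt by (simp add: wv e ltr_less W.mul_closed)
  qed (use pt iv in \<open>auto simp: e\<close>)
qed

subsection \<open>Atomic properties\<close>

text \<open>For properties that persist once a finite prefix has established them,
  \<open>e e\<close> can serve as the infinite power: \<open>e e e = e e\<close> makes the prefix
  products of a factorisation stabilise at \<open>s e e\<close>, and by monotonicity this stable
  value decides.\<close>

lemma prefix_walg:
  assumes "fsg N mu" and e: "\<And>e. e < N \<Longrightarrow> mu (mu e e) e = mu e e"
    and m: "\<And>s t. s < N \<Longrightarrow> t < N \<Longrightarrow> ac s \<Longrightarrow> ac (mu s t)"
  shows "walg N mu (\<lambda>e. mu e e) ac"
    and "(\<And>k. x k < N) \<Longrightarrow> wval mu (\<lambda>e. mu e e) ac x \<longleftrightarrow> (\<exists>n>0. ac (seg mu x 0 n))"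
proof -
  interpret fsg N mu by fact
  have mono: "ac (seg mu x 0 n)" if "ac (seg mu x 0 m)" "0 < m" "m \<le> n" "\<And>k. x k < N" for x m n
    using that m[of "seg mu x 0 m" "seg mu x m n"] seg_split[of 0 m n x] seg_closed[of 0 m x] seg_closed[of m n x]
    by (cases "m = n") auto
  have key: "ac (mu s (mu e e)) \<longleftrightarrow> (\<exists>n>0. ac (seg mu x 0 n))" if f: "fac mu x s e" and x: "\<And>k. x k < N" for x s e
  proof -
    obtain \<kappa> where \<kappa>: "strict_mono \<kappa>" "0 < \<kappa> 0" "seg mu x 0 (\<kappa> 0) = s" "\<And>i. seg mu x (\<kappa> i) (\<kappa> (Suc i)) = e"
      using f unfolding fac_def by blast
    have c: "s < N" "e < N" using \<kappa> seg_closed[of 0 "\<kappa> 0" x] seg_closed[of "\<kappa> 0" "\<kappa> 1" x] x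
      by (auto simp: strict_mono_less)
    have pos: "0 < \<kappa> i" for i using \<kappa>(1,2) by (metis gr0I not_less_zero strict_mono_less)
    have S: "seg mu x 0 (\<kappa> (Suc i)) = mu (seg mu x 0 (\<kappa> i)) e" for i
      using seg_split[of 0 "\<kappa> i" "\<kappa> (Suc i)" x] pos x \<kappa>(1,4) by (auto simp: strict_mono_less)
    have stab: "seg mu x 0 (\<kappa> (Suc (Suc i))) = mu s (mu e e)" for i
    proof (induction i)
      case 0 then show ?case using S[of 0] S[of 1] \<kappa>(3) c by (simp add: mul_assoc)
    next
      case (Suc i) then show ?case using S[of "Suc (Suc i)"] c e[of e] by (simp add: mul_assoc mul_closed)
    qed
    show ?thesis
    proof
      assume "ac (mu s (mu e e))" then show "\<exists>n>0. ac (seg mu x 0 n)" using stab[of 0] pos by metis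
    next
      assume "\<exists>n>0. ac (seg mu x 0 n)"
      then obtain n where n: "n > 0" "ac (seg mu x 0 n)" by blast
      have "n \<le> \<kappa> (Suc (Suc n))" using strict_mono_imp_increasing[OF \<kappa>(1), of "Suc (Suc n)"] by linarith
      from mono[OF n(2,1) this x] show "ac (mu s (mu e e))" by (simp add: stab)
    qed
  qed
  show W: "walg N mu (\<lambda>e. mu e e) ac"
    by unfold_locales (use key mul_closed in auto)
  interpret walg N mu "\<lambda>e. mu e e" ac by (rule W)
  assume x: "\<And>k. x k < N"
  obtain s e where "fac mu x s e" using fac_ex[of x] x by blast
  then show "wval mu (\<lambda>e. mu e e) ac x \<longleftrightarrow> (\<exists>n>0. ac (seg mu x 0 n))"
    using val_fac[of x] key[of x] x by blast
qed

text \<open>\<open>F w A\<close> summarises what happens at the times in an arbitrary set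
  \<open>A\<close>. Being compatible with ordered unions, it equals every derivable type of an
  interval, however the interval is cut.\<close>

lemma prefix_recogF:
  assumes "fsg N mu" and e: "\<And>e. e < N \<Longrightarrow> mu (mu e e) e = mu e e"
    and m: "\<And>s t. s < N \<Longrightarrow> t < N \<Longrightarrow> ac s \<Longrightarrow> ac (mu s t)"
    and c: "\<And>a. a < 2 ^ L \<Longrightarrow> pt a < N" "\<And>a. a < 2 ^ L \<Longrightarrow> iv a < N"
    and F1: "\<And>w t. F w {t} = pt (ltr L w t)"
    and F2: "\<And>w a b c. a < b \<Longrightarrow> (\<And>t. a < t \<Longrightarrow> t < b \<Longrightarrow> ltr L w t = c) \<Longrightarrow> F w {a<..<b} = iv c"
    and F3: "\<And>w A B. (\<And>a b. a \<in> A \<Longrightarrow> b \<in> B \<Longrightarrow> a < b) \<Longrightarrow> F w (A \<union> B) = mu (F w A) (F w B)"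
    and P: "\<And>w. P w \<longleftrightarrow> (\<exists>b>0. ac (F w {0..<b}))"
    and M: "\<And>w A B. A \<subseteq> B \<Longrightarrow> ac (F w A) \<Longrightarrow> ac (F w B)"
  shows "recogF L N pt iv mu (\<lambda>e. mu e e) ac P"
  unfolding recogF_def
proof (intro conjI allI impI)
  show "walg N mu (\<lambda>e. mu e e) ac" by (rule prefix_walg(1)[OF assms(1)]) (use e m in auto)
  interpret fsg N mu by fact
  fix w \<tau> s assume \<tau>: "breaks \<tau>" and s: "\<forall>i. OT L pt iv mu w (\<tau> i) (\<tau> (Suc i)) (s i)"
  interpret breaks \<tau> by fact
  have ot: "t = F w {a<..<b}" if "OT L pt iv mu w a b t" for a b t
    using that
  proof (induction rule: OT.induct)
    case (base a b c) then show ?case using F2[of a b w c] by simp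
  next
    case (step a b s c t)
    have l: "a < b" "b < c" using step.hyps OT_less by auto
    then have "{a<..<c} = {a<..<b} \<union> ({b} \<union> {b<..<c})" by auto
    also have "F w \<dots> = mu (F w {a<..<b}) (F w ({b} \<union> {b<..<c}))" by (intro F3) auto
    also have "F w ({b} \<union> {b<..<c}) = mu (F w {b}) (F w {b<..<c})" by (intro F3) auto
    finally show ?case using step F1 by simp
  qed
  define x where "x i = mu (pt (ltr L w (\<tau> i))) (s i)" for i
  have sN: "s i < N" for i
    by (rule OT_closed[where L = L and pt = pt and iv = iv, OF assms(1)]) (use s c in auto)
  have xN: "x i < N" for i unfolding x_def using sN c(1)[OF ltr_less] mul_closed by blast
  have xF: "x i = F w {\<tau> i..<\<tau> (Suc i)}" for i
  proof -
    have "\<tau> i < \<tau> (Suc i)" by simp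
    then have "{\<tau> i..<\<tau> (Suc i)} = {\<tau> i} \<union> {\<tau> i<..<\<tau> (Suc i)}" by force
    also have "F w \<dots> = mu (F w {\<tau> i}) (F w {\<tau> i<..<\<tau> (Suc i)})" by (intro F3) auto
    finally show ?thesis using ot[OF s[rule_format], of i] F1 by (simp add: x_def)
  qed
  have sgF: "seg mu x 0 n = F w {0..<\<tau> n}" if "0 < n" for n
    using that
  proof (induction rule: seg_induct)
    case one then show ?case using xF[of 0] tau0 by simp
  next
    case (Suc n)
    have "\<tau> n < \<tau> (Suc n)" "0 \<le> \<tau> n" by auto
    then have "{0..<\<tau> (Suc n)} = {0..<\<tau> n} \<union> {\<tau> n..<\<tau> (Suc n)}"
      by (intro ivl_disj_un_two(3)[symmetric]) auto
    also have "F w \<dots> = mu (F w {0..<\<tau> n}) (F w {\<tau> n..<\<tau> (Suc n)})" by (intro F3) auto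
    finally show ?case using Suc xF[of n] by (simp add: seg_Suc)
  qed
  have "wval mu (\<lambda>e. mu e e) ac x \<longleftrightarrow> (\<exists>n>0. ac (F w {0..<\<tau> n}))"
    using prefix_walg(2)[of N mu ac x] assms(1) e m xN sgF by auto
  also have "\<dots> \<longleftrightarrow> P w"
    unfolding P
  proof
    assume "\<exists>n>0. ac (F w {0..<\<tau> n})"
    then obtain n where "n > 0" "ac (F w {0..<\<tau> n})" by blast
    moreover have "\<tau> 0 < \<tau> n" using \<open>n > 0\<close> by (simp only: tau_less)
    ultimately show "\<exists>b>0. ac (F w {0..<b})" using tau0 by auto
  next
    assume "\<exists>b>0. ac (F w {0..<b})"
    then obtain b where b: "b > 0" "ac (F w {0..<b})" by blast
    obtain n where n: "b < \<tau> n" using tau_beyond by blast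
    then have "n \<noteq> 0" using b tau0 by (metis less_trans less_irrefl)
    moreover have "ac (F w {0..<\<tau> n})" using M[OF _ b(2), of "{0..<\<tau> n}"] n by auto
    ultimately show "\<exists>n>0. ac (F w {0..<\<tau> n})" by blast
  qed
  finally show "P w = wval mu (\<lambda>e. mu e e) ac (\<lambda>i. mu (pt (ltr L w (\<tau> i))) (s i))"
    unfolding x_def by simp
qed (use c in auto)

text \<open>Two elements suffice: 1 records that a letter satisfying \<open>g\<close> has
  occurred.\<close>

lemma recogF_meet:
  "recogF L 2 (\<lambda>a. if g a then 1 else 0) (\<lambda>a. if g a then 1 else 0) max (\<lambda>e. max e e) (\<lambda>s. s = 1)
     (\<lambda>w. \<exists>t\<ge>0. g (ltr L w t))"
proof (rule prefix_recogF[where F = "\<lambda>w A. if \<exists>t\<in>A. g (ltr L w t) then 1 else 0"], goal_cases)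
  case 1 show ?case by unfold_locales auto
next
  case (7 w a b c)
  obtain t where "a < t" "t < b" using dense[OF 7(1)] by blast
  then show ?case using 7(2) by auto
next
  case (9 w)
  have "(\<exists>t\<ge>0. g (ltr L w t)) \<longleftrightarrow> (\<exists>b>0. \<exists>t\<in>{0..<b}. g (ltr L w t))"
    by (metis atLeastLessThan_iff gt_ex less_eq_real_def less_trans)
  then show ?case by auto
qed (auto simp: max_def less_2_cases_iff split: if_splits)

text \<open>Elements are sets of three facts: bit 0 says that variable \<open>i\<close> has a point,
  bit 1 that \<open>j\<close> has one, bit 2 that a point of \<open>i\<close> lies strictly before a
  point of \<open>j\<close>. A product gains bit 2 when the two points come from different
  factors.\<close>

definition lmu :: "nat \<Rightarrow> nat \<Rightarrow> nat" where
  "lmu s t = bset 3 (\<lambda>k. bit s k \<or> bit t k \<or> (k = 2 \<and> bit s 0 \<and> bit t 1))"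

definition lpt :: "nat \<Rightarrow> nat \<Rightarrow> nat \<Rightarrow> nat" where
  "lpt i j a = bset 3 (\<lambda>k. (k = 0 \<and> bit a i) \<or> (k = 1 \<and> bit a j))"

text \<open>An open interval with a constant letter contains two points in order, so its type is the
  letter multiplied by itself, whereas a single point never sets bit 2.\<close>

lemma recogF_less:
  assumes "i < L" "j < L"
  shows "recogF L 8 (lpt i j) (\<lambda>a. lmu (lpt i j a) (lpt i j a)) lmu (\<lambda>e. lmu e e) (\<lambda>s. bit s 2)
     (\<lambda>w. \<exists>x y. 0 \<le> x \<and> x < y \<and> x \<in> w i \<and> y \<in> w j)"
proof -
  have 8: "bset 3 P < 8" for P using bset_less[of 3 P] by simp
  show ?thesis
  proof (rule prefix_recogF[where F = "\<lambda>w A. bset 3 (\<lambda>k. (k = 0 \<and> (\<exists>x\<in>A. x \<in> w i)) \<or> (k = 1 \<and> (\<exists>x\<in>A. x \<in> w j)) \<or>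
        (k = 2 \<and> (\<exists>x\<in>A. \<exists>y\<in>A. x < y \<and> x \<in> w i \<and> y \<in> w j)))"], goal_cases)
    case 1 show ?case
      by unfold_locales (auto simp: lmu_def 8 bit_bset intro!: bit_eqI)
  next
    case (2 e) show ?case by (rule bit_eqI) (auto simp: lmu_def bit_bset)
  next
    case (3 s t) then show ?case by (auto simp: lmu_def bit_bset)
  next
    case (6 w t) show ?case by (rule bit_eqI) (use assms in \<open>auto simp: lpt_def bit_bset bit_ltr\<close>)
  next
    case (7 w a b c)
    have ij: "t \<in> w i \<longleftrightarrow> bit c i" "t \<in> w j \<longleftrightarrow> bit c j" if "a < t" "t < b" for t
      using 7(2)[OF that] assms bit_ltr[of L w t] by auto
    obtain t where t: "a < t" "t < b" using dense[OF 7(1)] by blast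
    obtain u where u: "t < u" "u < b" using dense[OF t(2)] by blast
    have "u \<in> {a<..<b}" "t \<in> {a<..<b}" using t u by auto
    then have "(\<exists>x\<in>{a<..<b}. x \<in> w i) \<longleftrightarrow> bit c i" "(\<exists>x\<in>{a<..<b}. x \<in> w j) \<longleftrightarrow> bit c j"
      "(\<exists>x\<in>{a<..<b}. \<exists>y\<in>{a<..<b}. x < y \<and> x \<in> w i \<and> y \<in> w j) \<longleftrightarrow> bit c i \<and> bit c j"
      using ij u(1) by (meson greaterThanLessThan_iff)+
    then show ?case by (intro bit_eqI) (auto simp: lmu_def lpt_def bit_bset)
  next
    case (8 w A B)
    have "(\<exists>x\<in>A \<union> B. \<exists>y\<in>A \<union> B. x < y \<and> x \<in> w i \<and> y \<in> w j) \<longleftrightarrow>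
      (\<exists>x\<in>A. \<exists>y\<in>A. x < y \<and> x \<in> w i \<and> y \<in> w j) \<or> (\<exists>x\<in>B. \<exists>y\<in>B. x < y \<and> x \<in> w i \<and> y \<in> w j) \<or>
      (\<exists>x\<in>A. x \<in> w i) \<and> (\<exists>x\<in>B. x \<in> w j)" 
      (is "?l \<longleftrightarrow> ?r")
    proof
      assume ?l
      then obtain x y where xy: "x \<in> A \<union> B" "y \<in> A \<union> B" "x < y" "x \<in> w i" "y \<in> w j" by blast
      then show ?r using 8[of y x] by fastforce
    next
      assume ?r then show ?l using 8 by (elim disjE) blast+
    qed
    note eq = this
    show ?case
    proof (rule bit_eqI)
      fix n :: nat
      consider "n = 0" | "n = 1" | "n = 2" | "n \<ge> 3" by linarith
      then show "bit (bset 3 (\<lambda>k. (k = 0 \<and> (\<exists>x\<in>A \<union> B. x \<in> w i)) \<or> (k = 1 \<and> (\<exists>x\<in>A \<union> B. x \<in> w j)) \<or>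
        (k = 2 \<and> (\<exists>x\<in>A \<union> B. \<exists>y\<in>A \<union> B. x < y \<and> x \<in> w i \<and> y \<in> w j)))) n =
        bit (lmu (bset 3 (\<lambda>k. (k = 0 \<and> (\<exists>x\<in>A. x \<in> w i)) \<or> (k = 1 \<and> (\<exists>x\<in>A. x \<in> w j)) \<or>
        (k = 2 \<and> (\<exists>x\<in>A. \<exists>y\<in>A. x < y \<and> x \<in> w i \<and> y \<in> w j))))
        (bset 3 (\<lambda>k. (k = 0 \<and> (\<exists>x\<in>B. x \<in> w i)) \<or> (k = 1 \<and> (\<exists>x\<in>B. x \<in> w j)) \<or>
        (k = 2 \<and> (\<exists>x\<in>B. \<exists>y\<in>B. x < y \<and> x \<in> w i \<and> y \<in> w j))))) n"
      proof cases
        case 3 show ?thesis using eq by (simp add: 3 lmu_def bit_bset)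
      qed (auto simp: lmu_def bit_bset)
    qed
  next
    case (9 w)
    have "(\<exists>x y. 0 \<le> x \<and> x < y \<and> x \<in> w i \<and> y \<in> w j) \<longleftrightarrow>
      (\<exists>b>0. \<exists>x\<in>{0..<b}. \<exists>y\<in>{0..<b}. x < y \<and> x \<in> w i \<and> y \<in> w j)"
    proof
      assume "\<exists>x y. 0 \<le> x \<and> x < y \<and> x \<in> w i \<and> y \<in> w j"
      then obtain x y where "0 \<le> x" "x < y" "x \<in> w i" "y \<in> w j" by blast
      then show "\<exists>b>0. \<exists>x\<in>{0..<b}. \<exists>y\<in>{0..<b}. x < y \<and> x \<in> w i \<and> y \<in> w j"
        by (intro exI[of _ "y + 1"] conjI bexI[of _ x] bexI[of _ y]) auto
    qed auto
    then show ?case by (auto simp: bit_bset)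
  next
    case (10 w A B) then show ?case by (auto simp: bit_bset)
  qed (auto simp: lmu_def lpt_def 8)
qed

subsection \<open>Boolean operations\<close>

text \<open>Complementing the acceptance is sound because all factorisations of a sequence agree and
  at least one exists.\<close>

lemma recogF_neg:
  assumes "recogF L N pt iv mu om ac P"
  shows "recogF L N pt iv mu om (\<lambda>s. \<not> ac s) (\<lambda>w. \<not> P w)"
proof -
  interpret W: walg N mu om ac using assms by (simp add: recogF_def)
  have N: "walg N mu om (\<lambda>s. \<not> ac s)"
  proof unfold_locales
    fix x s e s' e' assume x: "\<And>k. x k < N" and f: "fac mu x s e" "fac mu x s' e'"
    show "(\<not> ac (mu s (om e))) = (\<not> ac (mu s' (om e')))" using W.consist[OF x f] by simp
  qed (use W.om_closed in auto)
  have v: "wval mu om (\<lambda>s. \<not> ac s) x \<longleftrightarrow> \<not> wval mu om ac x" if x: "\<And>k. x k < N" for x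
  proof -
    obtain s e where "fac mu x s e" using W.fac_ex[of x] x by blast
    then show ?thesis using walg.val_fac[OF N, of x] W.val_fac[of x] x by blast
  qed
  have s: "s < N" if "OT L pt iv mu w a b s" for w a b s
    using OT_closed[OF W.fsg_axioms _ _ that] assms by (auto simp: recogF_def)
  show ?thesis unfolding recogF_def
  proof (intro conjI allI impI N)
    fix w \<tau> t assume \<tau>: "breaks \<tau>" and t: "\<forall>i. OT L pt iv mu w (\<tau> i) (\<tau> (Suc i)) (t i)"
    have "mu (pt (ltr L w (\<tau> i))) (t i) < N" for i
      using W.mul_closed recogF_D(2)[OF assms ltr_less] t s by blast
    then show "(\<not> P w) = wval mu om (\<lambda>s. \<not> ac s) (\<lambda>i. mu (pt (ltr L w (\<tau> i))) (t i))"
      using recogF_D(5)[OF assms \<tau>, of w t] t v[of "\<lambda>i. mu (pt (ltr L w (\<tau> i))) (t i)"] by blast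
  qed (use assms in \<open>auto simp: recogF_def\<close>)
qed

definition prl :: "nat \<Rightarrow> nat \<Rightarrow> nat \<Rightarrow> nat" where
  "prl N s t = t * N + s"

lemma prl_dest [simp]: "s < N \<Longrightarrow> prl N s t mod N = s" "s < N \<Longrightarrow> prl N s t div N = t"
  by (auto simp: prl_def)

lemma prl_less: "s < N \<Longrightarrow> t < M \<Longrightarrow> prl N s t < N * M"
  using mult_le_mono1[of "Suc t" M N] by (simp add: prl_def algebra_simps)

lemma recogF_conj:
  assumes R1: "recogF L N pt iv mu om ac P" and R2: "recogF L N' pt' iv' mu' om' ac' P'"
  shows "recogF L (N * N') (\<lambda>a. prl N (pt a) (pt' a)) (\<lambda>a. prl N (iv a) (iv' a))
     (\<lambda>s t. prl N (mu (s mod N) (t mod N)) (mu' (s div N) (t div N)))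
     (\<lambda>s. prl N (om (s mod N)) (om' (s div N))) (\<lambda>s. ac (s mod N) \<and> ac' (s div N)) (\<lambda>w. P w \<and> P' w)"
proof -
  interpret W: walg N mu om ac using R1 by (simp add: recogF_def)
  interpret W': walg N' mu' om' ac' using R2 by (simp add: recogF_def)
  define mm where "mm = (\<lambda>s t. prl N (mu (s mod N) (t mod N)) (mu' (s div N) (t div N)))"
  define om2 where "om2 = (\<lambda>s. prl N (om (s mod N)) (om' (s div N)))"
  define aa where "aa = (\<lambda>s. ac (s mod N) \<and> ac' (s div N))"
  have d: "s mod N < N" "s div N < N'" if "s < N * N'" for s
    using that by (auto intro: less_mult_imp_div_less simp: mult.commute) (metis mod_less_divisor mult_0 not_gr_zero not_less_zero)
  have c: "pt a < N" "iv a < N" "pt' a < N'" "iv' a < N'" if "a < 2 ^ L" for a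
    using R1 R2 that by (auto simp: recogF_def)
  have mm1: "mm s t mod N = mu (s mod N) (t mod N)" "mm s t div N = mu' (s div N) (t div N)"
    if "s < N * N'" "t < N * N'" for s t
    using d[OF that(1)] d[OF that(2)] by (auto simp: mm_def W.mul_closed)
  interpret M: fsg "N * N'" mm
  proof
    show mc: "mm s t < N * N'" if "s < N * N'" "t < N * N'" for s t
      using d[OF that(1)] d[OF that(2)] by (auto simp: mm_def W.mul_closed W'.mul_closed intro!: prl_less)
    show "mm (mm s t) u = mm s (mm t u)" if "s < N * N'" "t < N * N'" "u < N * N'" for s t u
    proof -
      have "mm (mm s t) u = prl N (mu (mu (s mod N) (t mod N)) (u mod N)) (mu' (mu' (s div N) (t div N)) (u div N))"
        unfolding mm_def[of] using mm1[OF that(1,2)] by (simp add: mm_def)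
      also have "\<dots> = prl N (mu (s mod N) (mu (t mod N) (u mod N))) (mu' (s div N) (mu' (t div N) (u div N)))"
        using d[OF that(1)] d[OF that(2)] d[OF that(3)] by (simp add: W.mul_assoc W'.mul_assoc)
      also have "\<dots> = mm s (mm t u)" using mm1[OF that(2,3)] by (simp add: mm_def)
      finally show ?thesis .
    qed
  qed
  have sgm: "seg mm x i j mod N = seg mu (\<lambda>k. x k mod N) i j \<and> seg mm x i j div N = seg mu' (\<lambda>k. x k div N) i j"
    if "i < j" "\<And>k. x k < N * N'" for x i j
    using that(1)
  proof (induction rule: seg_induct)
    case (Suc j) then show ?case using mm1 M.seg_closed[of i j x] that(2) by (simp add: seg_Suc)
  qed simp
  have facm: "fac mu (\<lambda>k. x k mod N) (s mod N) (e mod N) \<and> fac mu' (\<lambda>k. x k div N) (s div N) (e div N) \<and> s < N * N' \<and> e < N * N'"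
    if f: "fac mm x s e" and x: "\<And>k. x k < N * N'" for x s e
  proof -
    obtain \<kappa> where \<kappa>: "strict_mono \<kappa>" "0 < \<kappa> 0" "seg mm x 0 (\<kappa> 0) = s" "\<And>i. seg mm x (\<kappa> i) (\<kappa> (Suc i)) = e"
      using f unfolding fac_def by blast
    have l: "\<kappa> i < \<kappa> (Suc i)" for i using \<kappa>(1) by (simp add: strict_mono_less)
    have "s < N * N'" "e < N * N'"
      using \<kappa>(3,4) M.seg_closed[OF \<kappa>(2), of x] M.seg_closed[OF l[of 0], of x] x by auto
    moreover have "fac mu (\<lambda>k. x k mod N) (s mod N) (e mod N)" "fac mu' (\<lambda>k. x k div N) (s div N) (e div N)"
      unfolding fac_def using \<kappa> sgm[OF \<kappa>(2), of x] sgm[OF l, of x] x by (intro exI[of _ \<kappa>]; simp)+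
    ultimately show ?thesis by blast
  qed
  have val: "aa (mm s (om2 e)) \<longleftrightarrow> wval mu om ac (\<lambda>k. x k mod N) \<and> wval mu' om' ac' (\<lambda>k. x k div N)"
    if f: "fac mm x s e" and x: "\<And>k. x k < N * N'" for x s e
  proof -
    have f': "fac mu (\<lambda>k. x k mod N) (s mod N) (e mod N)" "fac mu' (\<lambda>k. x k div N) (s div N) (e div N)"
      "s < N * N'" "e < N * N'" using facm[OF f x] by auto
    have "om2 e < N * N'" using d[OF f'(4)] by (auto simp: om2_def W.om_closed W'.om_closed intro!: prl_less)
    then have "aa (mm s (om2 e)) \<longleftrightarrow> ac (mu (s mod N) (om (e mod N))) \<and> ac' (mu' (s div N) (om' (e div N)))"
      using mm1[OF f'(3)] d[OF f'(4)] by (simp add: aa_def om2_def W.om_closed)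
    then show ?thesis using W.val_fac[OF _ f'(1)] W'.val_fac[OF _ f'(2)] d x by simp
  qed
  have WM: "walg (N * N') mm om2 aa"
  proof unfold_locales
    show "om2 s < N * N'" if "s < N * N'" for s
      using d[OF that] by (auto simp: om2_def W.om_closed W'.om_closed intro!: prl_less)
  qed (use val in blast)
  interpret M: walg "N * N'" mm om2 aa by (rule WM)
  have valm: "wval mm om2 aa x \<longleftrightarrow> wval mu om ac (\<lambda>k. x k mod N) \<and> wval mu' om' ac' (\<lambda>k. x k div N)"
    if x: "\<And>k. x k < N * N'" for x
  proof -
    obtain s e where f: "fac mm x s e" using M.fac_ex[of x] x by blast
    then show ?thesis using M.val_fac[of x, OF _ f] val[OF f] x by blast
  qed
  define pp where "pp = (\<lambda>a. prl N (pt a) (pt' a))"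
  define ii where "ii = (\<lambda>a. prl N (iv a) (iv' a))"
  have pc: "pp a < N * N'" "ii a < N * N'" if "a < 2 ^ L" for a using c[OF that] by (auto simp: pp_def ii_def intro!: prl_less)
  have ot: "s < N * N' \<and> OT L pt iv mu w a b (s mod N) \<and> OT L pt' iv' mu' w a b (s div N)"
    if "OT L pp ii mm w a b s" for w a b s
    using that
  proof (induction rule: OT.induct)
    case (base a b e)
    then show ?case using c[of e] pc[of e] by (auto simp: ii_def intro: OT.base)
  next
    case (step a b s e t)
    have "mm (pp (ltr L w b)) t < N * N'" using M.mul_closed pc(1)[OF ltr_less] step.IH by blast
    then show ?case
      using OT.step[of L pt iv mu w a b "s mod N" e "t mod N"] OT.step[of L pt' iv' mu' w a b "s div N" e "t div N"]
        step.IH mm1 M.mul_closed pc(1)[OF ltr_less, of w b] c[OF ltr_less, of w b]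
      by (simp add: pp_def)
  qed
  have "recogF L (N * N') pp ii mm om2 aa (\<lambda>w. P w \<and> P' w)"
    unfolding recogF_def
  proof (intro conjI allI impI)
    fix w \<tau> s assume \<tau>: "breaks \<tau>" and s: "\<forall>i. OT L pp ii mm w (\<tau> i) (\<tau> (Suc i)) (s i)"
    have s': "s i < N * N'" "OT L pt iv mu w (\<tau> i) (\<tau> (Suc i)) (s i mod N)"
      "OT L pt' iv' mu' w (\<tau> i) (\<tau> (Suc i)) (s i div N)" for i using s ot by blast+
    have "P w \<longleftrightarrow> wval mu om ac (\<lambda>i. mu (pt (ltr L w (\<tau> i))) (s i mod N))"
      "P' w \<longleftrightarrow> wval mu' om' ac' (\<lambda>i. mu' (pt' (ltr L w (\<tau> i))) (s i div N))"
      using recogF_D(5)[OF R1 \<tau>, of w "\<lambda>i. s i mod N"] recogF_D(5)[OF R2 \<tau>, of w "\<lambda>i. s i div N"] s'(2,3) by auto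
    moreover have "mm (pp (ltr L w (\<tau> i))) (s i) < N * N'" for i
      using M.mul_closed pc(1)[OF ltr_less] s'(1) by blast
    ultimately show "(P w \<and> P' w) = wval mm om2 aa (\<lambda>i. mm (pp (ltr L w (\<tau> i))) (s i))"
      using mm1[OF pc(1)[OF ltr_less] s'(1)] c[OF ltr_less] by (simp add: valm pp_def)
  qed (use WM pc in auto)
  then show ?thesis unfolding pp_def ii_def mm_def om2_def aa_def .
qed

subsection \<open>Quantification over signals\<close>

definition lup :: "nat \<Rightarrow> nat \<Rightarrow> nat \<Rightarrow> nat \<Rightarrow> nat \<Rightarrow> nat" where
  "lup L b c a v = bset L (\<lambda>j. if b \<le> j \<and> j < b + c then bit v (j - b) else bit a j)"

definition wup :: "nat \<Rightarrow> nat \<Rightarrow> (nat \<Rightarrow> real set) \<Rightarrow> (real \<Rightarrow> nat) \<Rightarrow> nat \<Rightarrow> real set" where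
  "wup b c w Z = (\<lambda>j. if b \<le> j \<and> j < b + c then component Z (j - b) else w j)"

lemma lup_less: "lup L b c a v < 2 ^ L"
  unfolding lup_def by (rule bset_less)

lemma ltr_wup: "0 \<le> t \<Longrightarrow> ltr L (wup b c w Z) t = lup L b c (ltr L w t) (Z t)"
  by (rule bit_eqI) (auto simp: lup_def bit_bset bit_ltr wup_def component_def)

text \<open>At a breakpoint the quantified signal may take any value \<open>v < p\<close>; the
  element collects the types of all letters that such a choice makes out of
  \<open>a\<close>.\<close>

definition ept :: "nat \<Rightarrow> nat \<Rightarrow> nat \<Rightarrow> nat \<Rightarrow> (nat \<Rightarrow> nat) \<Rightarrow> nat \<Rightarrow> nat" where
  "ept L N b p pt a = bset N (\<lambda>x. \<exists>v<p. x = pt (lup L b (ceillog2 p) a v))"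

text \<open>The quantified signal may change finitely often inside a gap where all other variables
  are constant. The possible types are thus the closure of those of constant signals under gluing at
  an interior point with an arbitrary value; the closure is written as an intersection to keep the
  quantifiers bounded.\<close>

definition eiv :: "nat \<Rightarrow> nat \<Rightarrow> nat \<Rightarrow> nat \<Rightarrow> (nat \<Rightarrow> nat) \<Rightarrow> (nat \<Rightarrow> nat) \<Rightarrow> (nat \<Rightarrow> nat \<Rightarrow> nat) \<Rightarrow> nat \<Rightarrow> nat" where
  "eiv L N b p pt iv mu a = bset N (\<lambda>x. \<forall>C<2 ^ N. (\<forall>v<p. bit C (iv (lup L b (ceillog2 p) a v))) \<and>
     (\<forall>s<N. \<forall>t<N. \<forall>v<p. bit C s \<and> bit C t \<longrightarrow> bit C (mu s (mu (pt (lup L b (ceillog2 p) a v)) t))) \<longrightarrow>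
     bit (C::nat) x)"

locale exq = walg N mu om ac for N mu om ac +
  fixes L b p :: nat and pt iv :: "nat \<Rightarrow> nat"
  assumes ptN: "a < 2 ^ L \<Longrightarrow> pt a < N" and ivN: "a < 2 ^ L \<Longrightarrow> iv a < N"
begin

abbreviation "up a v \<equiv> lup L b (ceillog2 p) a v"
abbreviation "wu w Z \<equiv> wup b (ceillog2 p) w Z"
abbreviation "ot \<equiv> OT L pt iv mu"
abbreviation "ot' \<equiv> OT L (ept L N b p pt) (eiv L N b p pt iv mu) (pmul N mu)"

inductive cl :: "nat \<Rightarrow> nat \<Rightarrow> bool" for a where
  base: "v < p \<Longrightarrow> cl a (iv (up a v))"
| step: "cl a s \<Longrightarrow> cl a t \<Longrightarrow> v < p \<Longrightarrow> cl a (mu s (mu (pt (up a v)) t))"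

lemma cl_less: "cl a s \<Longrightarrow> s < N"
  by (induction rule: cl.induct) (auto simp: ivN lup_less mul_closed ptN)

lemma bit_ept: "bit (ept L N b p pt a) x \<longleftrightarrow> (\<exists>v<p. x = pt (up a v))"
  unfolding ept_def bit_bset using ptN[OF lup_less] by auto

lemma bit_eiv: "bit (eiv L N b p pt iv mu a) x \<longleftrightarrow> cl a x"
proof
  assume L: "bit (eiv L N b p pt iv mu a) x"
  define C where "C = bset N (cl a)"
  have C: "bit C x \<longleftrightarrow> cl a x" for x unfolding C_def bit_bset using cl_less by auto
  have 1: "\<forall>v<p. bit C (iv (up a v))" unfolding C by (auto intro: cl.base)
  have 2: "\<forall>s<N. \<forall>t<N. \<forall>v<p. bit C s \<and> bit C t \<longrightarrow> bit C (mu s (mu (pt (up a v)) t))"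
    unfolding C by (auto intro: cl.step)
  have 3: "C < 2 ^ N" unfolding C_def by (rule bset_less)
  have "bit C x" using L 1 2 3 unfolding eiv_def bit_bset by blast
  then show "cl a x" by (simp add: C)
next
  assume x: "cl a x"
  have "bit C x" if C: "\<forall>v<p. bit C (iv (up a v))"
    "\<forall>s<N. \<forall>t<N. \<forall>v<p. bit C s \<and> bit C t \<longrightarrow> bit C (mu s (mu (pt (up a v)) t))" for C :: nat
    using x by (induction rule: cl.induct) (use C cl_less in auto)
  then show "bit (eiv L N b p pt iv mu a) x" unfolding eiv_def bit_bset using cl_less[OF x] by blast
qed

lemma glue:
  assumes "v < p" and c: "c = ltr L w m" and a: "0 \<le> a"
    and "\<exists>Z. (\<forall>t. Z t < p) \<and> pcw Z a m \<and> ot (wu w Z) a m s"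
    and "\<exists>Z. (\<forall>t. Z t < p) \<and> pcw Z m e \<and> ot (wu w Z) m e t"
  shows "\<exists>Z. (\<forall>t. Z t < p) \<and> pcw Z a e \<and> ot (wu w Z) a e (mu s (mu (pt (up c v)) t))"
proof -
  obtain Y where Y: "\<And>t. Y t < p" "pcw Y a m" "ot (wu w Y) a m s" using assms(4) by blast
  obtain Z where Z: "\<And>t. Z t < p" "pcw Z m e" "ot (wu w Z) m e t" using assms(5) by blast
  have l: "a < m" "m < e" using pcw_less[OF Y(2)] pcw_less[OF Z(2)] by auto
  define X where "X t = (if t < m then Y t else if t = m then v else Z t)" for t
  have "pcw X a m" by (rule pcw_cong[OF Y(2)]) (auto simp: X_def)
  moreover have "pcw X m e" by (rule pcw_cong[OF Z(2)]) (auto simp: X_def)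
  moreover have "ot (wu w X) a m s"
    by (rule OT_cong[OF Y(3)]) (use a in \<open>auto simp: ltr_wup X_def\<close>)
  moreover have "ot (wu w X) m e t"
    by (rule OT_cong[OF Z(3)]) (use a l in \<open>auto simp: ltr_wup X_def\<close>)
  moreover have "ltr L (wu w X) m = up c v" using a l c by (simp add: ltr_wup X_def)
  ultimately have "pcw X a e" "ot (wu w X) a e (mu s (mu (pt (up c v)) t))"
    using pcw.step[of X a m e] OT.step[of L pt iv mu "wu w X" a m s e t] by auto
  moreover have "X t < p" for t using Y Z assms(1) by (simp add: X_def)
  ultimately show ?thesis by blast
qed

lemma realize:
  assumes "ot' w a e S" "bit S s" "0 \<le> a"
  shows "\<exists>Z. (\<forall>t. Z t < p) \<and> pcw Z a e \<and> ot (wu w Z) a e s"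
  using assms
proof (induction arbitrary: s rule: OT.induct)
  case (base a e c)
  from base.prems(1) have "cl c s" by (simp add: bit_eiv)
  then show ?case using base.hyps base.prems(2)
  proof (induction arbitrary: a e rule: cl.induct)
    case (base v)
    have "ot (wu w (\<lambda>_. v)) a e (iv (up c v))"
      using base by (intro OT.base) (auto simp: ltr_wup lup_less)
    moreover have "pcw (\<lambda>_. v) a e" using base by (intro pcw.base) auto
    ultimately show ?case using base(1) by (intro exI[of _ "\<lambda>_. v"]) auto
  next
    case (step s t v)
    \<comment> \<open>Any interior point would do, because the outer letter is constant on the
      interval.\<close>
    define m where "m = (a + e) / 2"
    have m: "a < m" "m < e" using step.prems(1) by (auto simp: m_def)
    show ?case
    proof (rule glue)
      show "v < p" by fact
      show "c = ltr L w m" using step.prems(2) m by simp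
      show "\<exists>Z. (\<forall>t. Z t < p) \<and> pcw Z a m \<and> ot (wu w Z) a m s"
        using m step.prems by (intro step.IH(1)) auto
      show "\<exists>Z. (\<forall>t. Z t < p) \<and> pcw Z m e \<and> ot (wu w Z) m e t"
        using m step.prems by (intro step.IH(2)) auto
    qed (use step in auto)
  qed
next
  case (step a m S e T)
  then obtain s1 v t where s: "bit S s1" "v < p" "bit T t" "s = mu s1 (mu (pt (up (ltr L w m) v)) t)"
    by (auto simp: bit_pmul bit_ept)
  have "0 \<le> m" using step.prems OT_less[OF step.hyps(1)] by simp
  then show ?case unfolding s(4) using step s by (intro glue) auto
qed

lemma realize_rev:
  assumes Z: "\<And>a b. 0 \<le> a \<Longrightarrow> a < b \<Longrightarrow> pcw Z a b" "\<And>t. 0 \<le> t \<Longrightarrow> Z t < p"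
    and "ot' w a e S" "0 \<le> a"
  shows "\<exists>s. bit S s \<and> ot (wu w Z) a e s"
  using assms(3,4)
proof (induction rule: OT.induct)
  case (base a e c)
  have "pcw Z a e" using Z base by auto
  then have "\<exists>s. cl c s \<and> ot (wu w Z) a e s" using base.hyps(2) base.prems
  proof (induction rule: pcw.induct)
    case (base a e z)
    obtain t where t: "a < t" "t < e" using dense[OF base(1)] by blast
    then have "z < p" using base Z(2)[of t] by auto
    moreover have "ot (wu w Z) a e (iv (up c z))"
      using base by (intro OT.base) (auto simp: ltr_wup lup_less)
    ultimately show ?case by (auto intro: cl.base)
  next
    case (step a m e)
    have l: "a < m" "m < e" using step pcw_less by auto
    obtain s where s: "cl c s" "ot (wu w Z) a m s" using step.IH(1) step.prems l by auto
    obtain t where t: "cl c t" "ot (wu w Z) m e t" using step.IH(2) step.prems l by auto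
    have "ltr L (wu w Z) m = up c (Z m)" using step.prems l by (simp add: ltr_wup)
    then have "ot (wu w Z) a e (mu s (mu (pt (up c (Z m))) t))" using OT.step[OF s(2) t(2)] by simp
    moreover have "cl c (mu s (mu (pt (up c (Z m))) t))" using s t Z(2) l step.prems by (intro cl.step) auto
    ultimately show ?case by blast
  qed
  then show ?case by (simp add: bit_eiv)
next
  case (step a m S e T)
  have l: "0 \<le> m" using step.prems OT_less[OF step.hyps(1)] by simp
  obtain s where s: "bit S s" "ot (wu w Z) a m s" using step by blast
  obtain t where t: "bit T t" "ot (wu w Z) m e t" using step l by blast
  have c: "s < N" "t < N" using OT_closed[where pt = pt and iv = iv, OF fsg_axioms _ _ s(2)]
    OT_closed[where pt = pt and iv = iv, OF fsg_axioms _ _ t(2)] ptN ivN by auto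
  have "ot (wu w Z) a e (mu s (mu (pt (up (ltr L w m) (Z m))) t))"
    using OT.step[OF s(2) t(2)] l by (simp add: ltr_wup)
  moreover have "bit (pmul N mu S (pmul N mu (ept L N b p pt (ltr L w m)) T)) (mu s (mu (pt (up (ltr L w m) (Z m))) t))"
    unfolding bit_pmul bit_ept using s t c Z(2)[OF l] ptN[OF lup_less] mul_closed by blast
  ultimately show ?case by blast
qed

end

text \<open>By \<open>realize_rev\<close> a signal \<open>Z\<close> picks one element from every set
  in the sequence over the power algebra. Conversely a choice of elements is realised gap by gap,
  and the pieces are joined by the values chosen at the breakpoints. \<open>power_val\<close>
  identifies the existence of a choice with acceptance.\<close>

lemma recogF_ex:
  assumes R: "recogF L N pt iv mu om ac P"
  shows "recogF L (2 ^ N) (ept L N b p pt) (eiv L N b p pt iv mu) (pmul N mu) (pom N mu om) (pac N ac)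
    (\<lambda>w. \<exists>Z\<in>signals p. P (wup b (ceillog2 p) w Z))"
proof -
  interpret exq N mu om ac L b p pt iv
    using recogF_D(1)[OF R] recogF_D(2,3)[OF R] by (auto simp: exq_def exq_axioms_def)
  show ?thesis unfolding recogF_def
  proof (intro conjI allI impI)
    show "walg (2 ^ N) (pmul N mu) (pom N mu om) (pac N ac)" by (rule power_walg)
    fix a show "ept L N b p pt a < 2 ^ N" "eiv L N b p pt iv mu a < 2 ^ N"
      unfolding ept_def eiv_def by (rule bset_less)+
  next
    fix w \<tau> S assume \<tau>: "breaks \<tau>" and S: "\<forall>i. ot' w (\<tau> i) (\<tau> (Suc i)) (S i)"
    interpret breaks \<tau> by fact
    define X where "X i = pmul N mu (ept L N b p pt (ltr L w (\<tau> i))) (S i)" for i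
    have "X i < 2 ^ N" for i unfolding X_def pmul_def by (rule bset_less)
    then have V: "wval (pmul N mu) (pom N mu om) (pac N ac) X \<longleftrightarrow> (\<exists>y. (\<forall>k. bit (X k) (y k)) \<and> val y)"
      by (intro power_val) auto
    have "(\<exists>Z\<in>signals p. P (wu w Z)) \<longleftrightarrow> (\<exists>y. (\<forall>k. bit (X k) (y k)) \<and> val y)"
    proof
      assume "\<exists>Z\<in>signals p. P (wu w Z)"
      then obtain Z where Z: "Z \<in> signals p" "P (wu w Z)" by blast
      have "\<forall>i. \<exists>s. bit (S i) s \<and> ot (wu w Z) (\<tau> i) (\<tau> (Suc i)) s"
      proof
        fix i show "\<exists>s. bit (S i) s \<and> ot (wu w Z) (\<tau> i) (\<tau> (Suc i)) s"
          by (rule realize_rev) (use Z(1) S in \<open>auto simp: signals_def finitely_variable_iff PiE_iff\<close>)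
      qed
      then obtain s where s: "\<And>i. bit (S i) (s i)" "\<And>i. ot (wu w Z) (\<tau> i) (\<tau> (Suc i)) (s i)" by metis
      have sN: "s i < N" for i using recogF_D(4)[OF R s(2)] .
      define y where "y i = mu (pt (up (ltr L w (\<tau> i)) (Z (\<tau> i)))) (s i)" for i
      have "Z (\<tau> i) < p" for i using Z(1) by (auto simp: signals_def PiE_iff)
      then have "bit (X i) (y i)" for i
        unfolding X_def y_def bit_pmul bit_ept using s(1) sN ptN[OF lup_less] by blast
      moreover have "val y" using recogF_D(5)[OF R \<tau> s(2)] Z(2) by (simp add: ltr_wup y_def[abs_def])
      ultimately show "\<exists>y. (\<forall>k. bit (X k) (y k)) \<and> val y" by blast
    next
      assume "\<exists>y. (\<forall>k. bit (X k) (y k)) \<and> val y"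
      then obtain y where y: "\<And>k. bit (X k) (y k)" "val y" by blast
      have "\<forall>i. \<exists>v s. v < p \<and> bit (S i) s \<and> y i = mu (pt (up (ltr L w (\<tau> i)) v)) s"
        using y(1) unfolding X_def bit_pmul bit_ept by blast
      then obtain v s where vs: "\<And>i. v i < p" "\<And>i. bit (S i) (s i)"
        "\<And>i. y i = mu (pt (up (ltr L w (\<tau> i)) (v i))) (s i)" by metis
      have "\<forall>i. \<exists>Z. (\<forall>t. Z t < p) \<and> pcw Z (\<tau> i) (\<tau> (Suc i)) \<and> ot (wu w Z) (\<tau> i) (\<tau> (Suc i)) (s i)"
        using realize S vs(2) tau_nonneg by blast
      then obtain Y where Y: "\<And>i t. Y i t < p" "\<And>i. pcw (Y i) (\<tau> i) (\<tau> (Suc i))"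
        "\<And>i. ot (wu w (Y i)) (\<tau> i) (\<tau> (Suc i)) (s i)" by metis
      define ix where "ix t = (THE i. \<tau> i \<le> t \<and> t < \<tau> (Suc i))" for t
      have ix: "ix t = i" if "\<tau> i \<le> t" "t < \<tau> (Suc i)" for i t
        unfolding ix_def
      proof (rule the_equality)
        fix j assume j: "\<tau> j \<le> t \<and> t < \<tau> (Suc j)"
        have "\<tau> i < \<tau> (Suc j)" "\<tau> j < \<tau> (Suc i)" using that j by linarith+
        then show "j = i" by simp
      qed (use that in auto)
      \<comment> \<open>The value \<open>undefined\<close> at negative times makes \<open>Z\<close>
        extensional, as membership in \<open>signals\<close> demands.\<close>
      define Z where "Z t = (if t < 0 then undefined else if t = \<tau> (ix t) then v (ix t) else Y (ix t) t)" for t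
      have Zi: "Z t = Y i t" if "\<tau> i < t" "t < \<tau> (Suc i)" for i t
      proof -
        have "0 \<le> \<tau> i" by simp
        then have "0 \<le> t" using that by linarith
        then show ?thesis using ix[of i t] that by (simp add: Z_def)
      qed
      have Zt: "Z (\<tau> i) = v i" for i using ix[of i "\<tau> i"] by (simp add: Z_def not_less[symmetric])
        (use tau_nonneg not_less in blast)
      have "pcw Z (\<tau> i) (\<tau> (Suc i))" for i by (rule pcw_cong[OF Y(2)]) (rule Zi)
      then have "finitely_variable Z" unfolding finitely_variable_iff using pcw_all by blast
      then have "Z \<in> signals p" using vs(1) Y(1) by (auto simp: signals_def PiE_def extensional_def Z_def)
      moreover have "ot (wu w Z) (\<tau> i) (\<tau> (Suc i)) (s i)" for i
      proof (rule OT_cong[OF Y(3)])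
        fix t assume "\<tau> i < t" "t < \<tau> (Suc i)"
        moreover from this have "0 \<le> t" using tau_nonneg[of i] by linarith
        ultimately show "ltr L (wu w Z) t = ltr L (wu w (Y i)) t" using Zi by (simp add: ltr_wup)
      qed
      then have "P (wu w Z) \<longleftrightarrow> val (\<lambda>i. mu (pt (ltr L (wu w Z) (\<tau> i))) (s i))" by (rule recogF_D(5)[OF R \<tau>])
      then have "P (wu w Z)" using y(2) by (simp add: ltr_wup Zt vs(3)[symmetric])
      ultimately show "\<exists>Z\<in>signals p. P (wu w Z)" by blast
    qed
    then show "(\<exists>Z\<in>signals p. P (wu w Z)) =
        wval (pmul N mu) (pom N mu om) (pac N ac) (\<lambda>i. pmul N mu (ept L N b p pt (ltr L w (\<tau> i))) (S i))"
      using V by (simp add: X_def[abs_def])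
  qed
qed

subsection \<open>Algebras as numbers\<close>

type_synonym alg = "nat \<times> nat \<times> nat \<times> nat \<times> nat \<times> nat"

definition aN :: "alg \<Rightarrow> nat" where "aN A = fst A"
definition aPT :: "alg \<Rightarrow> nat \<Rightarrow> nat" where "aPT A a = lk (fst (snd A)) a"
definition aIV :: "alg \<Rightarrow> nat \<Rightarrow> nat" where "aIV A a = lk (fst (snd (snd A))) a"
definition aMU :: "alg \<Rightarrow> nat \<Rightarrow> nat \<Rightarrow> nat" where "aMU A s t = lk (fst (snd (snd (snd A)))) (prod_encode (s, t))"
definition aOM :: "alg \<Rightarrow> nat \<Rightarrow> nat" where "aOM A s = lk (fst (snd (snd (snd (snd A))))) s"
definition aAC :: "alg \<Rightarrow> nat \<Rightarrow> bool" where "aAC A s = bit (snd (snd (snd (snd (snd A))))) s"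

definition recog :: "nat \<Rightarrow> alg \<Rightarrow> ((nat \<Rightarrow> real set) \<Rightarrow> bool) \<Rightarrow> bool" where
  "recog L A = recogF L (aN A) (aPT A) (aIV A) (aMU A) (aOM A) (aAC A)"

text \<open>The multiplication table is indexed by codes of pairs, and
  \<open>prod_encode (N, N)\<close> exceeds the codes of all pairs of numbers below
  \<open>N\<close>. What the table holds at other codes is irrelevant by
  \<open>recogF_cong\<close>.\<close>

definition mkalg :: "nat \<Rightarrow> nat \<Rightarrow> (nat \<Rightarrow> nat) \<Rightarrow> (nat \<Rightarrow> nat) \<Rightarrow> (nat \<Rightarrow> nat \<Rightarrow> nat) \<Rightarrow> (nat \<Rightarrow> nat) \<Rightarrow>
    (nat \<Rightarrow> bool) \<Rightarrow> alg" where
  "mkalg L N pt iv mu om ac = (N, tab (2 ^ L) pt, tab (2 ^ L) iv,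
     tab (prod_encode (N, N)) (\<lambda>i. mu (fst (prod_decode i)) (snd (prod_decode i))), tab N om, bset N ac)"

lemma recog_mkalg:
  assumes "recogF L N pt iv mu om ac P" shows "recog L (mkalg L N pt iv mu om ac) P"
proof -
  have "prod_encode (s, t) < prod_encode (N, N)" if "s < N" "t < N" for s t
    using that triangle_mono[of "s + t" "N + N"] by (simp add: prod_encode_def)
  then show ?thesis unfolding recog_def
    using recogF_cong[OF assms, of "aPT (mkalg L N pt iv mu om ac)" "aIV (mkalg L N pt iv mu om ac)"
      "aMU (mkalg L N pt iv mu om ac)" "aOM (mkalg L N pt iv mu om ac)" "aAC (mkalg L N pt iv mu om ac)"]
    by (simp add: aN_def aPT_def aIV_def aMU_def aOM_def aAC_def mkalg_def lk_tab bit_bset)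
qed

lemma cmpf_mkalg:
  assumes "cmpf L" "cmpf N" "cmpf (\<lambda>x. pt (fst x) (snd x))" "cmpf (\<lambda>x. iv (fst x) (snd x))"
    "cmpf (\<lambda>x. mu (fst x) (fst (snd x)) (snd (snd x)))" "cmpf (\<lambda>x. om (fst x) (snd x))" "cmpf (\<lambda>x. ac (fst x) (snd x))"
  shows "cmpf (\<lambda>z. mkalg (L z) (N z) (\<lambda>a. pt a z) (\<lambda>a. iv a z) (\<lambda>s t. mu s t z) (\<lambda>s. om s z) (\<lambda>s. ac s z))"
proof -
  have "cmpf (\<lambda>x. mu (fst (prod_decode (fst x))) (snd (prod_decode (fst x))) (snd x))"
    using cmpf_comp[OF assms(5), of "\<lambda>x. (fst (prod_decode (fst x)), snd (prod_decode (fst x)), snd x)"]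
    by (simp add: cmpf_intros)
  then show ?thesis unfolding mkalg_def by (intro cmpf_intros assms)
qed

lemma cmpf_acc:
  assumes "cmpf A"
  shows "cmpf (\<lambda>z. aN (A z))" "cmpf f \<Longrightarrow> cmpf (\<lambda>z. aPT (A z) (f z))" "cmpf f \<Longrightarrow> cmpf (\<lambda>z. aIV (A z) (f z))"
    "cmpf f \<Longrightarrow> cmpf g \<Longrightarrow> cmpf (\<lambda>z. aMU (A z) (f z) (g z))" "cmpf f \<Longrightarrow> cmpf (\<lambda>z. aOM (A z) (f z))"
    "cmpf f \<Longrightarrow> cmpf (\<lambda>z. aAC (A z) (f z))"
  unfolding aN_def aPT_def aIV_def aMU_def aOM_def aAC_def by (intro cmpf_intros assms; assumption)+


section \<open>Computable algebras for atomic formulas, connectives and quantifiers\<close>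

definition A_in :: "nat \<Rightarrow> nat \<Rightarrow> nat \<Rightarrow> alg" where
  "A_in L i j = mkalg L 2 (\<lambda>a. if bit a i \<and> bit a j then 1 else 0) (\<lambda>a. if bit a i \<and> bit a j then 1 else 0)
     max (\<lambda>e. max e e) (\<lambda>s. s = 1)"

text \<open>For comparing two signals: their codes occupy the \<open>n\<close> variables from
  \<open>b\<close> on and from \<open>c\<close> on, and variable \<open>j\<close> holds the time of
  the comparison.\<close>

definition A_df :: "nat \<Rightarrow> nat \<Rightarrow> nat \<Rightarrow> nat \<Rightarrow> nat \<Rightarrow> alg" where
  "A_df L b c n j = mkalg L 2 (\<lambda>a. if bit a j \<and> (\<exists>k<n. bit a (b + k) \<noteq> bit a (c + k)) then 1 else 0)
     (\<lambda>a. if bit a j \<and> (\<exists>k<n. bit a (b + k) \<noteq> bit a (c + k)) then 1 else 0) max (\<lambda>e. max e e) (\<lambda>s. s = 1)"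

definition A_lt :: "nat \<Rightarrow> nat \<Rightarrow> nat \<Rightarrow> alg" where
  "A_lt L i j = mkalg L 8 (lpt i j) (\<lambda>a. lmu (lpt i j a) (lpt i j a)) lmu (\<lambda>e. lmu e e) (\<lambda>s. bit s 2)"

definition A_neg :: "nat \<Rightarrow> alg \<Rightarrow> alg" where
  "A_neg L A = mkalg L (aN A) (aPT A) (aIV A) (aMU A) (aOM A) (\<lambda>s. \<not> aAC A s)"

definition A_cj :: "nat \<Rightarrow> alg \<Rightarrow> alg \<Rightarrow> alg" where
  "A_cj L A B = mkalg L (aN A * aN B) (\<lambda>a. prl (aN A) (aPT A a) (aPT B a)) (\<lambda>a. prl (aN A) (aIV A a) (aIV B a))
     (\<lambda>s t. prl (aN A) (aMU A (s mod aN A) (t mod aN A)) (aMU B (s div aN A) (t div aN A)))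
     (\<lambda>s. prl (aN A) (aOM A (s mod aN A)) (aOM B (s div aN A))) (\<lambda>s. aAC A (s mod aN A) \<and> aAC B (s div aN A))"

definition A_ex :: "nat \<Rightarrow> nat \<Rightarrow> nat \<Rightarrow> alg \<Rightarrow> alg" where
  "A_ex L b p A = mkalg L (2 ^ aN A) (ept L (aN A) b p (aPT A)) (eiv L (aN A) b p (aPT A) (aIV A) (aMU A))
     (pmul (aN A) (aMU A)) (pom (aN A) (aMU A) (aOM A)) (pac (aN A) (aAC A))"

definition A_sg :: "nat \<Rightarrow> nat \<Rightarrow> alg" where
  "A_sg L i = A_cj L (A_in L i i) (A_neg L (A_lt L i i))"

lemma recog_weaken: "recog L A P \<Longrightarrow> (\<And>w. P w = Q w) \<Longrightarrow> recog L A Q"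
  by (simp add: recog_def recogF_def)

lemma recog_in: "i < L \<Longrightarrow> j < L \<Longrightarrow> recog L (A_in L i j) (\<lambda>w. \<exists>t\<ge>0. t \<in> w i \<and> t \<in> w j)"
  unfolding A_in_def by (rule recog_weaken[OF recog_mkalg[OF recogF_meet]]) (simp add: bit_ltr)

lemma recog_df: "b + n \<le> L \<Longrightarrow> c + n \<le> L \<Longrightarrow> j < L \<Longrightarrow>
    recog L (A_df L b c n j) (\<lambda>w. \<exists>t\<ge>0. t \<in> w j \<and> (\<exists>k<n. t \<in> w (b + k) \<longleftrightarrow> t \<notin> w (c + k)))"
  unfolding A_df_def by (rule recog_weaken[OF recog_mkalg[OF recogF_meet]]) (simp add: bit_ltr cong: conj_cong)

lemma recog_lt: "i < L \<Longrightarrow> j < L \<Longrightarrow>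
    recog L (A_lt L i j) (\<lambda>w. \<exists>x y. 0 \<le> x \<and> x < y \<and> x \<in> w i \<and> y \<in> w j)"
  unfolding A_lt_def by (rule recog_mkalg[OF recogF_less])

lemma recog_neg: "recog L A P \<Longrightarrow> recog L (A_neg L A) (\<lambda>w. \<not> P w)"
  unfolding A_neg_def by (rule recog_mkalg[OF recogF_neg]) (simp add: recog_def)

lemma recog_cj: "recog L A P \<Longrightarrow> recog L B Q \<Longrightarrow> recog L (A_cj L A B) (\<lambda>w. P w \<and> Q w)"
  unfolding A_cj_def by (rule recog_mkalg[OF recogF_conj]) (simp_all add: recog_def)

lemma recog_ex: "recog L A P \<Longrightarrow> recog L (A_ex L b p A) (\<lambda>w. \<exists>Z\<in>signals p. P (wup b (ceillog2 p) w Z))"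
  unfolding A_ex_def by (rule recog_mkalg[OF recogF_ex]) (simp add: recog_def)

lemma recog_sg:
  assumes "i < L"
  shows "recog L (A_sg L i) (\<lambda>w. (\<exists>t\<ge>0. t \<in> w i) \<and> \<not> (\<exists>x y. 0 \<le> x \<and> x < y \<and> x \<in> w i \<and> y \<in> w i))"
  unfolding A_sg_def
  by (rule recog_weaken[OF recog_cj[OF recog_in[OF assms assms] recog_neg[OF recog_lt[OF assms assms]]]]) auto

text \<open>The empty environment has the letter 0 everywhere. With the natural numbers as
  breakpoints its sequence is constant, each term being the product \<open>z\<close> of a point and
  a gap, and has the factorisation \<open>z z z ...\<close>.\<close>

definition truth :: "alg \<Rightarrow> bool" where
  "truth A \<longleftrightarrow> aAC A (aMU A (aMU A (aPT A 0) (aIV A 0)) (aOM A (aMU A (aPT A 0) (aIV A 0))))"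

lemma recog_truth:
  assumes R: "recog L A P" shows "P (\<lambda>_. {}) \<longleftrightarrow> truth A"
proof -
  note R = R[unfolded recog_def]
  interpret walg "aN A" "aMU A" "aOM A" "aAC A" by (rule recogF_D(1)[OF R])
  have br: "breaks real"
    by unfold_locales (auto simp: strict_mono_def bdd_above_def, meson not_le reals_Archimedean2)
  have l: "ltr L (\<lambda>_. {}) t = 0" for t by (rule bit_eqI) (simp add: bit_ltr)
  define z where "z = aMU A (aPT A 0) (aIV A 0)"
  have z: "z < aN A" unfolding z_def by (intro mul_closed recogF_D(2,3)[OF R]) auto
  have "OT L (aPT A) (aIV A) (aMU A) (\<lambda>_. {}) (real i) (real (Suc i)) (aIV A 0)" for i
    by (rule OT.base) (auto simp: l)
  from recogF_D(5)[OF R br this] have "P (\<lambda>_. {}) \<longleftrightarrow> val (\<lambda>i. z)" by (simp add: l z_def)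
  moreover have "fac (aMU A) (\<lambda>i. z) z z"
    unfolding fac_def by (intro exI[of _ Suc]) (auto simp: strict_mono_def)
  ultimately show ?thesis using val_fac[of "\<lambda>_. z" z z] z unfolding truth_def z_def by simp
qed

lemma cmpf_div: "cmpf f \<Longrightarrow> cmpf g \<Longrightarrow> cmpf (\<lambda>z. f z div g z :: nat)"
proof -
  assume fg: "cmpf f" "cmpf g"
  have eq: "m div d = (LEAST q. m < d * Suc q \<or> d = 0)" for m d :: nat
  proof (cases "d = 0")
    case False
    show ?thesis
    proof (intro Least_equality[symmetric])
      show "m < d * Suc (m div d) \<or> d = 0" using dividend_less_times_div[of d m] False by simp
      show "m div d \<le> q" if "m < d * Suc q \<or> d = 0" for q
        using less_mult_imp_div_less[of m "Suc q" d] that False by (simp add: mult.commute)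
    qed
  qed (simp add: Least_eq_0)
  have "cmpf (\<lambda>x. LEAST q. fst x < snd x * Suc q \<or> snd x = (0::nat))"
  proof (rule cmpf_least)
    show "\<exists>k. fst z < snd z * Suc k \<or> snd z = 0" for z :: "nat \<times> nat"
      using dividend_less_times_div[of "snd z" "fst z"] by (intro exI[of _ "fst z div snd z"]) auto
  qed (intro cmpf_intros)
  from cmpf_comp[OF this cmpf_pair[OF fg]] show ?thesis by (simp add: eq)
qed

lemma cmpf_mod: "cmpf f \<Longrightarrow> cmpf g \<Longrightarrow> cmpf (\<lambda>z. f z mod g z :: nat)"
  unfolding minus_mult_div_eq_mod[symmetric] by (intro cmpf_intros cmpf_div)

lemma cmpf_A_in: "cmpf L \<Longrightarrow> cmpf i \<Longrightarrow> cmpf j \<Longrightarrow> cmpf (\<lambda>z. A_in (L z) (i z) (j z))"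
  using cmpf_comp[of "\<lambda>x. A_in (fst x) (fst (snd x)) (snd (snd x))" "\<lambda>z. (L z, i z, j z)"]
  by (simp add: A_in_def max_def cmpf_intros cmpf_mkalg)

lemma cmpf_A_df: "cmpf L \<Longrightarrow> cmpf b \<Longrightarrow> cmpf c \<Longrightarrow> cmpf n \<Longrightarrow> cmpf j \<Longrightarrow>
    cmpf (\<lambda>z. A_df (L z) (b z) (c z) (n z) (j z))"
proof -
  assume a: "cmpf L" "cmpf b" "cmpf c" "cmpf n" "cmpf j"
  have "cmpf (\<lambda>x. A_df (fst x) (fst (snd x)) (fst (snd (snd x))) (fst (snd (snd (snd x)))) (snd (snd (snd (snd x)))))"
    unfolding A_df_def max_def by (intro cmpf_mkalg cmpf_intros)
  from cmpf_comp[OF this, of "\<lambda>z. (L z, b z, c z, n z, j z)"] a show ?thesis by (simp add: cmpf_intros)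
qed

lemma cmpf_A_lt: "cmpf L \<Longrightarrow> cmpf i \<Longrightarrow> cmpf j \<Longrightarrow> cmpf (\<lambda>z. A_lt (L z) (i z) (j z))"
proof -
  assume a: "cmpf L" "cmpf i" "cmpf j"
  have "cmpf (\<lambda>x. A_lt (fst x) (fst (snd x)) (snd (snd x)))"
    unfolding A_lt_def lpt_def lmu_def by (intro cmpf_mkalg cmpf_intros)
  from cmpf_comp[OF this, of "\<lambda>z. (L z, i z, j z)"] a show ?thesis by (simp add: cmpf_intros)
qed

lemma cmpf_A_neg: "cmpf L \<Longrightarrow> cmpf A \<Longrightarrow> cmpf (\<lambda>z. A_neg (L z) (A z))"
proof -
  assume a: "cmpf L" "cmpf A"
  have "cmpf (\<lambda>x. A_neg (fst x) (snd x))"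
    unfolding A_neg_def by (intro cmpf_mkalg cmpf_acc cmpf_intros)
  from cmpf_comp[OF this, of "\<lambda>z. (L z, A z)"] a show ?thesis by (simp add: cmpf_intros)
qed

lemma cmpf_A_cj: "cmpf L \<Longrightarrow> cmpf A \<Longrightarrow> cmpf B \<Longrightarrow> cmpf (\<lambda>z. A_cj (L z) (A z) (B z))"
proof -
  assume a: "cmpf L" "cmpf A" "cmpf B"
  have "cmpf (\<lambda>x. A_cj (fst x) (fst (snd x)) (snd (snd x)))"
    unfolding A_cj_def prl_def by (intro cmpf_mkalg cmpf_acc cmpf_mod cmpf_div cmpf_intros)
  from cmpf_comp[OF this, of "\<lambda>z. (L z, A z, B z)"] a show ?thesis by (simp add: cmpf_intros)
qed

lemma cmpf_A_ex: "cmpf L \<Longrightarrow> cmpf b \<Longrightarrow> cmpf p \<Longrightarrow> cmpf A \<Longrightarrow> cmpf (\<lambda>z. A_ex (L z) (b z) (p z) (A z))"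
proof -
  assume a: "cmpf L" "cmpf b" "cmpf p" "cmpf A"
  have "cmpf (\<lambda>x. A_ex (fst x) (fst (snd x)) (fst (snd (snd x))) (snd (snd (snd x))))"
    unfolding A_ex_def ept_def eiv_def pmul_def pom_def pgen_def pac_def lup_def
    by (intro cmpf_mkalg cmpf_acc cmpf_ceillog2 cmpf_intros)
  from cmpf_comp[OF this, of "\<lambda>z. (L z, b z, p z, A z)"] a show ?thesis by (simp add: cmpf_intros)
qed

lemma cmpf_A_sg: "cmpf L \<Longrightarrow> cmpf i \<Longrightarrow> cmpf (\<lambda>z. A_sg (L z) (i z))"
  unfolding A_sg_def by (intro cmpf_A_cj cmpf_A_in cmpf_A_neg cmpf_A_lt)

lemma cmpf_truth: "cmpf A \<Longrightarrow> cmpf (\<lambda>z. truth (A z))"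
  unfolding truth_def by (intro cmpf_acc cmpf_intros)

lemmas cmpf_algs = cmpf_A_in cmpf_A_df cmpf_A_lt cmpf_A_neg cmpf_A_cj cmpf_A_ex cmpf_A_sg cmpf_truth

section \<open>Deciding sentences\<close>

definition sing :: "(nat \<Rightarrow> real set) \<Rightarrow> nat \<Rightarrow> bool" where
  "sing w i \<longleftrightarrow> (\<exists>t\<ge>0. t \<in> w i) \<and> \<not> (\<exists>x y. 0 \<le> x \<and> x < y \<and> x \<in> w i \<and> y \<in> w i)"

text \<open>The first-order variable \<open>t\<close> is represented by the second-order variable \<open>M + t\<close>.\<close>

fun xsat :: "nat \<Rightarrow> (nat \<Rightarrow> real set) \<Rightarrow> mso \<Rightarrow> bool" where
  "xsat M w (Less t v) \<longleftrightarrow> (\<exists>x y. 0 \<le> x \<and> x < y \<and> x \<in> w (M + t) \<and> y \<in> w (M + v))"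
| "xsat M w (In X t) \<longleftrightarrow> (\<exists>r\<ge>0. r \<in> w X \<and> r \<in> w (M + t))"
| "xsat M w (Neg \<phi>) \<longleftrightarrow> \<not> xsat M w \<phi>"
| "xsat M w (Conj \<phi> \<psi>) \<longleftrightarrow> xsat M w \<phi> \<and> xsat M w \<psi>"
| "xsat M w (Disj \<phi> \<psi>) \<longleftrightarrow> \<not> (\<not> xsat M w \<phi> \<and> \<not> xsat M w \<psi>)"
| "xsat M w (Impl \<phi> \<psi>) \<longleftrightarrow> \<not> (xsat M w \<phi> \<and> \<not> xsat M w \<psi>)"
| "xsat M w (Ex1 t \<phi>) \<longleftrightarrow> (\<exists>Z\<in>signals 2. sing (wup (M + t) 1 w Z) (M + t) \<and> xsat M (wup (M + t) 1 w Z) \<phi>)"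
| "xsat M w (All1 t \<phi>) \<longleftrightarrow> \<not> (\<exists>Z\<in>signals 2. sing (wup (M + t) 1 w Z) (M + t) \<and> \<not> xsat M (wup (M + t) 1 w Z) \<phi>)"
| "xsat M w (Ex2 X \<phi>) \<longleftrightarrow> (\<exists>Z\<in>signals 2. xsat M (wup X 1 w Z) \<phi>)"
| "xsat M w (All2 X \<phi>) \<longleftrightarrow> \<not> (\<exists>Z\<in>signals 2. \<not> xsat M (wup X 1 w Z) \<phi>)"

lemma wup_1: "wup i 1 w Z = w(i := component Z 0)"
  by (auto simp: wup_def fun_eq_iff)

lemma component_signals_2: "(\<lambda>Z. component Z 0) ` signals 2 = bool_signals"
proof (intro equalityI subsetI)
  fix A assume "A \<in> (\<lambda>Z. component Z 0) ` signals 2"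
  then show "A \<in> bool_signals" using component_bool_signal by auto
next
  fix A assume A: "A \<in> bool_signals"
  define Z where "Z t = (if t < 0 then undefined else if t \<in> A then 1 else 0 :: nat)" for t :: real
  have "finitely_variable (\<lambda>t. if t \<in> A then 1 else 0 :: nat)"
    using fv_map[of "\<lambda>t. t \<in> A" "\<lambda>b. if b then 1 else 0 :: nat"] A by (auto simp: bool_signals_def)
  then have "finitely_variable Z" unfolding finitely_variable_iff
    by (intro allI impI) (rule pcw_cong[of "\<lambda>t. if t \<in> A then 1 else 0"], auto simp: Z_def)
  then have "Z \<in> signals 2" by (auto simp: signals_def PiE_def extensional_def Z_def)
  moreover have "component Z 0 = A" using A by (auto simp: component_def Z_def bool_signals_def bit_0 split: if_splits)
  ultimately show "A \<in> (\<lambda>Z. component Z 0) ` signals 2" by blast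
qed

lemma ex_signals_2: "(\<exists>Z\<in>signals 2. Q (wup i 1 w Z)) \<longleftrightarrow> (\<exists>A\<in>bool_signals. Q (w(i := A)))"
  unfolding wup_1 component_signals_2[symmetric] by blast

lemma sing_upd: "A \<in> bool_signals \<Longrightarrow> sing (w(i := A)) i \<longleftrightarrow> (\<exists>r\<ge>0. A = {r})"
proof -
  assume A: "A \<in> bool_signals"
  show ?thesis
  proof
    assume s: "sing (w(i := A)) i"
    then obtain t where t: "0 \<le> t" "t \<in> A" by (auto simp: sing_def)
    have "x = t" if "x \<in> A" for x
      using that s t A by (cases x t rule: linorder_cases) (auto simp: sing_def bool_signals_def)
    then show "\<exists>r\<ge>0. A = {r}" using t by blast
  qed (auto simp: sing_def)
qed

lemma prod_encode_ge: "a \<le> prod_encode (a, b)" "b \<le> prod_encode (a, b)"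
  using le_prod_encode_1 le_prod_encode_2 by auto

lemma prod_encode_gr: "0 < k \<Longrightarrow> n < prod_encode (k, n)"
proof -
  assume "0 < k"
  have "m \<le> triangle m" for m by (induction m) auto
  from this[of "k + n"] show ?thesis using \<open>0 < k\<close> by (simp add: prod_encode_def)
qed

lemma prod_encode_gr2:
  "0 < k \<Longrightarrow> a < prod_encode (k, prod_encode (a, b))" "0 < k \<Longrightarrow> b < prod_encode (k, prod_encode (a, b))"
  using prod_encode_ge(1)[of a b] prod_encode_ge(2)[of b a] prod_encode_gr[of k "prod_encode (a, b)"] by auto

text \<open>Subformulas have smaller codes, which is what course-of-values recursion on codes
  requires; and a code bounds the variables of its formula, the quantified ones included.\<close>

lemma code_sub:
  "code \<phi> < code (Neg \<phi>)" "code \<phi> < code (Conj \<phi> \<psi>)" "code \<psi> < code (Conj \<phi> \<psi>)"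
  "code \<phi> < code (Disj \<phi> \<psi>)" "code \<psi> < code (Disj \<phi> \<psi>)" "code \<phi> < code (Impl \<phi> \<psi>)" "code \<psi> < code (Impl \<phi> \<psi>)"
  "code \<phi> < code (Ex1 t \<phi>)" "code \<phi> < code (All1 t \<phi>)" "code \<phi> < code (Ex2 t \<phi>)" "code \<phi> < code (All2 t \<phi>)"
  "t < code (Ex1 t \<phi>)" "t < code (All1 t \<phi>)" "t < code (Ex2 t \<phi>)" "t < code (All2 t \<phi>)"
  "t \<le> code (Less t v)" "v \<le> code (Less t v)" "t \<le> code (In t v)" "v \<le> code (In t v)"
proof -
  have 2: "a \<le> prod_encode (k, prod_encode (a, b))" "b \<le> prod_encode (k, prod_encode (a, b))" for a b k
    using prod_encode_ge(1)[of a b] prod_encode_ge(2)[of b a] prod_encode_ge(2)[of "prod_encode (a, b)" k] by auto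
  show "code \<phi> < code (Neg \<phi>)" "code \<phi> < code (Conj \<phi> \<psi>)" "code \<psi> < code (Conj \<phi> \<psi>)"
    "code \<phi> < code (Disj \<phi> \<psi>)" "code \<psi> < code (Disj \<phi> \<psi>)" "code \<phi> < code (Impl \<phi> \<psi>)" "code \<psi> < code (Impl \<phi> \<psi>)"
    "code \<phi> < code (Ex1 t \<phi>)" "code \<phi> < code (All1 t \<phi>)" "code \<phi> < code (Ex2 t \<phi>)" "code \<phi> < code (All2 t \<phi>)"
    "t < code (Ex1 t \<phi>)" "t < code (All1 t \<phi>)" "t < code (Ex2 t \<phi>)" "t < code (All2 t \<phi>)"
    "t \<le> code (Less t v)" "v \<le> code (Less t v)" "t \<le> code (In t v)" "v \<le> code (In t v)"
    using 2 by (auto simp: prod_encode_gr prod_encode_gr2)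
qed

lemma fv_le_code: "X \<in> fv2 \<phi> \<Longrightarrow> X \<le> code \<phi>" "t \<in> fv1 \<phi> \<Longrightarrow> t \<le> code \<phi>"
proof (induction \<phi>)
  case (Less x y) { case 1 then show ?case by simp next case 2 then show ?case using code_sub(16)[of x y] code_sub(17)[of y x] by auto }
next
  case (In x y) { case 1 then show ?case using code_sub(18)[of x y] by auto next case 2 then show ?case using code_sub(19)[of y x] by auto }
next
  case (Neg \<phi>) { case 1 then show ?case using Neg code_sub(1)[of \<phi>] by (auto simp del: code.simps) next case 2 then show ?case using Neg code_sub(1)[of \<phi>] by (auto simp del: code.simps) }
next
  case (Conj \<phi> \<psi>)
  note c = code_sub(2)[of \<phi> \<psi>] code_sub(3)[of \<psi> \<phi>]
  { case 1 then show ?case using Conj c by (auto simp del: code.simps) next case 2 then show ?case using Conj c by (auto simp del: code.simps) }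
next
  case (Disj \<phi> \<psi>)
  note c = code_sub(4)[of \<phi> \<psi>] code_sub(5)[of \<psi> \<phi>]
  { case 1 then show ?case using Disj c by (auto simp del: code.simps) next case 2 then show ?case using Disj c by (auto simp del: code.simps) }
next
  case (Impl \<phi> \<psi>)
  note c = code_sub(6)[of \<phi> \<psi>] code_sub(7)[of \<psi> \<phi>]
  { case 1 then show ?case using Impl c by (auto simp del: code.simps) next case 2 then show ?case using Impl c by (auto simp del: code.simps) }
next
  case (Ex1 x \<phi>)
  note c = code_sub(8)[of \<phi> x]
  { case 1 then show ?case using Ex1 c by (auto simp del: code.simps) next case 2 then show ?case using Ex1 c by (auto simp del: code.simps) }
next
  case (All1 x \<phi>)
  note c = code_sub(9)[of \<phi> x]
  { case 1 then show ?case using All1 c by (auto simp del: code.simps) next case 2 then show ?case using All1 c by (auto simp del: code.simps) }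
next
  case (Ex2 x \<phi>)
  note c = code_sub(10)[of \<phi> x]
  { case 1 then show ?case using Ex2 c by (auto simp del: code.simps) next case 2 then show ?case using Ex2 c by (auto simp del: code.simps) }
next
  case (All2 x \<phi>)
  note c = code_sub(11)[of \<phi> x]
  { case 1 then show ?case using All2 c by (auto simp del: code.simps) next case 2 then show ?case using All2 c by (auto simp del: code.simps) }
qed

text \<open>The variables of the formula are below \<open>M\<close>, being bounded by its code. The
  indices from \<open>M\<close> on are thus free to hold the singletons that stand for first-order
  variables, and the two kinds of quantifiers do not disturb each other.\<close>

lemma xsat_sat:
  assumes "code \<phi> < M" "\<And>X. X \<in> fv2 \<phi> \<Longrightarrow> w' X = w X" "\<And>t. t \<in> fv1 \<phi> \<Longrightarrow> w' (M + t) = {u t} \<and> 0 \<le> u t"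
  shows "xsat M w' \<phi> \<longleftrightarrow> sat u w \<phi>"
  using assms
proof (induction \<phi> arbitrary: w' w u)
  case (In X t) then show ?case by auto
next
  case (Neg \<phi>) then show ?case using code_sub(1)[of \<phi>] by (simp del: code.simps)
next
  case (Conj \<phi> \<psi>)
  then have "xsat M w' \<phi> = sat u w \<phi>" "xsat M w' \<psi> = sat u w \<psi>"
    using code_sub(2)[of \<phi> \<psi>] code_sub(3)[of \<psi> \<phi>] by (auto simp del: code.simps)
  then show ?case by simp
next
  case (Disj \<phi> \<psi>)
  then have "xsat M w' \<phi> = sat u w \<phi>" "xsat M w' \<psi> = sat u w \<psi>"
    using code_sub(4)[of \<phi> \<psi>] code_sub(5)[of \<psi> \<phi>] by (auto simp del: code.simps)
  then show ?case by simp
next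
  case (Impl \<phi> \<psi>)
  then have "xsat M w' \<phi> = sat u w \<phi>" "xsat M w' \<psi> = sat u w \<psi>"
    using code_sub(6)[of \<phi> \<psi>] code_sub(7)[of \<psi> \<phi>] by (auto simp del: code.simps)
  then show ?case by simp
next
  case (Ex1 t \<phi>)
  have c: "code \<phi> < M" using Ex1.prems(1) code_sub(8)[of \<phi> t] by (simp del: code.simps)
  have fv2: "X < M" if "X \<in> fv2 \<phi>" for X using fv_le_code(1)[OF that] c by linarith
  have IH: "xsat M (w'(M + t := {r})) \<phi> = sat (u(t := r)) w \<phi>" if "0 \<le> r" for r
    using that Ex1.prems(2,3) fv2 by (intro Ex1.IH[OF c]) fastforce+
  have "xsat M w' (Ex1 t \<phi>) \<longleftrightarrow> (\<exists>A\<in>bool_signals. sing (w'(M + t := A)) (M + t) \<and> xsat M (w'(M + t := A)) \<phi>)"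
    using ex_signals_2[of "\<lambda>w. sing w (M + t) \<and> xsat M w \<phi>" "M + t" w'] by simp
  also have "\<dots> \<longleftrightarrow> (\<exists>r\<ge>0. xsat M (w'(M + t := {r})) \<phi>)"
    using singleton_bool_signal by (auto simp: sing_upd)
  finally show ?case using IH by auto
next
  case (All1 t \<phi>)
  have c: "code \<phi> < M" using All1.prems(1) code_sub(9)[of \<phi> t] by (simp del: code.simps)
  have fv2: "X < M" if "X \<in> fv2 \<phi>" for X using fv_le_code(1)[OF that] c by linarith
  have IH: "xsat M (w'(M + t := {r})) \<phi> = sat (u(t := r)) w \<phi>" if "0 \<le> r" for r
    using that All1.prems(2,3) fv2 by (intro All1.IH[OF c]) fastforce+
  have "xsat M w' (All1 t \<phi>) \<longleftrightarrow> \<not> (\<exists>A\<in>bool_signals. sing (w'(M + t := A)) (M + t) \<and> \<not> xsat M (w'(M + t := A)) \<phi>)"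
    using ex_signals_2[of "\<lambda>w. sing w (M + t) \<and> \<not> xsat M w \<phi>" "M + t" w'] by simp
  also have "\<dots> \<longleftrightarrow> (\<forall>r\<ge>0. xsat M (w'(M + t := {r})) \<phi>)"
    using singleton_bool_signal by (auto simp: sing_upd)
  finally show ?case using IH by auto
next
  case (Ex2 X \<phi>)
  have c: "code \<phi> < M" "X < M" using Ex2.prems(1) code_sub(10)[of \<phi> X] code_sub(14)[of X \<phi>] by (auto simp del: code.simps)
  have IH: "xsat M (w'(X := A)) \<phi> = sat u (w(X := A)) \<phi>" for A
    using Ex2.prems(2,3) c(2) by (intro Ex2.IH[OF c(1)]) fastforce+
  show ?case using ex_signals_2[of "\<lambda>w. xsat M w \<phi>" X w'] by (simp add: IH)
next
  case (All2 X \<phi>)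
  have c: "code \<phi> < M" "X < M" using All2.prems(1) code_sub(11)[of \<phi> X] code_sub(15)[of X \<phi>] by (auto simp del: code.simps)
  have IH: "xsat M (w'(X := A)) \<phi> = sat u (w(X := A)) \<phi>" for A
    using All2.prems(2,3) c(2) by (intro All2.IH[OF c(1)]) fastforce+
  show ?case using ex_signals_2[of "\<lambda>w. \<not> xsat M w \<phi>" X w'] by (simp add: IH)
qed auto

definition dalg :: "nat \<Rightarrow> alg" where
  "dalg n = (let (a, n) = prod_decode n; (b, n) = prod_decode n; (c, n) = prod_decode n;
     (d, n) = prod_decode n; (e, f) = prod_decode n in (a, b, c, d, e, f))"

lemma dalg_ce [simp]: "dalg (ce A) = A"
  by (cases A) (auto simp: dalg_def ce_prod_def ce_nat_def)

lemma cmpf_dalg: "cmpf f \<Longrightarrow> cmpf (\<lambda>z. dalg (f z))"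
  unfolding dalg_def Let_def case_prod_beta by (intro cmpf_intros)

lemma cmpf_ce: "cmpf f \<Longrightarrow> cmpf (\<lambda>z. ce (f z))"
  by (simp add: cmpf_def ce_nat_def)

text \<open>\<open>2 * M\<close> set variables are tracked, the upper half for the first-order ones.
  \<open>T\<close> is the array of the results for smaller numbers. A number that codes no formula
  also receives some result, about which nothing is claimed.\<close>

definition stepA :: "nat \<Rightarrow> nat \<Rightarrow> nat \<Rightarrow> nat" where
  "stepA M n T = (let L = 2 * M; k = fst (prod_decode n); r = snd (prod_decode n);
       i = fst (prod_decode r); j = snd (prod_decode r); A = dalg (lk T i); B = dalg (lk T j) in
     ce (if k = 0 then A_lt L (M + i) (M + j)
       else if k = 1 then A_in L i (M + j)
       else if k = 2 then A_neg L (dalg (lk T r))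
       else if k = 3 then A_cj L A B
       else if k = 4 then A_neg L (A_cj L (A_neg L A) (A_neg L B))
       else if k = 5 then A_neg L (A_cj L A (A_neg L B))
       else if k = 6 then A_ex L (M + i) 2 (A_cj L (A_sg L (M + i)) B)
       else if k = 7 then A_neg L (A_ex L (M + i) 2 (A_cj L (A_sg L (M + i)) (A_neg L B)))
       else if k = 8 then A_ex L i 2 B
       else A_neg L (A_ex L i 2 (A_neg L B))))"

definition alg_of :: "nat \<Rightarrow> nat \<Rightarrow> alg" where
  "alg_of M n = dalg (cov (stepA M) n)"

lemma cmpf_alg_of: "cmpf (M :: 'a::cenc \<Rightarrow> nat) \<Longrightarrow> cmpf n \<Longrightarrow> cmpf (\<lambda>z. alg_of (M z) (n z))"
proof -
  assume a: "cmpf M" "cmpf n"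
  have "cmpf (\<lambda>x. stepA (snd (snd x)) (fst x) (fst (snd x)))"
    unfolding stepA_def Let_def by (intro cmpf_ce cmpf_dalg cmpf_algs cmpf_intros)
  moreover have "cmpf (\<lambda>x :: nat \<times> nat \<times> 'a. (fst x, fst (snd x), M (snd (snd x))))"
    by (intro cmpf_pair cmpf_fst cmpf_snd cmpf_id cmpf_comp[OF a(1)])
  ultimately have "cmpf (\<lambda>x. stepA (M (snd (snd x))) (fst x) (fst (snd x)))"
    using cmpf_comp[of "\<lambda>x. stepA (snd (snd x)) (fst x) (fst (snd x))"] by fastforce
  from cmpf_cov[where s = "\<lambda>k T z. stepA (M z) k T", OF a(2) this] show ?thesis
    unfolding alg_of_def by (intro cmpf_dalg)
qed

lemma alg_of_unfold: "alg_of M n = dalg (stepA M n (tab n (cov (stepA M))))"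
  unfolding alg_of_def by (subst cov_unfold) simp

lemma dalg_lk: "k < n \<Longrightarrow> dalg (lk (tab n (cov (stepA M))) k) = alg_of M k"
  by (simp add: lk_tab alg_of_def)

lemma alg_of_code:
  "alg_of M (code (Less t v)) = A_lt (2 * M) (M + t) (M + v)"
  "alg_of M (code (In X t)) = A_in (2 * M) X (M + t)"
  "alg_of M (code (Neg \<phi>)) = A_neg (2 * M) (alg_of M (code \<phi>))"
  "alg_of M (code (Conj \<phi> \<psi>)) = A_cj (2 * M) (alg_of M (code \<phi>)) (alg_of M (code \<psi>))"
  "alg_of M (code (Disj \<phi> \<psi>)) = A_neg (2 * M) (A_cj (2 * M) (A_neg (2 * M) (alg_of M (code \<phi>))) (A_neg (2 * M) (alg_of M (code \<psi>))))"
  "alg_of M (code (Impl \<phi> \<psi>)) = A_neg (2 * M) (A_cj (2 * M) (alg_of M (code \<phi>)) (A_neg (2 * M) (alg_of M (code \<psi>))))"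
  "alg_of M (code (Ex1 t \<phi>)) = A_ex (2 * M) (M + t) 2 (A_cj (2 * M) (A_sg (2 * M) (M + t)) (alg_of M (code \<phi>)))"
  "alg_of M (code (All1 t \<phi>)) = A_neg (2 * M) (A_ex (2 * M) (M + t) 2 (A_cj (2 * M) (A_sg (2 * M) (M + t)) (A_neg (2 * M) (alg_of M (code \<phi>)))))"
  "alg_of M (code (Ex2 X \<phi>)) = A_ex (2 * M) X 2 (alg_of M (code \<phi>))"
  "alg_of M (code (All2 X \<phi>)) = A_neg (2 * M) (A_ex (2 * M) X 2 (A_neg (2 * M) (alg_of M (code \<phi>))))"
  by (subst alg_of_unfold, simp add: stepA_def Let_def dalg_lk prod_encode_gr prod_encode_gr2)+

lemma recog_alg_of: "code \<phi> < M \<Longrightarrow> recog (2 * M) (alg_of M (code \<phi>)) (\<lambda>w. xsat M w \<phi>)"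
proof (induction \<phi>)
  case (Less t v)
  then have "t < M" "v < M" using code_sub(16)[of t v] code_sub(17)[of v t] by auto
  then show ?case unfolding alg_of_code xsat.simps by (intro recog_lt) auto
next
  case (In X t)
  then have "X < M" "t < M" using code_sub(18)[of X t] code_sub(19)[of t X] by auto
  then show ?case unfolding alg_of_code xsat.simps by (intro recog_in) auto
next
  case (Neg \<phi>)
  have "code \<phi> < M" using Neg.prems code_sub(1)[of \<phi>] by linarith
  then show ?case unfolding alg_of_code xsat.simps by (intro recog_neg Neg.IH)
next
  case (Conj \<phi> \<psi>)
  have "code \<phi> < M" "code \<psi> < M" using Conj.prems code_sub(2)[of \<phi> \<psi>] code_sub(3)[of \<psi> \<phi>] by linarith+
  then show ?case unfolding alg_of_code xsat.simps by (intro recog_cj Conj.IH)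
next
  case (Disj \<phi> \<psi>)
  have "code \<phi> < M" "code \<psi> < M" using Disj.prems code_sub(4)[of \<phi> \<psi>] code_sub(5)[of \<psi> \<phi>] by linarith+
  then show ?case unfolding alg_of_code xsat.simps by (intro recog_cj recog_neg Disj.IH)
next
  case (Impl \<phi> \<psi>)
  have "code \<phi> < M" "code \<psi> < M" using Impl.prems code_sub(6)[of \<phi> \<psi>] code_sub(7)[of \<psi> \<phi>] by linarith+
  then show ?case unfolding alg_of_code xsat.simps by (intro recog_cj recog_neg Impl.IH)
next
  case (Ex1 t \<phi>)
  have c: "code \<phi> < M" "M + t < 2 * M" using Ex1.prems code_sub(8)[of \<phi> t] code_sub(12)[of t \<phi>] by linarith+
  have "recog (2 * M) (A_cj (2 * M) (A_sg (2 * M) (M + t)) (alg_of M (code \<phi>))) (\<lambda>w. sing w (M + t) \<and> xsat M w \<phi>)"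
    unfolding sing_def by (intro recog_cj recog_sg c Ex1.IH)
  from recog_ex[OF this, of "M + t" 2] show ?case unfolding alg_of_code xsat.simps by simp
next
  case (All1 t \<phi>)
  have c: "code \<phi> < M" "M + t < 2 * M" using All1.prems code_sub(9)[of \<phi> t] code_sub(13)[of t \<phi>] by linarith+
  have "recog (2 * M) (A_cj (2 * M) (A_sg (2 * M) (M + t)) (A_neg (2 * M) (alg_of M (code \<phi>)))) (\<lambda>w. sing w (M + t) \<and> \<not> xsat M w \<phi>)"
    unfolding sing_def by (intro recog_cj recog_sg c recog_neg All1.IH)
  from recog_neg[OF recog_ex[OF this, of "M + t" 2]] show ?case unfolding alg_of_code xsat.simps by simp
next
  case (Ex2 X \<phi>)
  have c: "code \<phi> < M" using Ex2.prems code_sub(10)[of \<phi> X] by linarith+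
  from recog_ex[OF Ex2.IH[OF c], of X 2] show ?case unfolding alg_of_code xsat.simps by simp
next
  case (All2 X \<phi>)
  have c: "code \<phi> < M" using All2.prems code_sub(11)[of \<phi> X] by linarith+
  from recog_neg[OF recog_ex[OF recog_neg[OF All2.IH[OF c]], of X 2]] show ?case unfolding alg_of_code xsat.simps by simp
qed


subsection \<open>Recognising codes of formulas\<close>

text \<open>The result is 0 for numbers that code no formula, and otherwise the successor of the
  pair of the sets of free first-order and second-order variables. The successor separates a closed
  formula, whose pair has code 0, from failure.\<close>

definition stepF :: "nat \<Rightarrow> nat \<Rightarrow> nat" where
  "stepF n T = (let k = fst (prod_decode n); r = snd (prod_decode n);
       i = fst (prod_decode r); j = snd (prod_decode r); a = prod_decode (lk T i - 1); b = prod_decode (lk T j - 1) in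
     if k = 0 then Suc (prod_encode (bset (Suc n) (\<lambda>x. x = i \<or> x = j), 0))
     else if k = 1 then Suc (prod_encode (bset (Suc n) (\<lambda>x. x = j), bset (Suc n) (\<lambda>x. x = i)))
     else if k = 2 then lk T r
     else if k = 3 \<or> k = 4 \<or> k = 5 then
       (if lk T i = 0 \<or> lk T j = 0 then 0 else
         Suc (prod_encode (bset (Suc n) (\<lambda>x. bit (fst a) x \<or> bit (fst b) x), bset (Suc n) (\<lambda>x. bit (snd a) x \<or> bit (snd b) x))))
     else if lk T j = 0 then 0
     else if k = 6 \<or> k = 7 then Suc (prod_encode (bset (Suc n) (\<lambda>x. bit (fst b) x \<and> x \<noteq> i), snd b))
     else if k = 8 \<or> k = 9 then Suc (prod_encode (fst b, bset (Suc n) (\<lambda>x. bit (snd b) x \<and> x \<noteq> i)))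
     else 0)"

definition fvc :: "nat \<Rightarrow> nat" where "fvc = cov stepF"

lemma cmpf_fvc: "cmpf n \<Longrightarrow> cmpf (\<lambda>z. fvc (n z))"
proof -
  assume a: "cmpf n"
  have "cmpf (\<lambda>x :: nat \<times> nat \<times> 'a. stepF (fst x) (fst (snd x)))"
    unfolding stepF_def Let_def by (intro cmpf_intros)
  from cmpf_cov[OF a this] show ?thesis by (simp add: fvc_def)
qed

lemma fvc_unfold: "fvc n = stepF n (tab n fvc)"
  unfolding fvc_def by (subst cov_unfold) simp

lemma fvc_code: "\<exists>a b. fvc (code \<phi>) = Suc (prod_encode (a, b)) \<and> (\<forall>x. bit a x \<longleftrightarrow> x \<in> fv1 \<phi>) \<and> (\<forall>x. bit b x \<longleftrightarrow> x \<in> fv2 \<phi>)"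
proof -
  have le: "x < Suc (code \<phi>)" if "x \<in> fv1 \<phi> \<or> x \<in> fv2 \<phi>" for x \<phi> using that fv_le_code by (auto simp: less_Suc_eq_le)
  show ?thesis
  proof (induction \<phi>)
    case (Less t v)
    show ?case using le[of _ "Less t v"] by (subst fvc_unfold) (auto simp: stepF_def Let_def bit_bset)
  next
    case (In X t)
    show ?case using le[of _ "In X t"] by (subst fvc_unfold) (auto simp: stepF_def Let_def bit_bset)
  next
    case (Neg \<phi>) then show ?case by (subst fvc_unfold) (auto simp: stepF_def Let_def lk_tab prod_encode_gr)
  next
    case (Conj \<phi> \<psi>) then show ?case using le[of _ "Conj \<phi> \<psi>"]
      by (subst fvc_unfold) (auto simp: stepF_def Let_def lk_tab prod_encode_gr2 bit_bset)
  next
    case (Disj \<phi> \<psi>) then show ?case using le[of _ "Disj \<phi> \<psi>"]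
      by (subst fvc_unfold) (auto simp: stepF_def Let_def lk_tab prod_encode_gr2 bit_bset)
  next
    case (Impl \<phi> \<psi>) then show ?case using le[of _ "Impl \<phi> \<psi>"]
      by (subst fvc_unfold) (auto simp: stepF_def Let_def lk_tab prod_encode_gr2 bit_bset)
  next
    case (Ex1 t \<phi>) then show ?case using le[of _ "Ex1 t \<phi>"]
      by (subst fvc_unfold) (auto simp: stepF_def Let_def lk_tab prod_encode_gr2 bit_bset)
  next
    case (All1 t \<phi>) then show ?case using le[of _ "All1 t \<phi>"]
      by (subst fvc_unfold) (auto simp: stepF_def Let_def lk_tab prod_encode_gr2 bit_bset)
  next
    case (Ex2 t \<phi>) then show ?case using le[of _ "Ex2 t \<phi>"]
      by (subst fvc_unfold) (auto simp: stepF_def Let_def lk_tab prod_encode_gr2 bit_bset)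
  next
    case (All2 t \<phi>) then show ?case using le[of _ "All2 t \<phi>"]
      by (subst fvc_unfold) (auto simp: stepF_def Let_def lk_tab prod_encode_gr2 bit_bset)
  qed
qed

lemma fvc_pos: "fvc n \<noteq> 0 \<Longrightarrow> \<exists>\<phi>. n = code \<phi>"
proof (induction n rule: less_induct)
  case (less n)
  obtain k i j where n: "n = prod_encode (k, prod_encode (i, j))"
    by (metis prod_decode_inverse surj_pair)
  have pos: "stepF n (tab n fvc) \<noteq> 0" using less.prems by (subst (asm) fvc_unfold)
  have IH: "\<exists>\<phi>. m = code \<phi>" if "lk (tab n fvc) m \<noteq> 0" "m < n" for m
    using less.IH[OF that(2)] that by (simp add: lk_tab)
  have lt: "i < n" "j < n" "prod_encode (i, j) < n" if "0 < k"
    using that unfolding n by (auto simp: prod_encode_gr prod_encode_gr2)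
  consider "k = 0" | "k = 1" | "k = 2" | "k \<in> {3,4,5}" | "k \<in> {6,7,8,9}" | "k > 9" by force
  then show ?case
  proof cases
    case 1 then show ?thesis unfolding n by (intro exI[of _ "Less i j"]) simp
  next
    case 2 then show ?thesis unfolding n by (intro exI[of _ "In i j"]) simp
  next
    case 3
    then have "lk (tab n fvc) (prod_encode (i, j)) \<noteq> 0" using pos by (simp add: stepF_def Let_def n)
    then obtain \<phi> where "prod_encode (i, j) = code \<phi>" using IH lt 3 by force
    then show ?thesis unfolding n 3 by (intro exI[of _ "Neg \<phi>"]) simp
  next
    case 4
    then have "lk (tab n fvc) i \<noteq> 0" "lk (tab n fvc) j \<noteq> 0"
      using pos by (auto simp: stepF_def Let_def n split: if_splits)
    then obtain \<phi> \<psi> where "i = code \<phi>" "j = code \<psi>" using IH lt 4 by force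
    then have "n = code (Conj \<phi> \<psi>) \<or> n = code (Disj \<phi> \<psi>) \<or> n = code (Impl \<phi> \<psi>)"
      using 4 unfolding n by auto
    then show ?thesis by blast
  next
    case 5
    then have "lk (tab n fvc) j \<noteq> 0"
      using pos by (auto simp: stepF_def Let_def n split: if_splits)
    then obtain \<psi> where "j = code \<psi>" using IH lt 5 by force
    then have "n = code (Ex1 i \<psi>) \<or> n = code (All1 i \<psi>) \<or> n = code (Ex2 i \<psi>) \<or> n = code (All2 i \<psi>)"
      using 5 unfolding n by auto
    then show ?thesis by blast
  next
    case 6 then show ?thesis using pos by (simp add: stepF_def Let_def n split: if_splits)
  qed
qed

text \<open>A bit position of a number is smaller than the number, so the bound on \<open>k\<close>
  covers every free second-order variable and makes the test decidable.\<close>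

definition is_form :: "nat \<Rightarrow> nat \<Rightarrow> nat \<Rightarrow> bool" where
  "is_form p q n \<longleftrightarrow> fvc n \<noteq> 0 \<and> fst (prod_decode (fvc n - 1)) = 0 \<and>
     (\<forall>k<snd (prod_decode (fvc n - 1)). bit (snd (prod_decode (fvc n - 1))) k \<longrightarrow> k < ceillog2 p + ceillog2 q)"

lemma cmpf_is_form: "cmpf p \<Longrightarrow> cmpf q \<Longrightarrow> cmpf n \<Longrightarrow> cmpf (\<lambda>z. is_form (p z) (q z) (n z))"
proof -
  assume a: "cmpf p" "cmpf q" "cmpf n"
  have "cmpf (\<lambda>x. is_form (fst x) (fst (snd x)) (snd (snd x)))"
    unfolding is_form_def by (intro cmpf_fvc cmpf_ceillog2 cmpf_intros)
  from cmpf_comp[OF this, of "\<lambda>z. (p z, q z, n z)"] a show ?thesis by (simp add: cmpf_intros)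
qed

lemma is_form_iff: "is_form p q n \<longleftrightarrow> (\<exists>U\<in>formulas p q. code U = n)"
proof -
  have "is_form p q (code U) \<longleftrightarrow> U \<in> formulas p q" for U
  proof -
    obtain a b where ab: "fvc (code U) = Suc (prod_encode (a, b))" "\<And>x. bit a x \<longleftrightarrow> x \<in> fv1 U" "\<And>x. bit b x \<longleftrightarrow> x \<in> fv2 U"
      using fvc_code by blast
    have "a = 0 \<longleftrightarrow> fv1 U = {}" using ab(2) bit_eq_iff[of a 0] by auto
    then show ?thesis using ab bit_imp_less[of b] by (auto simp: is_form_def formulas_def)
  qed
  moreover have "is_form p q n \<Longrightarrow> \<exists>\<phi>. n = code \<phi>" using fvc_pos by (auto simp: is_form_def)
  ultimately show ?thesis by blast
qed

section \<open>The sentence expressing that a formula defines an implementation\<close>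

text \<open>Recognises disagreement and is used negated: some time, held in variable
  \<open>M + 1\<close> and not after the time in variable \<open>M\<close>, at which the signals
  coded from 0 and from \<open>c + d\<close> on differ.\<close>

definition agrA :: "nat \<Rightarrow> nat \<Rightarrow> nat \<Rightarrow> alg" where
  "agrA M c d = A_ex (2 * M) (M + 1) 2 (A_cj (2 * M) (A_sg (2 * M) (M + 1))
     (A_cj (2 * M) (A_df (2 * M) 0 (c + d) c (M + 1)) (A_neg (2 * M) (A_lt (2 * M) M (M + 1)))))"

definition implA :: "nat \<Rightarrow> nat \<Rightarrow> nat \<Rightarrow> nat \<Rightarrow> nat \<Rightarrow> alg" where
  "implA M p q \<psi> u = A_neg (2 * M) (A_ex (2 * M) 0 p (A_neg (2 * M) (A_ex (2 * M) (ceillog2 p) q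
     (A_cj (2 * M) (alg_of M u) (alg_of M \<psi>)))))"

text \<open>Expresses \<open>causal_rel\<close>. Layout: \<open>X\<close> from 0, \<open>Y\<close>
  from \<open>ceillog2 p\<close>, the reference input \<open>X1\<close> from
  \<open>ceillog2 p + ceillog2 q\<close>, the reference output \<open>Z\<close> right after it, the
  time \<open>r\<close> in variable \<open>M\<close>. \<open>X\<close> and \<open>Y\<close> are
  where the formula expects them, so \<open>alg_of M u\<close> is used unchanged.\<close>

definition causA :: "nat \<Rightarrow> nat \<Rightarrow> nat \<Rightarrow> nat \<Rightarrow> alg" where
  "causA M p q u = A_neg (2 * M) (A_ex (2 * M) (ceillog2 p + ceillog2 q) p (A_ex (2 * M) M 2 (A_cj (2 * M) (A_sg (2 * M) M)
     (A_neg (2 * M) (A_ex (2 * M) (ceillog2 p + ceillog2 q + ceillog2 p) q (A_neg (2 * M)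
       (A_ex (2 * M) 0 p (A_ex (2 * M) (ceillog2 p) q (A_cj (2 * M) (A_neg (2 * M) (agrA M (ceillog2 p) (ceillog2 q)))
         (A_cj (2 * M) (alg_of M u) (A_df (2 * M) (ceillog2 p) (ceillog2 p + ceillog2 q + ceillog2 p) (ceillog2 q) M)))))))))))"

text \<open>\<open>M\<close> exceeds both formula codes and, since
  \<open>ceillog2 n \<le> n\<close>, also the number of variables needed for two inputs and two
  outputs.\<close>

definition chi_true :: "nat \<Rightarrow> nat \<Rightarrow> nat \<Rightarrow> nat \<Rightarrow> bool" where
  "chi_true p q \<psi> u \<longleftrightarrow> (let M = 2 * (p + q) + \<psi> + u + 2 in truth (implA M p q \<psi> u) \<and> truth (causA M p q u))"

lemma cmpf_chi_true: "cmpf p \<Longrightarrow> cmpf q \<Longrightarrow> cmpf \<psi> \<Longrightarrow> cmpf u \<Longrightarrow> cmpf (\<lambda>z. chi_true (p z) (q z) (\<psi> z) (u z))"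
proof -
  assume a: "cmpf p" "cmpf q" "cmpf \<psi>" "cmpf u"
  have "cmpf (\<lambda>x. chi_true (fst x) (fst (snd x)) (fst (snd (snd x))) (snd (snd (snd x))))"
    unfolding chi_true_def Let_def implA_def causA_def agrA_def
    by (intro cmpf_algs cmpf_alg_of cmpf_ceillog2 cmpf_intros)
  from cmpf_comp[OF this, of "\<lambda>z. (p z, q z, \<psi> z, u z)"] a show ?thesis by (simp add: cmpf_intros)
qed

lemma ceillog2_le: "ceillog2 n \<le> n"
  using ceillog2_le_iff[of n n] less_exp[of n] by (cases "n = 0") (auto intro: less_imp_le)

lemma xsat_FVsig:
  assumes "U \<in> formulas p q" "code U < M" "\<And>i. i < ceillog2 p \<Longrightarrow> w i = component X i"
    "\<And>i. i < ceillog2 q \<Longrightarrow> w (ceillog2 p + i) = component Y i"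
  shows "xsat M w U \<longleftrightarrow> FVsig_sat p U X Y"
  unfolding FVsig_sat_def
proof (rule xsat_sat)
  fix i assume "i \<in> fv2 U"
  then have "i < ceillog2 p + ceillog2 q" using assms(1) by (auto simp: formulas_def)
  then show "w i = (if i < ceillog2 p then component X i else component Y (i - ceillog2 p))"
    using assms(3)[of i] assms(4)[of "i - ceillog2 p"] by auto
qed (use assms in \<open>auto simp: formulas_def\<close>)

lemma bits_differ: "x < p \<Longrightarrow> y < p \<Longrightarrow> (\<exists>k<ceillog2 p. bit x k \<noteq> bit y k) \<longleftrightarrow> x \<noteq> y"
proof -
  assume "x < p" "y < p"
  then have "x < 2 ^ ceillog2 p" "y < 2 ^ ceillog2 p" using le_two_power_ceillog2[of p] by auto
  then show ?thesis using bit_less_exp bit_eq_iff[of x y] by blast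
qed

lemma ex_sing: "(\<exists>Z\<in>signals 2. sing (wup i 1 w Z) i \<and> H (wup i 1 w Z)) \<longleftrightarrow> (\<exists>r\<ge>0. H (w(i := {r})))"
  unfolding ex_signals_2[of "\<lambda>w. sing w i \<and> H w"] using singleton_bool_signal
  by (metis sing_upd)

text \<open>All outputs related to inputs that agree with \<open>X1\<close> up to \<open>r\<close>
  share one value at \<open>r\<close>, and \<open>Z\<close> serves to name it. The clause contains
  both functionality and causality, and it mentions \<open>U\<close> only once, so no copy of
  \<open>U\<close> with renamed variables is called for.\<close>

definition causal_rel :: "nat \<Rightarrow> nat \<Rightarrow> mso \<Rightarrow> bool" where
  "causal_rel p q U \<longleftrightarrow> (\<forall>X1\<in>signals p. \<forall>r\<ge>0. \<exists>Z\<in>signals q. \<forall>X\<in>signals p. \<forall>Y\<in>signals q.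
     (\<forall>x\<in>{0..r}. X x = X1 x) \<longrightarrow> FVsig_sat p U X Y \<longrightarrow> Y r = Z r)"

lemma truth_implA:
  assumes "U \<in> formulas p q" "\<Psi> \<in> formulas p q" "code U < M" "code \<Psi> < M"
  shows "truth (implA M p q (code \<Psi>) (code U)) \<longleftrightarrow>
    (\<forall>X\<in>signals p. \<exists>Y\<in>signals q. FVsig_sat p U X Y \<and> FVsig_sat p \<Psi> X Y)"
proof -
  let ?c = "ceillog2 p" and ?d = "ceillog2 q"
  note R = recog_neg[OF recog_ex[OF recog_neg[OF recog_ex[OF recog_cj[OF recog_alg_of[OF assms(3)] recog_alg_of[OF assms(4)]],
    of ?c q]], of 0 p]]
  have "xsat M (wup ?c ?d (wup 0 ?c (\<lambda>_. {}) X) Y) V \<longleftrightarrow> FVsig_sat p V X Y"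
    if "V \<in> formulas p q" "code V < M" for X Y V
    by (rule xsat_FVsig[OF that]) (auto simp: wup_def)
  then show ?thesis unfolding implA_def recog_truth[OF R, symmetric] using assms by simp
qed

lemma truth_causA:
  assumes U: "U \<in> formulas p q" "code U < M" and M: "2 * (ceillog2 p + ceillog2 q) + 1 < M"
  shows "truth (causA M p q (code U)) \<longleftrightarrow> causal_rel p q U"
proof -
  let ?c = "ceillog2 p" and ?d = "ceillog2 q"
  define Q where "Q w \<longleftrightarrow> (\<exists>t\<ge>0. t \<in> w (M + 1) \<and> (\<exists>k<?c. t \<in> w (0 + k) \<longleftrightarrow> t \<notin> w (?c + ?d + k))) \<and>
       \<not> (\<exists>x y. 0 \<le> x \<and> x < y \<and> x \<in> w M \<and> y \<in> w (M + 1))" for w :: "nat \<Rightarrow> real set"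
  have "recog (2 * M) (A_cj (2 * M) (A_sg (2 * M) (M + 1))
     (A_cj (2 * M) (A_df (2 * M) 0 (?c + ?d) ?c (M + 1)) (A_neg (2 * M) (A_lt (2 * M) M (M + 1))))) (\<lambda>w. sing w (M + 1) \<and> Q w)"
    unfolding sing_def Q_def by (intro recog_cj recog_sg recog_df recog_neg recog_lt) (use M in auto)
  from recog_ex[OF this, of "M + 1" 2]
  have AG: "recog (2 * M) (agrA M ?c ?d) (\<lambda>w. \<exists>r\<ge>0. Q (w(M + 1 := {r})))"
    unfolding agrA_def by (simp only: ceillog2_2 ex_sing)
  define ag where "ag w \<longleftrightarrow> (\<exists>t\<ge>0. (\<exists>k<?c. t \<in> w k \<longleftrightarrow> t \<notin> w (?c + ?d + k)) \<and> \<not> (\<exists>x\<ge>0. x < t \<and> x \<in> w M))" for w :: "nat \<Rightarrow> real set"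
  have agr: "recog (2 * M) (agrA M ?c ?d) ag"
  proof (rule recog_weaken[OF AG])
    fix w
    have "Q (w(M + 1 := {r})) \<longleftrightarrow> (\<exists>k<?c. r \<in> w k \<longleftrightarrow> r \<notin> w (?c + ?d + k)) \<and> \<not> (\<exists>x\<ge>0. x < r \<and> x \<in> w M)" if "0 \<le> r" for r
      unfolding Q_def using that M by (auto cong: conj_cong)
    then show "(\<exists>r\<ge>0. Q (w(M + 1 := {r}))) \<longleftrightarrow> ag w" unfolding ag_def by blast
  qed
  have df: "recog (2 * M) (A_df (2 * M) ?c (?c + ?d + ?c) ?d M)
      (\<lambda>w. \<exists>t\<ge>0. t \<in> w M \<and> (\<exists>k<?d. t \<in> w (?c + k) \<longleftrightarrow> t \<notin> w (?c + ?d + ?c + k)))"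
    by (rule recog_df) (use M in auto)
  define G where "G w \<longleftrightarrow> \<not> ag w \<and> xsat M w U \<and>
     (\<exists>t\<ge>0. t \<in> w M \<and> (\<exists>k<?d. t \<in> w (?c + k) \<longleftrightarrow> t \<notin> w (?c + ?d + ?c + k)))" for w
  have G: "recog (2 * M) (A_cj (2 * M) (A_neg (2 * M) (agrA M ?c ?d)) (A_cj (2 * M) (alg_of M (code U))
       (A_df (2 * M) ?c (?c + ?d + ?c) ?d M))) G"
    unfolding G_def by (intro recog_cj recog_neg agr recog_alg_of df U)
  have sg: "recog (2 * M) (A_sg (2 * M) M) (\<lambda>w. sing w M)" unfolding sing_def by (rule recog_sg) (use M in simp)
  define H where "H w \<longleftrightarrow> \<not> (\<exists>Z\<in>signals q. \<not> (\<exists>X\<in>signals p. \<exists>Y\<in>signals q. G (wup ?c ?d (wup 0 ?c (wup (?c + ?d + ?c) ?d w Z) X) Y)))" for w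
  from recog_neg[OF recog_ex[OF recog_neg[OF
    recog_ex[OF recog_ex[OF G, of ?c q], of 0 p]], of "?c + ?d + ?c" q]]
  have "recog (2 * M) (A_neg (2 * M) (A_ex (2 * M) (?c + ?d + ?c) q (A_neg (2 * M) (A_ex (2 * M) 0 p (A_ex (2 * M) ?c q
     (A_cj (2 * M) (A_neg (2 * M) (agrA M ?c ?d)) (A_cj (2 * M) (alg_of M (code U))
       (A_df (2 * M) ?c (?c + ?d + ?c) ?d M)))))))) H" unfolding H_def .
  note R = recog_neg[OF recog_ex[OF recog_ex[OF recog_cj[OF sg this], of M 2], of "?c + ?d" p]]
  have env: "G (wup ?c ?d (wup 0 ?c (wup (?c + ?d + ?c) ?d ((wup (?c + ?d) ?c (\<lambda>_. {}) X1)(M := {r})) Z) X) Y)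
      \<longleftrightarrow> (\<forall>x\<in>{0..r}. X x = X1 x) \<and> FVsig_sat p U X Y \<and> Y r \<noteq> Z r"
    if s: "X1 \<in> signals p" "X \<in> signals p" "Y \<in> signals q" "Z \<in> signals q" and r: "0 \<le> r" for X1 X Y Z r
  proof -
    define w where "w = wup ?c ?d (wup 0 ?c (wup (?c + ?d + ?c) ?d ((wup (?c + ?d) ?c (\<lambda>_. {}) X1)(M := {r})) Z) X) Y"
    have w: "k < ?c \<Longrightarrow> w k = component X k" "k < ?d \<Longrightarrow> w (?c + k) = component Y k"
      "k < ?c \<Longrightarrow> w (?c + ?d + k) = component X1 k" "k < ?d \<Longrightarrow> w (?c + ?d + ?c + k) = component Z k" "w M = {r}" for k
      using M by (auto simp: w_def wup_def)
    have lp: "0 \<le> t \<Longrightarrow> X t < p" "0 \<le> t \<Longrightarrow> X1 t < p" "0 \<le> t \<Longrightarrow> Y t < q" "0 \<le> t \<Longrightarrow> Z t < q" for t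
      using s by (auto simp: signals_def PiE_iff)
    have "(\<exists>k<?c. t \<in> w k \<longleftrightarrow> t \<notin> w (?c + ?d + k)) \<longleftrightarrow> X t \<noteq> X1 t" if "0 \<le> t" for t
      using bits_differ[OF lp(1)[OF that] lp(2)[OF that]] that by (simp add: w component_def cong: conj_cong)
    then have "ag w \<longleftrightarrow> (\<exists>t\<ge>0. X t \<noteq> X1 t \<and> \<not> r < t)" unfolding ag_def using r by (auto simp: w(5))
    then have "\<not> ag w \<longleftrightarrow> (\<forall>x\<in>{0..r}. X x = X1 x)" by auto
    moreover have "(\<exists>k<?d. r \<in> w (?c + k) \<longleftrightarrow> r \<notin> w (?c + ?d + ?c + k)) \<longleftrightarrow> Y r \<noteq> Z r"
      using bits_differ[OF lp(3)[OF r] lp(4)[OF r]] r by (simp add: w component_def cong: conj_cong)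
    moreover have "xsat M w U \<longleftrightarrow> FVsig_sat p U X Y" by (rule xsat_FVsig[OF U]) (auto simp: w)
    ultimately show ?thesis unfolding w_def[symmetric] G_def using r w(5) by auto
  qed
  have "truth (causA M p q (code U)) \<longleftrightarrow> \<not> (\<exists>X1\<in>signals p. \<exists>r\<ge>0. H ((wup (?c + ?d) ?c (\<lambda>_. {}) X1)(M := {r})))"
    unfolding causA_def recog_truth[OF R, symmetric] by (simp only: ceillog2_2 ex_sing)
  also have "\<dots> \<longleftrightarrow> (\<forall>X1\<in>signals p. \<forall>r\<ge>0. \<not> H ((wup (?c + ?d) ?c (\<lambda>_. {}) X1)(M := {r})))" by blast
  also have "\<dots> \<longleftrightarrow> causal_rel p q U" unfolding causal_rel_def
  proof (intro ball_cong refl all_cong1 imp_cong)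
    fix X1 and r :: real assume s: "X1 \<in> signals p" "0 \<le> r"
    show "\<not> H ((wup (?c + ?d) ?c (\<lambda>_. {}) X1)(M := {r})) \<longleftrightarrow> (\<exists>Z\<in>signals q. \<forall>X\<in>signals p. \<forall>Y\<in>signals q.
       (\<forall>x\<in>{0..r}. X x = X1 x) \<longrightarrow> FVsig_sat p U X Y \<longrightarrow> Y r = Z r)"
      unfolding H_def not_not
    proof (intro bex_cong refl)
      fix Z assume Z: "Z \<in> signals q"
      show "\<not> (\<exists>X\<in>signals p. \<exists>Y\<in>signals q. G (wup ?c ?d (wup 0 ?c (wup (?c + ?d + ?c) ?d
          ((wup (?c + ?d) ?c (\<lambda>_. {}) X1)(M := {r})) Z) X) Y)) \<longleftrightarrow> (\<forall>X\<in>signals p. \<forall>Y\<in>signals q.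
       (\<forall>x\<in>{0..r}. X x = X1 x) \<longrightarrow> FVsig_sat p U X Y \<longrightarrow> Y r = Z r)"
        using env[OF s(1) _ _ Z s(2)] by blast
    qed
  qed
  finally show ?thesis .
qed

lemma causal_rel_operator:
  "causal_rel p q U \<and> (\<forall>X\<in>signals p. \<exists>Y\<in>signals q. FVsig_sat p U X Y \<and> FVsig_sat p \<Psi> X Y) \<and> U \<in> formulas p q \<longleftrightarrow>
    (\<exists>F. C_operator p q F \<and> defines_operator p q U F \<and> implements p F \<Psi>)"
proof
  assume A: "causal_rel p q U \<and> (\<forall>X\<in>signals p. \<exists>Y\<in>signals q. FVsig_sat p U X Y \<and> FVsig_sat p \<Psi> X Y) \<and> U \<in> formulas p q"
  then have "\<forall>X. \<exists>Y. X \<in> signals p \<longrightarrow> Y \<in> signals q \<and> FVsig_sat p U X Y \<and> FVsig_sat p \<Psi> X Y" by blast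
  then obtain F where F: "\<And>X. X \<in> signals p \<Longrightarrow> F X \<in> signals q" "\<And>X. X \<in> signals p \<Longrightarrow> FVsig_sat p U X (F X)"
    "\<And>X. X \<in> signals p \<Longrightarrow> FVsig_sat p \<Psi> X (F X)" by metis
  have eq: "Y t = Y' t" if xy: "X \<in> signals p" "X' \<in> signals p" "0 \<le> t" "\<forall>x\<in>{0..t}. X' x = X x" "Y \<in> signals q" "Y' \<in> signals q"
    "FVsig_sat p U X Y" "FVsig_sat p U X' Y'" for X X' Y Y' t
  proof -
    obtain Z where "\<And>X'' Y. X'' \<in> signals p \<Longrightarrow> Y \<in> signals q \<Longrightarrow> \<forall>x\<in>{0..t}. X'' x = X x \<Longrightarrow> FVsig_sat p U X'' Y \<Longrightarrow> Y t = Z t"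
      using A xy(1,3) unfolding causal_rel_def by blast
    from this[of X Y] this[of X' Y'] show ?thesis using xy by simp
  qed
  have "C_operator p q F" unfolding C_operator_def
  proof (intro conjI allI impI ballI)
    fix t :: real and X1 X2 assume "0 \<le> t" "X1 \<in> signals p" "X2 \<in> signals p" "\<forall>s\<in>{0..t}. X1 s = X2 s"
    then show "F X1 t = F X2 t" by (intro eq[of X1 X2]) (simp_all add: F)
  qed (use F(1) in auto)
  moreover have "defines_operator p q U F" unfolding defines_operator_def
  proof (intro conjI ballI iffI)
    fix X Y assume s: "X \<in> signals p" "Y \<in> signals q"
    show "Y = F X" if "FVsig_sat p U X Y"
    proof
      fix t show "Y t = F X t"
        using eq[OF s(1) s(1), of t Y "F X"] F s that
        by (cases "0 \<le> t") (auto simp: signals_def PiE_def extensional_def)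
    qed
    show "FVsig_sat p U X Y" if "Y = F X" using F s that by simp
  qed (use A in simp)
  ultimately show "\<exists>F. C_operator p q F \<and> defines_operator p q U F \<and> implements p F \<Psi>"
    using F by (auto simp: implements_def)
next
  assume "\<exists>F. C_operator p q F \<and> defines_operator p q U F \<and> implements p F \<Psi>"
  then obtain F where F: "C_operator p q F" "defines_operator p q U F" "implements p F \<Psi>" by blast
  have Fq: "F X \<in> signals q" if "X \<in> signals p" for X using F(1) that by (auto simp: C_operator_def)
  have U: "FVsig_sat p U X Y \<longleftrightarrow> Y = F X" if "X \<in> signals p" "Y \<in> signals q" for X Y
    using F(2) that by (auto simp: defines_operator_def)
  have "causal_rel p q U" unfolding causal_rel_def
  proof (intro ballI allI impI)
    fix X1 and r :: real assume X1: "X1 \<in> signals p" "0 \<le> r"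
    show "\<exists>Z\<in>signals q. \<forall>X\<in>signals p. \<forall>Y\<in>signals q. (\<forall>x\<in>{0..r}. X x = X1 x) \<longrightarrow> FVsig_sat p U X Y \<longrightarrow> Y r = Z r"
    proof (intro bexI[of _ "F X1"] ballI impI)
      fix X Y assume s: "X \<in> signals p" "Y \<in> signals q" "\<forall>x\<in>{0..r}. X x = X1 x" "FVsig_sat p U X Y"
      then have "F X r = F X1 r" using F(1) X1 unfolding C_operator_def by blast
      then show "Y r = F X1 r" using U s by simp
    qed (use Fq X1 in auto)
  qed
  moreover have "\<forall>X\<in>signals p. \<exists>Y\<in>signals q. FVsig_sat p U X Y \<and> FVsig_sat p \<Psi> X Y"
    using Fq U F(3) by (auto simp: implements_def)
  ultimately show "causal_rel p q U \<and> (\<forall>X\<in>signals p. \<exists>Y\<in>signals q. FVsig_sat p U X Y \<and> FVsig_sat p \<Psi> X Y) \<and> U \<in> formulas p q"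
    using F(2) by (auto simp: defines_operator_def)
qed

lemma chi_true_iff:
  assumes "U \<in> formulas p q" "\<Psi> \<in> formulas p q"
  shows "chi_true p q (code \<Psi>) (code U) \<longleftrightarrow> (\<exists>F. C_operator p q F \<and> defines_operator p q U F \<and> implements p F \<Psi>)"
proof -
  have "2 * (ceillog2 p + ceillog2 q) + 1 < 2 * (p + q) + code \<Psi> + code U + 2"
    using ceillog2_le[of p] ceillog2_le[of q] by simp
  then show ?thesis
    unfolding chi_true_def Let_def causal_rel_operator[symmetric]
    using truth_implA[OF assms, of "2 * (p + q) + code \<Psi> + code U + 2"] truth_causA[OF assms(1), of "2 * (p + q) + code \<Psi> + code U + 2"] assms
    by auto
qed

section \<open>Positional determinacy of finite parity games\<close>

text \<open>The greatest priority that occurs infinitely often has the parity of player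
  \<open>i\<close>, where \<open>True\<close> is the player who wants it to be even.\<close>

definition pgood :: "('v \<Rightarrow> nat) \<Rightarrow> bool \<Rightarrow> (nat \<Rightarrow> 'v) \<Rightarrow> bool" where
  "pgood pr i \<pi> \<longleftrightarrow> (\<exists>d. (even d \<longleftrightarrow> i) \<and> (\<forall>n. \<exists>m\<ge>n. pr (\<pi> m) = d) \<and> (\<exists>n. \<forall>m\<ge>n. pr (\<pi> m) \<le> d))"

lemma pgood_suffix: assumes "pgood pr i (\<lambda>n. \<pi> (n + k))" shows "pgood pr i \<pi>"
proof -
  from assms obtain d n0 where d0: "even d \<longleftrightarrow> i" "\<forall>n. \<exists>m\<ge>n. pr (\<pi> (m + k)) = d" "\<forall>m\<ge>n0. pr (\<pi> (m + k)) \<le> d"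
    unfolding pgood_def by (elim exE conjE) (rule that)
  note d = d0(1) d0(2)[rule_format] d0(3)[rule_format]
  have "\<exists>m\<ge>n. pr (\<pi> m) = d" for n
  proof -
    obtain m where "m \<ge> n" "pr (\<pi> (m + k)) = d" using d(2) by blast
    then show ?thesis by (intro exI[of _ "m + k"]) simp
  qed
  moreover have "pr (\<pi> m) \<le> d" if "m \<ge> n0 + k" for m using d(3)[of "m - k"] that by simp
  ultimately show ?thesis unfolding pgood_def using d(1) by blast
qed

locale parity_game =
  fixes E :: "'v \<Rightarrow> 'v \<Rightarrow> bool" and own :: "'v \<Rightarrow> bool" and pr :: "'v \<Rightarrow> nat"
begin

definition path :: "bool \<Rightarrow> ('v \<Rightarrow> 'v) \<Rightarrow> 'v set \<Rightarrow> (nat \<Rightarrow> 'v) \<Rightarrow> bool" where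
  "path i \<sigma> W \<pi> \<longleftrightarrow> (\<forall>n. \<pi> n \<in> W \<and> E (\<pi> n) (\<pi> (Suc n)) \<and> (own (\<pi> n) = i \<longrightarrow> \<pi> (Suc n) = \<sigma> (\<pi> n)))"

text \<open>Everything is relative to the vertex set \<open>V\<close> of a subgame: the strategy
  stays in \<open>W\<close>, and the opponent cannot leave \<open>W\<close> inside \<open>V\<close>.
  Positionality is built in, as \<open>\<sigma>\<close> is a function of the vertex.\<close>

definition win :: "'v set \<Rightarrow> bool \<Rightarrow> 'v set \<Rightarrow> ('v \<Rightarrow> 'v) \<Rightarrow> bool" where
  "win V i W \<sigma> \<longleftrightarrow> W \<subseteq> V \<and> (\<forall>v\<in>W. own v = i \<longrightarrow> \<sigma> v \<in> W \<and> E v (\<sigma> v)) \<and>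
     (\<forall>v\<in>W. own v \<noteq> i \<longrightarrow> (\<forall>u\<in>V. E v u \<longrightarrow> u \<in> W)) \<and> (\<forall>\<pi>. path i \<sigma> W \<pi> \<longrightarrow> pgood pr i \<pi>)"

definition total :: "'v set \<Rightarrow> bool" where
  "total V \<longleftrightarrow> (\<forall>v\<in>V. \<exists>u\<in>V. E v u)"

lemma path_suffix: "path i \<sigma> W \<pi> \<Longrightarrow> path i \<sigma> W (\<lambda>n. \<pi> (n + k))"
  by (simp add: path_def)

text \<open>From \<open>B\<close> the opponent may escape to \<open>A\<close>, since
  \<open>B\<close> was won only in the game without \<open>A\<close>; but the play then remains in
  \<open>A\<close> and is won there, finite prefixes being irrelevant.\<close>

lemma win_union:
  assumes A: "win V i A \<sigma>" and B: "win (V - A) i B \<tau>"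
  shows "win V i (A \<union> B) (\<lambda>v. if v \<in> A then \<sigma> v else \<tau> v)"
  unfolding win_def
proof (intro conjI allI impI ballI)
  let ?\<rho> = "\<lambda>v. if v \<in> A then \<sigma> v else \<tau> v"
  have sub: "A \<subseteq> V" "B \<subseteq> V - A" using A B by (auto simp: win_def)
  then show "A \<union> B \<subseteq> V" by blast
  show "v \<in> A \<union> B \<Longrightarrow> own v = i \<Longrightarrow> ?\<rho> v \<in> A \<union> B" "v \<in> A \<union> B \<Longrightarrow> own v = i \<Longrightarrow> E v (?\<rho> v)" for v
    using A B sub unfolding win_def by auto
  show "u \<in> A \<union> B" if "v \<in> A \<union> B" "own v \<noteq> i" "u \<in> V" "E v u" for v u
    using that A B unfolding win_def by blast
  fix \<pi> assume p: "path i ?\<rho> (A \<union> B) \<pi>"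
  show "pgood pr i \<pi>"
  proof (cases "\<exists>k. \<pi> k \<in> A")
    case True
    then obtain k where k: "\<pi> k \<in> A" by blast
    have "\<pi> (n + k) \<in> A" for n
    proof (induction n)
      case (Suc n)
      have "\<pi> (Suc (n + k)) \<in> V" "E (\<pi> (n + k)) (\<pi> (Suc (n + k)))"
        "own (\<pi> (n + k)) = i \<Longrightarrow> \<pi> (Suc (n + k)) = \<sigma> (\<pi> (n + k))"
        using p[unfolded path_def, rule_format, of "n + k"] p[unfolded path_def, rule_format, of "Suc (n + k)"] Suc sub by auto
      then show ?case using A Suc unfolding win_def by (cases "own (\<pi> (n + k)) = i") auto
    qed (simp add: k)
    then have "path i \<sigma> A (\<lambda>n. \<pi> (n + k))" using path_suffix[OF p, of k] by (simp add: path_def)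
    then show ?thesis using A pgood_suffix unfolding win_def by blast
  next
    case False
    then have "path i \<tau> B \<pi>" using p by (auto simp: path_def)
    then show ?thesis using B unfolding win_def by blast
  qed
qed

lemma win_extend:
  assumes W: "win V i W \<sigma>" and v: "v \<in> V" "v \<notin> W"
    and s: "if own v = i then u \<in> W \<and> E v u else (\<forall>u\<in>V. E v u \<longrightarrow> u \<in> W)"
  shows "win V i (insert v W) (\<sigma>(v := u))"
  unfolding win_def
proof (intro conjI allI impI ballI)
  show "insert v W \<subseteq> V" using W v by (auto simp: win_def)
  show "x \<in> insert v W \<Longrightarrow> own x = i \<Longrightarrow> (\<sigma>(v := u)) x \<in> insert v W"
    "x \<in> insert v W \<Longrightarrow> own x = i \<Longrightarrow> E x ((\<sigma>(v := u)) x)" for x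
    using W s v unfolding win_def by (auto split: if_splits)
  show "y \<in> insert v W" if "x \<in> insert v W" "own x \<noteq> i" "y \<in> V" "E x y" for x y
    using that W s unfolding win_def by (auto split: if_splits)
  fix \<pi> assume p: "path i (\<sigma>(v := u)) (insert v W) \<pi>"
  have st: "\<pi> (Suc n) \<in> W" for n
  proof (cases "\<pi> n = v")
    case True
    have "\<pi> (Suc n) \<in> V" "E v (\<pi> (Suc n))" "own v = i \<Longrightarrow> \<pi> (Suc n) = u"
      using p True W v unfolding path_def win_def by (metis insert_iff subset_iff, metis, metis fun_upd_same)
    then show ?thesis using s by (auto split: if_splits)
  next
    case False
    then have "\<pi> n \<in> W" "E (\<pi> n) (\<pi> (Suc n))" "own (\<pi> n) = i \<Longrightarrow> \<pi> (Suc n) = \<sigma> (\<pi> n)" "\<pi> (Suc n) \<in> V"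
      using p W v unfolding path_def win_def by (metis insert_iff, metis, metis fun_upd_other, metis insert_iff subset_iff)
    then show ?thesis using W unfolding win_def by (cases "own (\<pi> n) = i") auto
  qed
  then have "path i \<sigma> W (\<lambda>n. \<pi> (n + 1))" using p v unfolding path_def by auto
  then show "pgood pr i \<pi>" using W pgood_suffix unfolding win_def by blast
qed

text \<open>The attractor of \<open>T\<close> is a maximal element of a finite family instead of the
  limit of an iteration; that no path following \<open>\<sigma>\<close> stays in
  \<open>A - T\<close> forever takes the place of a rank function. By maximality no further vertex
  can be attracted, so the complement is a trap for \<open>i\<close> and remains total.\<close>

lemma attractor:
  assumes "finite V" "total V" "T \<subseteq> V"
  obtains A \<sigma> where "T \<subseteq> A" "A \<subseteq> V"
    "\<And>v. v \<in> A - T \<Longrightarrow> own v = i \<Longrightarrow> \<sigma> v \<in> A \<and> E v (\<sigma> v)"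
    "\<And>v u. v \<in> A - T \<Longrightarrow> own v \<noteq> i \<Longrightarrow> u \<in> V \<Longrightarrow> E v u \<Longrightarrow> u \<in> A"
    "\<And>\<pi>. \<not> path i \<sigma> (A - T) \<pi>"
    "\<And>v u. v \<in> V - A \<Longrightarrow> own v = i \<Longrightarrow> u \<in> A \<Longrightarrow> \<not> E v u"
    "total (V - A)"
proof -
  define att where "att A \<sigma> \<longleftrightarrow> T \<subseteq> A \<and> A \<subseteq> V \<and> (\<forall>v\<in>A - T. own v = i \<longrightarrow> \<sigma> v \<in> A \<and> E v (\<sigma> v)) \<and>
    (\<forall>v\<in>A - T. own v \<noteq> i \<longrightarrow> (\<forall>u\<in>V. E v u \<longrightarrow> u \<in> A)) \<and> (\<forall>\<pi>. \<not> path i \<sigma> (A - T) \<pi>)" for A \<sigma>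
  have "finite {A. \<exists>\<sigma>. att A \<sigma>}"
    by (rule finite_subset[of _ "Pow V"]) (use assms in \<open>auto simp: att_def\<close>)
  moreover have "T \<in> {A. \<exists>\<sigma>. att A \<sigma>}" using assms by (auto simp: att_def path_def)
  ultimately have "\<exists>A\<in>{A. \<exists>\<sigma>. att A \<sigma>}. T \<subseteq> A \<and> (\<forall>B\<in>{A. \<exists>\<sigma>. att A \<sigma>}. A \<subseteq> B \<longrightarrow> A = B)"
    by (rule finite_has_maximal2)
  then obtain A where Ain: "A \<in> {A. \<exists>\<sigma>. att A \<sigma>}" and mx': "\<forall>B\<in>{A. \<exists>\<sigma>. att A \<sigma>}. A \<subseteq> B \<longrightarrow> A = B" by blast
  note mx = mx'[rule_format]
  from Ain obtain \<sigma> where \<sigma>: "att A \<sigma>" by blast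
  have ext: "\<not> (if own v = i then u \<in> A \<and> E v u else (\<forall>u\<in>V. E v u \<longrightarrow> u \<in> A))" if v: "v \<in> V - A" for v u
  proof
    assume s: "if own v = i then u \<in> A \<and> E v u else (\<forall>u\<in>V. E v u \<longrightarrow> u \<in> A)"
    have "att (insert v A) (\<sigma>(v := u))"
      unfolding att_def
    proof (intro conjI allI impI ballI)
      show "T \<subseteq> insert v A" "insert v A \<subseteq> V" using \<sigma> v by (auto simp: att_def)
      show "x \<in> insert v A - T \<Longrightarrow> own x = i \<Longrightarrow> (\<sigma>(v := u)) x \<in> insert v A"
        "x \<in> insert v A - T \<Longrightarrow> own x = i \<Longrightarrow> E x ((\<sigma>(v := u)) x)" for x
        using \<sigma> s v unfolding att_def by (auto split: if_splits)
      show "y \<in> insert v A" if "x \<in> insert v A - T" "own x \<noteq> i" "y \<in> V" "E x y" for x y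
        using that \<sigma> s unfolding att_def by (auto split: if_splits)
      fix \<pi>
      show "\<not> path i (\<sigma>(v := u)) (insert v A - T) \<pi>"
      proof
        assume p: "path i (\<sigma>(v := u)) (insert v A - T) \<pi>"
        have st: "\<pi> (Suc n) \<in> A - T" for n
        proof (cases "\<pi> n = v")
          case True
          have "\<pi> (Suc n) \<in> insert v A - T" "E v (\<pi> (Suc n))" "own v = i \<Longrightarrow> \<pi> (Suc n) = u"
            using p True unfolding path_def by (blast, metis, metis fun_upd_same)
          then show ?thesis using s v \<sigma> by (auto split: if_splits simp: att_def)
        next
          case False
          then have "\<pi> n \<in> A - T" "E (\<pi> n) (\<pi> (Suc n))" "own (\<pi> n) = i \<Longrightarrow> \<pi> (Suc n) = \<sigma> (\<pi> n)" "\<pi> (Suc n) \<in> insert v A - T"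
            using p unfolding path_def by (metis Diff_iff insert_iff, metis, metis fun_upd_other, blast)
          then show ?thesis using \<sigma> v unfolding att_def by (cases "own (\<pi> n) = i") auto
        qed
        then have "path i \<sigma> (A - T) (\<lambda>n. \<pi> (n + 1))" using p v unfolding path_def by auto
        then show False using \<sigma> unfolding att_def by blast
      qed
    qed
    then have "A = insert v A" by (intro mx) auto
    then show False using v by blast
  qed
  have "total (V - A)" unfolding total_def
  proof
    fix v assume v: "v \<in> V - A"
    show "\<exists>u\<in>V - A. E v u"
    proof (cases "own v = i")
      case True
      obtain u where "u \<in> V" "E v u" using assms(2) v unfolding total_def by blast
      moreover have "u \<notin> A" using ext[OF v, of u] True \<open>E v u\<close> by auto
      ultimately show ?thesis by blast
    next
      case False then show ?thesis using ext[OF v, of undefined] by auto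
    qed
  qed
  moreover have "\<not> E v u" if "v \<in> V - A" "own v = i" "u \<in> A" for v u using ext[OF that(1), of u] that by auto
  ultimately show ?thesis using \<sigma> by (intro that[of A \<sigma>]) (auto simp: att_def)
qed

text \<open>Zielonka's recursion on the number of vertices. \<open>i\<close> is the player favoured
  by the greatest priority and \<open>W\<close> a maximal winning region of the opponent. If
  \<open>W\<close> is not empty, the smaller game outside it is solved, and maximality leaves
  nothing there to the opponent. If it is empty, the attractor of the top priority is removed
  instead.\<close>

theorem positional_determinacy:
  assumes "finite V" "total V"
  shows "\<exists>W \<sigma> \<tau>. W \<subseteq> V \<and> win V True W \<sigma> \<and> win V False (V - W) \<tau>"
proof -
  have "\<exists>W \<sigma> \<tau>. W \<subseteq> V \<and> win V i W \<sigma> \<and> win V (\<not> i) (V - W) \<tau>"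
    if "V \<noteq> {}" "i = even (Max (pr ` V))" "finite V" "total V" for V i
    using that
  proof (induction "card V" arbitrary: V i rule: less_induct)
    case less
    \<comment> \<open>The player favoured by the top priority of the subgame may be the other one;
      the two regions are then exchanged.\<close>
    have IH: "\<exists>W \<sigma> \<tau>. W \<subseteq> U \<and> win U i W \<sigma> \<and> win U (\<not> i) (U - W) \<tau>" if U: "U \<subset> V" "total U" for U
    proof (cases "U = {}")
      case True then show ?thesis by (auto simp: win_def path_def)
    next
      case False
      have f: "finite U" "card U < card V" using U(1) less.prems(3) by (auto simp: finite_subset psubset_card_mono)
      obtain W \<sigma> \<tau> where W: "W \<subseteq> U" "win U (even (Max (pr ` U))) W \<sigma>" "win U (\<not> even (Max (pr ` U))) (U - W) \<tau>"
        using less.hyps[OF f(2) False refl f(1) U(2)] by blast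
      show ?thesis
      proof (cases "i = even (Max (pr ` U))")
        case True then show ?thesis using W by blast
      next
        case False
        then have "i = (\<not> even (Max (pr ` U)))" by auto
        then show ?thesis using W by (intro exI[of _ "U - W"] exI[of _ \<tau>] exI[of _ \<sigma>]) (auto simp: double_diff)
      qed
    qed
    let ?j = "\<not> i"
    have "finite {W. \<exists>\<sigma>. win V ?j W \<sigma>}"
      by (rule finite_subset[of _ "Pow V"]) (use less.prems in \<open>auto simp: win_def\<close>)
    moreover have "{} \<in> {W. \<exists>\<sigma>. win V ?j W \<sigma>}" by (auto simp: win_def path_def)
    ultimately have "\<exists>W\<in>{W. \<exists>\<sigma>. win V ?j W \<sigma>}. {} \<subseteq> W \<and> (\<forall>B\<in>{W. \<exists>\<sigma>. win V ?j W \<sigma>}. W \<subseteq> B \<longrightarrow> W = B)"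
      by (rule finite_has_maximal2)
    then obtain W where Win: "W \<in> {W. \<exists>\<sigma>. win V ?j W \<sigma>}" and mx': "\<forall>B\<in>{W. \<exists>\<sigma>. win V ?j W \<sigma>}. W \<subseteq> B \<longrightarrow> W = B" by blast
    note mx = mx'[rule_format]
    from Win obtain \<sigma> where \<sigma>: "win V ?j W \<sigma>" by blast
    have WV: "W \<subseteq> V" using \<sigma> by (simp add: win_def)
    have ext: "\<not> (if own v = ?j then u \<in> W \<and> E v u else (\<forall>u\<in>V. E v u \<longrightarrow> u \<in> W))" if v: "v \<in> V - W" for v u
    proof
      assume "if own v = ?j then u \<in> W \<and> E v u else (\<forall>u\<in>V. E v u \<longrightarrow> u \<in> W)"
      then have "win V ?j (insert v W) (\<sigma>(v := u))" using v by (intro win_extend[OF \<sigma>]) auto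
      then have "W = insert v W" by (intro mx) auto
      then show False using v by blast
    qed
    have tot: "total (V - W)" unfolding total_def
    proof
      fix v assume v: "v \<in> V - W"
      show "\<exists>u\<in>V - W. E v u"
      proof (cases "own v = ?j")
        case True
        obtain u where "u \<in> V" "E v u" using less.prems v unfolding total_def by blast
        moreover have "u \<notin> W" using ext[OF v, of u] True \<open>E v u\<close> by auto
        ultimately show ?thesis by blast
      next
        case False then show ?thesis using ext[OF v, of undefined] by auto
      qed
    qed
    have noW: "W' = {}" if "win (V - W) ?j W' \<tau>" for W' \<tau>
    proof -
      have "W = W \<union> W'" using win_union[OF \<sigma> that] by (intro mx) auto
      moreover have "W' \<subseteq> V - W" using that by (simp add: win_def)
      ultimately show ?thesis by blast
    qed
    have "\<exists>\<tau>. win V i (V - W) \<tau>"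
    proof (cases "W = {}")
      case False
      then have "V - W \<subset> V" using WV by blast
      from IH[OF this tot] obtain Wi \<tau> \<rho> where Wi: "Wi \<subseteq> V - W" "win (V - W) i Wi \<tau>" "win (V - W) ?j ((V - W) - Wi) \<rho>" by blast
      have "Wi = V - W" using noW[OF Wi(3)] Wi(1) by blast
      then have w: "win (V - W) i (V - W) \<tau>" using Wi by simp
      have "u \<in> V - W" if "v \<in> V - W" "own v \<noteq> i" "u \<in> V" "E v u" for v u
        using ext[OF that(1), of u] that by auto
      then have "win V i (V - W) \<tau>" using w unfolding win_def by blast
      then show ?thesis by blast
    next
      case True
      define d where "d = Max (pr ` V)"
      define T where "T = {v\<in>V. pr v = d}"
      have "d \<in> pr ` V" unfolding d_def using less.prems by (intro Max_in) auto
      then have T: "T \<subseteq> V" "T \<noteq> {}" by (auto simp: T_def)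
      obtain A \<alpha> where A: "T \<subseteq> A" "A \<subseteq> V"
        "\<And>v. v \<in> A - T \<Longrightarrow> own v = i \<Longrightarrow> \<alpha> v \<in> A \<and> E v (\<alpha> v)"
        "\<And>v u. v \<in> A - T \<Longrightarrow> own v \<noteq> i \<Longrightarrow> u \<in> V \<Longrightarrow> E v u \<Longrightarrow> u \<in> A"
        "\<And>\<pi>. \<not> path i \<alpha> (A - T) \<pi>"
        "\<And>v u. v \<in> V - A \<Longrightarrow> own v = i \<Longrightarrow> u \<in> A \<Longrightarrow> \<not> E v u"
        "total (V - A)"
        by (rule attractor[OF less.prems(3,4) T(1), of i]) (rule that; (assumption | blast))
      have "V - A \<subset> V" using A T by blast
      from IH[OF this A(7)] obtain Wi \<tau> \<rho> where Wi: "Wi \<subseteq> V - A" "win (V - A) i Wi \<tau>" "win (V - A) ?j ((V - A) - Wi) \<rho>" by blast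
      \<comment> \<open>From outside the attractor \<open>i\<close> has no move into it, so what the
        opponent wins in the smaller game is won in \<open>V\<close> as well. The maximal region
        \<open>W\<close> being empty, this region is empty too.\<close>
      have "win V ?j ((V - A) - Wi) \<rho>"
        unfolding win_def
      proof (intro conjI ballI impI)
        fix v u assume v: "v \<in> V - A - Wi" "own v \<noteq> ?j" "u \<in> V" "E v u"
        have "u \<in> V - A" using A(6)[of v u] v by blast
        then show "u \<in> V - A - Wi" using v Wi(3) unfolding win_def by blast
      qed (use Wi(3) in \<open>auto simp: win_def\<close>)
      then have "(V - A) - Wi = {}" using mx[of "(V - A) - Wi"] True by blast
      then have w: "win (V - A) i (V - A) \<tau>" using Wi by (metis Diff_eq_empty_iff subset_antisym)
      define nx where "nx v = (SOME u. u \<in> V \<and> E v u)" for v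
      have nx: "nx v \<in> V \<and> E v (nx v)" if "v \<in> V" for v
        unfolding nx_def by (rule someI_ex) (use less.prems(4) that in \<open>auto simp: total_def\<close>)
      \<comment> \<open>Outside \<open>A\<close> the strategy of the smaller game, at the top
        priority any move, elsewhere in \<open>A\<close> the attractor strategy. A play that meets
        \<open>A\<close> infinitely often meets the top priority infinitely often; any other play
        eventually follows \<open>\<tau>\<close>.\<close>
      define \<mu> where "\<mu> v = (if v \<in> V - A then \<tau> v else if v \<in> T then nx v else \<alpha> v)" for v
      have "win V i V \<mu>"
        unfolding win_def
      proof (intro conjI ballI impI allI)
        fix v assume v: "v \<in> V" "own v = i"
        have "\<mu> v \<in> V \<and> E v (\<mu> v)"
        proof (cases "v \<in> V - A")
          case True then show ?thesis using w v unfolding win_def \<mu>_def by auto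
        next
          case False
          then show ?thesis using nx[OF v(1)] A(2) A(3)[of v] v by (auto simp: \<mu>_def)
        qed
        then show "\<mu> v \<in> V" "E v (\<mu> v)" by auto
      next
        fix \<pi> assume p: "path i \<mu> V \<pi>"
        show "pgood pr i \<pi>"
        proof (cases "\<forall>n. \<exists>m\<ge>n. \<pi> m \<in> A")
          case True
          have "\<exists>m\<ge>n. \<pi> m \<in> T" for n
          proof (rule ccontr)
            assume c: "\<not> (\<exists>m\<ge>n. \<pi> m \<in> T)"
            obtain k where k: "k \<ge> n" "\<pi> k \<in> A" using True by blast
            have "\<pi> (m + k) \<in> A - T" for m
            proof (induction m)
              case 0 show ?case using k c by auto
            next
              case (Suc m)
              have "E (\<pi> (m + k)) (\<pi> (Suc (m + k)))" "\<pi> (Suc (m + k)) \<in> V" "own (\<pi> (m + k)) = i \<Longrightarrow> \<pi> (Suc (m + k)) = \<mu> (\<pi> (m + k))"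
                using p unfolding path_def by blast+
              then have "\<pi> (Suc (m + k)) \<in> A"
                using A(3,4)[of "\<pi> (m + k)"] Suc by (cases "own (\<pi> (m + k)) = i") (auto simp: \<mu>_def)
              moreover have "\<pi> (Suc (m + k)) \<notin> T" using c k(1) by auto
              ultimately show ?case by simp
            qed
            then have "path i \<alpha> (A - T) (\<lambda>n. \<pi> (n + k))" using path_suffix[OF p, of k] by (auto simp: path_def \<mu>_def)
            then show False using A(5) by blast
          qed
          then have "\<forall>n. \<exists>m\<ge>n. pr (\<pi> m) = d" unfolding T_def by blast
          moreover have "pr (\<pi> m) \<le> d" for m using p less.prems(3) by (auto simp: d_def path_def)
          ultimately show ?thesis unfolding pgood_def using less.prems(2) by (intro exI[of _ d]) (auto simp: d_def)
        next
          case False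
          then obtain k where k: "\<And>m. m \<ge> k \<Longrightarrow> \<pi> m \<notin> A" by blast
          then have "path i \<tau> (V - A) (\<lambda>n. \<pi> (n + k))" using path_suffix[OF p, of k] by (auto simp: path_def \<mu>_def)
          then show ?thesis using w pgood_suffix unfolding win_def by blast
        qed
      qed auto
      then show ?thesis using True by auto
    qed
    then obtain \<tau> where "win V i (V - W) \<tau>" by blast
    moreover have "V - (V - W) = W" using WV by blast
    ultimately show ?case using \<sigma> by (intro exI[of _ "V - W"] exI[of _ \<tau>] exI[of _ \<sigma>]) auto
  qed
  note main = this
  show ?thesis
  proof (cases "V = {}")
    case True then show ?thesis by (auto simp: win_def path_def)
  next
    case False
    from main[OF False refl assms] obtain W \<sigma> \<tau> where W: "W \<subseteq> V" "win V (even (Max (pr ` V))) W \<sigma>" "win V (\<not> even (Max (pr ` V))) (V - W) \<tau>" by blast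
    show ?thesis
    proof (cases "even (Max (pr ` V))")
      case True then show ?thesis using W by auto
    next
      case False
      then show ?thesis using W by (intro exI[of _ "V - W"] exI[of _ \<tau>] exI[of _ \<sigma>]) (auto simp: double_diff)
    qed
  qed
qed

end

section \<open>A deterministic parity condition for the value of a sequence\<close>

type_synonym pstate = "nat option \<times> (nat \<times> nat \<times> nat set) set"

lemma pigeonhole_io:
  fixes P :: "nat \<Rightarrow> 'z \<Rightarrow> bool"
  assumes "finite A" "\<forall>n. \<exists>m\<ge>n. \<exists>y\<in>A. P m y"
  shows "\<exists>y\<in>A. \<forall>n. \<exists>m\<ge>n. P m y"
proof (rule ccontr)
  assume "\<not> (\<exists>y\<in>A. \<forall>n. \<exists>m\<ge>n. P m y)"
  then have "\<forall>y\<in>A. \<exists>n. \<forall>m\<ge>n. \<not> P m y" by blast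
  then obtain b where b: "\<And>y m. y \<in> A \<Longrightarrow> m \<ge> b y \<Longrightarrow> \<not> P m y" by metis
  obtain m y where my: "m \<ge> Max (insert 0 (b ` A))" "y \<in> A" "P m y" using assms(2) by blast
  have "b y \<le> Max (insert 0 (b ` A))" using assms(1) my(2) by (intro Max_ge) auto
  then show False using b[OF my(2), of m] my by auto
qed

context walg begin

text \<open>After reading \<open>x 0, \<dots>, x (n - 1)\<close> the automaton knows, for every cut \<open>k\<close>, the product up to \<open>k\<close>,
  the product from \<open>k\<close> on, and the set of all earlier products from \<open>k\<close> on.\<close>

definition pstep :: "pstate \<Rightarrow> nat \<Rightarrow> pstate" where
  "pstep q x = (Some (case fst q of None \<Rightarrow> x | Some s \<Rightarrow> mul s x),
     (\<lambda>(s, u, D). (s, mul u x, insert u D)) ` snd q \<union> (case fst q of None \<Rightarrow> {} | Some s \<Rightarrow> {(s, x, {})}))"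

fun prun :: "(nat \<Rightarrow> nat) \<Rightarrow> nat \<Rightarrow> pstate" where
  "prun x 0 = (None, {})"
| "prun x (Suc n) = pstep (prun x n) (x n)"

lemma prun_inv: "prun x n = (if n = 0 then None else Some (sg x 0 n),
    {(sg x 0 k, sg x k n, {sg x k j | j. k < j \<and> j < n}) | k. 0 < k \<and> k < n})"
proof (induction n)
  case (Suc n)
  have 1: "(\<lambda>(s, u, D). (s, mul u (x n), insert u D)) ` {(sg x 0 k, sg x k n, {sg x k j | j. k < j \<and> j < n}) | k. 0 < k \<and> k < n}
    = {(sg x 0 k, sg x k (Suc n), {sg x k j | j. k < j \<and> j < Suc n}) | k. 0 < k \<and> k < n}" (is "?f ` ?A = ?B")
  proof -
    have "?A = (\<lambda>k. (sg x 0 k, sg x k n, {sg x k j | j. k < j \<and> j < n})) ` {0<..<n}" by auto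
    then have "?f ` ?A = (\<lambda>k. (sg x 0 k, mul (sg x k n) (x n), insert (sg x k n) {sg x k j | j. k < j \<and> j < n})) ` {0<..<n}"
      by (simp add: image_image)
    also have "\<dots> = (\<lambda>k. (sg x 0 k, sg x k (Suc n), {sg x k j | j. k < j \<and> j < Suc n})) ` {0<..<n}"
    proof (rule image_cong[OF refl])
      fix k assume "k \<in> {0<..<n}"
      then have k: "k < n" by simp
      have "insert (sg x k n) {sg x k j | j. k < j \<and> j < n} = {sg x k j | j. k < j \<and> j < Suc n}"
        using k by (auto simp: less_Suc_eq)
      then show "(sg x 0 k, mul (sg x k n) (x n), insert (sg x k n) {sg x k j | j. k < j \<and> j < n}) =
          (sg x 0 k, sg x k (Suc n), {sg x k j | j. k < j \<and> j < Suc n})" using k by (simp add: seg_Suc)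
    qed
    also have "\<dots> = ?B" by auto
    finally show ?thesis .
  qed
  have 2: "{(sg x 0 k, sg x k (Suc n), {sg x k j | j. k < j \<and> j < Suc n}) | k. 0 < k \<and> k < Suc n} =
    ?B \<union> (if n = 0 then {} else {(sg x 0 n, x n, {})})"
    by (auto simp: less_Suc_eq)
  show ?case unfolding prun.simps Suc pstep_def fst_conv snd_conv 1 2 by (auto simp: seg_Suc)
qed auto

text \<open>The smaller the right ideal generated by \<open>e\<close>, the greater the rank;
  descending in Green's R-order raises the priority.\<close>

definition rk :: "nat \<Rightarrow> nat" where "rk e = N - card (mul e ` {..<N})"

text \<open>The rank dominates, and acceptance decides the parity, even meaning accepted. The
  summand 1 keeps the value above 0, the priority of states without a hit.\<close>

definition pval :: "nat \<Rightarrow> nat \<Rightarrow> nat" where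
  "pval s e = 2 * (rk e + 1) + (if ac (mul s (om e)) then 0 else 1)"

text \<open>Some earlier cut has prefix product \<open>s\<close>, and the product from that cut on
  is \<open>e\<close> now for the first time. One cut can thus cause at most one hit of
  \<open>(s, e)\<close>, so infinitely many hits come from infinitely many cuts.\<close>

definition hits :: "pstate \<Rightarrow> nat \<Rightarrow> nat \<Rightarrow> bool" where
  "hits q s e \<longleftrightarrow> s < N \<and> e < N \<and> mul e e = e \<and> mul s e = s \<and> (\<exists>D. (s, e, D) \<in> snd q \<and> e \<notin> D)"

definition prio :: "pstate \<Rightarrow> nat" where
  "prio q = Max (insert 0 {pval s e | s e. hits q s e})"

lemma finite_pvals: "finite {pval s e | s e. hits q s e}"
proof (rule finite_subset)
  show "{pval s e | s e. hits q s e} \<subseteq> (\<lambda>(s, e). pval s e) ` ({..<N} \<times> {..<N})" by (force simp: hits_def)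
qed simp

lemma prio_ge: "hits q s e \<Longrightarrow> pval s e \<le> prio q"
  unfolding prio_def using finite_pvals by (intro Max_ge) auto

lemma prio_cases: "prio q = 0 \<or> (\<exists>s e. hits q s e \<and> prio q = pval s e)"
  using Max_in[of "insert 0 {pval s e | s e. hits q s e}"] finite_pvals by (auto simp: prio_def)

lemma prio_le: "prio q \<le> 2 * (N + 1) + 1"
  using prio_cases[of q] by (auto simp: pval_def rk_def)

text \<open>As \<open>f = e g\<close>, the right ideal of \<open>f\<close> is contained in that of
  \<open>e\<close>. Finite sets of equal size then coincide, and \<open>e\<close> lies in its own
  ideal by idempotence.\<close>

lemma rk_mono:
  assumes "e < N" "f < N" "g < N" "f = mul e g" "mul e e = e"
  shows "rk e \<le> rk f" "rk e = rk f \<Longrightarrow> \<exists>h<N. e = mul f h"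
proof -
  have sub: "mul f ` {..<N} \<subseteq> mul e ` {..<N}"
    using assms by (auto simp: mul_assoc mul_closed)
  then have c: "card (mul f ` {..<N}) \<le> card (mul e ` {..<N})" by (intro card_mono) auto
  then show "rk e \<le> rk f" by (simp add: rk_def)
  assume "rk e = rk f"
  moreover have "card (mul e ` {..<N}) \<le> N" "card (mul f ` {..<N}) \<le> N"
    using card_image_le[of "{..<N}"] by auto
  ultimately have "card (mul f ` {..<N}) = card (mul e ` {..<N})" by (simp add: rk_def)
  then have "mul f ` {..<N} = mul e ` {..<N}" using sub by (intro card_subset_eq) auto
  moreover have "e \<in> mul e ` {..<N}" using assms(1,5) by (metis image_eqI lessThan_iff)
  ultimately show "\<exists>h<N. e = mul f h" by auto
qed

text \<open>If \<open>e\<close> and \<open>f\<close> generate the same right ideal, the sequence \<open>s f e f e \<dots>\<close> can be read both as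
  \<open>s e e \<dots>\<close> and as \<open>s f f \<dots>\<close>.\<close>

lemma R_equiv_acc:
  assumes c: "s < N" "e < N" "f < N" "g < N" "h < N" and "mul e e = e" "mul f f = f" "f = mul e g" "e = mul f h" "mul s f = s"
  shows "ac (mul s (om e)) = ac (mul s (om f))"
proof -
  have fe: "mul f e = e" using assms by (metis mul_assoc)
  have ef: "mul e f = f" using assms by (metis mul_assoc)
  define z where "z k = (if k = 0 then s else if odd k then f else e)" for k :: nat
  have z: "z k < N" for k using c by (simp add: z_def)
  have b: "sg z k (k + 2) = mul (z k) (z (Suc k))" for k using seg_Suc[of k "Suc k" mul z] by simp
  have "fac mul z s e" unfolding fac_def
    using b[of "1 + 2 * i" for i] fe
    by (intro exI[of _ "\<lambda>i. 1 + 2 * i"]) (auto simp: strict_mono_Suc_iff z_def)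
  moreover have "fac mul z s f" unfolding fac_def
  proof (intro exI[of _ "\<lambda>i. 2 + 2 * i"] conjI allI)
    show "sg z 0 (2 + 2 * 0) = s" using b[of 0] assms(10) by (simp add: z_def numeral_2_eq_2)
    show "sg z (2 + 2 * i) (2 + 2 * Suc i) = f" for i using b[of "2 + 2 * i"] ef by (simp add: z_def)
  qed (auto simp: strict_mono_Suc_iff)
  ultimately show ?thesis using consist[of z] z by blast
qed

lemma hits_prun: "hits (prun x n) s e \<longleftrightarrow> s < N \<and> e < N \<and> mul e e = e \<and> mul s e = s \<and>
    (\<exists>k. 0 < k \<and> k < n \<and> sg x 0 k = s \<and> sg x k n = e \<and> (\<forall>j. k < j \<and> j < n \<longrightarrow> sg x k j \<noteq> e))"
proof -
  have "(\<exists>D. (s, e, D) \<in> snd (prun x n) \<and> e \<notin> D) \<longleftrightarrow>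
      (\<exists>k. 0 < k \<and> k < n \<and> sg x 0 k = s \<and> sg x k n = e \<and> (\<forall>j. k < j \<and> j < n \<longrightarrow> sg x k j \<noteq> e))"
    (is "?l \<longleftrightarrow> ?r")
  proof
    assume ?l
    then obtain D where D: "(s, e, D) \<in> snd (prun x n)" "e \<notin> D" by blast
    from D(1) obtain k where "s = sg x 0 k" "e = sg x k n" "D = {sg x k j | j. k < j \<and> j < n}" "0 < k" "k < n"
      unfolding prun_inv[of x n] by auto
    then show ?r using D(2) by (intro exI[of _ k]) auto
  next
    assume ?r
    then obtain k where k: "0 < k" "k < n" "sg x 0 k = s" "sg x k n = e" "\<forall>j. k < j \<and> j < n \<longrightarrow> sg x k j \<noteq> e" by blast
    then have "(s, e, {sg x k j | j. k < j \<and> j < n}) \<in> snd (prun x n)" unfolding prun_inv[of x n] by auto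
    moreover have "e \<notin> {sg x k j | j. k < j \<and> j < n}" using k(5) by auto
    ultimately show ?l by blast
  qed
  then show ?thesis unfolding hits_def by blast
qed

text \<open>From the cut \<open>\<kappa> n\<close> on, the product \<open>e\<close> is reached at
  \<open>\<kappa> (Suc n)\<close> at the latest; the first time at which it is reached is a hit
  after time \<open>n\<close>.\<close>

lemma fac_hits:
  fixes \<kappa> :: "nat \<Rightarrow> nat"
  assumes \<kappa>: "strict_mono \<kappa>" "0 < \<kappa> 0" "\<And>i. sg x 0 (\<kappa> i) = s" "\<And>i j. i < j \<Longrightarrow> sg x (\<kappa> i) (\<kappa> j) = e"
    and c: "mul e e = e" "mul s e = s" "s < N" "e < N"
  shows "\<exists>m\<ge>n. hits (prun x m) s e"
proof -
  have l: "\<kappa> n < \<kappa> (Suc n)" using \<kappa>(1) by (simp add: strict_mono_less)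
  define m where "m = (LEAST j. \<kappa> n < j \<and> sg x (\<kappa> n) j = e)"
  have m: "\<kappa> n < m \<and> sg x (\<kappa> n) m = e"
    unfolding m_def by (rule LeastI[of _ "\<kappa> (Suc n)"]) (use l \<kappa>(4)[of n "Suc n"] in auto)
  have m2: "sg x (\<kappa> n) j \<noteq> e" if "\<kappa> n < j" "j < m" for j
    using not_less_Least[of j "\<lambda>j. \<kappa> n < j \<and> sg x (\<kappa> n) j = e"] that by (auto simp: m_def)
  have "n \<le> \<kappa> n" using strict_mono_imp_increasing[OF \<kappa>(1)] .
  moreover have "0 < \<kappa> n" using \<kappa>(1,2) by (metis gr0I not_less_zero strict_mono_less)
  ultimately show ?thesis
    unfolding hits_prun using m m2 c \<kappa>(3)[of n] by (intro exI[of _ m]) auto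
qed

text \<open>Ramsey's theorem is applied inside the infinite set of cuts that have prefix product
  \<open>s\<close> and are followed by \<open>e\<close>. The idempotent \<open>f\<close> found there
  may differ from \<open>e\<close>, but the segment from the first chosen cut passes through
  \<open>e\<close>, so \<open>f\<close> lies in the right ideal of \<open>e\<close>.\<close>

lemma hits_fac:
  assumes x: "\<And>k. x k < N" and inf: "\<forall>n. \<exists>m\<ge>n. hits (prun x m) s e"
  obtains \<kappa> :: "nat \<Rightarrow> nat" and f g where "strict_mono \<kappa>" "0 < \<kappa> 0" "\<And>i. sg x 0 (\<kappa> i) = s" "\<And>i j. i < j \<Longrightarrow> sg x (\<kappa> i) (\<kappa> j) = f"
    "mul f f = f" "mul s f = s" "f < N" "g < N" "f = mul e g"
proof -
  define K where "K = {k. sg x 0 k = s \<and> (\<exists>n>k. sg x k n = e)}"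
  have "infinite K"
  proof
    assume "finite K"
    then have "finite ((\<lambda>k. LEAST j. k < j \<and> sg x k j = e) ` K)" by simp
    moreover have "{m. hits (prun x m) s e} \<subseteq> (\<lambda>k. LEAST j. k < j \<and> sg x k j = e) ` K"
    proof
      fix m assume "m \<in> {m. hits (prun x m) s e}"
      then obtain k where k: "0 < k" "k < m" "sg x 0 k = s" "sg x k m = e" "\<And>j. k < j \<Longrightarrow> j < m \<Longrightarrow> sg x k j \<noteq> e"
        unfolding hits_prun by blast
      have "(LEAST j. k < j \<and> sg x k j = e) = m"
        using k by (intro Least_equality) (auto simp: not_less[symmetric])
      moreover have "k \<in> K" using k by (auto simp: K_def)
      ultimately show "m \<in> (\<lambda>k. LEAST j. k < j \<and> sg x k j = e) ` K" by blast
    qed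
    ultimately have "finite {m. hits (prun x m) s e}" using finite_subset by blast
    then obtain B where "\<And>m. hits (prun x m) s e \<Longrightarrow> m < B" using finite_nat_set_iff_bounded by auto
    then show False using inf by (meson not_less)
  qed
  then obtain \<kappa> :: "nat \<Rightarrow> nat" and s' f where \<kappa>: "strict_mono \<kappa>" "0 < \<kappa> 0" "\<And>i. \<kappa> i \<in> K" "\<And>i. sg x 0 (\<kappa> i) = s'"
    "\<And>i j. i < j \<Longrightarrow> sg x (\<kappa> i) (\<kappa> j) = f" "mul f f = f" "mul s' f = s'" "s' < N" "f < N"
    by (rule ramsey_fac[where x = x]) (use x in auto)
  have s': "s' = s" using \<kappa>(3)[of 0] \<kappa>(4)[of 0] by (simp add: K_def)
  obtain n where n: "\<kappa> 0 < n" "sg x (\<kappa> 0) n = e" using \<kappa>(3)[of 0] by (auto simp: K_def)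
  have "n < \<kappa> (Suc n)" using strict_mono_imp_increasing[OF \<kappa>(1), of "Suc n"] by linarith
  then have "f = mul e (sg x n (\<kappa> (Suc n)))" "sg x n (\<kappa> (Suc n)) < N"
    using seg_split[of "\<kappa> 0" n "\<kappa> (Suc n)" x] n x \<kappa>(5)[of 0 "Suc n"] seg_closed[of n "\<kappa> (Suc n)" x] by auto
  then show ?thesis using \<kappa> s' by (intro that[of \<kappa> f "sg x n (\<kappa> (Suc n))"]) auto
qed

text \<open>Let \<open>(s, e)\<close> attain the greatest recurring priority. The pair
  \<open>(s, f)\<close> of a Ramsey factorisation through its cuts also hits infinitely often.
  Maximality forbids a greater rank for \<open>f\<close>, so \<open>e\<close> and \<open>f\<close>
  generate the same right ideal, and the parity read off from \<open>e\<close> is the verdict on the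
  actual factorisation.\<close>

theorem prio_val:
  assumes x: "\<And>k. x k < N"
  shows "\<exists>d. (\<forall>n. \<exists>m\<ge>n. prio (prun x m) = d) \<and> (\<exists>n. \<forall>m\<ge>n. prio (prun x m) \<le> d) \<and> (even d \<longleftrightarrow> val x)"
proof -
  define I where "I = {d. \<forall>n. \<exists>m\<ge>n. prio (prun x m) = d}"
  have sub: "I \<subseteq> {..2 * (N + 1) + 1}"
  proof
    fix d assume "d \<in> I"
    then obtain m where "prio (prun x m) = d" unfolding I_def by blast
    then show "d \<in> {..2 * (N + 1) + 1}" using prio_le[of "prun x m"] by auto
  qed
  then have fin: "finite I" using finite_subset by blast
  have "\<forall>n. \<exists>m\<ge>n. \<exists>y\<in>{..2 * (N + 1) + 1}. prio (prun x m) = y" using prio_le by auto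
  from pigeonhole_io[OF _ this] have "I \<noteq> {}" unfolding I_def by auto
  define d where "d = Max I"
  have dI: "d \<in> I" unfolding d_def using fin \<open>I \<noteq> {}\<close> by simp
  have d1: "\<forall>n. \<exists>m\<ge>n. prio (prun x m) = d" using dI unfolding I_def by blast
  have d2: "\<exists>n. \<forall>m\<ge>n. prio (prun x m) \<le> d"
  proof (rule ccontr)
    assume "\<not> (\<exists>n. \<forall>m\<ge>n. prio (prun x m) \<le> d)"
    then have "\<forall>n. \<exists>m\<ge>n. d < prio (prun x m)" by (meson not_less)
    then have "\<forall>n. \<exists>m\<ge>n. \<exists>y\<in>{d<..2 * (N + 1) + 1}. prio (prun x m) = y"
      using prio_le by (metis greaterThanAtMost_iff)
    from pigeonhole_io[OF _ this] obtain y where "y \<in> {d<..2 * (N + 1) + 1}" "y \<in> I" unfolding I_def by auto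
    then show False using Max_ge[OF fin, of y] by (auto simp: d_def)
  qed
  have bound: "pval s e \<le> d" if "\<forall>n. \<exists>m\<ge>n. hits (prun x m) s e" for s e
    using d2 that prio_ge by (meson order_trans)
  have UN: "infinite (UNIV :: nat set)" by simp
  obtain \<kappa> :: "nat \<Rightarrow> nat" and s0 e0 where "strict_mono \<kappa>" "0 < \<kappa> 0" "\<And>i. sg x 0 (\<kappa> i) = s0"
    "\<And>i j. i < j \<Longrightarrow> sg x (\<kappa> i) (\<kappa> j) = e0" "mul e0 e0 = e0" "mul s0 e0 = s0" "s0 < N" "e0 < N"
    by (rule ramsey_fac[OF UN, of x]) (use x in auto)
  from fac_hits[OF this] have "pval s0 e0 \<le> d" by (intro bound) blast
  then have "d \<noteq> 0" by (auto simp: pval_def)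
  have "\<forall>n. \<exists>m\<ge>n. \<exists>y\<in>{..<N} \<times> {..<N}. hits (prun x m) (fst y) (snd y) \<and> pval (fst y) (snd y) = d"
  proof
    fix n
    obtain m where m: "m \<ge> n" "prio (prun x m) = d" using d1 by blast
    then obtain s e where "hits (prun x m) s e" "d = pval s e" using prio_cases[of "prun x m"] \<open>d \<noteq> 0\<close> by auto
    then show "\<exists>m\<ge>n. \<exists>y\<in>{..<N} \<times> {..<N}. hits (prun x m) (fst y) (snd y) \<and> pval (fst y) (snd y) = d"
      using m(1) by (intro exI[of _ m] conjI bexI[of _ "(s, e)"]) (auto simp: hits_def)
  qed
  from pigeonhole_io[OF _ this] obtain s e where se: "\<forall>n. \<exists>m\<ge>n. hits (prun x m) s e \<and> pval s e = d" by auto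
  then have h: "\<forall>n. \<exists>m\<ge>n. hits (prun x m) s e" and d: "d = pval s e" by blast+
  obtain m where "hits (prun x m) s e" using h by blast
  then have c: "s < N" "e < N" "mul e e = e" "mul s e = s" by (auto simp: hits_def)
  obtain \<kappa> :: "nat \<Rightarrow> nat" and f g where \<kappa>: "strict_mono \<kappa>" "0 < \<kappa> 0" "\<And>i. sg x 0 (\<kappa> i) = s" "\<And>i j. i < j \<Longrightarrow> sg x (\<kappa> i) (\<kappa> j) = f"
    "mul f f = f" "mul s f = s" "f < N" "g < N" "f = mul e g" by (rule hits_fac[OF x h]) (rule that; assumption)
  have "pval s f \<le> d" using fac_hits[OF \<kappa>(1-6) c(1) \<kappa>(7)] by (intro bound) blast
  then have "rk f \<le> rk e" unfolding d pval_def by (auto split: if_splits)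
  then have "rk e = rk f" using rk_mono(1)[OF c(2) \<kappa>(7,8,9) c(3)] by simp
  then obtain h where h: "h < N" "e = mul f h" using rk_mono(2)[OF c(2) \<kappa>(7,8,9) c(3)] by blast
  have "ac (mul s (om e)) = ac (mul s (om f))"
    by (rule R_equiv_acc[OF c(1,2) \<kappa>(7,8) h(1) c(3) \<kappa>(5,9) h(2) \<kappa>(6)])
  moreover have "fac mul x s f" unfolding fac_def using \<kappa>(1-4) by (intro exI[of _ \<kappa>]) auto
  ultimately have "even d \<longleftrightarrow> val x" unfolding d pval_def using val_fac[of x s f] x by auto
  then show ?thesis using d1 d2 by blast
qed

end

section \<open>The synthesis game\<close>

text \<open>In round \<open>n\<close> Input chooses \<open>a < p\<close> and then Output chooses \<open>b < q\<close>; even rounds determine the letters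
  at a breakpoint, odd rounds the letters on the following open interval. A configuration consists of a state
  of the parity automaton, the kind of the current round (\<open>True\<close>: breakpoint), a flag, and the letters of the
  previous round. When the flag is set and Input repeats its letter, Output has to repeat its letter as well.\<close>

type_synonym conf = "pstate \<times> bool \<times> bool \<times> nat \<times> nat"

definition legal :: "conf \<Rightarrow> nat \<Rightarrow> nat \<Rightarrow> bool" where
  "legal c a b = (case c of (k, pnt, fl, la, lo) \<Rightarrow> fl \<and> a = la \<longrightarrow> b = lo)"

text \<open>\<open>pnt\<close> is the kind of the round just played. After a gap the flag is set, so
  a repetition at the next breakpoint binds Output. After a breakpoint it stays set only if the
  input has just been repeated there; a change at the breakpoint releases Output for the following
  gap.\<close>

definition flag :: "bool \<Rightarrow> bool \<Rightarrow> bool" where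
  "flag pnt b \<longleftrightarrow> (if pnt then b else True)"

locale synth_game = walg +
  fixes lab :: "bool \<Rightarrow> nat \<Rightarrow> nat \<Rightarrow> nat" and p q :: nat
  assumes lab_closed: "a < p \<Longrightarrow> b < q \<Longrightarrow> lab pnt a b < N" and p_pos: "0 < p" and q_pos: "0 < q"
begin

definition nxt :: "conf \<Rightarrow> nat \<Rightarrow> nat \<Rightarrow> conf" where
  "nxt c a b = (case c of (k, pnt, fl, la, lo) \<Rightarrow> (pstep k (lab pnt a b), \<not> pnt, flag pnt (fl \<and> a = la), a, b))"

text \<open>The previous letters are dummies, since the flag is not set; they are proper letters so
  that \<open>c0\<close> belongs to the finite set \<open>Cf\<close>.\<close>

definition c0 :: conf where "c0 = ((None, {}), True, False, 0, 0)"

definition PS :: "pstate set" where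
  "PS = insert None (Some ` {..<N}) \<times> Pow ({..<N} \<times> {..<N} \<times> Pow {..<N})"

definition Cf :: "conf set" where "Cf = PS \<times> UNIV \<times> UNIV \<times> {..<p} \<times> {..<q}"

lemma finite_Cf: "finite Cf"
  unfolding Cf_def PS_def by auto

lemma pstep_PS: "k \<in> PS \<Longrightarrow> x < N \<Longrightarrow> pstep k x \<in> PS"
  unfolding PS_def pstep_def by (force simp: mul_closed split: option.splits)

lemma c0_Cf: "c0 \<in> Cf"
  unfolding Cf_def c0_def PS_def using p_pos q_pos by auto

lemma nxt_Cf: "c \<in> Cf \<Longrightarrow> a < p \<Longrightarrow> b < q \<Longrightarrow> nxt c a b \<in> Cf"
  unfolding Cf_def nxt_def using pstep_PS lab_closed by auto

definition play :: "(nat \<Rightarrow> conf) \<Rightarrow> (nat \<Rightarrow> nat) \<Rightarrow> (nat \<Rightarrow> nat) \<Rightarrow> bool" where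
  "play c \<alpha> \<gamma> \<longleftrightarrow> c 0 = c0 \<and> (\<forall>n. c (Suc n) = nxt (c n) (\<alpha> n) (\<gamma> n) \<and> \<alpha> n < p \<and> \<gamma> n < q)"

abbreviation labs :: "(nat \<Rightarrow> nat) \<Rightarrow> (nat \<Rightarrow> nat) \<Rightarrow> nat \<Rightarrow> nat" where
  "labs \<alpha> \<gamma> n \<equiv> lab (even n) (\<alpha> n) (\<gamma> n)"

lemma play_Cf: "play c \<alpha> \<gamma> \<Longrightarrow> c n \<in> Cf"
  by (induction n) (auto simp: play_def c0_Cf nxt_Cf)

lemma play_conf: "play c \<alpha> \<gamma> \<Longrightarrow> fst (c n) = prun (labs \<alpha> \<gamma>) n \<and> fst (snd (c n)) = even n"
proof (induction n)
  case 0 then show ?case by (simp add: play_def c0_def)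
next
  case (Suc n)
  then have "c (Suc n) = nxt (c n) (\<alpha> n) (\<gamma> n)" by (simp add: play_def)
  then show ?case using Suc by (cases "c n") (simp add: nxt_def)
qed

fun gE :: "conf + conf \<times> nat \<Rightarrow> conf + conf \<times> nat \<Rightarrow> bool" where
  "gE (Inl c) (Inr (c', a)) \<longleftrightarrow> c' = c \<and> a < p"
| "gE (Inr (c, a)) (Inl c') \<longleftrightarrow> (\<exists>b<q. legal c a b \<and> c' = nxt c a b)"
| "gE _ _ \<longleftrightarrow> False"

fun gown :: "conf + conf \<times> nat \<Rightarrow> bool" where
  "gown (Inl _) = False" | "gown (Inr _) = True"

text \<open>Priority 0 at the vertices of Output leaves the greatest recurring priority unchanged,
  because every other vertex of a play is an \<open>Inl\<close> vertex.\<close>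

fun gpr :: "conf + conf \<times> nat \<Rightarrow> nat" where
  "gpr (Inl c) = prio (fst c)" | "gpr (Inr _) = 0"

definition gV :: "(conf + conf \<times> nat) set" where
  "gV = Inl ` Cf \<union> Inr ` (Cf \<times> {..<p})"

sublocale G: parity_game gE gown gpr .

lemma last_legal: "legal c a (snd (snd (snd (snd c))))"
  by (cases c) (simp add: legal_def)

lemma last_less: "c \<in> Cf \<Longrightarrow> snd (snd (snd (snd c))) < q"
  by (auto simp: Cf_def)

lemma gV_total: "G.total gV"
  unfolding G.total_def
proof
  fix v assume v: "v \<in> gV"
  show "\<exists>u\<in>gV. gE v u"
  proof (cases v)
    case (Inl c) then show ?thesis using v p_pos by (intro bexI[of _ "Inr (c, 0)"]) (auto simp: gV_def)
  next
    case (Inr y)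
    obtain c a where y: "y = (c, a)" by fastforce
    then have ca: "c \<in> Cf" "a < p" using v Inr by (auto simp: gV_def)
    show ?thesis
      using ca last_legal[of c a] last_less[OF ca(1)] nxt_Cf[OF ca last_less[OF ca(1)]] Inr y
      by (intro bexI[of _ "Inl (nxt c a (snd (snd (snd (snd c)))))"]) (auto simp: gV_def)
  qed
qed

definition gpath :: "(nat \<Rightarrow> conf) \<Rightarrow> (nat \<Rightarrow> nat) \<Rightarrow> nat \<Rightarrow> conf + conf \<times> nat" where
  "gpath c \<alpha> n = (if even n then Inl (c (n div 2)) else Inr (c (n div 2), \<alpha> (n div 2)))"

lemma gpath_good:
  assumes pl: "play c \<alpha> \<gamma>" and g: "pgood gpr i (gpath c \<alpha>)"
  shows "val (labs \<alpha> \<gamma>) \<longleftrightarrow> i"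
proof -
  let ?x = "labs \<alpha> \<gamma>"
  have x: "?x k < N" for k using pl lab_closed by (simp add: play_def)
  obtain d where d: "\<forall>n. \<exists>m\<ge>n. prio (prun ?x m) = d" "\<exists>n. \<forall>m\<ge>n. prio (prun ?x m) \<le> d" "even d \<longleftrightarrow> val ?x"
    using prio_val[of ?x] x by blast
  from g obtain d' n' where d': "even d' \<longleftrightarrow> i" "\<forall>n. \<exists>m\<ge>n. gpr (gpath c \<alpha> m) = d'" "\<forall>m\<ge>n'. gpr (gpath c \<alpha> m) \<le> d'"
    unfolding pgood_def by (elim exE conjE) (rule that)
  have gp: "gpr (gpath c \<alpha> (2 * m)) = prio (prun ?x m)" for m
    using play_conf[OF pl, of m] by (simp add: gpath_def)
  have "d \<le> d'"
  proof -
    obtain m where m: "m \<ge> n'" "prio (prun ?x m) = d" using d(1) by blast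
    then show ?thesis using d'(3)[rule_format, of "2 * m"] gp[of m] by simp
  qed
  moreover have "d' \<le> d"
  proof -
    obtain n where n: "\<forall>m\<ge>n. prio (prun ?x m) \<le> d" using d(2) by blast
    obtain m where m: "m \<ge> 2 * n" "gpr (gpath c \<alpha> m) = d'" using d'(2) by blast
    show ?thesis
    proof (cases "even m")
      case True
      then obtain k where "m = 2 * k" by (elim evenE)
      then show ?thesis using m n gp[of k] by auto
    next
      case False then show ?thesis using m by (simp add: gpath_def)
    qed
  qed
  ultimately show ?thesis using d(3) d'(1) by simp
qed

lemma gpath_path:
  assumes pl: "play c \<alpha> \<gamma>" and leg: "\<And>n. legal (c n) (\<alpha> n) (\<gamma> n)" and W: "G.win gV i W \<sigma>" and c0: "Inl c0 \<in> W"
    and i0: "\<And>n. \<not> i \<Longrightarrow> Inl (c n) \<in> W \<Longrightarrow> Inr (c n, \<alpha> n) = \<sigma> (Inl (c n))"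
    and i1: "\<And>n. i \<Longrightarrow> Inr (c n, \<alpha> n) \<in> W \<Longrightarrow> Inl (c (Suc n)) = \<sigma> (Inr (c n, \<alpha> n))"
  shows "G.path i \<sigma> W (gpath c \<alpha>)"
proof -
  have V: "Inl (c n) \<in> gV" "Inr (c n, \<alpha> n) \<in> gV" for n
    using play_Cf[OF pl, of n] pl by (auto simp: gV_def play_def)
  have E: "gE (Inl (c n)) (Inr (c n, \<alpha> n))" "gE (Inr (c n, \<alpha> n)) (Inl (c (Suc n)))" for n
    using pl leg by (auto simp: play_def)
  have R: "Inr (c n, \<alpha> n) \<in> W" if "Inl (c n) \<in> W" for n
  proof (cases i)
    case True then show ?thesis using W that V E(1) unfolding G.win_def by (metis gown.simps(1))
  next
    case False then show ?thesis using W that i0[OF False that] unfolding G.win_def by (metis gown.simps(1))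
  qed
  have L: "Inl (c (Suc n)) \<in> W" if "Inr (c n, \<alpha> n) \<in> W" for n
  proof (cases i)
    case True then show ?thesis using W that i1[OF True that] unfolding G.win_def by (metis gown.simps(2))
  next
    case False then show ?thesis using W that V E(2) unfolding G.win_def by (metis gown.simps(2))
  qed
  have A: "Inl (c n) \<in> W" for n
  proof (induction n)
    case 0 then show ?case using c0 pl by (simp add: play_def)
  qed (use R L in blast)
  show ?thesis unfolding G.path_def
  proof
    fix n
    show "gpath c \<alpha> n \<in> W \<and> gE (gpath c \<alpha> n) (gpath c \<alpha> (Suc n)) \<and>
        (gown (gpath c \<alpha> n) = i \<longrightarrow> gpath c \<alpha> (Suc n) = \<sigma> (gpath c \<alpha> n))"
    proof (cases "even n")
      case True
      then obtain k where "n = 2 * k" by (elim evenE)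
      then show ?thesis using A[of k] E(1)[of k] i0[of k] by (simp add: gpath_def)
    next
      case False
      then obtain k where "n = 2 * k + 1" by (elim oddE)
      then show ?thesis using A[of k] R[of k] E(2)[of k] i1[of k] by (simp add: gpath_def)
    qed
  qed
qed

theorem determined:
  "(\<exists>out. (\<forall>c\<in>Cf. \<forall>a<p. out c a < q \<and> legal c a (out c a)) \<and>
      (\<forall>c \<alpha> \<gamma>. play c \<alpha> \<gamma> \<longrightarrow> (\<forall>n. \<gamma> n = out (c n) (\<alpha> n)) \<longrightarrow> val (labs \<alpha> \<gamma>))) \<or>
   (\<exists>inp. (\<forall>c\<in>Cf. inp c < p) \<and>
      (\<forall>c \<alpha> \<gamma>. play c \<alpha> \<gamma> \<longrightarrow> (\<forall>n. \<alpha> n = inp (c n)) \<longrightarrow> (\<forall>n. legal (c n) (\<alpha> n) (\<gamma> n)) \<longrightarrow> \<not> val (labs \<alpha> \<gamma>)))"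
proof -
  have "finite gV" unfolding gV_def using finite_Cf by auto
  from G.positional_determinacy[OF this gV_total] obtain W \<sigma> \<tau>
    where W: "W \<subseteq> gV" "G.win gV True W \<sigma>" "G.win gV False (gV - W) \<tau>" by blast
  have c0V: "Inl c0 \<in> gV" using c0_Cf by (simp add: gV_def)
  show ?thesis
  proof (cases "Inl c0 \<in> W")
    case True
    \<comment> \<open>The strategy \<open>\<sigma>\<close> binds only inside \<open>W\<close>, but
      \<open>out\<close> has to be legal at every configuration; repeating the last letter always
      is.\<close>
    define ok where "ok c a b \<longleftrightarrow> b < q \<and> legal c a b \<and> (Inr (c, a) \<in> W \<longrightarrow> Inl (nxt c a b) = \<sigma> (Inr (c, a)))" for c a b
    have ex: "\<exists>b. ok c a b" if "c \<in> Cf" for c a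
    proof (cases "Inr (c, a) \<in> W")
      case True
      then have "gE (Inr (c, a)) (\<sigma> (Inr (c, a)))" using W(2) unfolding G.win_def by (metis gown.simps(2))
      then show ?thesis unfolding ok_def by (cases "\<sigma> (Inr (c, a))") auto
    next
      case False then show ?thesis unfolding ok_def using last_legal last_less[OF that] by blast
    qed
    define out where "out c a = (SOME b. ok c a b)" for c a
    have ok: "ok c a (out c a)" if "c \<in> Cf" for c a unfolding out_def using ex[OF that] by (rule someI_ex)
    show ?thesis
    proof (intro disjI1 exI[of _ out] conjI allI impI ballI)
      show "out c a < q" "legal c a (out c a)" if "c \<in> Cf" for c a using ok[OF that] by (auto simp: ok_def)
      fix c \<alpha> \<gamma> assume pl: "play c \<alpha> \<gamma>" and g: "\<forall>n. \<gamma> n = out (c n) (\<alpha> n)"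
      have okn: "ok (c n) (\<alpha> n) (\<gamma> n)" for n using ok[OF play_Cf[OF pl]] g by simp
      have "G.path True \<sigma> W (gpath c \<alpha>)"
        using okn pl by (intro gpath_path[OF pl _ W(2) True]) (auto simp: ok_def play_def)
      then have "pgood gpr True (gpath c \<alpha>)" using W(2) unfolding G.win_def by blast
      from gpath_good[OF pl this] show "val (labs \<alpha> \<gamma>)" by simp
    qed
  next
    case False
    then have F: "Inl c0 \<in> gV - W" using c0V by simp
    define ok where "ok c a \<longleftrightarrow> a < p \<and> (Inl c \<in> gV - W \<longrightarrow> Inr (c, a) = \<tau> (Inl c))" for c a
    have ex: "\<exists>a. ok c a" for c
    proof (cases "Inl c \<in> gV - W")
      case True
      then have "gE (Inl c) (\<tau> (Inl c))" using W(3) unfolding G.win_def by (metis gown.simps(1))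
      then show ?thesis unfolding ok_def by (cases "\<tau> (Inl c)") auto
    next
      case False then show ?thesis unfolding ok_def using p_pos by blast
    qed
    define inp where "inp c = (SOME a. ok c a)" for c
    have ok: "ok c (inp c)" for c unfolding inp_def using ex by (rule someI_ex)
    show ?thesis
    proof (intro disjI2 exI[of _ inp] conjI allI impI ballI)
      show "inp c < p" for c using ok by (auto simp: ok_def)
      fix c \<alpha> \<gamma> assume pl: "play c \<alpha> \<gamma>" and a: "\<forall>n. \<alpha> n = inp (c n)" and l: "\<forall>n. legal (c n) (\<alpha> n) (\<gamma> n)"
      have "G.path False \<tau> (gV - W) (gpath c \<alpha>)"
        using ok a l pl by (intro gpath_path[OF pl _ W(3) F]) (auto simp: ok_def play_def)
      then have "pgood gpr False (gpath c \<alpha>)" using W(3) unfolding G.win_def by blast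
      from gpath_good[OF pl this] show "\<not> val (labs \<alpha> \<gamma>)" by simp
    qed
  qed
qed

end

section \<open>Certificates for unsolvability\<close>

text \<open>Legality of a whole play in terms of the letter sequences alone. Index
  \<open>2 * i + 1\<close> is a gap, \<open>2 * i + 2\<close> the breakpoint that ends it,
  \<open>2 * i + 3\<close> the next gap. In this form it can be verified for the samples of an
  operator, where there are no configurations.\<close>

definition obeys :: "(nat \<Rightarrow> nat) \<Rightarrow> (nat \<Rightarrow> nat) \<Rightarrow> bool" where
  "obeys \<alpha> \<gamma> \<longleftrightarrow> (\<forall>i. \<alpha> (2 * i + 2) = \<alpha> (2 * i + 1) \<longrightarrow> \<gamma> (2 * i + 2) = \<gamma> (2 * i + 1) \<and>
     (\<alpha> (2 * i + 3) = \<alpha> (2 * i + 2) \<longrightarrow> \<gamma> (2 * i + 3) = \<gamma> (2 * i + 2)))"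

definition fl_at :: "(nat \<Rightarrow> nat) \<Rightarrow> nat \<Rightarrow> bool" where
  "fl_at \<alpha> n \<longleftrightarrow> 0 < n \<and> (odd n \<longrightarrow> 1 < n \<and> \<alpha> (n - 1) = \<alpha> (n - 2))"

lemma fl_at_Suc: "fl_at \<alpha> (Suc n) \<longleftrightarrow> flag (even n) (fl_at \<alpha> n \<and> \<alpha> n = \<alpha> (n - 1))"
  by (cases n) (auto simp: fl_at_def flag_def)

lemma obeys_iff: "obeys \<alpha> \<gamma> \<longleftrightarrow> (\<forall>n. fl_at \<alpha> n \<and> \<alpha> n = \<alpha> (n - 1) \<longrightarrow> \<gamma> n = \<gamma> (n - 1))"
proof
  assume o: "obeys \<alpha> \<gamma>"
  show "\<forall>n. fl_at \<alpha> n \<and> \<alpha> n = \<alpha> (n - 1) \<longrightarrow> \<gamma> n = \<gamma> (n - 1)"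
  proof (intro allI impI, elim conjE)
    fix n assume f: "fl_at \<alpha> n" "\<alpha> n = \<alpha> (n - 1)"
    consider "n = 0" | "n = 1" | i where "n = 2 * i + 2" | i where "n = 2 * i + 3"
    proof (cases "even n")
      case True then show ?thesis using that by (metis add.commute add_2_eq_Suc' dvdE mult_Suc_right nat.exhaust mult_0_right)
    next
      case False
      then obtain k where "n = 2 * k + 1" by (elim oddE)
      then show ?thesis using that(2) that(4)[of "k - 1"] by (cases k) auto
    qed
    then show "\<gamma> n = \<gamma> (n - 1)"
    proof cases
      case 1 then show ?thesis using f by (simp add: fl_at_def)
    next
      case 2 then show ?thesis using f by (simp add: fl_at_def)
    next
      case (3 i) then show ?thesis using f o[unfolded obeys_def, rule_format, of i] by simp
    next
      case (4 i)
      then have e: "n - 1 = 2 * i + 2" "n - 2 = 2 * i + 1" "odd n" by auto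
      then show ?thesis using f o[unfolded obeys_def, rule_format, of i] unfolding fl_at_def e using 4 by simp
    qed
  qed
next
  assume r: "\<forall>n. fl_at \<alpha> n \<and> \<alpha> n = \<alpha> (n - 1) \<longrightarrow> \<gamma> n = \<gamma> (n - 1)"
  show "obeys \<alpha> \<gamma>" unfolding obeys_def
  proof (intro allI impI conjI)
    fix i assume a: "\<alpha> (2 * i + 2) = \<alpha> (2 * i + 1)"
    show "\<gamma> (2 * i + 2) = \<gamma> (2 * i + 1)" using r[rule_format, of "2 * i + 2"] a by (simp add: fl_at_def)
    assume b: "\<alpha> (2 * i + 3) = \<alpha> (2 * i + 2)"
    show "\<gamma> (2 * i + 3) = \<gamma> (2 * i + 2)" 
    proof -
      have e: "2 * i + 3 - 1 = 2 * i + 2" "2 * i + 3 - 2 = 2 * i + 1" by auto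
      show ?thesis using r[rule_format, of "2 * i + 3"] a b unfolding fl_at_def e by simp
    qed
  qed
qed

context synth_game begin

lemma play_fields:
  assumes "play c \<alpha> \<gamma>"
  shows "fst (snd (snd (c n))) = fl_at \<alpha> n \<and> (0 < n \<longrightarrow> snd (snd (snd (c n))) = (\<alpha> (n - 1), \<gamma> (n - 1)))"
proof (induction n)
  case 0 then show ?case using assms by (simp add: play_def c0_def fl_at_def)
next
  case (Suc n)
  obtain k pnt fl la lo where c: "c n = (k, pnt, fl, la, lo)" by (metis prod.exhaust)
  have "pnt = even n" using play_conf[OF assms, of n] c by simp
  moreover have "c (Suc n) = nxt (c n) (\<alpha> n) (\<gamma> n)" using assms by (simp add: play_def)
  moreover have "fl \<and> \<alpha> n = la \<longleftrightarrow> fl_at \<alpha> n \<and> \<alpha> n = \<alpha> (n - 1)"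
    using Suc c by (cases "n = 0") (auto simp: fl_at_def)
  ultimately show ?case using c by (simp add: nxt_def fl_at_Suc)
qed

lemma play_legal: "play c \<alpha> \<gamma> \<Longrightarrow> (\<forall>n. legal (c n) (\<alpha> n) (\<gamma> n)) \<longleftrightarrow> obeys \<alpha> \<gamma>"
proof -
  assume pl: "play c \<alpha> \<gamma>"
  have "legal (c n) (\<alpha> n) (\<gamma> n) \<longleftrightarrow> (fl_at \<alpha> n \<and> \<alpha> n = \<alpha> (n - 1) \<longrightarrow> \<gamma> n = \<gamma> (n - 1))" for n
    using play_fields[OF pl, of n] by (cases "c n"; cases "n = 0") (auto simp: legal_def fl_at_def)
  then show ?thesis unfolding obeys_iff by blast
qed

end

text \<open>The first component is an arbitrary identifier. The others are what the rules of the
  game depend on, so a certificate can be checked without the parity automaton.\<close>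

definition node :: "nat \<Rightarrow> bool \<Rightarrow> bool \<Rightarrow> nat \<Rightarrow> nat \<Rightarrow> nat" where
  "node i pnt fl a b = ce (i, pnt, fl, a, b)"

definition nd_pnt :: "nat \<Rightarrow> bool" where "nd_pnt m \<longleftrightarrow> fst (prod_decode (snd (prod_decode m))) = 1"
definition nd_fl :: "nat \<Rightarrow> bool" where "nd_fl m \<longleftrightarrow> fst (prod_decode (snd (prod_decode (snd (prod_decode m))))) = 1"
definition nd_la :: "nat \<Rightarrow> nat" where "nd_la m = fst (prod_decode (snd (prod_decode (snd (prod_decode (snd (prod_decode m)))))))"
definition nd_lo :: "nat \<Rightarrow> nat" where "nd_lo m = snd (prod_decode (snd (prod_decode (snd (prod_decode (snd (prod_decode m)))))))"

lemma nd_node [simp]: "nd_pnt (node i pnt fl a b) = pnt" "nd_fl (node i pnt fl a b) = fl" "nd_la (node i pnt fl a b) = a" "nd_lo (node i pnt fl a b) = b"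
  by (auto simp: node_def nd_pnt_def nd_fl_def nd_la_def nd_lo_def ce_prod_def ce_bool_def ce_nat_def)

definition tri :: "nat \<Rightarrow> nat \<Rightarrow> nat \<Rightarrow> nat" where "tri m s m' = prod_encode (m, prod_encode (s, m'))"

lemma tri_eq [simp]: "tri m s m' = tri k t k' \<longleftrightarrow> m = k \<and> s = t \<and> m' = k'"
  by (simp add: tri_def)

text \<open>A finite graph on which Input can play: \<open>nd\<close> is the set of nodes, and
  \<open>tri m s m'\<close> in \<open>P\<close> stands for a path from \<open>m\<close> to
  \<open>m'\<close> with product \<open>s\<close>. Every node offers a letter such that all legal
  replies lead on inside the graph, \<open>P\<close> is closed under composition, and every lasso
  from \<open>m0\<close> is rejected. By \<open>bit_tri_less\<close> the components of members of
  \<open>P\<close> are below \<open>P\<close>, hence the bounds.\<close>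

definition cert :: "nat \<Rightarrow> nat \<Rightarrow> (nat \<Rightarrow> nat \<Rightarrow> nat) \<Rightarrow> (nat \<Rightarrow> nat) \<Rightarrow> (nat \<Rightarrow> bool) \<Rightarrow> (bool \<Rightarrow> nat \<Rightarrow> nat \<Rightarrow> nat) \<Rightarrow>
    nat \<Rightarrow> nat \<Rightarrow> nat \<Rightarrow> bool" where
  "cert p q mul om ac lab m0 nd P \<longleftrightarrow> bit nd m0 \<and> nd_pnt m0 \<and> \<not> nd_fl m0 \<and>
     (\<forall>m<nd. bit nd m \<longrightarrow> (\<exists>a<p. \<forall>b<q. (nd_fl m \<and> a = nd_la m \<longrightarrow> b = nd_lo m) \<longrightarrow>
        (\<exists>m'<nd. bit nd m' \<and> (nd_pnt m' = (\<not> nd_pnt m)) \<and> (nd_fl m' = (nd_pnt m \<longrightarrow> nd_fl m \<and> a = nd_la m)) \<and>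
           nd_la m' = a \<and> nd_lo m' = b \<and> bit P (tri m (lab (nd_pnt m) a b) m')))) \<and>
     (\<forall>m<P. \<forall>s<P. \<forall>m'<P. \<forall>t<P. \<forall>m''<P. bit P (tri m s m') \<and> bit P (tri m' t m'') \<longrightarrow> bit P (tri m (mul s t) m'')) \<and>
     (\<forall>m<P. \<forall>s<P. \<forall>e<P. bit P (tri m0 s m) \<and> bit P (tri m e m) \<longrightarrow> \<not> ac (mul s (om e)))"

lemma bit_tri_less: "bit P (tri m s m') \<Longrightarrow> m < P \<and> s < P \<and> m' < P"
  using bit_imp_less[of P "tri m s m'"] prod_encode_ge(1)[of m "prod_encode (s, m')"] prod_encode_ge(2)[of "prod_encode (s, m')" m]
    prod_encode_ge(1)[of s m'] prod_encode_ge(2)[of m' s] by (simp add: tri_def)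

context walg begin

text \<open>\<open>resp\<close> is an arbitrary causal reply, with no finiteness assumed. Input
  follows the certificate; some node recurs, and Ramsey's theorem on its visits turns the infinite
  play into a lasso \<open>s e e ...\<close> through that node, which is rejected.\<close>

lemma cert_defeats:
  assumes C: "cert p q mul om ac lab m0 nd P"
    and lab: "\<And>pnt a b. a < p \<Longrightarrow> b < q \<Longrightarrow> lab pnt a b < N"
    and resp: "\<And>\<alpha> n. (\<And>n. \<alpha> n < p) \<Longrightarrow> resp \<alpha> n < q" "\<And>\<alpha>. (\<And>n. \<alpha> n < p) \<Longrightarrow> obeys \<alpha> (resp \<alpha>)"
    and causal: "\<And>\<alpha> \<beta> n. (\<And>n. \<alpha> n < p) \<Longrightarrow> (\<And>n. \<beta> n < p) \<Longrightarrow> (\<And>i. i \<le> n \<Longrightarrow> \<alpha> i = \<beta> i) \<Longrightarrow> resp \<alpha> n = resp \<beta> n"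
  shows "\<exists>\<alpha>. (\<forall>n. \<alpha> n < p) \<and> \<not> val (\<lambda>n. lab (even n) (\<alpha> n) (resp \<alpha> n))"
proof -
  define good where "good m a b m' \<longleftrightarrow> bit nd m' \<and> (nd_pnt m' = (\<not> nd_pnt m)) \<and> (nd_fl m' = (nd_pnt m \<longrightarrow> nd_fl m \<and> a = nd_la m)) \<and>
           nd_la m' = a \<and> nd_lo m' = b \<and> bit P (tri m (lab (nd_pnt m) a b) m')" for m a b m'
  have m0: "bit nd m0" "nd_pnt m0" "\<not> nd_fl m0" using C unfolding cert_def by simp_all
  have c2: "\<forall>m<nd. bit nd m \<longrightarrow> (\<exists>a<p. \<forall>b<q. (nd_fl m \<and> a = nd_la m \<longrightarrow> b = nd_lo m) \<longrightarrow> (\<exists>m'<nd. good m a b m'))"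
    using C unfolding cert_def good_def by (elim conjE)
  have c3: "\<forall>m<P. \<forall>s<P. \<forall>m'<P. \<forall>t<P. \<forall>m''<P. bit P (tri m s m') \<and> bit P (tri m' t m'') \<longrightarrow> bit P (tri m (mul s t) m'')"
    using C unfolding cert_def by (elim conjE)
  have c4: "\<forall>m<P. \<forall>s<P. \<forall>e<P. bit P (tri m0 s m) \<and> bit P (tri m e m) \<longrightarrow> \<not> ac (mul s (om e))"
    using C unfolding cert_def by (elim conjE)
  have "\<exists>a<p. \<forall>b<q. (nd_fl m \<and> a = nd_la m \<longrightarrow> b = nd_lo m) \<longrightarrow> (\<exists>m'. good m a b m')" if "bit nd m" for m
    using c2[rule_format, OF bit_imp_less[OF that] that] by blast
  then obtain ch where ch: "\<And>m. bit nd m \<Longrightarrow> ch m < p"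
    "\<And>m b. bit nd m \<Longrightarrow> b < q \<Longrightarrow> (nd_fl m \<and> ch m = nd_la m \<longrightarrow> b = nd_lo m) \<Longrightarrow> \<exists>m'. good m (ch m) b m'"
    by metis
  define nx where "nx m a b = (SOME m'. good m a b m')" for m a b
  have nx: "good m (ch m) b (nx m (ch m) b)" if "bit nd m" "b < q" "nd_fl m \<and> ch m = nd_la m \<longrightarrow> b = nd_lo m" for m b
    unfolding nx_def using ch(2)[OF that] by (rule someI_ex)
  have p: "ch m0 < p" using ch(1) m0 by blast
  \<comment> \<open>\<open>resp\<close> expects a complete input while only a finite part is known.
    The list so far is continued with the next letter forever; by causality the reply in question
    does not depend on the continuation. The test \<open>a < p\<close> keeps the sequence in range
    before the invariant on nodes is available.\<close>
  define ext where "ext xs a i = (if i < length xs then xs ! i else if a < p then a else ch m0)" for xs :: "nat list" and a i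
  define st where "st = rec_nat ([], m0) (\<lambda>n (xs, m). (xs @ [ext xs (ch m) n], nx m (ch m) (resp (ext xs (ch m)) n)))"
  have st0: "st 0 = ([], m0)" by (simp add: st_def)
  have stS: "st (Suc n) = (fst (st n) @ [ext (fst (st n)) (ch (snd (st n))) n],
      nx (snd (st n)) (ch (snd (st n))) (resp (ext (fst (st n)) (ch (snd (st n)))) n))" for n
    by (simp add: st_def case_prod_beta)
  define \<alpha> where "\<alpha> n = fst (st (Suc n)) ! n" for n
  have len: "length (fst (st n)) = n" for n by (induction n) (auto simp: st0 stS)
  have pre: "fst (st n) ! i = \<alpha> i" if "i < n" for n i
    using that
  proof (induction n)
    case (Suc n) then show ?case by (cases "i = n") (auto simp: \<alpha>_def stS len nth_append)
  qed simp
  have ap: "\<alpha> n < p" for n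
    using p by (induction n rule: less_induct) (auto simp: \<alpha>_def stS len nth_append ext_def)
  have \<alpha>n: "\<alpha> n = (if ch (snd (st n)) < p then ch (snd (st n)) else ch m0)" for n
    by (simp add: \<alpha>_def stS len nth_append ext_def)
  define \<gamma> where "\<gamma> = resp \<alpha>"
  have rs: "resp (ext (fst (st n)) (ch (snd (st n)))) n = \<gamma> n" for n
    unfolding \<gamma>_def
  proof (rule causal)
    show "ext (fst (st n)) (ch (snd (st n))) i < p" for i using p ap pre[of i n] by (auto simp: ext_def len)
    show "ext (fst (st n)) (ch (snd (st n))) i = \<alpha> i" if "i \<le> n" for i
      using that pre[of i n] \<alpha>n[of n] by (auto simp: ext_def len)
  qed (rule ap)
  define m where "m n = snd (st n)" for n
  have mS: "m (Suc n) = nx (m n) (ch (m n)) (\<gamma> n)" for n unfolding m_def stS rs by simp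
  have gq: "\<gamma> n < q" for n unfolding \<gamma>_def using resp(1) ap by blast
  have ob: "obeys \<alpha> \<gamma>" unfolding \<gamma>_def using resp(2) ap by blast
  have inv: "bit nd (m n) \<and> nd_pnt (m n) = even n \<and> nd_fl (m n) = fl_at \<alpha> n \<and> (0 < n \<longrightarrow> nd_la (m n) = \<alpha> (n - 1) \<and> nd_lo (m n) = \<gamma> (n - 1))
      \<and> \<alpha> n = ch (m n) \<and> good (m n) (\<alpha> n) (\<gamma> n) (m (Suc n))" for n
  proof (induction n)
    case 0
    have "\<alpha> 0 = ch (m 0)" using \<alpha>n[of 0] p by (simp add: m_def st0)
    moreover have m00: "m 0 = m0" by (simp add: m_def st0)
    moreover have "good m0 (ch m0) (\<gamma> 0) (nx m0 (ch m0) (\<gamma> 0))" using m0 gq by (intro nx) auto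
    ultimately show ?case using m0 mS[of 0] by (simp add: fl_at_def)
  next
    case (Suc n)
    have g: "good (m n) (\<alpha> n) (\<gamma> n) (m (Suc n))" using Suc by (elim conjE)
    have pn: "nd_pnt (m n) = even n" using Suc by (elim conjE)
    have fn: "nd_fl (m n) = fl_at \<alpha> n" using Suc by (elim conjE)
    have ln: "0 < n \<longrightarrow> nd_la (m n) = \<alpha> (n - 1) \<and> nd_lo (m n) = \<gamma> (n - 1)" using Suc by (elim conjE)
    have 1: "bit nd (m (Suc n))" "nd_pnt (m (Suc n)) = even (Suc n)" "nd_la (m (Suc n)) = \<alpha> n" "nd_lo (m (Suc n)) = \<gamma> n"
      using g pn unfolding good_def by simp_all
    have "nd_fl (m (Suc n)) = (even n \<longrightarrow> fl_at \<alpha> n \<and> \<alpha> n = nd_la (m n))" using g pn fn unfolding good_def by simp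
    then have 2: "nd_fl (m (Suc n)) = fl_at \<alpha> (Suc n)"
      using ln by (cases "n = 0") (auto simp: fl_at_Suc flag_def fl_at_def)
    have 3: "\<alpha> (Suc n) = ch (m (Suc n))" using \<alpha>n[of "Suc n"] ch(1)[OF 1(1)] by (simp add: m_def)
    have "nd_fl (m (Suc n)) \<and> ch (m (Suc n)) = nd_la (m (Suc n)) \<longrightarrow> \<gamma> (Suc n) = nd_lo (m (Suc n))"
      using ob[unfolded obeys_iff, rule_format, of "Suc n"] 1 2 3 by simp
    from nx[OF 1(1) gq this] have "good (m (Suc n)) (\<alpha> (Suc n)) (\<gamma> (Suc n)) (m (Suc (Suc n)))" using mS 3 by simp
    then show ?case using 1 2 3 by simp
  qed
  define x where "x n = lab (even n) (\<alpha> n) (\<gamma> n)" for n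
  have xN: "x n < N" for n unfolding x_def using lab ap gq by blast
  have edge: "bit P (tri (m n) (x n) (m (Suc n)))" for n 
  proof -
    have 1: "good (m n) (\<alpha> n) (\<gamma> n) (m (Suc n))" using inv[of n] by (elim conjE)
    have 2: "nd_pnt (m n) = even n" using inv[of n] by (elim conjE)
    show ?thesis using 1 2 by (simp add: good_def x_def)
  qed
  have trans: "bit P (tri a (mul s t) c)" if "bit P (tri a s b)" "bit P (tri b t c)" for a s b t c
    using c3 that bit_tri_less[OF that(1)] bit_tri_less[OF that(2)] by blast
  have sgP: "bit P (tri (m i) (sg x i j) (m j))" if "i < j" for i j
    using that by (induction rule: seg_induct) (auto simp: edge seg_Suc intro: trans)
  have "\<forall>n. \<exists>k\<ge>n. \<exists>y\<in>{k. bit nd k}. m k = y" using inv by auto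
  moreover have "finite {k. bit nd k}" using bit_imp_less finite_nat_set_iff_bounded by blast
  ultimately obtain y where y: "\<forall>n. \<exists>k\<ge>n. m k = y" using pigeonhole_io[of "{k. bit nd k}" "\<lambda>k y. m k = y"] by blast
  have "infinite {k. m k = y}"
    unfolding infinite_nat_iff_unbounded_le using y by auto
  then obtain \<kappa> :: "nat \<Rightarrow> nat" and s e where \<kappa>: "strict_mono \<kappa>" "0 < \<kappa> 0" "\<And>i. \<kappa> i \<in> {k. m k = y}" "\<And>i. sg x 0 (\<kappa> i) = s"
    "\<And>i j. i < j \<Longrightarrow> sg x (\<kappa> i) (\<kappa> j) = e"
    by (rule ramsey_fac[where x = x]) (use xN in auto)
  have "\<kappa> 0 < \<kappa> 1" using \<kappa>(1) by (simp add: strict_mono_less)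
  then have e: "bit P (tri m0 s y)" "bit P (tri y e y)"
    using sgP[OF \<kappa>(2)] sgP[of "\<kappa> 0" "\<kappa> 1"] \<kappa>(3)[of 0] \<kappa>(3)[of 1] \<kappa>(4)[of 0] \<kappa>(5)[of 0 1] by (auto simp: m_def st0)
  then have "\<not> ac (mul s (om e))" using c4 bit_tri_less[OF e(1)] bit_tri_less[OF e(2)] by blast
  moreover have "fac mul x s e" unfolding fac_def using \<kappa>(1,2,4,5) by (intro exI[of _ \<kappa>]) auto
  ultimately have "\<not> val x" using val_fac[of x s e] xN by blast
  then show ?thesis using ap unfolding x_def \<gamma>_def by blast
qed

end


lemma finite_set_code: assumes "finite S" obtains n :: nat where "\<And>k. bit n k \<longleftrightarrow> k \<in> S"
proof -
  obtain B where "\<And>k. k \<in> S \<Longrightarrow> k < B" using assms finite_nat_set_iff_bounded by auto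
  then show ?thesis using that[of "bset B (\<lambda>k. k \<in> S)"] by (auto simp: bit_bset)
qed

context synth_game begin

text \<open>Conversely, a winning strategy of Input yields a certificate: its edges are the types of the finite
  parts of plays that are consistent with the strategy.\<close>

fun iterc :: "(conf \<Rightarrow> nat) \<Rightarrow> conf \<Rightarrow> (nat \<Rightarrow> nat) \<Rightarrow> nat \<Rightarrow> conf" where
  "iterc f c \<beta> 0 = c"
| "iterc f c \<beta> (Suc n) = nxt (iterc f c \<beta> n) (f (iterc f c \<beta> n)) (\<beta> n)"

definition xlab :: "(conf \<Rightarrow> nat) \<Rightarrow> conf \<Rightarrow> (nat \<Rightarrow> nat) \<Rightarrow> nat \<Rightarrow> nat" where
  "xlab f c \<beta> n = lab (fst (snd (iterc f c \<beta> n))) (f (iterc f c \<beta> n)) (\<beta> n)"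

definition okb :: "(conf \<Rightarrow> nat) \<Rightarrow> conf \<Rightarrow> (nat \<Rightarrow> nat) \<Rightarrow> nat \<Rightarrow> bool" where
  "okb f c \<beta> n \<longleftrightarrow> legal (iterc f c \<beta> n) (f (iterc f c \<beta> n)) (\<beta> n)"

definition reach :: "(conf \<Rightarrow> nat) \<Rightarrow> conf \<Rightarrow> nat \<Rightarrow> conf \<Rightarrow> bool" where
  "reach f c s c' \<longleftrightarrow> (\<exists>\<beta> k. 0 < k \<and> (\<forall>n. \<beta> n < q) \<and> (\<forall>n<k. okb f c \<beta> n) \<and> c' = iterc f c \<beta> k \<and> s = sg (xlab f c \<beta>) 0 k)"

lemma iterc_cong: "(\<And>i. i < n \<Longrightarrow> \<beta> i = \<beta>' i) \<Longrightarrow> iterc f c \<beta> n = iterc f c \<beta>' n"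
  by (induction n) auto

lemma iterc_add: "iterc f c \<beta> (k + n) = iterc f (iterc f c \<beta> k) (\<lambda>i. \<beta> (k + i)) n"
  by (induction n) auto

lemma xlab_add: "xlab f c \<beta> (k + n) = xlab f (iterc f c \<beta> k) (\<lambda>i. \<beta> (k + i)) n"
  by (simp add: xlab_def iterc_add)

lemma okb_add: "okb f c \<beta> (k + n) = okb f (iterc f c \<beta> k) (\<lambda>i. \<beta> (k + i)) n"
  by (simp add: okb_def iterc_add)

lemma xlab_cong: "(\<And>i. i \<le> n \<Longrightarrow> \<beta> i = \<beta>' i) \<Longrightarrow> xlab f c \<beta> n = xlab f c \<beta>' n"
  using iterc_cong[of n \<beta> \<beta>' f c] by (simp add: xlab_def)

lemma okb_cong: "(\<And>i. i \<le> n \<Longrightarrow> \<beta> i = \<beta>' i) \<Longrightarrow> okb f c \<beta> n = okb f c \<beta>' n"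
  using iterc_cong[of n \<beta> \<beta>' f c] by (simp add: okb_def)

context
  fixes f :: "conf \<Rightarrow> nat" assumes f: "\<And>c. c \<in> Cf \<Longrightarrow> f c < p"
begin

lemma iterc_Cf: "c \<in> Cf \<Longrightarrow> (\<And>n. \<beta> n < q) \<Longrightarrow> iterc f c \<beta> n \<in> Cf"
  by (induction n) (auto simp: nxt_Cf f)

lemma xlab_less: "c \<in> Cf \<Longrightarrow> (\<And>n. \<beta> n < q) \<Longrightarrow> xlab f c \<beta> n < N"
  unfolding xlab_def by (intro lab_closed f iterc_Cf) auto

lemma reach_closed: "c \<in> Cf \<Longrightarrow> reach f c s c' \<Longrightarrow> s < N \<and> c' \<in> Cf"
  unfolding reach_def using iterc_Cf[of c] seg_closed[of 0 _ "xlab f c _"] xlab_less[of c] by metis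

lemma reach_step: "c \<in> Cf \<Longrightarrow> b < q \<Longrightarrow> legal c (f c) b \<Longrightarrow> reach f c (lab (fst (snd c)) (f c) b) (nxt c (f c) b)"
  unfolding reach_def by (intro exI[of _ "\<lambda>_. b"] exI[of _ 1]) (auto simp: okb_def xlab_def seg_def)

lemma seg_shift': "0 < n \<Longrightarrow> sg x k (k + n) = sg (\<lambda>i. x (k + i)) 0 n"
  using seg_shift[of 0 n mul x k] by (simp add: add.commute)

lemma reach_trans:
  assumes c: "c \<in> Cf" and 1: "reach f c s c'" and 2: "reach f c' t c''"
  shows "reach f c (mul s t) c''"
proof -
  obtain \<beta> k where b: "0 < k" "\<And>n. \<beta> n < q" "\<And>n. n < k \<Longrightarrow> okb f c \<beta> n" "c' = iterc f c \<beta> k" "s = sg (xlab f c \<beta>) 0 k"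
    using 1 unfolding reach_def by blast
  obtain \<beta>' k' where b': "0 < k'" "\<And>n. \<beta>' n < q" "\<And>n. n < k' \<Longrightarrow> okb f c' \<beta>' n" "c'' = iterc f c' \<beta>' k'" "t = sg (xlab f c' \<beta>') 0 k'"
    using 2 unfolding reach_def by blast
  define \<delta> where "\<delta> n = (if n < k then \<beta> n else \<beta>' (n - k))" for n
  have d: "\<delta> n < q" for n using b(2) b'(2) by (simp add: \<delta>_def)
  have it: "iterc f c \<delta> k = c'" unfolding b(4) by (rule iterc_cong) (simp add: \<delta>_def)
  have dk: "(\<lambda>i. \<delta> (k + i)) = \<beta>'" by (simp add: \<delta>_def fun_eq_iff)
  have "sg (xlab f c \<delta>) 0 k = s" unfolding b(5) using b(1)
    by (intro seg_cong xlab_cong) (auto simp: \<delta>_def)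
  moreover have "sg (xlab f c \<delta>) k (k + k') = t"
    using seg_shift'[OF b'(1), of "xlab f c \<delta>" k] by (simp add: xlab_add it dk b'(5))
  ultimately have "sg (xlab f c \<delta>) 0 (k + k') = mul s t"
    using seg_split[of 0 k "k + k'" "xlab f c \<delta>"] b(1) b'(1) xlab_less[OF c, of \<delta>] d by auto
  moreover have "okb f c \<delta> n" if "n < k + k'" for n
  proof (cases "n < k")
    case True then show ?thesis using b(3)[OF True] okb_cong[of n \<delta> \<beta> f c] by (simp add: \<delta>_def)
  next
    case False
    then obtain j where j: "n = k + j" using le_Suc_ex not_less by blast
    then show ?thesis using b'(3)[of j] that by (simp add: okb_add it dk)
  qed
  moreover have "iterc f c \<delta> (k + k') = c''" by (simp add: iterc_add it dk b'(4))
  ultimately show ?thesis unfolding reach_def using b(1) d by (intro exI[of _ \<delta>] exI[of _ "k + k'"]) auto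
qed

text \<open>The strategy depends on the configuration only, so the replies of Output along the loop
  can be repeated forever. The resulting play is consistent with the winning strategy and has the
  factorisation \<open>s e e ...\<close>.\<close>

lemma reach_lasso:
  assumes w: "\<And>c \<alpha> \<gamma>. play c \<alpha> \<gamma> \<Longrightarrow> (\<forall>n. \<alpha> n = f (c n)) \<Longrightarrow> (\<forall>n. legal (c n) (\<alpha> n) (\<gamma> n)) \<Longrightarrow> \<not> val (labs \<alpha> \<gamma>)"
    and 1: "reach f c0 s c" and 2: "reach f c e c"
  shows "\<not> ac (mul s (om e))"
proof -
  obtain \<beta> k where b: "0 < k" "\<And>n. \<beta> n < q" "\<And>n. n < k \<Longrightarrow> okb f c0 \<beta> n" "c = iterc f c0 \<beta> k" "s = sg (xlab f c0 \<beta>) 0 k"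
    using 1 unfolding reach_def by blast
  obtain \<beta>' k' where b': "0 < k'" "\<And>n. \<beta>' n < q" "\<And>n. n < k' \<Longrightarrow> okb f c \<beta>' n" "c = iterc f c \<beta>' k'" "e = sg (xlab f c \<beta>') 0 k'"
    using 2 unfolding reach_def by blast
  define \<delta> where "\<delta> n = (if n < k then \<beta> n else \<beta>' ((n - k) mod k'))" for n
  define \<rho> where "\<rho> n = \<beta>' (n mod k')" for n
  have d: "\<delta> n < q" for n using b(2) b'(2) by (simp add: \<delta>_def)
  have it: "iterc f c0 \<delta> k = c" unfolding b(4) by (rule iterc_cong) (simp add: \<delta>_def)
  have dk: "(\<lambda>i. \<delta> (k + i)) = \<rho>" by (simp add: \<delta>_def \<rho>_def fun_eq_iff)
  have rr: "(\<lambda>j. \<rho> (i * k' + j)) = \<rho>" for i by (simp add: \<rho>_def fun_eq_iff)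
  have lp: "iterc f c \<rho> (i * k') = c" for i
  proof (induction i)
    case (Suc i)
    have "iterc f c \<rho> (i * k' + k') = iterc f c \<rho> k'" by (simp add: iterc_add Suc rr)
    also have "\<dots> = iterc f c \<beta>' k'" by (rule iterc_cong) (simp add: \<rho>_def)
    finally show ?case using b'(4) by (simp add: add.commute)
  qed simp
  have lpj: "okb f c \<rho> (i * k' + j) = okb f c \<rho> j" "xlab f c \<rho> (i * k' + j) = xlab f c \<rho> j" for i j
    by (simp_all add: okb_add xlab_add lp rr)
  have okr: "okb f c \<rho> n" for n
  proof -
    have "okb f c \<rho> n = okb f c \<rho> (n mod k')" using lpj(1)[of "n div k'" "n mod k'"] by simp
    also have "\<dots> = okb f c \<beta>' (n mod k')"
      by (rule okb_cong) (use b'(1) in \<open>auto simp: \<rho>_def dest!: le_less_trans[OF _ mod_less_divisor[of k' n]]\<close>)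
    finally show ?thesis using b'(1,3) by simp
  qed
  have okd: "okb f c0 \<delta> n" for n
  proof (cases "n < k")
    case True then show ?thesis using b(3)[OF True] okb_cong[of n \<delta> \<beta> f c0] by (simp add: \<delta>_def)
  next
    case False
    then obtain j where j: "n = k + j" using le_Suc_ex not_less by blast
    then show ?thesis using okr[of j] by (simp add: okb_add it dk)
  qed
  define cc where "cc = iterc f c0 \<delta>"
  have cC: "cc n \<in> Cf" for n unfolding cc_def using iterc_Cf[OF c0_Cf] d by blast
  have pl: "play cc (\<lambda>n. f (cc n)) \<delta>" unfolding play_def using d f cC by (simp add: cc_def)
  have "\<not> val (labs (\<lambda>n. f (cc n)) \<delta>)"
    using okd by (intro w[OF pl]) (auto simp: okb_def cc_def)
  moreover have "labs (\<lambda>n. f (cc n)) \<delta> = xlab f c0 \<delta>"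
    using play_conf[OF pl] by (simp add: xlab_def cc_def fun_eq_iff)
  moreover have "fac mul (xlab f c0 \<delta>) s e"
    unfolding fac_def
  proof (intro exI[of _ "\<lambda>i. k + i * k'"] conjI allI)
    show "strict_mono (\<lambda>i. k + i * k')" using b'(1) by (simp add: strict_mono_Suc_iff)
    show "0 < k + 0 * k'" using b(1) by simp
    show "sg (xlab f c0 \<delta>) 0 (k + 0 * k') = s" unfolding b(5) using b(1)
      by (auto intro!: seg_cong xlab_cong simp: \<delta>_def)
    fix i
    have "sg (xlab f c0 \<delta>) (k + i * k') (k + i * k' + k') = sg (\<lambda>j. xlab f c0 \<delta> (k + i * k' + j)) 0 k'"
      by (rule seg_shift'[OF b'(1)])
    also have "(\<lambda>j. xlab f c0 \<delta> (k + i * k' + j)) = xlab f c \<rho>"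
      by (simp add: add.assoc xlab_add[of f c0 \<delta> k] it dk lpj fun_eq_iff)
    also have "sg (xlab f c \<rho>) 0 k' = e" unfolding b'(5) using b'(1)
      by (intro seg_cong xlab_cong) (auto simp: \<rho>_def)
    finally show "sg (xlab f c0 \<delta>) (k + i * k') (k + Suc i * k') = e" by (simp add: algebra_simps)
  qed
  ultimately show ?thesis using val_fac[of "xlab f c0 \<delta>" s e] xlab_less[OF c0_Cf, of \<delta>] d by auto
qed

lemma cert_exists:
  assumes w: "\<And>c \<alpha> \<gamma>. play c \<alpha> \<gamma> \<Longrightarrow> (\<forall>n. \<alpha> n = f (c n)) \<Longrightarrow> (\<forall>n. legal (c n) (\<alpha> n) (\<gamma> n)) \<Longrightarrow> \<not> val (labs \<alpha> \<gamma>)"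
  shows "\<exists>m0 nd P. cert p q mul om ac lab m0 nd P"
proof -
  \<comment> \<open>The number of the configuration serves as the identifier, which makes
    \<open>en\<close> injective on \<open>Cf\<close>.\<close>
  define en where "en c = (case c of (k, pnt, fl, la, lo) \<Rightarrow> node (to_nat_on Cf c) pnt fl la lo)" for c :: conf
  have en: "nd_pnt (en c) = fst (snd c)" "nd_fl (en c) = fst (snd (snd c))" "nd_la (en c) = fst (snd (snd (snd c)))"
    "nd_lo (en c) = snd (snd (snd (snd c)))" for c by (cases c; simp add: en_def)+
  have inj: "c = c'" if "en c = en c'" "c \<in> Cf" "c' \<in> Cf" for c c'
  proof -
    have "to_nat_on Cf c = to_nat_on Cf c'"
      using that(1) by (cases c, cases c') (auto simp: en_def node_def ce_prod_def ce_nat_def ce_bool_def)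
    then show ?thesis using that(2,3) to_nat_on_inj[OF countable_finite[OF finite_Cf]] by blast
  qed
  obtain nd :: nat where nd: "\<And>k. bit nd k \<longleftrightarrow> k \<in> en ` Cf" using finite_set_code[of "en ` Cf"] finite_Cf by blast
  define Ps where "Ps = {tri (en c) s (en c') | c s c'. c \<in> Cf \<and> reach f c s c'}"
  have "Ps \<subseteq> (\<lambda>(c, s, c'). tri (en c) s (en c')) ` (Cf \<times> {..<N} \<times> Cf)"
    unfolding Ps_def using reach_closed by force
  then have "finite Ps" using finite_Cf by (auto intro: finite_subset)
  then obtain P :: nat where P: "\<And>k. bit P k \<longleftrightarrow> k \<in> Ps" using finite_set_code by blast
  have Pt: "bit P (tri m s m') \<longleftrightarrow> (\<exists>c c'. m = en c \<and> m' = en c' \<and> c \<in> Cf \<and> reach f c s c')" for m s m'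
    unfolding P Ps_def by auto
  have "cert p q mul om ac lab (en c0) nd P"
    unfolding cert_def
  proof (intro conjI allI impI)
    show "bit nd (en c0)" using nd c0_Cf by blast
    show "nd_pnt (en c0)" "\<not> nd_fl (en c0)" by (simp_all add: en c0_def)
  next
    fix m assume "bit nd m"
    then obtain c where c: "c \<in> Cf" "m = en c" using nd by blast
    show "\<exists>a<p. \<forall>b<q. (nd_fl m \<and> a = nd_la m \<longrightarrow> b = nd_lo m) \<longrightarrow>
        (\<exists>m'<nd. bit nd m' \<and> (nd_pnt m' = (\<not> nd_pnt m)) \<and> (nd_fl m' = (nd_pnt m \<longrightarrow> nd_fl m \<and> a = nd_la m)) \<and>
           nd_la m' = a \<and> nd_lo m' = b \<and> bit P (tri m (lab (nd_pnt m) a b) m'))"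
    proof (rule exI[of _ "f c"], intro conjI allI impI)
      show "f c < p" using f c by blast
      fix b assume b: "b < q" "nd_fl m \<and> f c = nd_la m \<longrightarrow> b = nd_lo m"
      then have l: "legal c (f c) b" by (cases c) (auto simp: legal_def c(2) en)
      have n: "nxt c (f c) b \<in> Cf" using nxt_Cf f c b by blast
      have "bit nd (en (nxt c (f c) b))" using n nd by blast
      moreover have "bit P (tri m (lab (nd_pnt m) (f c) b) (en (nxt c (f c) b)))"
        unfolding Pt using reach_step[OF c(1) b(1) l] c
        by (intro exI[of _ c] exI[of _ "nxt c (f c) b"]) (simp add: en)
      ultimately show "\<exists>m'<nd. bit nd m' \<and> (nd_pnt m' = (\<not> nd_pnt m)) \<and> (nd_fl m' = (nd_pnt m \<longrightarrow> nd_fl m \<and> f c = nd_la m)) \<and>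
           nd_la m' = f c \<and> nd_lo m' = b \<and> bit P (tri m (lab (nd_pnt m) (f c) b) m')"
        using bit_imp_less by (intro exI[of _ "en (nxt c (f c) b)"]) (cases c, auto simp: en nxt_def flag_def c(2))
    qed
  next
    fix m s m' t m'' assume "bit P (tri m s m') \<and> bit P (tri m' t m'')"
    then obtain c c' d d' where "m = en c" "m' = en c'" "c \<in> Cf" "reach f c s c'" "m' = en d" "m'' = en d'" "d \<in> Cf" "reach f d t d'"
      unfolding Pt by blast
    moreover from this have "c' = d" using inj[of c' d] reach_closed by auto
    ultimately show "bit P (tri m (mul s t) m'')" unfolding Pt using reach_trans by blast
  next
    fix m s e assume "bit P (tri (en c0) s m) \<and> bit P (tri m e m)"
    then obtain c c' d d' where h: "en c0 = en c" "m = en c'" "c \<in> Cf" "reach f c s c'" "m = en d" "m = en d'" "d \<in> Cf" "reach f d e d'"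
      unfolding Pt by blast
    have "c = c0" using inj[of c0 c] h c0_Cf by auto
    moreover have "c' = d" "d' = d" using inj h reach_closed by auto
    ultimately have r: "reach f c0 s d" "reach f d e d" using h by auto
    show "\<not> ac (mul s (om e))" by (rule reach_lasso[OF _ r]) (use w in blast)
  qed
  then show ?thesis by blast
qed

end

end

section \<open>Definable operators are invariant under automorphisms of the time line\<close>

locale autom =
  fixes \<rho> \<rho>' :: "real \<Rightarrow> real"
  assumes inv1 [simp]: "\<rho> (\<rho>' x) = x" and inv2 [simp]: "\<rho>' (\<rho> x) = x"
    and mono1: "x < y \<Longrightarrow> \<rho> x < \<rho> y" and zero [simp]: "\<rho> 0 = 0"
begin

lemma less1 [simp]: "\<rho> x < \<rho> y \<longleftrightarrow> x < y"
  using mono1 by (metis less_irrefl less_trans linorder_neqE)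

lemma less2 [simp]: "\<rho>' x < \<rho>' y \<longleftrightarrow> x < y"
  by (metis inv1 less1)

lemma zero' [simp]: "\<rho>' 0 = 0"
  by (metis inv2 zero)

lemma nonneg1 [simp]: "0 \<le> \<rho> x \<longleftrightarrow> 0 \<le> x"
  using less1[of x 0] by (simp add: not_less[symmetric])

lemma nonneg2 [simp]: "0 \<le> \<rho>' x \<longleftrightarrow> 0 \<le> x"
  using less2[of x 0] by (simp add: not_less[symmetric])

lemma pcw_comp: "pcw f a b \<Longrightarrow> pcw (\<lambda>t. f (\<rho> t)) (\<rho>' a) (\<rho>' b)"
proof (induction rule: pcw.induct)
  case (base a b c)
  show ?case
  proof (rule pcw.base)
    fix t assume "\<rho>' a < t" "t < \<rho>' b"
    then have "a < \<rho> t" "\<rho> t < b" using less1[of "\<rho>' a" t] less1[of t "\<rho>' b"] by auto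
    then show "f (\<rho> t) = c" by (rule base)
  qed (use base in simp)
qed (rule pcw.step)

lemma fv_comp: "finitely_variable f \<Longrightarrow> finitely_variable (\<lambda>t. f (\<rho> t))"
  unfolding finitely_variable_iff
proof (intro allI impI)
  fix a b :: real assume f: "\<forall>a b. 0 \<le> a \<longrightarrow> a < b \<longrightarrow> pcw f a b" and ab: "0 \<le> a" "a < b"
  have "pcw f (\<rho> a) (\<rho> b)" using f ab by simp
  from pcw_comp[OF this] show "pcw (\<lambda>t. f (\<rho> t)) a b" by simp
qed

lemma bool_signals_image: "A \<in> bool_signals \<Longrightarrow> \<rho>' ` A \<in> bool_signals"
proof -
  assume A: "A \<in> bool_signals"
  have "t \<in> \<rho>' ` A \<longleftrightarrow> \<rho> t \<in> A" for t by (metis image_iff inv1 inv2)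
  then show ?thesis using A fv_comp[of "\<lambda>t. t \<in> A"] by (auto simp: bool_signals_def)
qed

end

lemma autom_sym: "autom \<rho> \<rho>' \<Longrightarrow> autom \<rho>' \<rho>"
proof -
  assume a: "autom \<rho> \<rho>'"
  interpret autom \<rho> \<rho>' by fact
  show ?thesis by unfold_locales auto
qed

context autom begin

lemma sat_image: "sat (\<lambda>t. \<rho> (u t)) (\<lambda>X. \<rho> ` w X) \<phi> \<longleftrightarrow> sat u w \<phi>"
proof (induction \<phi> arbitrary: u w)
  case (In X t)
  have "\<rho> (u t) \<in> \<rho> ` w X \<longleftrightarrow> u t \<in> w X" by (metis image_iff inv2)
  then show ?case by simp
next
  case (Ex1 t \<phi>)
  have u: "(\<lambda>x. \<rho> (u x))(t := \<rho> r) = (\<lambda>x. \<rho> ((u(t := r)) x))" for r by auto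
  have "(\<exists>r\<ge>0. sat ((\<lambda>x. \<rho> (u x))(t := r)) (\<lambda>X. \<rho> ` w X) \<phi>) \<longleftrightarrow> (\<exists>r\<ge>0. sat ((\<lambda>x. \<rho> (u x))(t := \<rho> r)) (\<lambda>X. \<rho> ` w X) \<phi>)"
    by (metis inv1 nonneg2 nonneg1)
  also have "\<dots> \<longleftrightarrow> (\<exists>r\<ge>0. sat (u(t := r)) w \<phi>)" unfolding u Ex1 ..
  finally show ?case by auto
next
  case (All1 t \<phi>)
  have u: "(\<lambda>x. \<rho> (u x))(t := \<rho> r) = (\<lambda>x. \<rho> ((u(t := r)) x))" for r by auto
  have "(\<forall>r\<ge>0. sat ((\<lambda>x. \<rho> (u x))(t := r)) (\<lambda>X. \<rho> ` w X) \<phi>) \<longleftrightarrow> (\<forall>r\<ge>0. sat ((\<lambda>x. \<rho> (u x))(t := \<rho> r)) (\<lambda>X. \<rho> ` w X) \<phi>)"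
    by (metis inv1 nonneg2 nonneg1)
  also have "\<dots> \<longleftrightarrow> (\<forall>r\<ge>0. sat (u(t := r)) w \<phi>)" unfolding u All1 ..
  finally show ?case by auto
next
  case (Ex2 Z \<phi>)
  have w: "(\<lambda>X. \<rho> ` w X)(Z := \<rho> ` A) = (\<lambda>X. \<rho> ` ((w(Z := A)) X))" for A by (rule ext) simp
  have i: "\<rho> ` \<rho>' ` A = A" for A by (simp add: image_image)
  interpret S: autom \<rho>' \<rho> by (rule autom_sym) unfold_locales
  have "(\<exists>A\<in>bool_signals. sat (\<lambda>t. \<rho> (u t)) ((\<lambda>X. \<rho> ` w X)(Z := A)) \<phi>) \<longleftrightarrow>
      (\<exists>A\<in>bool_signals. sat (\<lambda>t. \<rho> (u t)) ((\<lambda>X. \<rho> ` w X)(Z := \<rho> ` A)) \<phi>)"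
    by (metis i bool_signals_image S.bool_signals_image)
  also have "\<dots> \<longleftrightarrow> (\<exists>A\<in>bool_signals. sat u (w(Z := A)) \<phi>)" unfolding w Ex2 ..
  finally show ?case by simp
next
  case (All2 Z \<phi>)
  have w: "(\<lambda>X. \<rho> ` w X)(Z := \<rho> ` A) = (\<lambda>X. \<rho> ` ((w(Z := A)) X))" for A by (rule ext) simp
  have i: "\<rho> ` \<rho>' ` A = A" for A by (simp add: image_image)
  interpret S: autom \<rho>' \<rho> by (rule autom_sym) unfold_locales
  have "(\<forall>A\<in>bool_signals. sat (\<lambda>t. \<rho> (u t)) ((\<lambda>X. \<rho> ` w X)(Z := A)) \<phi>) \<longleftrightarrow>
      (\<forall>A\<in>bool_signals. sat (\<lambda>t. \<rho> (u t)) ((\<lambda>X. \<rho> ` w X)(Z := \<rho> ` A)) \<phi>)"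
    by (metis i bool_signals_image S.bool_signals_image)
  also have "\<dots> \<longleftrightarrow> (\<forall>A\<in>bool_signals. sat u (w(Z := A)) \<phi>)" unfolding w All2 ..
  finally show ?case by simp
qed auto

lemma component_comp: "component (\<lambda>t. X (\<rho>' t)) i = \<rho> ` component X i"
proof (intro set_eqI iffI)
  fix t assume "t \<in> component (\<lambda>t. X (\<rho>' t)) i"
  then have "\<rho>' t \<in> component X i" by (simp add: component_def)
  then show "t \<in> \<rho> ` component X i" by (metis image_eqI inv1)
qed (auto simp: component_def)

lemma FVsig_sat_comp: "FVsig_sat p U (\<lambda>t. X (\<rho>' t)) (\<lambda>t. Y (\<rho>' t)) \<longleftrightarrow> FVsig_sat p U X Y"
proof -
  have "(\<lambda>i. if i < ceillog2 p then component (\<lambda>t. X (\<rho>' t)) i else component (\<lambda>t. Y (\<rho>' t)) (i - ceillog2 p)) =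
    (\<lambda>i. \<rho> ` (if i < ceillog2 p then component X i else component Y (i - ceillog2 p)))"
    by (rule ext) (simp add: component_comp)
  then show ?thesis unfolding FVsig_sat_def using sat_image[of "\<lambda>_. 0"] by simp
qed

lemma signals_comp: "X \<in> signals p \<Longrightarrow> (\<lambda>t. X (\<rho>' t)) \<in> signals p"
proof -
  interpret S: autom \<rho>' \<rho> by (rule autom_sym) unfold_locales
  assume "X \<in> signals p"
  then show ?thesis using S.fv_comp[of X] unfolding signals_def PiE_def extensional_def by auto
qed

text \<open>Truth of formulas is invariant under automorphisms and the graph of \<open>F\<close> is
  defined by a formula; so the transported output is the output of the transported input.\<close>

lemma operator_comp:
  assumes "defines_operator p q U F" "C_operator p q F" "X \<in> signals p"
  shows "F (\<lambda>t. X (\<rho>' t)) = (\<lambda>t. F X (\<rho>' t))"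
proof -
  have FX: "F X \<in> signals q" using assms by (auto simp: C_operator_def)
  then have "FVsig_sat p U X (F X)" using assms by (auto simp: defines_operator_def)
  then have "FVsig_sat p U (\<lambda>t. X (\<rho>' t)) (\<lambda>t. F X (\<rho>' t))" by (simp add: FVsig_sat_comp)
  then show ?thesis using assms(1) signals_comp[OF assms(3)] signals_comp[OF FX] by (auto simp: defines_operator_def)
qed

end

section \<open>Local automorphisms and the constancy of outputs\<close>

definition pl :: "real \<Rightarrow> real \<Rightarrow> real \<Rightarrow> real \<Rightarrow> real \<Rightarrow> real" where
  "pl s t a b x = (if x \<le> s \<or> t \<le> x then x else if x \<le> a then s + (x - s) * ((b - s) / (a - s))
     else t - (t - x) * ((t - b) / (t - a)))"

lemma pl_range:
  assumes "s < a" "a < t" "s < b" "b < t" "s < x" "x < t"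
  shows "x \<le> a \<Longrightarrow> s < pl s t a b x \<and> pl s t a b x \<le> b" "a < x \<Longrightarrow> b < pl s t a b x \<and> pl s t a b x < t"
proof -
  assume x: "x \<le> a"
  have 0: "pl s t a b x = s + (x - s) * ((b - s) / (a - s))" using assms x by (simp add: pl_def)
  have "0 < (x - s) * ((b - s) / (a - s))" using assms by simp
  moreover have "(x - s) * ((b - s) / (a - s)) \<le> (a - s) * ((b - s) / (a - s))" using assms x by (intro mult_right_mono) auto
  ultimately show "s < pl s t a b x \<and> pl s t a b x \<le> b" unfolding 0 using assms by auto
next
  assume x: "a < x"
  have 0: "pl s t a b x = t - (t - x) * ((t - b) / (t - a))" using assms x by (simp add: pl_def)
  have "0 < (t - x) * ((t - b) / (t - a))" using assms by simp
  moreover have "(t - x) * ((t - b) / (t - a)) < (t - a) * ((t - b) / (t - a))" using assms x by (intro mult_strict_right_mono) auto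
  ultimately show "b < pl s t a b x \<and> pl s t a b x < t" unfolding 0 using assms by auto
qed

text \<open>\<open>pl s t a b\<close> is the identity outside the interval from \<open>s\<close> to
  \<open>t\<close> and moves \<open>a\<close> to \<open>b\<close> inside it, linearly on either side
  of \<open>a\<close>; the inverse moves \<open>b\<close> back to \<open>a\<close> in the same
  way.\<close>

lemma pl_inv:
  assumes "s < a" "a < t" "s < b" "b < t"
  shows "pl s t b a (pl s t a b x) = x"
proof -
  consider "x \<le> s \<or> t \<le> x" | "s < x" "x \<le> a" | "a < x" "x < t" by linarith
  then show ?thesis
  proof cases
    case 1 then show ?thesis by (auto simp: pl_def)
  next
    case 2
    then have r: "s < pl s t a b x \<and> pl s t a b x \<le> b" using pl_range(1)[OF assms, of x] assms by auto
    have "pl s t a b x = s + (x - s) * ((b - s) / (a - s))" using assms 2 by (simp add: pl_def)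
    moreover have "pl s t b a (pl s t a b x) = s + (pl s t a b x - s) * ((a - s) / (b - s))"
      using r assms unfolding pl_def[of s t b a] by auto
    ultimately show ?thesis using assms by simp
  next
    case 3
    then have r: "b < pl s t a b x \<and> pl s t a b x < t" using pl_range(2)[OF assms, of x] assms by auto
    have "pl s t a b x = t - (t - x) * ((t - b) / (t - a))" using assms 3 by (simp add: pl_def)
    moreover have "pl s t b a (pl s t a b x) = t - (t - pl s t a b x) * ((t - a) / (t - b))"
      using r assms unfolding pl_def[of s t b a] by auto
    ultimately show ?thesis using assms by simp
  qed
qed

lemma pl_mono:
  assumes "s < a" "a < t" "s < b" "b < t" "x < y"
  shows "pl s t a b x < pl s t a b y"
proof -
  note r = pl_range[OF assms(1-4)]
  have o: "pl s t a b z = z" if "z \<le> s \<or> t \<le> z" for z using that by (auto simp: pl_def)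
  have i: "s < pl s t a b z \<and> pl s t a b z < t" if "s < z" "z < t" for z
    using r[OF that] assms by (cases "z \<le> a") auto
  consider "x \<le> s \<or> t \<le> x" | "s < x" "x < t" "t \<le> y" | "s < x" "y \<le> a" | "s < x" "x \<le> a" "a < y" "y < t" | "a < x" "y < t"
    using assms(5) by linarith
  then show ?thesis
  proof cases
    case 1
    then show ?thesis using o[of x] o[of y] i[of y] assms by (cases "s < y \<and> y < t") auto
  next
    case 2 then show ?thesis using i[of x] o[of y] by auto
  next
    case 3
    have "(x - s) * ((b - s) / (a - s)) < (y - s) * ((b - s) / (a - s))" using assms by (intro mult_strict_right_mono) auto
    then show ?thesis using 3 assms by (simp add: pl_def)
  next
    case 4 then show ?thesis using r(1)[of x] r(2)[of y] assms by auto
  next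
    case 5
    have "(t - y) * ((t - b) / (t - a)) < (t - x) * ((t - b) / (t - a))" using assms by (intro mult_strict_right_mono) auto
    then show ?thesis using 5 assms by (simp add: pl_def)
  qed
qed

lemma pl_autom: "0 \<le> s \<Longrightarrow> s < a \<Longrightarrow> a < t \<Longrightarrow> s < b \<Longrightarrow> b < t \<Longrightarrow> autom (pl s t a b) (pl s t b a)"
  by unfold_locales (auto simp: pl_inv pl_mono, simp add: pl_def)

text \<open>The automorphism that moves \<open>a\<close> to \<open>b\<close> and is the identity
  outside the interval of constancy fixes \<open>X\<close>; hence it fixes
  \<open>F X\<close>.\<close>

lemma operator_constant:
  assumes D: "defines_operator p q U F" and C: "C_operator p q F" and X: "X \<in> signals p"
    and s: "0 \<le> s" and c: "\<And>x. s < x \<Longrightarrow> x < t \<Longrightarrow> X x = c" and ab: "s < a" "a < t" "s < b" "b < t"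
  shows "F X a = F X b"
proof -
  interpret autom "pl s t a b" "pl s t b a" using pl_autom s ab by blast
  have "X (pl s t b a x) = X x" for x
  proof (cases "s < x \<and> x < t")
    case True
    then have "s < pl s t b a x \<and> pl s t b a x < t"
      using pl_range[OF ab(3,4,1,2), of x] ab by (cases "x \<le> b") auto
    then show ?thesis using c True by auto
  next
    case False then show ?thesis by (auto simp: pl_def)
  qed
  then have "(\<lambda>x. X (pl s t b a x)) = X" by (rule ext)
  then have "F X = (\<lambda>x. F X (pl s t b a x))" using operator_comp[OF D C X] by simp
  then have "F X b = F X (pl s t b a b)" by (rule fun_cong)
  moreover have "pl s t b a b = a" using ab by (simp add: pl_def)
  ultimately show ?thesis by simp
qed

lemma C_operatorD:
  assumes "C_operator p q F" "0 \<le> t" "X \<in> signals p" "Y \<in> signals p" "\<And>x. 0 \<le> x \<Longrightarrow> x \<le> t \<Longrightarrow> X x = Y x"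
  shows "F X t = F Y t"
proof -
  have "\<forall>x\<in>{0..t}. X x = Y x" using assms(5) by simp
  then show ?thesis using assms(1-4) unfolding C_operator_def by blast
qed

text \<open>An automorphism that moves the end point \<open>t\<close> may fail to fix
  \<open>X\<close>, which can change right after \<open>t\<close>. Causality removes the obstacle:
  \<open>Z\<close> continues \<open>X\<close> after \<open>t\<close> with the constant
  \<open>c\<close>, has the same output up to \<open>t\<close>, and is constant on an open interval
  around \<open>t\<close>.\<close>

lemma operator_left:
  assumes D: "defines_operator p q U F" and C: "C_operator p q F" and X: "X \<in> signals p"
    and s: "0 \<le> s" and c: "\<And>x. s < x \<Longrightarrow> x \<le> t \<Longrightarrow> X x = c" and a: "s < a" "a < t"
  shows "F X t = F X a"
proof -
  define Z where "Z x = (if x \<le> t then X x else c)" for x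
  have t: "0 < t" "0 \<le> a" using s a by linarith+
  have cp: "c < p" using c[of t] X a t by (auto simp: signals_def PiE_iff)
  have "pcw Z e f" if "0 \<le> e" "e < f" for e f
  proof -
    have pX: "pcw X e' f'" if "0 \<le> e'" "e' < f'" for e' f' using X that by (auto simp: signals_def finitely_variable_iff)
    consider "f \<le> t" | "t \<le> e" | "e < t" "t < f" by linarith
    then show ?thesis
    proof cases
      case 1 then show ?thesis using that by (intro pcw_cong[OF pX]) (auto simp: Z_def)
    next
      case 2 then show ?thesis using that by (intro pcw.base[of e f Z c]) (auto simp: Z_def)
    next
      case 3
      have "pcw Z e t" using that 3 by (intro pcw_cong[OF pX]) (auto simp: Z_def)
      moreover have "pcw Z t f" using 3 by (intro pcw.base[of t f Z c]) (auto simp: Z_def)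
      ultimately show ?thesis by (rule pcw.step)
    qed
  qed
  then have "finitely_variable Z" by (simp add: finitely_variable_iff)
  then have Z: "Z \<in> signals p" using X cp t by (auto simp: signals_def PiE_def extensional_def Z_def)
  have "F X t = F Z t" "F X a = F Z a"
    using t a by (intro C_operatorD[OF C _ X Z]; simp add: Z_def)+
  moreover have "F Z t = F Z a"
    by (rule operator_constant[OF D C Z s, of "t + 1" c]) (use a c in \<open>auto simp: Z_def\<close>)
  ultimately show ?thesis by simp
qed

section \<open>Signals and plays\<close>

definition lcode :: "nat \<Rightarrow> nat \<Rightarrow> nat \<Rightarrow> nat \<Rightarrow> nat" where
  "lcode p q a b = bset (ceillog2 p + ceillog2 q) (\<lambda>j. if j < ceillog2 p then bit a j else bit b (j - ceillog2 p))"

definition glab :: "alg \<Rightarrow> nat \<Rightarrow> nat \<Rightarrow> bool \<Rightarrow> nat \<Rightarrow> nat \<Rightarrow> nat" where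
  "glab A p q pnt a b = (if pnt then aPT A (lcode p q a b) else aIV A (lcode p q a b))"

lemma lcode_less: "ceillog2 p + ceillog2 q \<le> L \<Longrightarrow> lcode p q a b < 2 ^ L"
  unfolding lcode_def by (rule less_le_trans[OF bset_less]) simp

locale spec =
  fixes p q M :: nat and \<Psi> :: mso
  assumes form: "\<Psi> \<in> formulas p q" and codeM: "code \<Psi> < M" and bitsM: "ceillog2 p + ceillog2 q \<le> 2 * M"
begin

definition "A = alg_of M (code \<Psi>)"

lemma rec: "recogF (2 * M) (aN A) (aPT A) (aIV A) (aMU A) (aOM A) (aAC A) (\<lambda>w. xsat M w \<Psi>)"
  using recog_alg_of[OF codeM] by (simp add: recog_def A_def)

sublocale walg "aN A" "aMU A" "aOM A" "aAC A"
  by (rule recogF_D(1)[OF rec])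

lemma glab_less: "glab A p q pnt a b < aN A"
  unfolding glab_def using recogF_D(2,3)[OF rec] lcode_less[OF bitsM] by simp

text \<open>\<open>recogF\<close> has one term for a breakpoint together with its gap, the game
  treats them as separate rounds; \<open>val_blocks\<close> with blocks of length 2 connects the
  two.\<close>

lemma FVsig_val:
  assumes \<tau>: "breaks \<tau>"
    and X: "\<And>i. X (\<tau> i) = \<alpha> (2 * i)" "\<And>i t. \<tau> i < t \<Longrightarrow> t < \<tau> (Suc i) \<Longrightarrow> X t = \<alpha> (2 * i + 1)"
    and Y: "\<And>i. Y (\<tau> i) = \<gamma> (2 * i)" "\<And>i t. \<tau> i < t \<Longrightarrow> t < \<tau> (Suc i) \<Longrightarrow> Y t = \<gamma> (2 * i + 1)"
  shows "FVsig_sat p \<Psi> X Y \<longleftrightarrow> val (\<lambda>n. glab A p q (even n) (\<alpha> n) (\<gamma> n))"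
proof -
  interpret breaks \<tau> by fact
  let ?c = "ceillog2 p" and ?d = "ceillog2 q"
  define w where "w i = (if i < ?c then component X i else if i < ?c + ?d then component Y (i - ?c) else {})" for i
  have l: "ltr (2 * M) w t = lcode p q (X t) (Y t)" if "0 \<le> t" for t
    by (rule bit_eqI) (use that bitsM in \<open>auto simp: bit_ltr lcode_def bit_bset w_def component_def\<close>)
  define x where "x n = glab A p q (even n) (\<alpha> n) (\<gamma> n)" for n
  have s: "OT (2 * M) (aPT A) (aIV A) (aMU A) w (\<tau> i) (\<tau> (Suc i)) (aIV A (lcode p q (\<alpha> (2 * i + 1)) (\<gamma> (2 * i + 1))))" for i
  proof (rule OT.base)
    fix t assume t: "\<tau> i < t" "t < \<tau> (Suc i)"
    have "0 \<le> \<tau> i" by simp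
    then have "0 \<le> t" using t by linarith
    then show "ltr (2 * M) w t = lcode p q (\<alpha> (2 * i + 1)) (\<gamma> (2 * i + 1))" using l X(2)[OF t] Y(2)[OF t] by simp
  qed (use lcode_less[OF bitsM] in auto)
  have "xsat M w \<Psi> \<longleftrightarrow> val (\<lambda>i. aMU A (aPT A (ltr (2 * M) w (\<tau> i))) (aIV A (lcode p q (\<alpha> (2 * i + 1)) (\<gamma> (2 * i + 1)))))"
    by (rule recogF_D(5)[OF rec \<tau> s])
  also have "(\<lambda>i. aMU A (aPT A (ltr (2 * M) w (\<tau> i))) (aIV A (lcode p q (\<alpha> (2 * i + 1)) (\<gamma> (2 * i + 1))))) =
      (\<lambda>i. sg x (2 * i) (2 * Suc i))"
    using X(1) Y(1) by (auto simp: fun_eq_iff l seg_Suc x_def glab_def)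
  also have "val (\<lambda>i. sg x (2 * i) (2 * Suc i)) \<longleftrightarrow> val x"
    by (rule val_blocks) (auto simp: strict_mono_Suc_iff x_def glab_less)
  finally have "xsat M w \<Psi> \<longleftrightarrow> val x" .
  moreover have "xsat M w \<Psi> \<longleftrightarrow> FVsig_sat p \<Psi> X Y" by (rule xsat_FVsig[OF form codeM]) (auto simp: w_def)
  ultimately show ?thesis by (simp add: x_def[abs_def])
qed

end

section \<open>Signals with breakpoints at the natural numbers\<close>

definition sigl :: "(nat \<Rightarrow> nat) \<Rightarrow> real \<Rightarrow> nat" where
  "sigl \<alpha> t = (if t < 0 then undefined else if t = real (nat \<lfloor>t\<rfloor>) then \<alpha> (2 * nat \<lfloor>t\<rfloor>) else \<alpha> (2 * nat \<lfloor>t\<rfloor> + 1))"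

lemma breaks_real: "breaks real"
  by unfold_locales (auto simp: strict_mono_def bdd_above_def, meson not_le reals_Archimedean2)

lemma sigl_nat: "sigl \<alpha> (real i) = \<alpha> (2 * i)"
  by (simp add: sigl_def)

lemma sigl_between: "real i < t \<Longrightarrow> t < real (Suc i) \<Longrightarrow> sigl \<alpha> t = \<alpha> (2 * i + 1)"
proof -
  assume t: "real i < t" "t < real (Suc i)"
  then have "\<lfloor>t\<rfloor> = int i" by linarith
  then show ?thesis using t by (simp add: sigl_def)
qed

lemma sigl_signal: "(\<And>n. \<alpha> n < p) \<Longrightarrow> sigl \<alpha> \<in> signals p"
proof -
  assume a: "\<And>n. \<alpha> n < p"
  interpret breaks real by (rule breaks_real)
  have "pcw (sigl \<alpha>) (real i) (real (Suc i))" for i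
    by (rule pcw.base[of _ _ _ "\<alpha> (2 * i + 1)"]) (use sigl_between in auto)
  then have "finitely_variable (sigl \<alpha>)" unfolding finitely_variable_iff using pcw_all by blast
  then show ?thesis using a by (auto simp: signals_def PiE_def extensional_def sigl_def)
qed

text \<open>Sampling times: even rounds are the breakpoints, odd rounds the midpoints of the
  gaps.\<close>

definition tm :: "nat \<Rightarrow> real" where "tm n = real n / 2"

context spec begin

text \<open>A definable causal operator, applied to signals with breakpoints at the natural numbers
  and sampled at \<open>tm\<close>, is a causal reply that obeys the repetition rule by
  \<open>operator_left\<close> and \<open>operator_constant\<close>. The samples determine the
  output on every gap, so the play won by the certificate is an input at which \<open>\<Psi>\<close>
  fails.\<close>

theorem cert_sound:
  assumes cert: "cert p q (aMU A) (aOM A) (aAC A) (glab A p q) m0 nd P"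
  shows "\<not> (\<exists>F. C_operator p q F \<and> definable_operator p q F \<and> implements p F \<Psi>)"
proof
  assume "\<exists>F. C_operator p q F \<and> definable_operator p q F \<and> implements p F \<Psi>"
  then obtain F U where C: "C_operator p q F" and D: "defines_operator p q U F" and I: "implements p F \<Psi>"
    unfolding definable_operator_def by blast
  define resp where "resp \<alpha> n = F (sigl \<alpha>) (tm n)" for \<alpha> n
  have FX: "F X \<in> signals q" if "X \<in> signals p" for X using C that by (auto simp: C_operator_def)
  have e: "tm (2 * i) = real i" "real i < tm (2 * i + 1)" "tm (2 * i + 1) < real (Suc i)" for i by (auto simp: tm_def field_simps)
  have "\<exists>\<alpha>. (\<forall>n. \<alpha> n < p) \<and> \<not> val (\<lambda>n. glab A p q (even n) (\<alpha> n) (resp \<alpha> n))"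
  proof (rule cert_defeats[OF cert])
    show "glab A p q pnt a b < aN A" for pnt a b by (rule glab_less)
  next
    fix \<alpha> :: "nat \<Rightarrow> nat" and n assume a: "\<And>n. \<alpha> n < p"
    have "F (sigl \<alpha>) \<in> signals q" by (intro FX sigl_signal a)
    then show "resp \<alpha> n < q" by (auto simp: resp_def signals_def PiE_iff tm_def)
  next
    fix \<alpha> :: "nat \<Rightarrow> nat" assume a: "\<And>n. \<alpha> n < p"
    note S = sigl_signal[of \<alpha>, OF a]
    show "obeys \<alpha> (resp \<alpha>)" unfolding obeys_def
    proof (intro allI impI conjI)
      fix i assume 1: "\<alpha> (2 * i + 2) = \<alpha> (2 * i + 1)"
      have c1: "sigl \<alpha> x = \<alpha> (2 * i + 1)" if "real i < x" "x \<le> real (Suc i)" for x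
        using sigl_between[of i x \<alpha>] sigl_nat[of \<alpha> "Suc i"] 1 that by (cases "x = real (Suc i)") auto
      have "F (sigl \<alpha>) (real (Suc i)) = F (sigl \<alpha>) (tm (2 * i + 1))"
        using e[of i] by (intro operator_left[OF D C S, of "real i" _ "\<alpha> (2 * i + 1)"] c1) auto
      then show "resp \<alpha> (2 * i + 2) = resp \<alpha> (2 * i + 1)" using e(1)[of "Suc i"] by (simp add: resp_def)
      assume 2: "\<alpha> (2 * i + 3) = \<alpha> (2 * i + 2)"
      have c2: "sigl \<alpha> x = \<alpha> (2 * i + 1)" if "real i < x" "x < real (Suc (Suc i))" for x
        using c1[of x] sigl_between[of "Suc i" x \<alpha>] 1 2 that by (cases "x \<le> real (Suc i)") (auto simp: eval_nat_numeral)
      have "F (sigl \<alpha>) (tm (2 * i + 3)) = F (sigl \<alpha>) (tm (2 * i + 2))"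
        by (rule operator_constant[OF D C S, of "real i" "real (Suc (Suc i))" "\<alpha> (2 * i + 1)"])
          (use c2 in \<open>auto simp: tm_def field_simps\<close>)
      then show "resp \<alpha> (2 * i + 3) = resp \<alpha> (2 * i + 2)" by (simp add: resp_def)
    qed
  next
    fix \<alpha> \<beta> :: "nat \<Rightarrow> nat" and n assume a: "\<And>n. \<alpha> n < p" "\<And>n. \<beta> n < p" and eq: "\<And>i. i \<le> n \<Longrightarrow> \<alpha> i = \<beta> i"
    show "resp \<alpha> n = resp \<beta> n" unfolding resp_def
    proof (rule C_operatorD[OF C _ sigl_signal sigl_signal])
      fix x assume x: "0 \<le> x" "x \<le> tm n"
      define k where "k = nat \<lfloor>x\<rfloor>"
      have k: "real k \<le> x" "x < real (Suc k)" using x(1) unfolding k_def by linarith+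
      show "sigl \<alpha> x = sigl \<beta> x"
      proof (cases "x = real k")
        case True
        then have "2 * k \<le> n" using x(2) by (simp add: tm_def)
        then show ?thesis using True by (simp add: sigl_nat eq)
      next
        case False
        then have "2 * k < n" using x(2) k by (simp add: tm_def)
        then show ?thesis using False k eq[of "2 * k + 1"] sigl_between[of k x \<alpha>] sigl_between[of k x \<beta>] by simp
      qed
    qed (use a in \<open>auto simp: tm_def\<close>)
  qed
  then obtain \<alpha> where a: "\<And>n. \<alpha> n < p" "\<not> val (\<lambda>n. glab A p q (even n) (\<alpha> n) (resp \<alpha> n))" by blast
  note S = sigl_signal[of \<alpha>, OF a(1)]
  have "FVsig_sat p \<Psi> (sigl \<alpha>) (F (sigl \<alpha>)) \<longleftrightarrow> val (\<lambda>n. glab A p q (even n) (\<alpha> n) (resp \<alpha> n))"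
  proof (rule FVsig_val[OF breaks_real])
    show "F (sigl \<alpha>) (real i) = resp \<alpha> (2 * i)" for i using e(1)[of i] by (simp add: resp_def)
    show "F (sigl \<alpha>) t = resp \<alpha> (2 * i + 1)" if "real i < t" "t < real (Suc i)" for i t
      unfolding resp_def
      by (rule operator_constant[OF D C S, of "real i" "real (Suc i)" "\<alpha> (2 * i + 1)"])
        (use sigl_between e(2,3)[of i] that in auto)
  qed (use sigl_nat sigl_between in auto)
  then show False using I S a(2) by (auto simp: implements_def)
qed

end

definition is_cert :: "nat \<Rightarrow> nat \<Rightarrow> nat \<Rightarrow> nat \<Rightarrow> bool" where
  "is_cert p q \<psi> k \<longleftrightarrow> (let A = alg_of (p + q + \<psi> + 1) \<psi> in
     cert p q (aMU A) (aOM A) (aAC A) (glab A p q) (fst (prod_decode k)) (fst (prod_decode (snd (prod_decode k))))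
       (snd (prod_decode (snd (prod_decode k)))))"

lemma cmpf_lcode: "cmpf p \<Longrightarrow> cmpf q \<Longrightarrow> cmpf a \<Longrightarrow> cmpf b \<Longrightarrow> cmpf (\<lambda>z. lcode (p z) (q z) (a z) (b z))"
proof -
  assume a: "cmpf p" "cmpf q" "cmpf a" "cmpf b"
  have "cmpf (\<lambda>x. lcode (fst x) (fst (snd x)) (fst (snd (snd x))) (snd (snd (snd x))))"
    unfolding lcode_def by (intro cmpf_ceillog2 cmpf_intros)
  from cmpf_comp[OF this, of "\<lambda>z. (p z, q z, a z, b z)"] a show ?thesis by (simp add: cmpf_intros)
qed

lemma cmpf_is_cert: "cmpf p \<Longrightarrow> cmpf q \<Longrightarrow> cmpf \<psi> \<Longrightarrow> cmpf k \<Longrightarrow> cmpf (\<lambda>z. is_cert (p z) (q z) (\<psi> z) (k z))"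
proof -
  assume a: "cmpf p" "cmpf q" "cmpf \<psi>" "cmpf k"
  have "cmpf (\<lambda>x. is_cert (fst x) (fst (snd x)) (fst (snd (snd x))) (snd (snd (snd x))))"
    unfolding is_cert_def Let_def cert_def glab_def nd_pnt_def nd_fl_def nd_la_def nd_lo_def tri_def
    by (intro cmpf_acc cmpf_alg_of cmpf_lcode cmpf_intros)
  from cmpf_comp[OF this, of "\<lambda>z. (p z, q z, \<psi> z, k z)"] a show ?thesis by (simp add: cmpf_intros)
qed

lemma spec_std: "\<Psi> \<in> formulas p q \<Longrightarrow> spec p q (p + q + code \<Psi> + 1) \<Psi>"
  using ceillog2_le[of p] ceillog2_le[of q] by unfold_locales auto

lemma is_cert_sound:
  assumes "\<Psi> \<in> formulas p q" "is_cert p q (code \<Psi>) k"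
  shows "\<not> (\<exists>F. C_operator p q F \<and> definable_operator p q F \<and> implements p F \<Psi>)"
proof -
  interpret spec p q "p + q + code \<Psi> + 1" \<Psi> by (rule spec_std[OF assms(1)])
  show ?thesis using assms(2) cert_sound unfolding is_cert_def Let_def A_def[symmetric] by blast
qed

lemma is_certI:
  assumes "cert p q (aMU A) (aOM A) (aAC A) (glab A p q) m0 nd P" "A = alg_of (p + q + \<psi> + 1) \<psi>"
  shows "\<exists>k. is_cert p q \<psi> k"
  using assms by (intro exI[of _ "prod_encode (m0, prod_encode (nd, P))"]) (simp add: is_cert_def Let_def)

section \<open>Definable relations\<close>

text \<open>A semantic notion of definability with closure rules, so that no formula has to be
  written out. Agreement is required on proper assignments: nonnegative times and signals.\<close>

definition dfn :: "nat set \<Rightarrow> nat set \<Rightarrow> ((nat \<Rightarrow> real) \<Rightarrow> (nat \<Rightarrow> real set) \<Rightarrow> bool) \<Rightarrow> bool" where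
  "dfn V1 V2 P \<longleftrightarrow> (\<exists>\<phi>. fv1 \<phi> \<subseteq> V1 \<and> fv2 \<phi> \<subseteq> V2 \<and>
     (\<forall>u w. (\<forall>i. 0 \<le> u i) \<longrightarrow> (\<forall>i. w i \<in> bool_signals) \<longrightarrow> sat u w \<phi> = P u w))"

lemma dfn_less: "x \<in> V1 \<Longrightarrow> y \<in> V1 \<Longrightarrow> dfn V1 V2 (\<lambda>u w. u x < u y)"
  unfolding dfn_def by (intro exI[of _ "Less x y"]) auto

lemma dfn_in: "x \<in> V1 \<Longrightarrow> X \<in> V2 \<Longrightarrow> dfn V1 V2 (\<lambda>u w. u x \<in> w X)"
  unfolding dfn_def by (intro exI[of _ "In X x"]) auto

lemma dfn_not: "dfn V1 V2 P \<Longrightarrow> dfn V1 V2 (\<lambda>u w. \<not> P u w)"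
  unfolding dfn_def by (elim exE, rename_tac \<phi>, rule_tac x = "Neg \<phi>" in exI) auto

lemma dfn_and: "dfn V1 V2 P \<Longrightarrow> dfn V1 V2 Q \<Longrightarrow> dfn V1 V2 (\<lambda>u w. P u w \<and> Q u w)"
  unfolding dfn_def by (elim exE, rename_tac \<phi> \<psi>, rule_tac x = "Conj \<phi> \<psi>" in exI) auto

lemma dfn_or: "dfn V1 V2 P \<Longrightarrow> dfn V1 V2 Q \<Longrightarrow> dfn V1 V2 (\<lambda>u w. P u w \<or> Q u w)"
  unfolding dfn_def by (elim exE, rename_tac \<phi> \<psi>, rule_tac x = "Disj \<phi> \<psi>" in exI) auto

lemma dfn_imp: "dfn V1 V2 P \<Longrightarrow> dfn V1 V2 Q \<Longrightarrow> dfn V1 V2 (\<lambda>u w. P u w \<longrightarrow> Q u w)"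
  unfolding dfn_def by (elim exE, rename_tac \<phi> \<psi>, rule_tac x = "Impl \<phi> \<psi>" in exI) auto

lemma dfn_const: "dfn V1 V2 (\<lambda>u w. b)"
proof -
  have "dfn V1 V2 (\<lambda>u w. True)" unfolding dfn_def by (intro exI[of _ "All1 0 (Neg (Less 0 0))"]) auto
  then show ?thesis using dfn_not[of V1 V2 "\<lambda>u w. True"] by (cases b) auto
qed

text \<open>The second hypothesis is semantic freshness: \<open>P\<close> does not look at the value
  of \<open>x\<close> in \<open>u\<close>, so \<open>x\<close> can be the quantified
  variable.\<close>

lemma dfn_ex1:
  assumes "dfn (insert x V1) V2 (\<lambda>u w. P (u x) u w)" "\<And>r r' u w. P r (u(x := r')) w = P r u w"
  shows "dfn V1 V2 (\<lambda>u w. \<exists>r\<ge>0. P r u w)"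
proof -
  obtain \<phi> where \<phi>: "fv1 \<phi> \<subseteq> insert x V1" "fv2 \<phi> \<subseteq> V2"
    "\<And>u w. (\<forall>i. 0 \<le> u i) \<Longrightarrow> (\<forall>i. w i \<in> bool_signals) \<Longrightarrow> sat u w \<phi> = P (u x) u w"
    using assms(1) unfolding dfn_def by blast
  have "sat u w (Ex1 x \<phi>) = (\<exists>r\<ge>0. P r u w)" if "\<forall>i. 0 \<le> u i" "\<forall>i. w i \<in> bool_signals" for u w
    using that \<phi>(3)[of "u(x := r)" w for r] assms(2) by auto
  then show ?thesis unfolding dfn_def using \<phi>(1,2) by (intro exI[of _ "Ex1 x \<phi>"]) auto
qed

lemma dfn_all1:
  assumes "dfn (insert x V1) V2 (\<lambda>u w. P (u x) u w)" "\<And>r r' u w. P r (u(x := r')) w = P r u w"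
  shows "dfn V1 V2 (\<lambda>u w. \<forall>r\<ge>0. P r u w)"
  using dfn_not[OF dfn_ex1[where P = "\<lambda>r u w. \<not> P r u w", OF dfn_not[OF assms(1)]]] assms(2) by auto

lemma dfn_fin_ex:
  assumes "finite I" "\<And>i. i \<in> I \<Longrightarrow> dfn V1 V2 (P i)" shows "dfn V1 V2 (\<lambda>u w. \<exists>i\<in>I. P i u w)"
  using assms
proof (induction rule: finite_induct)
  case empty then show ?case using dfn_const[of V1 V2 False] by simp
next
  case (insert i I) then show ?case using dfn_or[of V1 V2 "P i" "\<lambda>u w. \<exists>i\<in>I. P i u w"] by simp
qed

lemma dfn_lex: "(\<And>i. i < (n::nat) \<Longrightarrow> dfn V1 V2 (P i)) \<Longrightarrow> dfn V1 V2 (\<lambda>u w. \<exists>i<n. P i u w)"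
  using dfn_fin_ex[OF finite_lessThan, of n V1 V2 P] by (simp add: Bex_def)

lemma dfn_lall: "(\<And>i. i < (n::nat) \<Longrightarrow> dfn V1 V2 (P i)) \<Longrightarrow> dfn V1 V2 (\<lambda>u w. \<forall>i<n. P i u w)"
  using dfn_not[OF dfn_lex[of n V1 V2 "\<lambda>i u w. \<not> P i u w"]] dfn_not by auto

text \<open>A block of set variables holds the code of one signal over a larger alphabet; the
  induction adds its quantifiers one variable at a time.\<close>

lemma dfn_ex2_block:
  assumes "dfn V1 (V2 \<union> {B..<B + c}) P"
  shows "dfn V1 (V2 - {B..<B + c}) (\<lambda>u w. \<exists>Z. (\<forall>k. Z k \<in> bool_signals) \<and> P u (\<lambda>i. if B \<le> i \<and> i < B + c then Z i else w i))"
  using assms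
proof (induction c arbitrary: P V2)
  case 0
  have "\<exists>Z. \<forall>k :: nat. Z k \<in> bool_signals" using singleton_bool_signal[of 0] by (intro exI[of _ "\<lambda>_. {0}"]) simp
  moreover have "(\<lambda>i. if B \<le> i \<and> i < B + 0 then Z i else w i) = w" for Z w :: "nat \<Rightarrow> real set"
    by (rule ext) auto
  ultimately show ?case using 0 by simp
next
  case (Suc c)
  obtain \<phi> where \<phi>: "fv1 \<phi> \<subseteq> V1" "fv2 \<phi> \<subseteq> V2 \<union> {B..<B + Suc c}"
    "\<And>u w. (\<forall>i. 0 \<le> u i) \<Longrightarrow> (\<forall>i. w i \<in> bool_signals) \<Longrightarrow> sat u w \<phi> = P u w"
    using Suc.prems unfolding dfn_def by blast
  define Q where "Q u w \<longleftrightarrow> (\<exists>A\<in>bool_signals. P u (w(B + c := A)))" for u w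
  have "sat u w (Ex2 (B + c) \<phi>) = Q u w" if "\<forall>i. 0 \<le> u i" "\<forall>i. w i \<in> bool_signals" for u w
    using that \<phi>(3)[of u "w(B + c := A)" for A] by (auto simp: Q_def)
  then have "dfn V1 ((V2 - {B + c}) \<union> {B..<B + c}) Q" unfolding dfn_def using \<phi>(1,2)
    by (intro exI[of _ "Ex2 (B + c) \<phi>"]) auto
  from Suc.IH[OF this]
  have D: "dfn V1 (V2 - {B + c} - {B..<B + c}) (\<lambda>u w. \<exists>Z. (\<forall>k. Z k \<in> bool_signals) \<and> Q u (\<lambda>i. if B \<le> i \<and> i < B + c then Z i else w i))" .
  have V: "V2 - {B + c} - {B..<B + c} = V2 - {B..<B + Suc c}" by auto
  have eq: "(\<exists>Z. (\<forall>k. Z k \<in> bool_signals) \<and> Q u (\<lambda>i. if B \<le> i \<and> i < B + c then Z i else w i)) \<longleftrightarrow>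
    (\<exists>Z. (\<forall>k. Z k \<in> bool_signals) \<and> P u (\<lambda>i. if B \<le> i \<and> i < B + Suc c then Z i else w i))" (is "?l = ?r") for u w
  proof
    assume ?l
    then obtain Z A where Z: "\<forall>k. Z k \<in> bool_signals" "A \<in> bool_signals" "P u ((\<lambda>i. if B \<le> i \<and> i < B + c then Z i else w i)(B + c := A))"
      by (auto simp: Q_def)
    have "(\<lambda>i. if B \<le> i \<and> i < B + c then Z i else w i)(B + c := A) = (\<lambda>i. if B \<le> i \<and> i < B + Suc c then (Z(B + c := A)) i else w i)"
      by (auto simp: fun_eq_iff)
    then show ?r using Z by (intro exI[of _ "Z(B + c := A)"]) auto
  next
    assume ?r
    then obtain Z where Z: "\<forall>k. Z k \<in> bool_signals" "P u (\<lambda>i. if B \<le> i \<and> i < B + Suc c then Z i else w i)" by blast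
    have "(\<lambda>i. if B \<le> i \<and> i < B + c then Z i else w i)(B + c := Z (B + c)) = (\<lambda>i. if B \<le> i \<and> i < B + Suc c then Z i else w i)"
      by (auto simp: fun_eq_iff)
    then show ?l using Z unfolding Q_def by (intro exI[of _ Z]) (auto intro!: bexI[of _ "Z (B + c)"])
  qed
  show ?case using D unfolding V eq .
qed

definition lv :: "nat \<Rightarrow> nat \<Rightarrow> (nat \<Rightarrow> real set) \<Rightarrow> real \<Rightarrow> nat" where
  "lv b c w t = bset c (\<lambda>k. t \<in> w (b + k))"

definition rlim :: "(real \<Rightarrow> nat) \<Rightarrow> real \<Rightarrow> nat \<Rightarrow> bool" where
  "rlim f t a \<longleftrightarrow> (\<exists>e\<ge>0. t < e \<and> (\<forall>r\<ge>0. t < r \<and> r < e \<longrightarrow> f r = a))"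

definition llim :: "(real \<Rightarrow> nat) \<Rightarrow> real \<Rightarrow> nat \<Rightarrow> bool" where
  "llim f t a \<longleftrightarrow> (\<exists>s\<ge>0. s < t \<and> (\<forall>r\<ge>0. s < r \<and> r < t \<longrightarrow> f r = a))"

lemma dfn_lv: "x \<in> V1 \<Longrightarrow> {b..<b + c} \<subseteq> V2 \<Longrightarrow> dfn V1 V2 (\<lambda>u w. lv b c w (u x) = a)"
proof -
  assume x: "x \<in> V1" and b: "{b..<b + c} \<subseteq> V2"
  have eq: "lv b c w t = a \<longleftrightarrow> a < 2 ^ c \<and> (\<forall>k<c. (t \<in> w (b + k)) = bit a k)" for w t
  proof
    assume "lv b c w t = a"
    then show "a < 2 ^ c \<and> (\<forall>k<c. (t \<in> w (b + k)) = bit a k)"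
      using bset_less[of c "\<lambda>k. t \<in> w (b + k)"] by (auto simp: lv_def bit_bset)
  next
    assume "a < 2 ^ c \<and> (\<forall>k<c. (t \<in> w (b + k)) = bit a k)"
    then show "lv b c w t = a" using bit_less_exp[of a c] by (intro bit_eqI) (auto simp: lv_def bit_bset)
  qed
  have "dfn V1 V2 (\<lambda>u w. (u x \<in> w (b + k)) = bit a k)" if "k < c" for k
  proof -
    have "dfn V1 V2 (\<lambda>u w. u x \<in> w (b + k))" using x b that by (intro dfn_in) auto
    then show ?thesis using dfn_not[of V1 V2 "\<lambda>u w. u x \<in> w (b + k)"] by (cases "bit a k") auto
  qed
  then show ?thesis unfolding eq by (intro dfn_and dfn_const dfn_lall)
qed

lemma dfn_rlim:
  assumes "x \<in> V1" "{b..<b + c} \<subseteq> V2" shows "dfn V1 V2 (\<lambda>u w. rlim (lv b c w) (u x) a)"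
  unfolding rlim_def
  by (rule dfn_ex1[where x = "x + 1" and P = "\<lambda>e u w. u x < e \<and> (\<forall>r\<ge>0. u x < r \<and> r < e \<longrightarrow> lv b c w r = a)"],
      intro dfn_and dfn_less,
      use assms in simp, simp,
      rule dfn_all1[where x = "x + 2" and P = "\<lambda>r u w. u x < r \<and> r < u (x + 1) \<longrightarrow> lv b c w r = a"],
      intro dfn_and dfn_less dfn_imp dfn_lv, use assms in auto)

lemma dfn_llim:
  assumes "x \<in> V1" "{b..<b + c} \<subseteq> V2" shows "dfn V1 V2 (\<lambda>u w. llim (lv b c w) (u x) a)"
  unfolding llim_def
  by (rule dfn_ex1[where x = "x + 1" and P = "\<lambda>e u w. e < u x \<and> (\<forall>r\<ge>0. e < r \<and> r < u x \<longrightarrow> lv b c w r = a)"],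
      intro dfn_and dfn_less,
      simp, use assms in simp,
      rule dfn_all1[where x = "x + 2" and P = "\<lambda>r u w. u (x + 1) < r \<and> r < u x \<longrightarrow> lv b c w r = a"],
      intro dfn_and dfn_less dfn_imp dfn_lv, use assms in auto)


section \<open>Operators computed by finite-state machines\<close>

text \<open>The state after time \<open>t\<close> is a signal \<open>K\<close>. At a time where \<open>X\<close> is continuous nothing happens; at a
  discontinuity the machine reads the letter at the point and the letter on the following interval. If \<open>X\<close> is
  continuous from the left, causality forces the machine to postpone reading the first of these letters.\<close>

locale mealy =
  fixes p q n m0 :: nat and upd :: "nat \<Rightarrow> nat \<Rightarrow> nat" and om :: "nat \<Rightarrow> nat"
  assumes m0: "m0 < n" and updn: "m < n \<Longrightarrow> a < p \<Longrightarrow> upd m a < n" and omq: "m < n \<Longrightarrow> om m < q"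
begin

definition T1 :: "nat \<Rightarrow> nat \<Rightarrow> nat \<Rightarrow> nat" where "T1 m l x = (if x = l then m else upd m x)"
definition T2 :: "nat \<Rightarrow> nat \<Rightarrow> nat \<Rightarrow> nat \<Rightarrow> nat" where "T2 m l x r = (if x = l \<and> r = x then m else upd (upd m x) r)"

text \<open>Only values and one-sided limits of \<open>X\<close> and \<open>K\<close> occur, which
  are first-order definable, and no breakpoints are mentioned. In the vocabulary of the order,
  \<open>\<not> (\<exists>s\<ge>0. s < t)\<close> expresses that \<open>t\<close> is 0.\<close>

definition Run :: "(real \<Rightarrow> nat) \<Rightarrow> (real \<Rightarrow> nat) \<Rightarrow> bool" where
  "Run X K \<longleftrightarrow> (\<forall>t\<ge>0. \<exists>m<n. K t = m) \<and>
     (\<forall>t\<ge>0. \<not> (\<exists>s\<ge>0. s < t) \<longrightarrow>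
        (\<exists>x<p. \<exists>r<p. X t = x \<and> rlim X t r \<and> K t = upd m0 x \<and> rlim K t (upd (upd m0 x) r))) \<and>
     (\<forall>t\<ge>0. (\<exists>s\<ge>0. s < t) \<longrightarrow> (\<exists>l<p. \<exists>x<p. \<exists>r<p. \<exists>m<n. llim X t l \<and> X t = x \<and> rlim X t r \<and>
        llim K t m \<and> K t = T1 m l x \<and> rlim K t (T2 m l x r)))"

text \<open>For an input with letters \<open>\<alpha>\<close>, \<open>kk \<alpha> i\<close> is the
  state on the gap after breakpoint \<open>i\<close> and \<open>kp \<alpha> i\<close> the state at
  that breakpoint.\<close>

fun kk :: "(nat \<Rightarrow> nat) \<Rightarrow> nat \<Rightarrow> nat" where
  "kk \<alpha> 0 = upd (upd m0 (\<alpha> 0)) (\<alpha> 1)"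
| "kk \<alpha> (Suc i) = T2 (kk \<alpha> i) (\<alpha> (2 * i + 1)) (\<alpha> (2 * i + 2)) (\<alpha> (2 * i + 3))"

fun kp :: "(nat \<Rightarrow> nat) \<Rightarrow> nat \<Rightarrow> nat" where
  "kp \<alpha> 0 = upd m0 (\<alpha> 0)"
| "kp \<alpha> (Suc i) = T1 (kk \<alpha> i) (\<alpha> (2 * i + 1)) (\<alpha> (2 * i + 2))"

lemma kk_less: "(\<And>i. \<alpha> i < p) \<Longrightarrow> kk \<alpha> i < n"
  by (induction i) (auto simp: updn m0 T2_def)

lemma kp_less: "(\<And>i. \<alpha> i < p) \<Longrightarrow> kp \<alpha> i < n"
  using kk_less by (cases i) (auto simp: updn m0 T1_def)

lemma rlim_unique: "rlim f t a \<Longrightarrow> rlim f t b \<Longrightarrow> 0 \<le> t \<Longrightarrow> a = b"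
proof -
  assume "rlim f t a" "rlim f t b" and t: "0 \<le> t"
  then obtain e e' where e: "t < e" "\<And>r. 0 \<le> r \<Longrightarrow> t < r \<Longrightarrow> r < e \<Longrightarrow> f r = a" "t < e'" "\<And>r. 0 \<le> r \<Longrightarrow> t < r \<Longrightarrow> r < e' \<Longrightarrow> f r = b"
    unfolding rlim_def by blast
  obtain r where r: "t < r" "r < min e e'" using dense[of t "min e e'"] e by auto
  then show "a = b" using e(2)[of r] e(4)[of r] t by auto
qed

lemma llim_unique: "llim f t a \<Longrightarrow> llim f t b \<Longrightarrow> a = b"
proof -
  assume "llim f t a" "llim f t b"
  then obtain e e' where e: "0 \<le> e" "e < t" "\<And>r. 0 \<le> r \<Longrightarrow> e < r \<Longrightarrow> r < t \<Longrightarrow> f r = a" "e' < t" "\<And>r. 0 \<le> r \<Longrightarrow> e' < r \<Longrightarrow> r < t \<Longrightarrow> f r = b"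
    unfolding llim_def by blast
  obtain r where r: "max e e' < r" "r < t" using dense[of "max e e'" t] e by auto
  then show "a = b" using e(3)[of r] e(5)[of r] e(1) by auto
qed

lemma gap_limits:
  assumes "breaks \<tau>" and c': "\<forall>i t. \<tau> i < t \<and> t < \<tau> (Suc i) \<longrightarrow> f t = g i"
  shows "rlim f (\<tau> i) (g i)" "llim f (\<tau> (Suc i)) (g i)"
    "\<tau> i < t \<Longrightarrow> t < \<tau> (Suc i) \<Longrightarrow> rlim f t (g i)" "\<tau> i < t \<Longrightarrow> t < \<tau> (Suc i) \<Longrightarrow> llim f t (g i)"
proof -
  interpret breaks \<tau> by fact
  have c: "\<And>i t. \<tau> i < t \<Longrightarrow> t < \<tau> (Suc i) \<Longrightarrow> f t = g i" using c' by blast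
  show "rlim f (\<tau> i) (g i)" unfolding rlim_def by (intro exI[of _ "\<tau> (Suc i)"]) (auto intro: c)
  show "llim f (\<tau> (Suc i)) (g i)" unfolding llim_def by (intro exI[of _ "\<tau> i"]) (auto intro: c)
  show "rlim f t (g i)" if "\<tau> i < t" "t < \<tau> (Suc i)"
    unfolding rlim_def using that by (intro exI[of _ "\<tau> (Suc i)"]) (auto intro: c)
  show "llim f t (g i)" if "\<tau> i < t" "t < \<tau> (Suc i)"
    unfolding llim_def using that by (intro exI[of _ "\<tau> i"]) (auto intro: c)
qed

lemma run_values:
  assumes \<tau>: "breaks \<tau>" and X: "\<And>i. X (\<tau> i) = \<alpha> (2 * i)" "\<And>i t. \<tau> i < t \<Longrightarrow> t < \<tau> (Suc i) \<Longrightarrow> X t = \<alpha> (2 * i + 1)"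
    and K: "\<And>i t. \<tau> i < t \<Longrightarrow> t < \<tau> (Suc i) \<Longrightarrow> K t = g i" and R: "Run X K"
  shows "K (\<tau> i) = kp \<alpha> i \<and> g i = kk \<alpha> i"
proof -
  interpret breaks \<tau> by fact
  have "\<forall>i t. \<tau> i < t \<and> t < \<tau> (Suc i) \<longrightarrow> X t = \<alpha> (2 * i + 1)" using X(2) by blast
  note LX = gap_limits[OF \<tau> this]
  have "\<forall>i t. \<tau> i < t \<and> t < \<tau> (Suc i) \<longrightarrow> K t = g i" using K by blast
  note LK = gap_limits[OF \<tau> this]
  show ?thesis
  proof (induction i)
    case 0
    have "\<not> (\<exists>s\<ge>0. s < (0::real))" by auto
    then obtain x r where xr: "X 0 = x" "rlim X 0 r" "K 0 = upd m0 x" "rlim K 0 (upd (upd m0 x) r)"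
      using R unfolding Run_def by blast
    have "r = \<alpha> 1" using rlim_unique[OF xr(2)] LX(1)[of 0] tau0 by simp
    moreover have "g 0 = upd (upd m0 x) r" using rlim_unique[OF LK(1)[of 0]] xr(4) tau0 by simp
    moreover have "x = \<alpha> 0" using xr(1) X(1)[of 0] tau0 by simp
    ultimately show ?case using xr(3) tau0 by simp
  next
    case (Suc i)
    have "\<exists>s\<ge>0. s < \<tau> (Suc i)" by (intro exI[of _ "\<tau> i"]) simp
    moreover have "0 \<le> \<tau> (Suc i)" by simp
    ultimately obtain l x r m where h: "llim X (\<tau> (Suc i)) l" "X (\<tau> (Suc i)) = x" "rlim X (\<tau> (Suc i)) r"
      "llim K (\<tau> (Suc i)) m" "K (\<tau> (Suc i)) = T1 m l x" "rlim K (\<tau> (Suc i)) (T2 m l x r)"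
      using R unfolding Run_def by blast
    have "l = \<alpha> (2 * i + 1)" using llim_unique[OF h(1) LX(2)] .
    moreover have "x = \<alpha> (2 * i + 2)" using h(2) X(1)[of "Suc i"] by simp
    moreover have "r = \<alpha> (2 * i + 3)" using rlim_unique[OF h(3) LX(1)] by (simp add: eval_nat_numeral)
    moreover have "m = kk \<alpha> i" using llim_unique[OF h(4) LK(2)] Suc by simp
    moreover have "g (Suc i) = T2 m l x r" using rlim_unique[OF LK(1) h(6)] by simp
    ultimately show ?case using h(5) by simp
  qed
qed

lemma run_exists:
  assumes \<tau>: "breaks \<tau>" and X: "\<And>i. X (\<tau> i) = \<alpha> (2 * i)" "\<And>i t. \<tau> i < t \<Longrightarrow> t < \<tau> (Suc i) \<Longrightarrow> X t = \<alpha> (2 * i + 1)"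
    and a: "\<And>i. \<alpha> i < p"
  shows "\<exists>K. Run X K \<and> finitely_variable K \<and> (\<forall>i. K (\<tau> i) = kp \<alpha> i) \<and>
    (\<forall>i t. \<tau> i < t \<longrightarrow> t < \<tau> (Suc i) \<longrightarrow> K t = kk \<alpha> i)"
proof -
  interpret breaks \<tau> by fact
  define ix where "ix t = (THE i. \<tau> i \<le> t \<and> t < \<tau> (Suc i))" for t
  have ix: "ix t = i" if "\<tau> i \<le> t" "t < \<tau> (Suc i)" for i t
    unfolding ix_def
  proof (rule the_equality)
    fix j assume j: "\<tau> j \<le> t \<and> t < \<tau> (Suc j)"
    have "\<tau> i < \<tau> (Suc j)" "\<tau> j < \<tau> (Suc i)" using that j by linarith+
    then show "j = i" by simp
  qed (use that in auto)
  define K where "K t = (if t = \<tau> (ix t) then kp \<alpha> (ix t) else kk \<alpha> (ix t))" for t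
  have Kp: "K (\<tau> i) = kp \<alpha> i" for i using ix[of i "\<tau> i"] by (simp add: K_def)
  have Kk: "K t = kk \<alpha> i" if "\<tau> i < t" "t < \<tau> (Suc i)" for i t using ix[of i t] that by (simp add: K_def)
  have "pcw K (\<tau> i) (\<tau> (Suc i))" for i by (rule pcw.base[of _ _ _ "kk \<alpha> i"]) (auto intro: Kk)
  then have "finitely_variable K" unfolding finitely_variable_iff using pcw_all by blast
  have "\<forall>i t. \<tau> i < t \<and> t < \<tau> (Suc i) \<longrightarrow> X t = \<alpha> (2 * i + 1)" using X(2) by blast
  note LX = gap_limits[OF \<tau> this]
  have "\<forall>i t. \<tau> i < t \<and> t < \<tau> (Suc i) \<longrightarrow> K t = kk \<alpha> i" using Kk by blast
  note LK = gap_limits[OF \<tau> this]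
  note kb = kk_less[of \<alpha>, OF a] kp_less[of \<alpha>, OF a]
  have "Run X K" unfolding Run_def
  proof (intro conjI allI impI)
    fix t :: real assume "0 \<le> t"
    show "\<exists>m<n. K t = m" using kb by (simp add: K_def)
  next
    fix t :: real assume t: "0 \<le> t" "\<not> (\<exists>s\<ge>0. s < t)"
    then have "t = \<tau> 0" using tau0 by (metis less_eq_real_def order_refl)
    then show "\<exists>x<p. \<exists>r<p. X t = x \<and> rlim X t r \<and> K t = upd m0 x \<and> rlim K t (upd (upd m0 x) r)"
      using X(1)[of 0] LX(1)[of 0] LK(1)[of 0] Kp[of 0] a
      by (intro exI[of _ "\<alpha> 0"] conjI exI[of _ "\<alpha> 1"]) auto
  next
    fix t :: real assume t: "0 \<le> t" "\<exists>s\<ge>0. s < t"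
    obtain i where i: "\<tau> i \<le> t" "t < \<tau> (Suc i)" using tau_locate[OF t(1)] .
    show "\<exists>l<p. \<exists>x<p. \<exists>r<p. \<exists>m<n. llim X t l \<and> X t = x \<and> rlim X t r \<and> llim K t m \<and> K t = T1 m l x \<and> rlim K t (T2 m l x r)"
    proof (cases "t = \<tau> i")
      case True
      have "i \<noteq> 0"
      proof
        assume "i = 0" then show False using t True tau0 by auto
      qed
      then obtain j where j: "i = Suc j" by (cases i) auto
      show ?thesis
        using True j LX(1)[of i] LX(2)[of j] LK(1)[of i] LK(2)[of j] X(1)[of i] Kp[of i] a kb(1)[of j]
        by (intro exI[of _ "\<alpha> (2 * j + 1)"] conjI exI[of _ "\<alpha> (2 * j + 2)"] exI[of _ "\<alpha> (2 * j + 3)"] exI[of _ "kk \<alpha> j"])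
          (auto simp: eval_nat_numeral)
    next
      case False
      then have i': "\<tau> i < t" using i by simp
      show ?thesis
        using LX(3,4)[OF i' i(2)] LK(3,4)[OF i' i(2)] X(2)[OF i' i(2)] Kk[OF i' i(2)] a kb(1)[of i]
        by (intro exI[of _ "\<alpha> (2 * i + 1)"] conjI exI[of _ "kk \<alpha> i"]) (auto simp: T1_def T2_def)
    qed
  qed
  then show ?thesis using \<open>finitely_variable K\<close> Kp Kk by blast
qed


lemma signal_breaks:
  assumes "finitely_variable f"
  obtains \<tau> c where "breaks \<tau>" "\<And>i. f (\<tau> i) = c (2 * i)" "\<And>i t. \<tau> i < t \<Longrightarrow> t < \<tau> (Suc i) \<Longrightarrow> f t = c (2 * i + 1)"
proof -
  obtain \<tau> d where d: "breaks \<tau>" "\<And>i t. \<tau> i < t \<Longrightarrow> t < \<tau> (Suc i) \<Longrightarrow> f t = d i" using fv_breaks[OF assms] by metis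
  show ?thesis
    by (rule that[OF d(1), of "\<lambda>i. if even i then f (\<tau> (i div 2)) else d (i div 2)"]) (auto simp: d(2))
qed

text \<open>Both inputs and both runs are cut at common breakpoints. The state at a breakpoint uses
  no later letter, and the state on a gap uses no letter beyond that of the gap, which is already
  visible at any time inside it.\<close>

lemma run_causal:
  assumes X: "finitely_variable X" "finitely_variable X'" "finitely_variable K" "finitely_variable K'"
    and R: "Run X K" "Run X' K'" and t: "0 \<le> t" and eq: "\<And>s. 0 \<le> s \<Longrightarrow> s \<le> t \<Longrightarrow> X s = X' s"
  shows "K t = K' t"
proof -
  have "finitely_variable (\<lambda>t. ((X t, X' t), (K t, K' t)))" by (intro fv_pair X)
  then obtain \<tau> c where c: "breaks \<tau>" "\<And>i. ((X (\<tau> i), X' (\<tau> i)), (K (\<tau> i), K' (\<tau> i))) = c (2 * i)"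
    "\<And>i t. \<tau> i < t \<Longrightarrow> t < \<tau> (Suc i) \<Longrightarrow> ((X t, X' t), (K t, K' t)) = c (2 * i + 1)"
    by (rule signal_breaks) (rule that; assumption)
  interpret breaks \<tau> by fact
  define \<alpha> where "\<alpha> i = fst (fst (c i))" for i
  define \<beta> where "\<beta> i = snd (fst (c i))" for i
  have XX: "X (\<tau> i) = \<alpha> (2 * i)" "X' (\<tau> i) = \<beta> (2 * i)" for i using c(2)[of i, symmetric] by (auto simp: \<alpha>_def \<beta>_def)
  have XG: "X t = \<alpha> (2 * i + 1)" "X' t = \<beta> (2 * i + 1)" "K t = fst (snd (c (2 * i + 1)))" "K' t = snd (snd (c (2 * i + 1)))"
    if "\<tau> i < t" "t < \<tau> (Suc i)" for i t
    using c(3)[OF that, symmetric] by (auto simp: \<alpha>_def \<beta>_def)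
  have V: "K (\<tau> i) = kp \<alpha> i \<and> fst (snd (c (2 * i + 1))) = kk \<alpha> i" "K' (\<tau> i) = kp \<beta> i \<and> snd (snd (c (2 * i + 1))) = kk \<beta> i" for i
    by (rule run_values[OF c(1) _ _ _ R(1)]; simp add: XX XG) (rule run_values[OF c(1) _ _ _ R(2)]; simp add: XX XG)
  obtain j where j: "\<tau> j \<le> t" "t < \<tau> (Suc j)" using tau_locate[OF t] .
  have ab: "\<alpha> (2 * i) = \<beta> (2 * i)" if "i \<le> j" for i
  proof -
    have "\<tau> i \<le> \<tau> j" using that by simp
    then have "\<tau> i \<le> t" using j(1) by linarith
    then show ?thesis using eq[of "\<tau> i"] XX[of i] by simp
  qed
  \<comment> \<open>A gap that begins before \<open>t\<close> contains a time before
    \<open>t\<close>, so its letter is the same for both inputs even if the gap extends beyond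
    \<open>t\<close>.\<close>
  have ab': "\<alpha> (2 * i + 1) = \<beta> (2 * i + 1)" if it: "\<tau> i < t" for i
  proof -
    have "\<tau> i < \<tau> (Suc i)" by simp
    then obtain s where s: "\<tau> i < s" "s < min t (\<tau> (Suc i))" using dense[of "\<tau> i" "min t (\<tau> (Suc i))"] it by auto
    have "0 \<le> \<tau> i" by simp
    then have "0 \<le> s" using s(1) by linarith
    then show ?thesis using eq[of s] XG(1,2)[of i s] s by auto
  qed
  have k: "kk \<alpha> i = kk \<beta> i" if "\<tau> i < t" "i \<le> j" for i
    using that
  proof (induction i)
    case 0 then show ?case using ab[of 0] ab'[of 0] by simp
  next
    case (Suc i)
    have "\<tau> i < \<tau> (Suc i)" by simp
    then have "\<tau> i < t" using Suc.prems by linarith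
    then show ?case using Suc ab[of "Suc i"] ab'[of i] ab'[of "Suc i"] by (simp add: eval_nat_numeral)
  qed
  have kpe: "kp \<alpha> i = kp \<beta> i" if "i \<le> j" for i
  proof (cases i)
    case 0 then show ?thesis using ab[of 0] by simp
  next
    case (Suc h)
    have "\<tau> h < \<tau> i" "\<tau> i \<le> \<tau> j" using Suc that by auto
    then have "\<tau> h < t" using j(1) by linarith
    then show ?thesis using k[of h] ab[of i] ab'[of h] Suc that by simp
  qed
  show ?thesis
  proof (cases "t = \<tau> j")
    case True then show ?thesis using V(1)[of j] V(2)[of j] kpe[of j] by simp
  next
    case False
    then have "\<tau> j < t" using j by simp
    then show ?thesis using V(1)[of j] V(2)[of j] XG(3,4)[of j t] j k[of j] by simp
  qed
qed

definition rn :: "(real \<Rightarrow> nat) \<Rightarrow> real \<Rightarrow> nat" where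
  "rn X = (SOME K. Run X K \<and> finitely_variable K)"

definition op :: "(real \<Rightarrow> nat) \<Rightarrow> real \<Rightarrow> nat" where
  "op X t = (if t < 0 then undefined else om (rn X t))"

lemma rn: "X \<in> signals p \<Longrightarrow> Run X (rn X) \<and> finitely_variable (rn X)"
proof -
  assume X: "X \<in> signals p"
  then have f: "finitely_variable X" by (simp add: signals_def)
  obtain \<tau> \<alpha> where a: "breaks \<tau>" "\<And>i. X (\<tau> i) = \<alpha> (2 * i)" "\<And>i t. \<tau> i < t \<Longrightarrow> t < \<tau> (Suc i) \<Longrightarrow> X t = \<alpha> (2 * i + 1)"
    by (rule signal_breaks[OF f]) (rule that; assumption)
  interpret breaks \<tau> by fact
  have Xp: "X t < p" if "0 \<le> t" for t using X that by (auto simp: signals_def PiE_iff)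
  have "\<alpha> i < p" for i
  proof (cases "even i")
    case True
    then obtain k where "i = 2 * k" by (elim evenE)
    moreover have "0 \<le> \<tau> k" by simp
    ultimately show ?thesis using a(2)[of k] Xp[of "\<tau> k"] by simp
  next
    case False
    then obtain k where k: "i = 2 * k + 1" by (elim oddE)
    have "\<tau> k < \<tau> (Suc k)" "0 \<le> \<tau> k" by auto
    then obtain s where s: "\<tau> k < s" "s < \<tau> (Suc k)" using dense by blast
    then have "0 \<le> s" using \<open>0 \<le> \<tau> k\<close> by linarith
    then show ?thesis using a(3)[OF s] Xp[of s] k by simp
  qed
  from run_exists[OF a this] have "\<exists>K. Run X K \<and> finitely_variable K" by blast
  then show ?thesis unfolding rn_def by (rule someI_ex)
qed

lemma run_less: "Run X K \<Longrightarrow> 0 \<le> t \<Longrightarrow> K t < n"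
  unfolding Run_def by blast

lemma op_signal: "X \<in> signals p \<Longrightarrow> op X \<in> signals q"
proof -
  assume X: "X \<in> signals p"
  have "finitely_variable (\<lambda>t. om (rn X t))" using rn[OF X] fv_map[of "rn X" om] by blast
  then have "finitely_variable (op X)" unfolding finitely_variable_iff
    by (intro allI impI) (rule pcw_cong[of "\<lambda>t. om (rn X t)"], auto simp: op_def)
  then show ?thesis using run_less rn[OF X] omq by (auto simp: signals_def PiE_def extensional_def op_def)
qed

lemma op_C: "C_operator p q op"
  unfolding C_operator_def
proof (intro conjI allI impI ballI)
  show "op \<in> signals p \<rightarrow> signals q" using op_signal by blast
  fix t :: real and X Y assume t: "0 \<le> t" and X: "X \<in> signals p" "Y \<in> signals p" and eq: "\<forall>s\<in>{0..t}. X s = Y s"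
  have "rn X t = rn Y t"
  proof (rule run_causal)
    show "finitely_variable X" "finitely_variable Y" using X by (auto simp: signals_def)
    show "finitely_variable (rn X)" "finitely_variable (rn Y)" "Run X (rn X)" "Run Y (rn Y)" using rn X by auto
    show "X s = Y s" if "0 \<le> s" "s \<le> t" for s using eq that by simp
  qed (rule t)
  then show "op X t = op Y t" by (simp add: op_def)
qed

lemma op_iff:
  assumes X: "X \<in> signals p" "Y \<in> signals q"
  shows "Y = op X \<longleftrightarrow> (\<exists>K. finitely_variable K \<and> Run X K \<and> (\<forall>t\<ge>0. \<exists>m<n. K t = m \<and> Y t = om m))"
proof
  assume "Y = op X"
  then show "\<exists>K. finitely_variable K \<and> Run X K \<and> (\<forall>t\<ge>0. \<exists>m<n. K t = m \<and> Y t = om m)"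
    using rn[OF X(1)] run_less by (intro exI[of _ "rn X"]) (auto simp: op_def)
next
  assume "\<exists>K. finitely_variable K \<and> Run X K \<and> (\<forall>t\<ge>0. \<exists>m<n. K t = m \<and> Y t = om m)"
  then obtain K where K: "finitely_variable K" "Run X K" "\<And>t. 0 \<le> t \<Longrightarrow> Y t = om (K t)" by blast
  have "K t = rn X t" if "0 \<le> t" for t
    by (rule run_causal[of X X]) (use K rn[OF X(1)] X that in \<open>auto simp: signals_def\<close>)
  then show "Y = op X" using K X(2) by (auto simp: fun_eq_iff op_def signals_def PiE_def extensional_def)
qed

end

lemma component_fv: "finitely_variable f \<Longrightarrow> component f i \<in> bool_signals"
proof -
  assume "finitely_variable f"
  then have "finitely_variable (\<lambda>t. bit (f t) i)" by (rule fv_map)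
  then have "finitely_variable (\<lambda>t. t \<in> component f i)"
    unfolding finitely_variable_iff component_def
    by (intro allI impI) (rule pcw_cong[of "\<lambda>t. bit (f t) i"], auto)
  then show ?thesis by (auto simp: bool_signals_def component_def)
qed

lemma fv_lv: "(\<And>k. w k \<in> bool_signals) \<Longrightarrow> finitely_variable (lv b c w)"
proof (induction c)
  case 0
  then have "finitely_variable (\<lambda>t. t \<in> w 0)" by (simp add: bool_signals_def)
  from fv_map[OF this, of "\<lambda>_. 0"] show ?case by (simp add: lv_def bset_def)
next
  case (Suc c)
  have "finitely_variable (\<lambda>t. t \<in> w (b + c))" using Suc.prems by (simp add: bool_signals_def)
  from fv_map[OF fv_pair[OF this Suc.IH[OF Suc.prems]], of "\<lambda>x. if fst x then snd x + 2 ^ c else snd x"]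
  have "finitely_variable (\<lambda>t. if t \<in> w (b + c) then lv b c w t + 2 ^ c else lv b c w t)"
    by (simp only: fst_conv snd_conv)
  moreover have "lv b (Suc c) w = (\<lambda>t. if t \<in> w (b + c) then lv b c w t + 2 ^ c else lv b c w t)"
    by (simp add: fun_eq_iff lv_def bset_def)
  ultimately show ?case by simp
qed

lemma rlim_cong: "(\<And>t. 0 \<le> t \<Longrightarrow> f t = g t) \<Longrightarrow> rlim f = rlim g"
  by (simp add: fun_eq_iff rlim_def)

lemma llim_cong: "(\<And>t. 0 \<le> t \<Longrightarrow> f t = g t) \<Longrightarrow> llim f = llim g"
  by (simp add: fun_eq_iff llim_def)

context mealy begin

lemma Run_cong:
  assumes "\<And>t. 0 \<le> t \<Longrightarrow> X t = X' t" "\<And>t. 0 \<le> t \<Longrightarrow> K t = K' t"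
  shows "Run X K \<longleftrightarrow> Run X' K'"
  unfolding Run_def rlim_cong[of X X', OF assms(1), simplified] rlim_cong[of K K', OF assms(2), simplified]
    llim_cong[of X X', OF assms(1), simplified] llim_cong[of K K', OF assms(2), simplified]
  by (simp add: assms)

lemma dfn_Run:
  assumes "{b..<b + c} \<subseteq> V2" "{d..<d + e} \<subseteq> V2"
  shows "dfn {} V2 (\<lambda>u w. Run (lv b c w) (lv d e w))"
proof -
  have pos: "dfn {0} V2 (\<lambda>u w. \<exists>s\<ge>0. s < u 0)"
    by (rule dfn_ex1[where x = 1 and P = "\<lambda>s u w. s < u 0"]) (auto intro: dfn_less)
  show ?thesis unfolding Run_def
  proof (intro dfn_and)
    show "dfn {} V2 (\<lambda>u w. \<forall>t\<ge>0. \<exists>m<n. lv d e w t = m)"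
      by (rule dfn_all1[where x = 0 and P = "\<lambda>t u w. \<exists>m<n. lv d e w t = m"], intro dfn_lex dfn_lv)
        (use assms in auto)
    show "dfn {} V2 (\<lambda>u w. \<forall>t\<ge>0. \<not> (\<exists>s\<ge>0. s < t) \<longrightarrow> (\<exists>x<p. \<exists>r<p. lv b c w t = x \<and> rlim (lv b c w) t r \<and>
        lv d e w t = upd m0 x \<and> rlim (lv d e w) t (upd (upd m0 x) r)))"
      by (rule dfn_all1[where x = 0 and P = "\<lambda>t u w. \<not> (\<exists>s\<ge>0. s < t) \<longrightarrow> (\<exists>x<p. \<exists>r<p. lv b c w t = x \<and> rlim (lv b c w) t r \<and>
        lv d e w t = upd m0 x \<and> rlim (lv d e w) t (upd (upd m0 x) r))"], intro dfn_imp dfn_not pos dfn_lex dfn_and dfn_lv dfn_rlim)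
        (use assms in auto)
    show "dfn {} V2 (\<lambda>u w. \<forall>t\<ge>0. (\<exists>s\<ge>0. s < t) \<longrightarrow> (\<exists>l<p. \<exists>x<p. \<exists>r<p. \<exists>m<n. llim (lv b c w) t l \<and> lv b c w t = x \<and>
        rlim (lv b c w) t r \<and> llim (lv d e w) t m \<and> lv d e w t = T1 m l x \<and> rlim (lv d e w) t (T2 m l x r)))"
      by (rule dfn_all1[where x = 0 and P = "\<lambda>t u w. (\<exists>s\<ge>0. s < t) \<longrightarrow> (\<exists>l<p. \<exists>x<p. \<exists>r<p. \<exists>m<n. llim (lv b c w) t l \<and> lv b c w t = x \<and>
        rlim (lv b c w) t r \<and> llim (lv d e w) t m \<and> lv d e w t = T1 m l x \<and> rlim (lv d e w) t (T2 m l x r))"],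
        intro dfn_imp dfn_not pos dfn_lex dfn_and dfn_lv dfn_rlim dfn_llim) (use assms in auto)
  qed
qed

text \<open>A run is a signal over \<open>n\<close> letters; the formula quantifies its
  \<open>ceillog2 n\<close> components and says that they code a run whose outputs form
  \<open>Y\<close>. Since runs are unique, \<open>op_iff\<close> makes this the graph of
  \<open>op\<close>.\<close>

theorem op_definable: "\<exists>U. defines_operator p q U op"
proof -
  let ?c = "ceillog2 p" and ?d = "ceillog2 q" and ?e = "ceillog2 n"
  let ?B = "?c + ?d"
  define P where "P u w \<longleftrightarrow> Run (lv 0 ?c w) (lv ?B ?e w) \<and> (\<forall>t\<ge>0. \<exists>m<n. lv ?B ?e w t = m \<and> lv ?c ?d w t = om m)"
    for u :: "nat \<Rightarrow> real" and w
  have "dfn {} ({..<?B} \<union> {?B..<?B + ?e}) P"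
    unfolding P_def
  proof (intro dfn_and dfn_Run)
    show "dfn {} ({..<?B} \<union> {?B..<?B + ?e}) (\<lambda>u w. \<forall>t\<ge>0. \<exists>m<n. lv ?B ?e w t = m \<and> lv ?c ?d w t = om m)"
      by (rule dfn_all1[where x = 0 and P = "\<lambda>t u w. \<exists>m<n. lv ?B ?e w t = m \<and> lv ?c ?d w t = om m"],
          intro dfn_lex dfn_and dfn_lv) auto
  qed auto
  from dfn_ex2_block[OF this] obtain U where U: "fv1 U \<subseteq> {}" "fv2 U \<subseteq> {..<?B}"
    "\<And>u w. (\<forall>i. 0 \<le> u i) \<Longrightarrow> (\<forall>i. w i \<in> bool_signals) \<Longrightarrow> sat u w U \<longleftrightarrow>
       (\<exists>Z. (\<forall>k. Z k \<in> bool_signals) \<and> P u (\<lambda>i. if ?B \<le> i \<and> i < ?B + ?e then Z i else w i))"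
    unfolding dfn_def by blast
  have "U \<in> formulas p q" using U(1,2) by (auto simp: formulas_def)
  moreover have "FVsig_sat p U X Y \<longleftrightarrow> Y = op X" if X: "X \<in> signals p" and Y: "Y \<in> signals q" for X Y
  proof -
    define w where "w i = (if i < ?c then component X i else component Y (i - ?c))" for i
    have w: "\<forall>i. w i \<in> bool_signals" using component_bool_signal[OF X] component_bool_signal[OF Y] by (simp add: w_def)
    have b: "bset (ceillog2 k) (bit a) = a" if "a < k" for a k
      using nat_eq_bset[of a "ceillog2 k"] that le_two_power_ceillog2[of k] by simp
    have lX: "lv 0 ?c w' t = X t" if "0 \<le> t" "\<And>i. i < ?c \<Longrightarrow> w' i = w i" for w' t
    proof -
      have "lv 0 ?c w' t = bset ?c (bit (X t))"
        by (rule bit_eqI) (use that in \<open>auto simp: lv_def bit_bset w_def component_def\<close>)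
      also have "\<dots> = X t" by (rule b) (use X that in \<open>auto simp: signals_def PiE_iff\<close>)
      finally show ?thesis .
    qed
    have lY: "lv ?c ?d w' t = Y t" if "0 \<le> t" "\<And>i. i < ?B \<Longrightarrow> w' i = w i" for w' t
    proof -
      have "lv ?c ?d w' t = bset ?d (bit (Y t))"
        by (rule bit_eqI) (use that in \<open>auto simp: lv_def bit_bset w_def component_def\<close>)
      also have "\<dots> = Y t" by (rule b) (use Y that in \<open>auto simp: signals_def PiE_iff\<close>)
      finally show ?thesis .
    qed
    have "FVsig_sat p U X Y \<longleftrightarrow> (\<exists>Z. (\<forall>k. Z k \<in> bool_signals) \<and> P (\<lambda>_. 0) (\<lambda>i. if ?B \<le> i \<and> i < ?B + ?e then Z i else w i))"
      using U(3)[of "\<lambda>_. 0" w] w by (simp add: FVsig_sat_def w_def[abs_def])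
    also have "\<dots> \<longleftrightarrow> (\<exists>K. finitely_variable K \<and> Run X K \<and> (\<forall>t\<ge>0. \<exists>m<n. K t = m \<and> Y t = om m))"
    proof
      assume "\<exists>Z. (\<forall>k. Z k \<in> bool_signals) \<and> P (\<lambda>_. 0) (\<lambda>i. if ?B \<le> i \<and> i < ?B + ?e then Z i else w i)"
      then obtain Z where Z: "\<forall>k. Z k \<in> bool_signals" "P (\<lambda>_. 0) (\<lambda>i. if ?B \<le> i \<and> i < ?B + ?e then Z i else w i)" by blast
      define w' where "w' = (\<lambda>i. if ?B \<le> i \<and> i < ?B + ?e then Z i else w i)"
      have "finitely_variable (lv ?B ?e w')" by (rule fv_lv) (use Z(1) w in \<open>auto simp: w'_def\<close>)
      moreover have "Run X (lv ?B ?e w') = Run (lv 0 ?c w') (lv ?B ?e w')" by (rule Run_cong) (auto simp: lX w'_def)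
      moreover have "lv ?c ?d w' t = Y t" if "0 \<le> t" for t using that by (intro lY) (auto simp: w'_def)
      ultimately show "\<exists>K. finitely_variable K \<and> Run X K \<and> (\<forall>t\<ge>0. \<exists>m<n. K t = m \<and> Y t = om m)"
        using Z(2) unfolding P_def w'_def[symmetric] by (intro exI[of _ "lv ?B ?e w'"]) auto
    next
      assume "\<exists>K. finitely_variable K \<and> Run X K \<and> (\<forall>t\<ge>0. \<exists>m<n. K t = m \<and> Y t = om m)"
      then obtain K where K: "finitely_variable K" "Run X K" "\<And>t. 0 \<le> t \<Longrightarrow> K t < n \<and> Y t = om (K t)" by blast
      define Z where "Z i = component K (i - ?B)" for i
      define w' where "w' = (\<lambda>i. if ?B \<le> i \<and> i < ?B + ?e then Z i else w i)"
      have lK: "lv ?B ?e w' t = K t" if "0 \<le> t" for t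
      proof -
        have "lv ?B ?e w' t = bset ?e (bit (K t))"
          by (rule bit_eqI) (use that in \<open>auto simp: lv_def bit_bset w'_def Z_def component_def\<close>)
        also have "\<dots> = K t" by (rule b) (use K(3) that in auto)
        finally show ?thesis .
      qed
      have "Run (lv 0 ?c w') (lv ?B ?e w') = Run X K"
      proof (rule Run_cong)
        show "lv 0 ?c w' t = X t" if "0 \<le> t" for t using that by (intro lX) (auto simp: w'_def)
      qed (rule lK)
      moreover have "lv ?c ?d w' t = Y t" if "0 \<le> t" for t using that by (intro lY) (auto simp: w'_def)
      ultimately have "P (\<lambda>_. 0) w'" unfolding P_def using K lK by auto
      moreover have "\<forall>k. Z k \<in> bool_signals" using component_fv[OF K(1)] by (simp add: Z_def)
      ultimately show "\<exists>Z. (\<forall>k. Z k \<in> bool_signals) \<and> P (\<lambda>_. 0) (\<lambda>i. if ?B \<le> i \<and> i < ?B + ?e then Z i else w i)"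
        unfolding w'_def by blast
    qed
    also have "\<dots> \<longleftrightarrow> Y = op X" by (rule op_iff[OF X Y, symmetric])
    finally show ?thesis .
  qed
  ultimately show ?thesis unfolding defines_operator_def by blast
qed

text \<open>\<open>mm\<close> reads every letter, the machine skips repetitions. While
  \<open>act\<close> holds, letters are merely postponed and the states agree after the gap has been
  read; during the delay the outputs agree because \<open>obeys\<close> forces Output to repeat.
  Once \<open>act\<close> fails it fails forever: the machine is frozen, and its output is the one
  that \<open>obeys\<close> prescribes for the constant rest.\<close>

lemma run_outputs:
  assumes mm: "mm 0 = m0" "\<And>k. mm (Suc k) = upd (mm k) (\<alpha> k)" and \<gamma>: "\<And>k. \<gamma> k = om (mm (Suc k))" and o: "obeys \<alpha> \<gamma>"
    and act: "\<And>i. act (Suc i) \<Longrightarrow> act i"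
      "\<And>i. act i \<longleftrightarrow> \<not> (\<alpha> (2 * i + 2) = \<alpha> (2 * i + 1) \<and> \<alpha> (2 * i + 3) = \<alpha> (2 * i + 2))"
  shows "om (kp \<alpha> i) = \<gamma> (2 * i) \<and> om (kk \<alpha> i) = \<gamma> (2 * i + 1) \<and> (act i \<longrightarrow> kk \<alpha> i = mm (2 * i + 2))"
proof (induction i)
  case 0 then show ?case using mm \<gamma> by (simp add: eval_nat_numeral)
next
  case (Suc i)
  have oi: "\<alpha> (2 * i + 2) = \<alpha> (2 * i + 1) \<Longrightarrow> \<gamma> (2 * i + 2) = \<gamma> (2 * i + 1)"
    "\<alpha> (2 * i + 2) = \<alpha> (2 * i + 1) \<Longrightarrow> \<alpha> (2 * i + 3) = \<alpha> (2 * i + 2) \<Longrightarrow> \<gamma> (2 * i + 3) = \<gamma> (2 * i + 2)"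
    using o unfolding obeys_def by blast+
  have e: "2 * Suc i = 2 * i + 2" "2 * Suc i + 1 = 2 * i + 3" "2 * Suc i + 2 = Suc (2 * i + 3)" "2 * i + 3 = Suc (2 * i + 2)" by auto
  show ?case
  proof (cases "act i")
    case True
    then have k: "kk \<alpha> i = mm (2 * i + 2)" using Suc by blast
    have 2: "kk \<alpha> (Suc i) = mm (Suc (2 * i + 3))"
      using True act(2)[of i] k mm(2)[of "2 * i + 3"] mm(2)[of "2 * i + 2"] by (auto simp: T2_def e(4))
    have "om (kp \<alpha> (Suc i)) = \<gamma> (2 * i + 2)"
    proof (cases "\<alpha> (2 * i + 2) = \<alpha> (2 * i + 1)")
      case True then show ?thesis using Suc oi(1) by (simp add: T1_def)
    next
      case False
      then have "kp \<alpha> (Suc i) = mm (Suc (2 * i + 2))" using k mm(2)[of "2 * i + 2"] by (simp add: T1_def)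
      then show ?thesis using \<gamma> by simp
    qed
    then show ?thesis using 2 \<gamma>[of "2 * i + 3"] unfolding e by simp
  next
    case False
    then have eq: "\<alpha> (2 * i + 2) = \<alpha> (2 * i + 1)" "\<alpha> (2 * i + 3) = \<alpha> (2 * i + 2)" using act(2) by blast+
    then have "kp \<alpha> (Suc i) = kk \<alpha> i" "kk \<alpha> (Suc i) = kk \<alpha> i" by (auto simp: T1_def T2_def)
    moreover have "\<gamma> (2 * i + 2) = \<gamma> (2 * i + 1)" "\<gamma> (2 * i + 3) = \<gamma> (2 * i + 1)" using oi eq by auto
    ultimately show ?thesis using Suc act(1) False unfolding e by auto
  qed
qed

end

subsection \<open>Breakpoints at the discontinuities of a signal\<close>

definition ctn :: "(real \<Rightarrow> 'a) \<Rightarrow> real \<Rightarrow> bool" where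
  "ctn f t \<longleftrightarrow> (\<exists>e>0. \<forall>r. \<bar>r - t\<bar> < e \<longrightarrow> f r = f t)"

lemma ctnE:
  assumes "ctn f m" "a < m" "m < b"
  obtains r s where "a < r" "r < m" "m < s" "s < b" "f r = f m" "f s = f m"
proof -
  obtain e where e: "e > 0" "\<And>r. \<bar>r - m\<bar> < e \<Longrightarrow> f r = f m" using assms(1) by (auto simp: ctn_def)
  obtain r where r: "max a (m - e) < r" "r < m" using dense[of "max a (m - e)" m] assms e by auto
  obtain s where s: "m < s" "s < min b (m + e)" using dense[of m "min b (m + e)"] assms e by auto
  show ?thesis using r s e(2)[of r] e(2)[of s] by (intro that[of r s]) auto
qed

lemma pcw_ctn_constant: "pcw f a b \<Longrightarrow> (\<And>t. a < t \<Longrightarrow> t < b \<Longrightarrow> ctn f t) \<Longrightarrow> \<exists>c. \<forall>t. a < t \<longrightarrow> t < b \<longrightarrow> f t = c"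
proof (induction rule: pcw.induct)
  case (step a m b)
  have l: "a < m" "m < b" using step.hyps pcw_less by auto
  obtain c where c: "\<And>t. a < t \<Longrightarrow> t < m \<Longrightarrow> f t = c" using step.IH(1) step.prems l by auto
  obtain d where d: "\<And>t. m < t \<Longrightarrow> t < b \<Longrightarrow> f t = d" using step.IH(2) step.prems l by auto
  obtain r s where "a < r" "r < m" "m < s" "s < b" "f r = f m" "f s = f m" using ctnE[OF step.prems[OF l] l] .
  then have "f m = c" "d = c" using c d by auto
  then show ?case using c d by (metis linorder_neqE)
qed blast

text \<open>The breakpoints after 0 are the discontinuities, followed by artificial ones if there
  are only finitely many. \<open>act i\<close> says that a discontinuity lies after
  \<open>\<tau> i\<close>; then \<open>\<tau> (Suc i)\<close> is one, and the letters there cannot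
  both be repetitions.\<close>

lemma canonical_breaks:
  assumes f: "finitely_variable f"
  obtains \<tau> \<alpha> act where "breaks \<tau>" "\<And>i. f (\<tau> i) = \<alpha> (2 * i)" "\<And>i t. \<tau> i < t \<Longrightarrow> t < \<tau> (Suc i) \<Longrightarrow> f t = \<alpha> (2 * i + 1)"
    "\<And>i. act (Suc i) \<Longrightarrow> act i"
    "\<And>i. act i \<longleftrightarrow> \<not> (\<alpha> (2 * i + 2) = \<alpha> (2 * i + 1) \<and> \<alpha> (2 * i + 3) = \<alpha> (2 * i + 2))"
proof -
  \<comment> \<open>0 is a breakpoint in any case, and \<open>ctn\<close> at 0 would depend on
    values at negative times.\<close>
  define D where "D = {t. 0 < t \<and> \<not> ctn f t}"
  have "finite (D \<inter> {0..T})" for T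
  proof -
    obtain \<tau> c where c: "breaks \<tau>" "\<And>i t. \<tau> i < t \<Longrightarrow> t < \<tau> (Suc i) \<Longrightarrow> f t = c i"
      using fv_breaks[OF f] by metis
    interpret breaks \<tau> by fact
    obtain n where n: "T < \<tau> n" using tau_beyond by blast
    have "D \<inter> {0..T} \<subseteq> \<tau> ` {..n}"
    proof
      fix t assume t: "t \<in> D \<inter> {0..T}"
      then obtain i where i: "\<tau> i \<le> t" "t < \<tau> (Suc i)" using tau_locate[of t] by auto
      have "t = \<tau> i"
      proof (rule ccontr)
        assume "t \<noteq> \<tau> i"
        then have "\<tau> i < t" using i by simp
        then have "ctn f t" unfolding ctn_def using i c(2)
          by (intro exI[of _ "min (t - \<tau> i) (\<tau> (Suc i) - t)"]) (auto simp: abs_less_iff)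
        then show False using t by (simp add: D_def)
      qed
      moreover have "\<tau> i < \<tau> n" using i(1) n t by (intro le_less_trans[of "\<tau> i" t]) auto
      then have "i < n" by simp
      ultimately show "t \<in> \<tau> ` {..n}" by auto
    qed
    then show ?thesis using finite_subset by blast
  qed
  then obtain \<tau> where \<tau>: "breaks \<tau>" "\<And>i. D \<inter> {\<tau> i<..<\<tau> (Suc i)} = {}" "\<And>i. D \<inter> {\<tau> i<..} \<noteq> {} \<Longrightarrow> \<tau> (Suc i) \<in> D"
    using locally_finite_enum by metis
  interpret breaks \<tau> by fact
  have "\<exists>c. \<forall>t. \<tau> i < t \<longrightarrow> t < \<tau> (Suc i) \<longrightarrow> f t = c" for i
  proof (rule pcw_ctn_constant)
    show "pcw f (\<tau> i) (\<tau> (Suc i))" using f by (simp add: finitely_variable_iff)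
    show "ctn f t" if "\<tau> i < t" "t < \<tau> (Suc i)" for t
    proof -
      have "0 \<le> \<tau> i" by simp
      then have "0 < t" using that by linarith
      then show ?thesis using \<tau>(2)[of i] that by (auto simp: D_def)
    qed
  qed
  then obtain g where g: "\<And>i t. \<tau> i < t \<Longrightarrow> t < \<tau> (Suc i) \<Longrightarrow> f t = g i" by metis
  define \<alpha> where "\<alpha> j = (if even j then f (\<tau> (j div 2)) else g (j div 2))" for j
  have a: "\<alpha> (2 * i + 1) = g i" "\<alpha> (2 * i + 2) = f (\<tau> (Suc i))" "\<alpha> (2 * i + 3) = g (Suc i)" for i
  proof -
    have "2 * i + 2 = 2 * Suc i" "2 * i + 3 = 2 * Suc i + 1" by auto
    then show "\<alpha> (2 * i + 1) = g i" "\<alpha> (2 * i + 2) = f (\<tau> (Suc i))" "\<alpha> (2 * i + 3) = g (Suc i)"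
      unfolding \<alpha>_def by (auto simp del: mult_Suc_right)
  qed
  define act where "act i \<longleftrightarrow> D \<inter> {\<tau> i<..} \<noteq> {}" for i
  have m: "\<tau> i < \<tau> (Suc i)" "\<tau> (Suc i) < \<tau> (Suc (Suc i))" "0 < \<tau> (Suc i)" for i
    using tau_less[of 0 "Suc i"] tau0 by auto
  have ct: "ctn f (\<tau> (Suc i)) \<longleftrightarrow> f (\<tau> (Suc i)) = g i \<and> g (Suc i) = f (\<tau> (Suc i))" for i
  proof
    assume "ctn f (\<tau> (Suc i))"
    from ctnE[OF this m(1) m(2)] obtain r s where "\<tau> i < r" "r < \<tau> (Suc i)" "\<tau> (Suc i) < s" "s < \<tau> (Suc (Suc i))"
      "f r = f (\<tau> (Suc i))" "f s = f (\<tau> (Suc i))" .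
    then show "f (\<tau> (Suc i)) = g i \<and> g (Suc i) = f (\<tau> (Suc i))" using g[of i r] g[of "Suc i" s] by simp
  next
    assume e: "f (\<tau> (Suc i)) = g i \<and> g (Suc i) = f (\<tau> (Suc i))"
    have near: "f r = f (\<tau> (Suc i))" if "\<tau> i < r" "r < \<tau> (Suc (Suc i))" for r
      using e g[of i r] g[of "Suc i" r] that by (cases r "\<tau> (Suc i)" rule: linorder_cases) auto
    show "ctn f (\<tau> (Suc i))" unfolding ctn_def
    proof (intro exI conjI allI impI)
      show "0 < min (\<tau> (Suc i) - \<tau> i) (\<tau> (Suc (Suc i)) - \<tau> (Suc i))" using m(1,2)[of i] by simp
      fix r assume "\<bar>r - \<tau> (Suc i)\<bar> < min (\<tau> (Suc i) - \<tau> i) (\<tau> (Suc (Suc i)) - \<tau> (Suc i))"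
      then show "f r = f (\<tau> (Suc i))" by (intro near) linarith+
    qed
  qed
  show ?thesis
  proof (rule that[OF \<tau>(1), of \<alpha> act])
    show "f (\<tau> i) = \<alpha> (2 * i)" for i by (simp add: \<alpha>_def)
    show "f t = \<alpha> (2 * i + 1)" if "\<tau> i < t" "t < \<tau> (Suc i)" for i t using g[OF that] by (simp add: \<alpha>_def)
    show "act i" if l: "act (Suc i)" for i
    proof -
      obtain t where t: "t \<in> D" "\<tau> (Suc i) < t" using l by (auto simp: act_def)
      then have "t \<in> D \<inter> {\<tau> i<..}" using m(1)[of i] by (auto simp del: tau_less intro: less_trans)
      then show ?thesis unfolding act_def by blast
    qed
    show "act i \<longleftrightarrow> \<not> (\<alpha> (2 * i + 2) = \<alpha> (2 * i + 1) \<and> \<alpha> (2 * i + 3) = \<alpha> (2 * i + 2))" for i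
    proof -
      have "act i \<longleftrightarrow> \<tau> (Suc i) \<in> D" using \<tau>(3)[of i] m(1)[of i] by (auto simp: act_def)
      also have "\<dots> \<longleftrightarrow> \<not> ctn f (\<tau> (Suc i))" using m(3) by (simp add: D_def)
      finally show ?thesis unfolding a ct by simp
    qed
  qed
qed

section \<open>Decidability\<close>

context spec begin

text \<open>Numbered configurations are the states of a machine whose output is the last letter of
  Output stored in the configuration. By \<open>run_outputs\<close> its outputs at the canonical
  breakpoints are those of the play with \<open>out\<close>, and the value of that play is the truth
  of \<open>\<Psi>\<close>.\<close>

theorem winning_operator:
  assumes pq: "0 < p" "0 < q" and nc: "\<nexists>m0 nd P. cert p q (aMU A) (aOM A) (aAC A) (glab A p q) m0 nd P"
  shows "\<exists>F. C_operator p q F \<and> definable_operator p q F \<and> implements p F \<Psi>"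
proof -
  interpret S: synth_game "aN A" "aMU A" "aOM A" "aAC A" "glab A p q" p q
    by unfold_locales (use pq glab_less in auto)
  obtain out where out: "\<And>c a. c \<in> S.Cf \<Longrightarrow> a < p \<Longrightarrow> out c a < q \<and> legal c a (out c a)"
    "\<And>c \<alpha> \<gamma>. S.play c \<alpha> \<gamma> \<Longrightarrow> \<forall>n. \<gamma> n = out (c n) (\<alpha> n) \<Longrightarrow> val (S.labs \<alpha> \<gamma>)"
  proof (rule disjE[OF S.determined], goal_cases)
    case 1
    from 1(2) obtain out where "\<forall>c\<in>S.Cf. \<forall>a<p. out c a < q \<and> legal c a (out c a)"
      "\<forall>c \<alpha> \<gamma>. S.play c \<alpha> \<gamma> \<longrightarrow> (\<forall>n. \<gamma> n = out (c n) (\<alpha> n)) \<longrightarrow> val (S.labs \<alpha> \<gamma>)" by (elim exE conjE)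
    then show ?case by (intro 1(1)[of out]) auto
  next
    case 2
    from 2(2) obtain inp where i: "\<forall>c\<in>S.Cf. inp c < p" "\<forall>c \<alpha> \<gamma>. S.play c \<alpha> \<gamma> \<longrightarrow> (\<forall>n. \<alpha> n = inp (c n)) \<longrightarrow>
      (\<forall>n. legal (c n) (\<alpha> n) (\<gamma> n)) \<longrightarrow> \<not> val (S.labs \<alpha> \<gamma>)" by (elim exE conjE)
    have "\<exists>m0 nd P. cert p q (aMU A) (aOM A) (aAC A) (glab A p q) m0 nd P"
      by (rule S.cert_exists[of inp]) (use i in blast)+
    then show ?case using nc by blast
  qed
  obtain h where h: "bij_betw h S.Cf {0..<card S.Cf}" using ex_bij_betw_finite_nat[OF S.finite_Cf] by blast
  define g where "g = inv_into S.Cf h"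
  have gh: "g (h c) = c" "h c < card S.Cf" if "c \<in> S.Cf" for c
    using h that unfolding g_def bij_betw_def by (auto simp: inv_into_f_f)
  have gC: "g m \<in> S.Cf" if "m < card S.Cf" for m
    using h that unfolding g_def bij_betw_def by (metis atLeastLessThan_iff inv_into_into zero_le)
  define up where "up m a = h (S.nxt (g m) a (out (g m) a))" for m a
  define lst where "lst m = snd (snd (snd (snd (g m))))" for m
  interpret E: mealy p q "card S.Cf" "h S.c0" up lst
  proof
    show "h S.c0 < card S.Cf" using gh(2)[OF S.c0_Cf] .
    show "up m a < card S.Cf" if "m < card S.Cf" "a < p" for m a
      unfolding up_def using gC[OF that(1)] out(1) that S.nxt_Cf by (intro gh(2)) auto
    show "lst m < q" if "m < card S.Cf" for m unfolding lst_def using S.last_less[OF gC[OF that]] .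
  qed
  have "FVsig_sat p \<Psi> X (E.op X)" if X: "X \<in> signals p" for X
  proof -
    have fv: "finitely_variable X" using X by (simp add: signals_def)
    obtain \<tau> \<alpha> act where t: "breaks \<tau>" "\<And>i. X (\<tau> i) = \<alpha> (2 * i)" "\<And>i t. \<tau> i < t \<Longrightarrow> t < \<tau> (Suc i) \<Longrightarrow> X t = \<alpha> (2 * i + 1)"
      "\<And>i. act (Suc i) \<Longrightarrow> act i"
      "\<And>i. act i \<longleftrightarrow> \<not> (\<alpha> (2 * i + 2) = \<alpha> (2 * i + 1) \<and> \<alpha> (2 * i + 3) = \<alpha> (2 * i + 2))"
      by (rule canonical_breaks[OF fv]) (rule that; assumption)
    interpret breaks \<tau> by fact
    have Xp: "X t < p" if "0 \<le> t" for t using X that by (auto simp: signals_def PiE_iff)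
    have ap: "\<alpha> i < p" for i
    proof (cases "even i")
      case True
      then obtain k where "i = 2 * k" by (elim evenE)
      then show ?thesis using t(2)[of k] Xp[of "\<tau> k"] by simp
    next
      case False
      then obtain k where k: "i = 2 * k + 1" by (elim oddE)
      have "\<tau> k < \<tau> (Suc k)" "0 \<le> \<tau> k" by auto
      then obtain s where s: "\<tau> k < s" "s < \<tau> (Suc k)" using dense by blast
      then have "0 \<le> s" using \<open>0 \<le> \<tau> k\<close> by linarith
      then show ?thesis using t(3)[OF s] Xp[of s] k by simp
    qed
    \<comment> \<open>The play that reads every letter of the canonical word, repetitions
      included.\<close>
    define cs where "cs = rec_nat S.c0 (\<lambda>n c. S.nxt c (\<alpha> n) (out c (\<alpha> n)))"
    define \<gamma> where "\<gamma> n = out (cs n) (\<alpha> n)" for n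
    have cs: "cs 0 = S.c0" "cs (Suc n) = S.nxt (cs n) (\<alpha> n) (\<gamma> n)" for n by (auto simp: cs_def \<gamma>_def)
    have cC: "cs n \<in> S.Cf" for n
      by (induction n) (use cs S.c0_Cf S.nxt_Cf out(1) ap in \<open>auto simp: \<gamma>_def\<close>)
    have pl: "S.play cs \<alpha> \<gamma>" unfolding S.play_def using cs ap out(1)[OF cC ap] by (simp add: \<gamma>_def)
    have v: "val (S.labs \<alpha> \<gamma>)" using out(2)[OF pl] by (simp add: \<gamma>_def)
    have ob: "obeys \<alpha> \<gamma>" using S.play_legal[OF pl] out(1)[OF cC ap] by (simp add: \<gamma>_def)
    have mS: "h (cs (Suc k)) = up (h (cs k)) (\<alpha> k)" for k unfolding up_def gh(1)[OF cC] cs(2) \<gamma>_def ..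
    have gk: "\<gamma> k = lst (h (cs (Suc k)))" for k
    proof -
      have "lst (h (cs (Suc k))) = snd (snd (snd (snd (S.nxt (cs k) (\<alpha> k) (\<gamma> k)))))"
        unfolding lst_def gh(1)[OF cC[of "Suc k"]] by (simp only: cs(2))
      then show ?thesis by (cases "cs k") (simp add: S.nxt_def)
    qed
    have O: "lst (E.kp \<alpha> i) = \<gamma> (2 * i) \<and> lst (E.kk \<alpha> i) = \<gamma> (2 * i + 1)" for i
      using E.run_outputs[of "\<lambda>k. h (cs k)" \<alpha> \<gamma> act i] mS gk ob t(4,5) cs(1) by auto
    obtain K where K: "E.Run X K" "finitely_variable K" "\<And>i. K (\<tau> i) = E.kp \<alpha> i"
      "\<And>i t. \<tau> i < t \<Longrightarrow> t < \<tau> (Suc i) \<Longrightarrow> K t = E.kk \<alpha> i"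
      using E.run_exists[of \<tau> X \<alpha>] t(1,2,3) ap by blast
    have KR: "E.rn X t = K t" if "0 \<le> t" for t
      by (rule E.run_causal[of X X]) (use K E.rn[OF X] fv that in auto)
    have "FVsig_sat p \<Psi> X (E.op X) \<longleftrightarrow> val (\<lambda>n. glab A p q (even n) (\<alpha> n) (\<gamma> n))"
    proof (rule FVsig_val[OF t(1)])
      show "X (\<tau> i) = \<alpha> (2 * i)" for i by (rule t(2))
      show "X t = \<alpha> (2 * i + 1)" if "\<tau> i < t" "t < \<tau> (Suc i)" for i t using t(3)[OF that] .
      show "E.op X (\<tau> i) = \<gamma> (2 * i)" for i
        using KR[of "\<tau> i"] K(3)[of i] O[of i] tau_nonneg[of i] not_less[of "\<tau> i" 0] by (simp add: E.op_def)
      show "E.op X t = \<gamma> (2 * i + 1)" if "\<tau> i < t" "t < \<tau> (Suc i)" for i t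
      proof -
        have "0 \<le> \<tau> i" by simp
        then have "0 \<le> t" using that by linarith
        then show ?thesis using KR[of t] K(4)[OF that] O[of i] by (simp add: E.op_def)
      qed
    qed
    then show ?thesis using v by simp
  qed
  then show ?thesis using E.op_C E.op_definable unfolding definable_operator_def implements_def by blast
qed

end

lemma cert_or_operator:
  assumes \<Psi>: "\<Psi> \<in> formulas p q"
  shows "(\<exists>k. is_cert p q (code \<Psi>) k) \<or> (\<exists>F. C_operator p q F \<and> definable_operator p q F \<and> implements p F \<Psi>)"
proof -
  interpret spec p q "p + q + code \<Psi> + 1" \<Psi> by (rule spec_std[OF \<Psi>])
  consider "p = 0" | "0 < p" "q = 0" | "0 < p" "0 < q" by blast
  then show ?thesis
  proof cases
    case 1
    \<comment> \<open>There is no signal over the empty alphabet, so any closed formula defines any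
      operator.\<close>
    have "All1 0 (Less 0 0) \<in> formulas p q" by (simp add: formulas_def)
    moreover have "signals p = {}" unfolding 1 signals_def by (auto simp: PiE_eq_empty_iff)
    ultimately show ?thesis unfolding C_operator_def definable_operator_def defines_operator_def implements_def by auto
  next
    case 2
    \<comment> \<open>Output has no letter at all, so a single node without edges satisfies the
      condition on replies vacuously.\<close>
    have "cert p q (aMU A) (aOM A) (aAC A) (glab A p q) (node 0 True False 0 0) (2 ^ node 0 True False 0 0) 0"
      unfolding cert_def using 2 by (auto simp: bit_exp_iff)
    then show ?thesis using is_certI A_def by blast
  next
    case 3
    then show ?thesis using winning_operator is_certI A_def by blast
  qed
qed

section \<open>The search for a formula or a certificate\<close>

lemma cmpf_computes:
  assumes "cmpf (\<lambda>x. f (fst x) (fst (snd x)) (snd (snd x)))"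
  shows "\<exists>d. \<forall>a b c. computes d [a, b, c] (ce (f a b c))"
proof -
  obtain r where r: "\<And>x. computes r [ce x] (ce (f (fst x) (fst (snd x)) (snd (snd x))))"
    using assms unfolding cmpf_def by blast
  have "rcomp 3 (\<lambda>xs. prod_encode (xs ! 0, prod_encode (xs ! 1, xs ! 2)))"
    by (intro rcomp_pair rcomp_proj) auto
  then obtain e where e: "\<And>xs. length xs = 3 \<Longrightarrow> computes e xs (prod_encode (xs ! 0, prod_encode (xs ! 1, xs ! 2)))"
    unfolding rcomp_def by blast
  have "computes (Comp r [e]) [a, b, c] (ce (f a b c))" for a b c
    using r[of "(a, b, c)"] e[of "[a, b, c]"]
    by (intro computes.Comp[of _ _ "[ce (a, b, c)]"]) (auto simp: ce_prod_def ce_nat_def)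
  then show ?thesis by blast
qed

text \<open>The last disjunct makes the search total, as minimisation requires: it stops at once when the third argument
  is not the code of a formula.\<close>

definition witness :: "nat \<Rightarrow> nat \<Rightarrow> nat \<Rightarrow> nat \<Rightarrow> bool" where
  "witness p q \<psi> k \<longleftrightarrow> is_form p q k \<and> chi_true p q \<psi> k"

definition search :: "nat \<Rightarrow> nat \<Rightarrow> nat \<Rightarrow> nat" where
  "search p q \<psi> = (LEAST k. witness p q \<psi> k \<or> is_cert p q \<psi> k \<or> \<not> is_form p q \<psi>)"

lemma cmpf_witness: "cmpf p \<Longrightarrow> cmpf q \<Longrightarrow> cmpf \<psi> \<Longrightarrow> cmpf k \<Longrightarrow> cmpf (\<lambda>z. witness (p z) (q z) (\<psi> z) (k z))"
  unfolding witness_def by (intro cmpf_conj cmpf_is_form cmpf_chi_true)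

lemma witness_iff:
  assumes "\<Psi> \<in> formulas p q"
  shows "witness p q (code \<Psi>) k \<longleftrightarrow> (\<exists>U F. k = code U \<and> C_operator p q F \<and> defines_operator p q U F \<and> implements p F \<Psi>)"
proof
  assume "witness p q (code \<Psi>) k"
  then obtain U where "U \<in> formulas p q" "k = code U" "chi_true p q (code \<Psi>) (code U)"
    unfolding witness_def is_form_iff by blast
  then show "\<exists>U F. k = code U \<and> C_operator p q F \<and> defines_operator p q U F \<and> implements p F \<Psi>"
    using chi_true_iff assms by blast
next
  assume "\<exists>U F. k = code U \<and> C_operator p q F \<and> defines_operator p q U F \<and> implements p F \<Psi>"
  then obtain U F where U: "k = code U" "C_operator p q F" "defines_operator p q U F" "implements p F \<Psi>" by blast
  then have "U \<in> formulas p q" by (simp add: defines_operator_def)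
  then show "witness p q (code \<Psi>) k" unfolding witness_def is_form_iff using chi_true_iff assms U by blast
qed

lemma search_ex: "\<exists>k. witness p q \<psi> k \<or> is_cert p q \<psi> k \<or> \<not> is_form p q \<psi>"
proof (cases "is_form p q \<psi>")
  case True
  then obtain \<Psi> where \<Psi>: "\<Psi> \<in> formulas p q" "\<psi> = code \<Psi>" using is_form_iff by metis
  then show ?thesis using cert_or_operator[OF \<Psi>(1)] witness_iff[OF \<Psi>(1)] unfolding definable_operator_def by blast
qed blast

lemma cmpf_search: "cmpf p \<Longrightarrow> cmpf q \<Longrightarrow> cmpf \<psi> \<Longrightarrow> cmpf (\<lambda>z. search (p z) (q z) (\<psi> z))"
proof -
  assume a: "cmpf p" "cmpf q" "cmpf \<psi>"
  have "cmpf (\<lambda>z. search (fst z) (fst (snd z)) (snd (snd z)))"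
    unfolding search_def
    by (rule cmpf_least) (intro cmpf_disj cmpf_not cmpf_witness cmpf_is_cert cmpf_is_form cmpf_intros, rule search_ex)
  from cmpf_comp[OF this, of "\<lambda>z. (p z, q z, \<psi> z)"] a show ?thesis by (simp add: cmpf_intros)
qed

text \<open>The search may stop at either kind of number, so its result is tested once more. If an
  operator exists, \<open>is_cert_sound\<close> rules out certificates, and the search can only have
  stopped at a defining formula.\<close>

lemma search_correct:
  assumes "\<Psi> \<in> formulas p q"
  shows "witness p q (code \<Psi>) (search p q (code \<Psi>)) \<longleftrightarrow> (\<exists>F. C_operator p q F \<and> definable_operator p q F \<and> implements p F \<Psi>)"
proof
  assume "witness p q (code \<Psi>) (search p q (code \<Psi>))"
  then show "\<exists>F. C_operator p q F \<and> definable_operator p q F \<and> implements p F \<Psi>"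
    unfolding witness_iff[OF assms] definable_operator_def by blast
next
  assume e: "\<exists>F. C_operator p q F \<and> definable_operator p q F \<and> implements p F \<Psi>"
  have "witness p q (code \<Psi>) (search p q (code \<Psi>)) \<or> is_cert p q (code \<Psi>) (search p q (code \<Psi>)) \<or> \<not> is_form p q (code \<Psi>)"
    unfolding search_def using search_ex by (rule LeastI_ex)
  moreover have "is_form p q (code \<Psi>)" using assms is_form_iff by blast
  ultimately show "witness p q (code \<Psi>) (search p q (code \<Psi>))" using is_cert_sound[OF assms] e by blast
qed

theorem theorem1p5:
  shows "(\<exists>d. \<forall>p q. \<forall>\<Psi>\<in>formulas p q.
            computes d [p, q, code \<Psi>]
              (if \<exists>F. C_operator p q F \<and> definable_operator p q F \<and> implements p F \<Psi> then 1 else 0))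
       \<and> (\<exists>c. \<forall>p q. \<forall>\<Psi>\<in>formulas p q.
            (\<exists>F. C_operator p q F \<and> definable_operator p q F \<and> implements p F \<Psi>) \<longrightarrow>
            (\<exists>U F. computes c [p, q, code \<Psi>] (code U) \<and>
                   C_operator p q F \<and> defines_operator p q U F \<and> implements p F \<Psi>))"
proof (intro conjI)
  have "cmpf (\<lambda>x. witness (fst x) (fst (snd x)) (snd (snd x)) (search (fst x) (fst (snd x)) (snd (snd x))))"
    by (intro cmpf_witness cmpf_search cmpf_intros)
  then obtain d where d: "\<And>p q \<psi>. computes d [p, q, \<psi>] (ce (witness p q \<psi> (search p q \<psi>)))"
    using cmpf_computes[of "\<lambda>p q \<psi>. witness p q \<psi> (search p q \<psi>)"] by blast
  show "\<exists>d. \<forall>p q. \<forall>\<Psi>\<in>formulas p q. computes d [p, q, code \<Psi>]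
      (if \<exists>F. C_operator p q F \<and> definable_operator p q F \<and> implements p F \<Psi> then 1 else 0)"
  proof (intro exI[of _ d] allI ballI)
    fix p q \<Psi> assume "\<Psi> \<in> formulas p q"
    from d[of p q "code \<Psi>"] show "computes d [p, q, code \<Psi>]
        (if \<exists>F. C_operator p q F \<and> definable_operator p q F \<and> implements p F \<Psi> then 1 else 0)"
      unfolding search_correct[OF \<open>\<Psi> \<in> formulas p q\<close>] by (simp add: ce_bool_def)
  qed
  \<comment> \<open>For solvable inputs the number found is itself the code of a defining formula,
    so the second algorithm is the search without the final test.\<close>
  have "cmpf (\<lambda>x. search (fst x) (fst (snd x)) (snd (snd x)))" by (intro cmpf_search cmpf_intros)
  then obtain c where c: "\<And>p q \<psi>. computes c [p, q, \<psi>] (search p q \<psi>)"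
    using cmpf_computes[of search] by (auto simp: ce_nat_def)
  show "\<exists>c. \<forall>p q. \<forall>\<Psi>\<in>formulas p q. (\<exists>F. C_operator p q F \<and> definable_operator p q F \<and> implements p F \<Psi>) \<longrightarrow>
      (\<exists>U F. computes c [p, q, code \<Psi>] (code U) \<and> C_operator p q F \<and> defines_operator p q U F \<and> implements p F \<Psi>)"
  proof (intro exI[of _ c] allI ballI impI)
    fix p q \<Psi> assume \<Psi>: "\<Psi> \<in> formulas p q" and "\<exists>F. C_operator p q F \<and> definable_operator p q F \<and> implements p F \<Psi>"
    then have "witness p q (code \<Psi>) (search p q (code \<Psi>))" using search_correct by blast
    then show "\<exists>U F. computes c [p, q, code \<Psi>] (code U) \<and> C_operator p q F \<and> defines_operator p q U F \<and> implements p F \<Psi>"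
      using c[of p q "code \<Psi>"] unfolding witness_iff[OF \<Psi>] by metis
  qed
qed

end
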